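(* Let $\lambda>0$ be arbitrary and let $\{(\mathbf{\Sigma}^{(p)},\theta^{(p)})\}_{p\ge 1}$ (with $\mathbf{\Sigma}^{(p)}$ of size $p\times p$ and $n=\delta p$) admit a standard distributional limit, denoted by $(\Theta,\Upsilon^{1/2}Z,\Upsilon)$, where $Z\sim\mathcal N(0,1)$ and $\Theta,\Upsilon$ are random variables independent of $Z$. Let $\tau$ be the constant in the definition of the standard distributional limit, let $\mu_\Theta$ be the law of $\Theta$, and let $L:=\lim_{p\to\infty}\|(\mathbf P^{(p)}_{jj})_j\|_{\mathsf{LP}}$, where $\mathbf P^{(p)}=(\mathbf{\Sigma}^{(p)})^{-1}$ and the limit exists almost surely by the standard distributional limit assumption. Consider the variable selection procedure which selects those $j\in\{1,\dots,p\}$ with $|\hat\theta^u_j|\ge t$, where $\hat\theta^u$ is the debiased Lasso estimator with parameter $\lambda$. Then, with the choice $t=L^{1/4}$, $$\limsup_{p\to\infty}\{\mathsf{FDR}^{(p)}+(1-\mathsf{PWR}^{(p)})\}\le C_{L,\mu_\Theta,\tau},$$ where $C_{L,\mu_\Theta,\tau}$ depends only on $L,\mu_\Theta,\tau$ and satisfies $\lim_{L\to0}C_{L,\mu_\Theta,\tau}=0$ for any $\tau$ and any $\mu_\Theta$ with $\mathbb P[|\Theta|>0]>0$. In particular, if $\delta>1$, then $\tau$ can be bounded in terms of $\sigma,\lambda,\delta$ and $\mu_\Theta$ only (independently of the law of $\Upsilon$), and hence, still with $t=L^{1/4}$, $\limsup_{p\to\infty}\{\mathsf{FDR}^{(p)}+(1-\mathsf{PWR}^{(p)})\}\le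 C_{L,\mu_\Theta,\sigma,\lambda,\delta}$ for a quantity $C_{L,\mu_\Theta,\sigma,\lambda,\delta}$ depending only on $L,\mu_\Theta,\sigma,\lambda,\delta$ and satisfying $\lim_{L\to0}C_{L,\mu_\Theta,\sigma,\lambda,\delta}=0$.
   Context: **Model.** For each $p$, $\mathbf\Sigma=\mathbf\Sigma^{(p)}$ is a known positive definite $p\times p$ covariance matrix and $\theta=\theta^{(p)}\in\mathbb R^p$. One observes $n$ i.i.d. copies of $(X,Y)$, $Y=X^\top\theta+\xi$, with $X\sim\mathcal N(0,\mathbf\Sigma)$ and independent noise $\xi\sim\mathcal N(0,n\sigma^2)$, $\sigma>0$ fixed. $\mathbf X\in\mathbb R^{n\times p}$ is the design matrix (rows are the copies of $X$) and $\mathbf Y\in\mathbb R^n$ the response vector. The sampling rate $n=\delta p$ is constant. **Debiased Lasso.** With $\lambda$ independent of $p$, $$\hat\theta=\arg\min_{t\in\mathbb R^p}\Big\{\tfrac1{2n}\|\mathbf Y-\mathbf Xt\|_2^2+\lambda\|t\|_1\Big\},\qquad \hat\theta^u=\hat\theta+\frac{\mathsf d}{n}\mathbf\Sigma^{-1}\mathbf X^\top(\mathbf Y-\mathbf X\hat\theta),\qquad \frac1{\mathsf d}=1-\frac{\|\hat\theta\|_0}{n}.$$ **Standard distributional limit.** The sequence $\{(\mathbf\Sigma^{(p)},\theta^{(p)})\}$ has a standard distributional limit if (i) there is a deterministic $\tau\ne0$ such that, with $\hat\theta^u$ computed using the (possibly random) $\mathsf d$ given by $1/\mathsf d=1-\|\hat\theta\|_0/n$,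 the empirical measure $\frac1p\sum_{j=1}^p\delta_{(\theta_j,\,(\hat\theta^u_j-\theta_j)/\tau,\,(\mathbf\Sigma^{-1})_{jj})}$ converges weakly, almost surely, as $p\to\infty$ to the law $\nu$ on $\mathbb R^3$ of $(\Theta,\Upsilon^{1/2}Z,\Upsilon)$, where $Z\sim\mathcal N(0,1)$ and $(\Theta,\Upsilon)$ is independent of $Z$; and (ii) almost surely $\frac1p\|\theta^{(p)}\|_0\to\mathbb P[|\Theta|>0]$ and $\frac1p\|\theta^{(p)}\|_1\to\mathbb E[|\Theta|]$. **LP notation.** For $x\in\mathbb R^m$, $\|(x_j)_j\|_{\mathsf{LP}}$ is the Lévy–Prokhorov distance between $\frac1m\sum_{j=1}^m\delta_{x_j}$ and $\delta_0$; for nonnegative entries it equals $\inf\{\epsilon>0:\#\{j:x_j\ge\epsilon\}/m\le\epsilon\}$. **FDR and power.** For a procedure with selected set $\hat S\subset\{1,\dots,p\}$, $$\mathsf{FDR}=\mathbb E\Big[\frac{\#\{j\in\hat S:\theta_j=0\}}{\#\hat S\vee1}\Big],\qquad \mathsf{PWR}=\mathbb E\Big[\frac{\#\{j\in\hat S:\theta_j\ne0\}}{\#\{j:\theta_j\neq0\}}\Big].$$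
   Formalization: The bound on τ for δ>1 is claimed only when L>0: if L=0 (Υ=0 a.s.) any nonzero τ fits the definition, so no bound can hold. The constants serve all models on one arbitrary sample-space type; a standard space suffices, as only joint laws matter. *)

theory Defs
  imports
    "HOL-Probability.Probability"
    "Jordan_Normal_Form.Determinant"
    "Jordan_Normal_Form.Gauss_Jordan_Elimination"
begin

text \<open>
  Vectors and matrices of varying dimension are those of Jordan_Normal_Form. Coordinates are
  numbered \<open>0, \<dots>, p - 1\<close>. The names \<open>vec\<close>, \<open>$\<close>, \<open>det\<close> also exist in HOL-Analysis, so they are
  qualified below, and \<open>scalar_prod\<close> is written out.
\<close>

definition norm0 :: "real vec \<Rightarrow> nat" where
  "norm0 t = card {j. j < dim_vec t \<and> vec_index t j \<noteq> 0}"

definition norm1 :: "real vec \<Rightarrow> real" where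
  "norm1 t = (\<Sum>j<dim_vec t. \<bar>vec_index t j\<bar>)"

definition norm2_sq :: "real vec \<Rightarrow> real" where
  "norm2_sq t = scalar_prod t t"

definition pos_def_mat :: "nat \<Rightarrow> real mat \<Rightarrow> bool" where
  "pos_def_mat p S \<longleftrightarrow> S \<in> carrier_mat p p \<and> transpose_mat S = S \<and>
     (\<forall>v\<in>carrier_vec p. v \<noteq> 0\<^sub>v p \<longrightarrow> 0 < scalar_prod v (S *\<^sub>v v))"

definition precision_mat :: "real mat \<Rightarrow> real mat" where
  "precision_mat S = the (mat_inverse S)"


subsection \<open>Gaussian data\<close>

definition mvn_law :: "nat \<Rightarrow> real mat \<Rightarrow> (nat \<Rightarrow> real) measure" where
  "mvn_law p S = density (Pi\<^sub>M {..<p} (\<lambda>_. lborel))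
     (\<lambda>x. ennreal (let v = Matrix.vec p x in
        exp (- scalar_prod v (precision_mat S *\<^sub>v v) / 2) /
        sqrt ((2 * pi) ^ p * Determinant.det S)))"

text \<open>
  For the random design matrix \<open>X\<close>, \<open>design_row p X i\<close> is its \<open>i\<close>-th row as a random element of
  \<open>\<real>\<^sup>p\<close>, the latter represented by the product space over the index set \<open>{..<p}\<close>.
\<close>

definition design_row :: "nat \<Rightarrow> ('w \<Rightarrow> real mat) \<Rightarrow> nat \<Rightarrow> 'w \<Rightarrow> nat \<Rightarrow> real" where
  "design_row p X i \<omega> = (\<lambda>j\<in>{..<p}. X \<omega> $$ (i, j))"

text \<open>
  The \<open>m\<close> pairs (row \<open>i\<close> of \<open>X\<close>, \<open>i\<close>-th noise) are i.i.d., with the row distributed as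
  \<open>N(0, S)\<close>, the noise as \<open>N(0, s\<^sup>2)\<close>, and the two independent of each other
  (the joint law is a product measure). Measurability is part of \<open>indep_vars\<close>.
\<close>

definition gaussian_data ::
  "'w measure \<Rightarrow> nat \<Rightarrow> nat \<Rightarrow> real mat \<Rightarrow> real \<Rightarrow> ('w \<Rightarrow> real mat) \<Rightarrow> ('w \<Rightarrow> real vec) \<Rightarrow> bool"
where
  "gaussian_data M m p S s X \<xi> \<longleftrightarrow>
     (\<forall>\<omega>\<in>space M. X \<omega> \<in> carrier_mat m p \<and> \<xi> \<omega> \<in> carrier_vec m) \<and>
     (\<forall>i<m. distr M (Pi\<^sub>M {..<p} (\<lambda>_. borel) \<Otimes>\<^sub>M borel)
                (\<lambda>\<omega>. (design_row p X i \<omega>, vec_index (\<xi> \<omega>) i)) =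
              mvn_law p S \<Otimes>\<^sub>M density lborel (\<lambda>x. ennreal (normal_density 0 s x))) \<and>
     prob_space.indep_vars M (\<lambda>_. Pi\<^sub>M {..<p} (\<lambda>_. borel) \<Otimes>\<^sub>M borel)
       (\<lambda>i \<omega>. (design_row p X i \<omega>, vec_index (\<xi> \<omega>) i)) {..<m}"

definition response :: "real mat \<Rightarrow> real vec \<Rightarrow> real vec \<Rightarrow> real vec" where
  "response A \<theta> x = A *\<^sub>v \<theta> + x"


subsection \<open>Lasso and debiased Lasso\<close>

definition lasso_objective :: "real \<Rightarrow> real mat \<Rightarrow> real vec \<Rightarrow> real vec \<Rightarrow> real" where
  "lasso_objective lam A y t =
     norm2_sq (y - A *\<^sub>v t) / (2 * real (dim_row A)) + lam * norm1 t"

definition is_lasso :: "real \<Rightarrow> real mat \<Rightarrow> real vec \<Rightarrow> real vec \<Rightarrow> bool" where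
  "is_lasso lam A y t \<longleftrightarrow> is_arg_min (lasso_objective lam A y) (\<lambda>t. t \<in> carrier_vec (dim_col A)) t"

text \<open>
  If \<open>norm0 t\<close> equals the number of observations, \<open>1/0 = 0\<close> makes the correction term vanish.
\<close>

definition debias_factor :: "nat \<Rightarrow> real vec \<Rightarrow> real" where
  "debias_factor m t = 1 / (1 - real (norm0 t) / real m)"

definition debiased :: "real mat \<Rightarrow> real mat \<Rightarrow> real vec \<Rightarrow> real vec \<Rightarrow> real vec" where
  "debiased S A y t =
     t + (debias_factor (dim_row A) t / real (dim_row A)) \<cdot>\<^sub>v
           (precision_mat S *\<^sub>v (transpose_mat A *\<^sub>v (y - A *\<^sub>v t)))"

text \<open>
  A sequence of Lasso problems, indexed by the dimension \<open>p \<ge> 1\<close>, on one probability space \<open>M\<close>;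
  nothing is assumed about the joint law of the data for different \<open>p\<close>. The sample size
  \<open>n = \<delta> p\<close> is meant up to rounding to an integer, in either direction: the condition
  \<open>\<bar>n - \<delta> p\<bar> < 1\<close> forces \<open>n = \<delta> p\<close> whenever \<open>\<delta> p\<close> is an integer. The minimizer is not
  assumed to be unique; \<open>\<theta>h p\<close> is any random vector all of whose values are minimizers.
\<close>

definition lasso_sequence ::
  "'w measure \<Rightarrow> real \<Rightarrow> real \<Rightarrow> real \<Rightarrow> (nat \<Rightarrow> nat) \<Rightarrow> (nat \<Rightarrow> real mat) \<Rightarrow> (nat \<Rightarrow> real vec) \<Rightarrow>
   (nat \<Rightarrow> 'w \<Rightarrow> real mat) \<Rightarrow> (nat \<Rightarrow> 'w \<Rightarrow> real vec) \<Rightarrow> (nat \<Rightarrow> 'w \<Rightarrow> real vec) \<Rightarrow> bool"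
where
  "lasso_sequence M \<sigma> lam \<delta> n S \<theta> X \<xi> \<theta>h \<longleftrightarrow>
     prob_space M \<and> 0 < \<sigma> \<and> 0 < lam \<and> 0 < \<delta> \<and>
     (\<forall>p\<ge>1.
        \<bar>real (n p) - \<delta> * real p\<bar> < 1 \<and>
        pos_def_mat p (S p) \<and> \<theta> p \<in> carrier_vec p \<and>
        gaussian_data M (n p) p (S p) (sqrt (real (n p) * \<sigma>\<^sup>2)) (X p) (\<xi> p) \<and>
        (\<forall>j<p. (\<lambda>\<omega>. vec_index (\<theta>h p \<omega>) j) \<in> borel_measurable M) \<and>
        (\<forall>\<omega>\<in>space M. is_lasso lam (X p \<omega>) (response (X p \<omega>) (\<theta> p) (\<xi> p \<omega>)) (\<theta>h p \<omega>)))"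

definition debiased_sequence ::
  "(nat \<Rightarrow> real mat) \<Rightarrow> (nat \<Rightarrow> real vec) \<Rightarrow> (nat \<Rightarrow> 'w \<Rightarrow> real mat) \<Rightarrow> (nat \<Rightarrow> 'w \<Rightarrow> real vec) \<Rightarrow>
   (nat \<Rightarrow> 'w \<Rightarrow> real vec) \<Rightarrow> nat \<Rightarrow> 'w \<Rightarrow> real vec"
where
  "debiased_sequence S \<theta> X \<xi> \<theta>h p \<omega> =
     debiased (S p) (X p \<omega>) (response (X p \<omega>) (\<theta> p) (\<xi> p \<omega>)) (\<theta>h p \<omega>)"


subsection \<open>Standard distributional limit\<close>

definition empirical_measure :: "nat \<Rightarrow> (nat \<Rightarrow> 'a::topological_space) \<Rightarrow> 'a measure" where
  "empirical_measure m x = distr (uniform_count_measure {..<m}) borel x"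

text \<open>Weak convergence on arbitrary spaces; the library notion is restricted to the real line.\<close>

definition weakly_converges :: "(nat \<Rightarrow> 'a::topological_space measure) \<Rightarrow> 'a measure \<Rightarrow> bool" where
  "weakly_converges \<mu> \<nu> \<longleftrightarrow>
     (\<forall>f :: 'a \<Rightarrow> real. continuous_on UNIV f \<and> bounded (range f) \<longrightarrow>
        (\<lambda>k. \<integral>x. f x \<partial>\<mu> k) \<longlonglongrightarrow> (\<integral>x. f x \<partial>\<nu>))"

text \<open>
  The limit is given through the joint law \<open>\<kappa>\<close> of \<open>(\<Theta>, \<Upsilon>)\<close>; \<open>sdl_law \<kappa>\<close> is the law of
  \<open>(\<Theta>, \<Upsilon>\<^sup>1\<^sup>/\<^sup>2 Z, \<Upsilon>)\<close> with \<open>Z \<sim> N(0, 1)\<close> independent of \<open>(\<Theta>, \<Upsilon>)\<close>.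
\<close>

definition sdl_law :: "(real \<times> real) measure \<Rightarrow> (real \<times> real \<times> real) measure" where
  "sdl_law \<kappa> =
     distr (\<kappa> \<Otimes>\<^sub>M density lborel (\<lambda>z. ennreal (std_normal_density z))) borel
       (\<lambda>((a, u), z). (a, sqrt u * z, u))"

definition law_Theta :: "(real \<times> real) measure \<Rightarrow> real measure" where
  "law_Theta \<kappa> = distr \<kappa> borel fst"

text \<open>Here \<open>\<theta>u\<close> is the sequence of debiased estimators.\<close>

definition standard_distributional_limit ::
  "'w measure \<Rightarrow> (nat \<Rightarrow> real mat) \<Rightarrow> (nat \<Rightarrow> real vec) \<Rightarrow> (nat \<Rightarrow> 'w \<Rightarrow> real vec) \<Rightarrow>
   real \<Rightarrow> (real \<times> real) measure \<Rightarrow> bool"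
where
  "standard_distributional_limit M S \<theta> \<theta>u \<tau> \<kappa> \<longleftrightarrow>
     \<tau> \<noteq> 0 \<and> prob_space \<kappa> \<and> sets \<kappa> = sets borel \<and>
     (AE \<omega> in M. weakly_converges
        (\<lambda>p. empirical_measure p (\<lambda>j.
           (vec_index (\<theta> p) j,
            (vec_index (\<theta>u p \<omega>) j - vec_index (\<theta> p) j) / \<tau>,
            precision_mat (S p) $$ (j, j))))
        (sdl_law \<kappa>)) \<and>
     (\<lambda>p. real (norm0 (\<theta> p)) / real p) \<longlonglongrightarrow> measure (law_Theta \<kappa>) {x. \<bar>x\<bar> > 0} \<and>
     integrable (law_Theta \<kappa>) (\<lambda>x. \<bar>x\<bar>) \<and>
     (\<lambda>p. norm1 (\<theta> p) / real p) \<longlonglongrightarrow> (\<integral>x. \<bar>x\<bar> \<partial>law_Theta \<kappa>)"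


subsection \<open>Levy--Prokhorov distance\<close>

definition LP_dist :: "'a::metric_space measure \<Rightarrow> 'a measure \<Rightarrow> real" where
  "LP_dist \<mu> \<nu> = Inf {\<epsilon>. 0 < \<epsilon> \<and> (\<forall>A\<in>sets borel.
     measure \<mu> A \<le> measure \<nu> (\<Union>a\<in>A. ball a \<epsilon>) + \<epsilon> \<and>
     measure \<nu> A \<le> measure \<mu> (\<Union>a\<in>A. ball a \<epsilon>) + \<epsilon>)}"

definition LP_norm :: "nat \<Rightarrow> (nat \<Rightarrow> real) \<Rightarrow> real" where
  "LP_norm m x = LP_dist (empirical_measure m x) (return borel 0)"

definition LP_precision :: "(nat \<Rightarrow> real mat) \<Rightarrow> nat \<Rightarrow> real" where
  "LP_precision S p = LP_norm p (\<lambda>j. precision_mat (S p) $$ (j, j))"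


subsection \<open>Variable selection\<close>

definition selected :: "real \<Rightarrow> real vec \<Rightarrow> nat set" where
  "selected t v = {j. j < dim_vec v \<and> t \<le> \<bar>vec_index v j\<bar>}"

definition FDR :: "'w measure \<Rightarrow> real vec \<Rightarrow> ('w \<Rightarrow> nat set) \<Rightarrow> real" where
  "FDR M \<theta> Sh =
     (\<integral>\<omega>. real (card {j \<in> Sh \<omega>. vec_index \<theta> j = 0}) / real (max (card (Sh \<omega>)) 1) \<partial>M)"

text \<open>The value is \<open>0\<close> if \<open>\<theta> = 0\<close>, where the power is not defined.\<close>

definition PWR :: "'w measure \<Rightarrow> real vec \<Rightarrow> ('w \<Rightarrow> nat set) \<Rightarrow> real" where
  "PWR M \<theta> Sh =
     (\<integral>\<omega>. real (card {j \<in> Sh \<omega>. vec_index \<theta> j \<noteq> 0}) /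
            real (card {j. j < dim_vec \<theta> \<and> vec_index \<theta> j \<noteq> 0}) \<partial>M)"

text \<open>
  \<open>limsup {FDR + (1 - PWR)}\<close> for the procedure that selects the \<open>j\<close> with \<open>\<bar>\<theta>u\<^sub>j\<bar> \<ge> t\<close>.
\<close>

definition limsup_error ::
  "'w measure \<Rightarrow> (nat \<Rightarrow> real vec) \<Rightarrow> (nat \<Rightarrow> 'w \<Rightarrow> real vec) \<Rightarrow> real \<Rightarrow> ereal"
where
  "limsup_error M \<theta> \<theta>u t =
     limsup (\<lambda>p. ereal (FDR M (\<theta> p) (\<lambda>\<omega>. selected t (\<theta>u p \<omega>)) +
                        (1 - PWR M (\<theta> p) (\<lambda>\<omega>. selected t (\<theta>u p \<omega>)))))"

definition nonzero_law :: "real measure \<Rightarrow> bool" where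
  "nonzero_law \<mu> \<longleftrightarrow> prob_space \<mu> \<and> sets \<mu> = sets borel \<and> measure \<mu> {x. \<bar>x\<bar> > 0} > 0"

end

(* A coordinate with |P_jj| small has small noise in the limit, since the debiased error there is
   about tau sqrt(P_jj) Z. The Levy-Prokhorov level L bounds the fraction of the other coordinates,
   so up to a fraction O(L + tau^2 t^2) all errors are below t = L^(1/4). Signals of size below 3t
   carry vanishing mass as L -> 0, hence thresholding at t makes few errors of either kind.

   For delta > 1 the bound on tau comes from showing that, for all large p, every debiased coordinate
   deviates by at most K sqrt(P_jj) with probability at least 1/2, where K depends on sigma, lambda,
   delta and E|Theta| only. Let z = X P e_j / sqrt(P_jj), a standard Gaussian vector independent of
   the other columns, N the squared norm of its projection orthogonal to them, r the Lasso residual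
   and a = (theta_hat_j - theta_j) / sqrt(P_jj). The error of the debiased coordinate j is
   sqrt(P_jj) (<z, r> + a v) / v with v = n - |theta_hat|_0. As a function of z, the damped residual
   N / (n + N) r is Lipschitz and almost everywhere differentiable, and its divergence is
   - N / (n + N) a v up to a term of lower order. Stein's second-order identity, applied to
   finite Cameron-Martin shifts, therefore bounds the second moment of N / (n + N) (<z, r> + a v).
   If tau were larger than 4 K, the limit law would violate this concentration on the coordinates
   with P_jj > L/4, which have positive mass. *)
theory Submission
  imports Defs
begin

text \<open>Two obstacles shape the bound on tau. Weak convergence carries no moments, so a bound on
  single coordinates can reach the limit law only through probabilities, and a second moment is used
  just to obtain probability 1/2. Moreover the Lasso residual is neither differentiable everywhere
  nor uniformly Lipschitz: changing column j by w can move it by a multiple of |w| divided by the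
  distance of the column to the span of the others, a distance proportional to sqrt N. The factor N
  / (n + N) is small enough near N = 0 to cancel this quotient, and bounded below once N is of order
  n. Exact identities for finite shifts replace integration by parts, so the derivative enters only
  through Fatou's lemma and may fail to exist on a null set. The divergence contains the trace n -
  |theta_hat|_0 of the projection orthogonal to the active columns; this is the origin of the
  debiasing factor. For delta > 1 one has n > p eventually: the columns are then independent almost
  surely, the minimizer is unique, and N concentrates around at least n - p.\<close>

subsection \<open>Stein's identity for finite Gaussian shifts\<close>

text \<open>Abstract form of independent standard Gaussian coordinates \<open>z i\<close>: what is
  used of them is how the law reacts to a finite translation of one coordinate. Under the weighted
  law \<open>z i\<close> is centred at \<open>- \<eta>\<close>, and \<open>T i \<eta>\<close> moves
  it back.\<close>

locale gaussian_shift = prob_space \<mu> for \<mu> :: "'e measure" +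
  fixes I :: "'i set" and T :: "'i \<Rightarrow> real \<Rightarrow> 'e \<Rightarrow> 'e" and z :: "'i \<Rightarrow> 'e \<Rightarrow> real"
  assumes finite_I: "finite I"
    and T_measurable[measurable]: "\<And>i \<eta>. i \<in> I \<Longrightarrow> T i \<eta> \<in> measurable \<mu> \<mu>"
    and z_measurable[measurable]: "\<And>i. i \<in> I \<Longrightarrow> z i \<in> borel_measurable \<mu>"
    and T_commute: "\<And>i k \<eta> \<zeta> x. i \<in> I \<Longrightarrow> k \<in> I \<Longrightarrow> x \<in> space \<mu> \<Longrightarrow> T i \<eta> (T k \<zeta> x) = T k \<zeta> (T i \<eta> x)"
    and T_inverse: "\<And>i \<eta> x. i \<in> I \<Longrightarrow> x \<in> space \<mu> \<Longrightarrow> T i \<eta> (T i (- \<eta>) x) = x"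
    and z_T: "\<And>i k \<eta> x. i \<in> I \<Longrightarrow> k \<in> I \<Longrightarrow> x \<in> space \<mu> \<Longrightarrow>
                 z i (T k \<eta> x) = z i x + (if i = k then \<eta> else 0)"
    and cameron_martin: "\<And>i \<eta>. i \<in> I \<Longrightarrow>
          distr (density \<mu> (\<lambda>x. ennreal (exp (- \<eta> * z i x - \<eta>\<^sup>2 / 2)))) \<mu> (T i \<eta>) = \<mu>"
begin

definition weight :: "'i \<Rightarrow> real \<Rightarrow> 'e \<Rightarrow> real" where
  "weight i \<eta> x = exp (- \<eta> * z i x - \<eta>\<^sup>2 / 2)"

lemma weight_measurable[measurable]: "i \<in> I \<Longrightarrow> weight i \<eta> \<in> borel_measurable \<mu>"
  unfolding weight_def by measurable

lemma T_inverse': "i \<in> I \<Longrightarrow> x \<in> space \<mu> \<Longrightarrow> T i (- \<eta>) (T i \<eta> x) = x"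
  using T_inverse[of i x "- \<eta>"] by simp

lemma integral_shift:
  fixes F :: "'e \<Rightarrow> real"
  assumes i: "i \<in> I" and F[measurable]: "F \<in> borel_measurable \<mu>"
  shows "integrable \<mu> (\<lambda>x. F (T i \<eta> x) * weight i \<eta> x) \<longleftrightarrow> integrable \<mu> F"
    and "(\<integral>x. F (T i \<eta> x) * weight i \<eta> x \<partial>\<mu>) = (\<integral>x. F x \<partial>\<mu>)"
proof -
  note [measurable] = T_measurable[OF i] weight_measurable[OF i]
  let ?D = "density \<mu> (\<lambda>x. ennreal (weight i \<eta> x))"
  have D: "distr ?D \<mu> (T i \<eta>) = \<mu>"
    using cameron_martin[OF i, of \<eta>] by (simp add: weight_def)
  have "integrable \<mu> F \<longleftrightarrow> integrable (distr ?D \<mu> (T i \<eta>)) F" by (simp add: D)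
  also have "\<dots> \<longleftrightarrow> integrable ?D (\<lambda>x. F (T i \<eta> x))"
    by (subst integrable_distr_eq) auto
  also have "\<dots> \<longleftrightarrow> integrable \<mu> (\<lambda>x. weight i \<eta> x *\<^sub>R F (T i \<eta> x))"
    by (subst integrable_density) (auto simp: weight_def)
  finally show "integrable \<mu> (\<lambda>x. F (T i \<eta> x) * weight i \<eta> x) \<longleftrightarrow> integrable \<mu> F"
    by (simp add: mult.commute)
  have "integral\<^sup>L \<mu> F = integral\<^sup>L (distr ?D \<mu> (T i \<eta>)) F" by (simp add: D)
  also have "\<dots> = integral\<^sup>L ?D (\<lambda>x. F (T i \<eta> x))"
    by (subst integral_distr) auto
  also have "\<dots> = integral\<^sup>L \<mu> (\<lambda>x. weight i \<eta> x *\<^sub>R F (T i \<eta> x))"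
    by (subst integral_density) (auto simp: weight_def)
  finally show "(\<integral>x. F (T i \<eta> x) * weight i \<eta> x \<partial>\<mu>) = (\<integral>x. F x \<partial>\<mu>)"
    by (simp add: mult.commute)
qed

text \<open>The weight is positive, so the weighted measure has the null sets of
  \<open>\<mu>\<close>; its image under \<open>T i \<eta>\<close> is \<open>\<mu>\<close>, so null
  sets are pulled back to null sets.\<close>

lemma AE_shift:
  assumes i: "i \<in> I" and P: "AE x in \<mu>. P x"
  shows "AE x in \<mu>. P (T i \<eta> x)"
proof -
  note [measurable] = T_measurable[OF i] weight_measurable[OF i]
  let ?D = "density \<mu> (\<lambda>x. ennreal (weight i \<eta> x))"
  have D: "distr ?D \<mu> (T i \<eta>) = \<mu>"
    using cameron_martin[OF i, of \<eta>] by (simp add: weight_def)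
  have "AE x in ?D. P (T i \<eta> x)"
  proof (rule AE_distrD[of "T i \<eta>" ?D \<mu>])
    show "AE x in distr ?D \<mu> (T i \<eta>). P x" unfolding D by (rule P)
  qed auto
  then show ?thesis
    by (subst (asm) AE_density) (auto, auto simp: weight_def)
qed

text \<open>Adjoint of the backward difference: integrating \<open>quot \<eta> i F\<close> against
  \<open>G\<close> is integrating \<open>F\<close> against
  \<open>(G (T i (- \<eta>) x) - G x) / \<eta>\<close>. For \<open>\<eta>\<close> tending to 0 it
  becomes the derivative of \<open>F\<close> in direction \<open>i\<close> minus
  \<open>z i * F\<close>.\<close>

definition quot :: "real \<Rightarrow> 'i \<Rightarrow> ('e \<Rightarrow> real) \<Rightarrow> 'e \<Rightarrow> real" where
  "quot \<eta> i F x = (F (T i \<eta> x) * weight i \<eta> x - F x) / \<eta>"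

text \<open>Finite difference form of Stein's second-order identity: the indices of the two
  differences on the right are exchanged, and for \<open>i = k\<close> the mean of
  \<open>F * G\<close> is added. Since the shifts commute, the only defect is the action of
  \<open>T i\<close> on its own weight.\<close>

lemma quot_product:
  fixes F G :: "'e \<Rightarrow> real"
  assumes i: "i \<in> I" and k: "k \<in> I" and \<eta>: "\<eta> \<noteq> 0"
    and F[measurable]: "F \<in> borel_measurable \<mu>" and G[measurable]: "G \<in> borel_measurable \<mu>"
    and int: "integrable \<mu> (\<lambda>x. F x * G x)" "integrable \<mu> (\<lambda>x. F x * G (T i (- \<eta>) x))"
       "integrable \<mu> (\<lambda>x. F (T k (- \<eta>) x) * G x)"
       "integrable \<mu> (\<lambda>x. F (T k (- \<eta>) x) * G (T i (- \<eta>) x))"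
  shows "integrable \<mu> (\<lambda>x. quot \<eta> i F x * quot \<eta> k G x)"
    and "(\<integral>x. quot \<eta> i F x * quot \<eta> k G x \<partial>\<mu>) =
       (\<integral>x. (F x - F (T k (- \<eta>) x)) * (G x - G (T i (- \<eta>) x)) \<partial>\<mu>) / \<eta>\<^sup>2 +
       (if i = k then (exp (\<eta>\<^sup>2) - 1) / \<eta>\<^sup>2 * (\<integral>x. F (T i (- \<eta>) x) * G (T i (- \<eta>) x) \<partial>\<mu>) else 0)"
proof -
  note [measurable] = T_measurable[OF i] T_measurable[OF k] weight_measurable[OF i] weight_measurable[OF k]
  \<comment> \<open>The factor by which \<open>T i (- \<eta>)\<close> changes
    \<open>weight k \<eta>\<close>.\<close>
  define e where "e = (if i = k then exp (\<eta>\<^sup>2) else 1)"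
  define K where "K = (\<lambda>x. F (T k (- \<eta>) x) * G (T i (- \<eta>) x))"
  \<comment> \<open>Shifted by \<open>T i \<eta>\<close> and weighted, \<open>H\<close> becomes the
    product of the two weighted shifts; by commutation \<open>H\<close> is also \<open>e\<close>
    times the weighted shift of \<open>K\<close> by \<open>T k \<eta>\<close>. Two changes of
    variables then remove both weights.\<close>
  define H where "H = (\<lambda>x. F x * (G (T k \<eta> (T i (- \<eta>) x)) * weight k \<eta> (T i (- \<eta>) x)))"
  have [measurable]: "K \<in> borel_measurable \<mu>" "H \<in> borel_measurable \<mu>"
    unfolding K_def H_def by measurable
  have wT: "weight k \<eta> (T i (- \<eta>) x) = weight k \<eta> x * e" if "x \<in> space \<mu>" for x
    using z_T[OF k i that, of "- \<eta>"]
    by (auto simp: weight_def e_def exp_add[symmetric] field_simps power2_eq_square)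
  have HK: "H x = e * (K (T k \<eta> x) * weight k \<eta> x)" if x: "x \<in> space \<mu>" for x
    using T_inverse'[OF k x, of \<eta>] T_commute[OF i k x, of "- \<eta>" \<eta>] wT[OF x]
    by (simp add: H_def K_def)
  have HT: "F (T i \<eta> x) * weight i \<eta> x * (G (T k \<eta> x) * weight k \<eta> x) = H (T i \<eta> x) * weight i \<eta> x"
    if x: "x \<in> space \<mu>" for x
    using T_inverse'[OF i x, of \<eta>] by (simp add: H_def)
  have iK: "integrable \<mu> K" unfolding K_def by (rule int)
  have iH: "integrable \<mu> H"
    by (subst Bochner_Integration.integrable_cong[OF refl HK])
      (use iK integral_shift(1)[OF k, of K \<eta>] in auto)
  have EH: "(\<integral>x. H x \<partial>\<mu>) = e * (\<integral>x. K x \<partial>\<mu>)"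
    by (subst Bochner_Integration.integral_cong[OF refl HK])
      (use integral_shift(2)[OF k, of K \<eta>] in auto)
  have a1: "integrable \<mu> (\<lambda>x. F (T i \<eta> x) * weight i \<eta> x * (G (T k \<eta> x) * weight k \<eta> x))"
    by (subst Bochner_Integration.integrable_cong[OF refl HT])
      (use iH integral_shift(1)[OF i, of H \<eta>] in auto)
  have e1: "(\<integral>x. F (T i \<eta> x) * weight i \<eta> x * (G (T k \<eta> x) * weight k \<eta> x) \<partial>\<mu>) = e * (\<integral>x. K x \<partial>\<mu>)"
    by (subst Bochner_Integration.integral_cong[OF refl HT])
      (use EH integral_shift(2)[OF i, of H \<eta>] in auto)
  let ?A = "\<lambda>x. F x * G (T i (- \<eta>) x)"
  have AT: "F (T i \<eta> x) * weight i \<eta> x * G x = ?A (T i \<eta> x) * weight i \<eta> x" if x: "x \<in> space \<mu>" for x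
    using T_inverse'[OF i x, of \<eta>] by simp
  have a2: "integrable \<mu> (\<lambda>x. F (T i \<eta> x) * weight i \<eta> x * G x)"
    by (subst Bochner_Integration.integrable_cong[OF refl AT])
      (use int(2) integral_shift(1)[OF i, of ?A \<eta>] in auto)
  have e2: "(\<integral>x. F (T i \<eta> x) * weight i \<eta> x * G x \<partial>\<mu>) = (\<integral>x. ?A x \<partial>\<mu>)"
    by (subst Bochner_Integration.integral_cong[OF refl AT])
      (use integral_shift(2)[OF i, of ?A \<eta>] in auto)
  let ?B = "\<lambda>x. F (T k (- \<eta>) x) * G x"
  have BT: "F x * (G (T k \<eta> x) * weight k \<eta> x) = ?B (T k \<eta> x) * weight k \<eta> x" if x: "x \<in> space \<mu>" for x
    using T_inverse'[OF k x, of \<eta>] by simp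
  have a3: "integrable \<mu> (\<lambda>x. F x * (G (T k \<eta> x) * weight k \<eta> x))"
    by (subst Bochner_Integration.integrable_cong[OF refl BT])
      (use int(3) integral_shift(1)[OF k, of ?B \<eta>] in auto)
  have e3: "(\<integral>x. F x * (G (T k \<eta> x) * weight k \<eta> x) \<partial>\<mu>) = (\<integral>x. ?B x \<partial>\<mu>)"
    by (subst Bochner_Integration.integral_cong[OF refl BT])
      (use integral_shift(2)[OF k, of ?B \<eta>] in auto)
  let ?X = "\<lambda>x. F (T i \<eta> x) * weight i \<eta> x * (G (T k \<eta> x) * weight k \<eta> x)
     - F (T i \<eta> x) * weight i \<eta> x * G x - F x * (G (T k \<eta> x) * weight k \<eta> x) + F x * G x"
  have eq: "quot \<eta> i F x * quot \<eta> k G x = ?X x / \<eta>\<^sup>2" for x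
    using \<eta> by (simp add: quot_def field_simps power2_eq_square)
  have iX: "integrable \<mu> ?X" using a1 a2 a3 int(1) by auto
  show "integrable \<mu> (\<lambda>x. quot \<eta> i F x * quot \<eta> k G x)"
    unfolding eq using iX by auto
  have "(\<integral>x. quot \<eta> i F x * quot \<eta> k G x \<partial>\<mu>) = (\<integral>x. ?X x \<partial>\<mu>) / \<eta>\<^sup>2"
    unfolding eq by simp
  also have "(\<integral>x. ?X x \<partial>\<mu>) = e * (\<integral>x. K x \<partial>\<mu>) - (\<integral>x. ?A x \<partial>\<mu>) - (\<integral>x. ?B x \<partial>\<mu>) + (\<integral>x. F x * G x \<partial>\<mu>)"
    using a1 a2 a3 int(1) e1 e2 e3 by simp
  also have "\<dots> = (\<integral>x. K x - ?A x - ?B x + F x * G x \<partial>\<mu>) + (e - 1) * (\<integral>x. K x \<partial>\<mu>)"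
    using iK int by (simp add: algebra_simps)
  also have "(\<lambda>x. K x - ?A x - ?B x + F x * G x) =
      (\<lambda>x. (F x - F (T k (- \<eta>) x)) * (G x - G (T i (- \<eta>) x)))"
    by (auto simp: K_def algebra_simps)
  finally show "(\<integral>x. quot \<eta> i F x * quot \<eta> k G x \<partial>\<mu>) =
       (\<integral>x. (F x - F (T k (- \<eta>) x)) * (G x - G (T i (- \<eta>) x)) \<partial>\<mu>) / \<eta>\<^sup>2 +
       (if i = k then (exp (\<eta>\<^sup>2) - 1) / \<eta>\<^sup>2 * (\<integral>x. F (T i (- \<eta>) x) * G (T i (- \<eta>) x) \<partial>\<mu>) else 0)"
    by (simp add: e_def K_def add_divide_distrib)
qed

lemma integrable_mult_of_squares:
  fixes F G :: "'e \<Rightarrow> real"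
  assumes [measurable]: "F \<in> borel_measurable \<mu>" "G \<in> borel_measurable \<mu>"
    and "integrable \<mu> (\<lambda>x. (F x)\<^sup>2)" "integrable \<mu> (\<lambda>x. (G x)\<^sup>2)"
  shows "integrable \<mu> (\<lambda>x. F x * G x)"
proof (rule Bochner_Integration.integrable_bound)
  show "integrable \<mu> (\<lambda>x. (F x)\<^sup>2 + (G x)\<^sup>2)" using assms by auto
  have "\<bar>a * b\<bar> \<le> a\<^sup>2 + b\<^sup>2" for a b :: real
  proof -
    have "2 * \<bar>a * b\<bar> \<le> a\<^sup>2 + b\<^sup>2" using sum_squares_bound[of "\<bar>a\<bar>" "\<bar>b\<bar>"] by (simp add: abs_mult)
    then show ?thesis using abs_ge_zero[of "a * b"] by linarith
  qed
  then show "AE x in \<mu>. norm (F x * G x) \<le> norm ((F x)\<^sup>2 + (G x)\<^sup>2)" by simp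
qed simp

text \<open>Product rule, with \<open>- z i x\<close> the derivative of the weight at 0. The
  sequence \<open>1 / Suc m\<close> is used so that later only countably many shifts have to avoid
  null sets.\<close>

lemma quot_tendsto:
  assumes "(\<lambda>m. (F (T i (1 / real (Suc m)) x) - F x) * real (Suc m)) \<longlonglongrightarrow> D"
  shows "(\<lambda>m. quot (1 / real (Suc m)) i F x) \<longlonglongrightarrow> D - z i x * F x"
proof -
  define w where "w = (\<lambda>\<eta>. exp (- \<eta> * z i x - \<eta>\<^sup>2 / 2))"
  have s: "filterlim (\<lambda>m. 1 / real (Suc m)) (at 0) sequentially"
    using LIMSEQ_inverse_real_of_nat by (auto simp: filterlim_at inverse_eq_divide)
  have "(w has_field_derivative - z i x) (at 0)"
    unfolding w_def by (auto intro!: derivative_eq_intros)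
  then have "((\<lambda>h. (w (0 + h) - w 0) / h) \<longlongrightarrow> - z i x) (at 0)"
    by (simp add: DERIV_def)
  from filterlim_compose[OF this s]
  have 1: "(\<lambda>m. (w (1 / real (Suc m)) - 1) * real (Suc m)) \<longlonglongrightarrow> - z i x"
    by (simp add: w_def)
  have "isCont w 0" unfolding w_def by (auto intro!: continuous_intros)
  then have "(w \<longlongrightarrow> w 0) (at 0)" by (simp add: isCont_def)
  from filterlim_compose[OF this s]
  have 2: "(\<lambda>m. w (1 / real (Suc m))) \<longlonglongrightarrow> 1" by (simp add: w_def)
  have "(\<lambda>m. (F (T i (1 / real (Suc m)) x) - F x) * real (Suc m) * w (1 / real (Suc m))
      + F x * ((w (1 / real (Suc m)) - 1) * real (Suc m))) \<longlonglongrightarrow> D * 1 + F x * (- z i x)"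
    by (intro tendsto_intros assms 1 2)
  moreover have "(F (T i (1 / real (Suc m)) x) - F x) * real (Suc m) * w (1 / real (Suc m))
      + F x * ((w (1 / real (Suc m)) - 1) * real (Suc m)) = quot (1 / real (Suc m)) i F x" for m
    by (simp add: quot_def weight_def w_def algebra_simps del: of_nat_Suc)
  ultimately show ?thesis by (simp add: mult.commute)
qed

text \<open>By \<open>quot_product\<close> the expanded square splits into a cross term, at most the
  mean of \<open>G\<close>, and a diagonal term, at most twice the mean square of the shifted
  \<open>f\<close>. The latter square is at most \<open>2 * f\<^sup>2 + 2 * G\<close>; hence the
  constants 4 and 5 = 1 + 4.\<close>

lemma stein_quot_bound:
  fixes f :: "'i \<Rightarrow> 'e \<Rightarrow> real"
  assumes f: "\<And>i. i \<in> I \<Longrightarrow> f i \<in> borel_measurable \<mu>"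
    and f2: "\<And>i. i \<in> I \<Longrightarrow> integrable \<mu> (\<lambda>x. (f i x)\<^sup>2)"
    and G: "integrable \<mu> G" and \<eta>: "0 < \<eta>" "\<eta> \<le> 1"
    and lip: "AE x in \<mu>. (\<Sum>k\<in>I. \<Sum>i\<in>I. (f i x - f i (T k (- \<eta>) x))\<^sup>2) \<le> \<eta>\<^sup>2 * G x"
  shows "integrable \<mu> (\<lambda>x. (\<Sum>i\<in>I. quot \<eta> i (f i) x)\<^sup>2)"
    and "(\<integral>x. (\<Sum>i\<in>I. quot \<eta> i (f i) x)\<^sup>2 \<partial>\<mu>) \<le> 4 * (\<integral>x. (\<Sum>i\<in>I. (f i x)\<^sup>2) \<partial>\<mu>) + 5 * (\<integral>x. G x \<partial>\<mu>)"
proof -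
  note [measurable] = f
  have G0: "AE x in \<mu>. 0 \<le> G x"
    using lip
  proof eventually_elim
    case (elim x)
    have "0 \<le> (\<Sum>k\<in>I. \<Sum>i\<in>I. (f i x - f i (T k (- \<eta>) x))\<^sup>2)" by (intro sum_nonneg) auto
    with elim have "0 \<le> \<eta>\<^sup>2 * G x" by linarith
    with \<eta> show ?case by (simp add: zero_le_mult_iff)
  qed
  have A2: "integrable \<mu> (\<lambda>x. (f i x - f i (T k (- \<eta>) x))\<^sup>2)" if ik: "i \<in> I" "k \<in> I" for i k
  proof (rule Bochner_Integration.integrable_bound)
    show "integrable \<mu> (\<lambda>x. \<eta>\<^sup>2 * G x)" using G by auto
    show "(\<lambda>x. (f i x - f i (T k (- \<eta>) x))\<^sup>2) \<in> borel_measurable \<mu>" using ik by measurable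
    show "AE x in \<mu>. norm ((f i x - f i (T k (- \<eta>) x))\<^sup>2) \<le> norm (\<eta>\<^sup>2 * G x)"
      using lip G0
    proof eventually_elim
      case (elim x)
      have "(f i x - f i (T k (- \<eta>) x))\<^sup>2 \<le> (\<Sum>i\<in>I. (f i x - f i (T k (- \<eta>) x))\<^sup>2)"
        using ik finite_I by (intro member_le_sum) auto
      also have "\<dots> \<le> (\<Sum>k\<in>I. \<Sum>i\<in>I. (f i x - f i (T k (- \<eta>) x))\<^sup>2)"
        using ik finite_I by (intro member_le_sum[where f = "\<lambda>k. \<Sum>i\<in>I. (f i x - f i (T k (- \<eta>) x))\<^sup>2"] sum_nonneg) auto
      finally show ?case using elim by auto
    qed
  qed
  have sh: "integrable \<mu> (\<lambda>x. (f i (T k (- \<eta>) x))\<^sup>2)" if ik: "i \<in> I" "k \<in> I" for i k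
  proof (rule Bochner_Integration.integrable_bound)
    show "integrable \<mu> (\<lambda>x. 2 * (f i x)\<^sup>2 + 2 * (f i x - f i (T k (- \<eta>) x))\<^sup>2)"
      using f2[OF ik(1)] A2[OF ik] by auto
    show "(\<lambda>x. (f i (T k (- \<eta>) x))\<^sup>2) \<in> borel_measurable \<mu>" using ik by measurable
    have "b\<^sup>2 \<le> 2 * a\<^sup>2 + 2 * (a - b)\<^sup>2" for a b :: real
      using zero_le_power2[of "2 * a - b"] by (simp add: power2_eq_square algebra_simps)
    then show "AE x in \<mu>. norm ((f i (T k (- \<eta>) x))\<^sup>2) \<le> norm (2 * (f i x)\<^sup>2 + 2 * (f i x - f i (T k (- \<eta>) x))\<^sup>2)"
      by auto
  qed
  have m: "(\<lambda>x. f i (T k (- \<eta>) x)) \<in> borel_measurable \<mu>" if "i \<in> I" "k \<in> I" for i k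
    using that by measurable
  \<comment> \<open>\<open>exp y \<le> 1 + y + y\<^sup>2\<close> at
    \<open>y = \<eta>\<^sup>2 \<le> 1\<close> gives \<open>c \<le> 2\<close>.\<close>
  define c where "c = (exp (\<eta>\<^sup>2) - 1) / \<eta>\<^sup>2"
  have c: "0 \<le> c" "c \<le> 2"
  proof -
    have "\<eta>\<^sup>2 \<le> 1" using \<eta> by (simp add: power_le_one)
    then have "exp (\<eta>\<^sup>2) \<le> 1 + \<eta>\<^sup>2 + (\<eta>\<^sup>2)\<^sup>2" by (intro exp_bound) auto
    also have "(\<eta>\<^sup>2)\<^sup>2 \<le> \<eta>\<^sup>2" using \<open>\<eta>\<^sup>2 \<le> 1\<close> by (simp add: power2_eq_square mult_left_le)
    finally show "c \<le> 2" using \<eta> by (simp add: c_def field_simps)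
    show "0 \<le> c" by (simp add: c_def)
  qed
  let ?A = "\<lambda>i k x. f i x - f i (T k (- \<eta>) x)"
  have qp: "integrable \<mu> (\<lambda>x. quot \<eta> i (f i) x * quot \<eta> k (f k) x)"
      "(\<integral>x. quot \<eta> i (f i) x * quot \<eta> k (f k) x \<partial>\<mu>) = (\<integral>x. ?A i k x * ?A k i x \<partial>\<mu>) / \<eta>\<^sup>2 +
       (if i = k then c * (\<integral>x. f i (T i (- \<eta>) x) * f k (T i (- \<eta>) x) \<partial>\<mu>) else 0)"
    if ik: "i \<in> I" "k \<in> I" for i k
    unfolding c_def
  proof -
    have i1: "integrable \<mu> (\<lambda>x. f i x * f k x)" "integrable \<mu> (\<lambda>x. f i x * f k (T i (- \<eta>) x))"
       "integrable \<mu> (\<lambda>x. f i (T k (- \<eta>) x) * f k x)"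
       "integrable \<mu> (\<lambda>x. f i (T k (- \<eta>) x) * f k (T i (- \<eta>) x))"
      by (intro integrable_mult_of_squares f f2 sh m ik)+
    have "\<eta> \<noteq> 0" using \<eta> by simp
    note Q = quot_product[OF ik this f[OF ik(1)] f[OF ik(2)] i1]
    show "integrable \<mu> (\<lambda>x. quot \<eta> i (f i) x * quot \<eta> k (f k) x)" by (rule Q(1))
    show "(\<integral>x. quot \<eta> i (f i) x * quot \<eta> k (f k) x \<partial>\<mu>) = (\<integral>x. ?A i k x * ?A k i x \<partial>\<mu>) / \<eta>\<^sup>2 +
       (if i = k then (exp (\<eta>\<^sup>2) - 1) / \<eta>\<^sup>2 * (\<integral>x. f i (T i (- \<eta>) x) * f k (T i (- \<eta>) x) \<partial>\<mu>) else 0)"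
      by (rule Q(2))
  qed
  have sq: "(\<Sum>i\<in>I. quot \<eta> i (f i) x)\<^sup>2 = (\<Sum>i\<in>I. \<Sum>k\<in>I. quot \<eta> i (f i) x * quot \<eta> k (f k) x)" for x
    by (simp add: power2_eq_square sum_product)
  show "integrable \<mu> (\<lambda>x. (\<Sum>i\<in>I. quot \<eta> i (f i) x)\<^sup>2)"
    unfolding sq using qp by auto
  have iA: "integrable \<mu> (\<lambda>x. ?A i k x * ?A k i x)" if "i \<in> I" "k \<in> I" for i k
    using that by (intro integrable_mult_of_squares A2) (auto intro!: borel_measurable_diff f m)
  have "(\<integral>x. (\<Sum>i\<in>I. quot \<eta> i (f i) x)\<^sup>2 \<partial>\<mu>) = (\<Sum>i\<in>I. \<Sum>k\<in>I. (\<integral>x. quot \<eta> i (f i) x * quot \<eta> k (f k) x \<partial>\<mu>))"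
    unfolding sq using qp(1) by (simp add: Bochner_Integration.integral_sum)
  also have "\<dots> = (\<Sum>i\<in>I. \<Sum>k\<in>I. (\<integral>x. ?A i k x * ?A k i x \<partial>\<mu>) / \<eta>\<^sup>2) +
      (\<Sum>i\<in>I. c * (\<integral>x. (f i (T i (- \<eta>) x))\<^sup>2 \<partial>\<mu>))"
    using finite_I by (simp add: qp(2) sum.distrib power2_eq_square)
  also have "(\<Sum>i\<in>I. \<Sum>k\<in>I. (\<integral>x. ?A i k x * ?A k i x \<partial>\<mu>) / \<eta>\<^sup>2) =
      (\<integral>x. (\<Sum>i\<in>I. \<Sum>k\<in>I. ?A i k x * ?A k i x) \<partial>\<mu>) / \<eta>\<^sup>2"
    using iA by (simp add: Bochner_Integration.integral_sum sum_divide_distrib)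
  also have "\<dots> \<le> (\<integral>x. \<eta>\<^sup>2 * G x \<partial>\<mu>) / \<eta>\<^sup>2"
  proof (rule divide_right_mono, rule integral_mono_AE)
    show "integrable \<mu> (\<lambda>x. \<Sum>i\<in>I. \<Sum>k\<in>I. ?A i k x * ?A k i x)" using iA by auto
    show "integrable \<mu> (\<lambda>x. \<eta>\<^sup>2 * G x)" using G by auto
    show "AE x in \<mu>. (\<Sum>i\<in>I. \<Sum>k\<in>I. ?A i k x * ?A k i x) \<le> \<eta>\<^sup>2 * G x"
      using lip
    proof eventually_elim
      case (elim x)
      \<comment> \<open>The trace of the square of the difference matrix is at most its squared
        Frobenius norm.\<close>
      have ab: "a * b \<le> (a\<^sup>2 + b\<^sup>2) / 2" for a b :: real
        using sum_squares_bound[of a b] by simp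
      have "(\<Sum>i\<in>I. \<Sum>k\<in>I. ?A i k x * ?A k i x) \<le> (\<Sum>i\<in>I. \<Sum>k\<in>I. ((?A i k x)\<^sup>2 + (?A k i x)\<^sup>2) / 2)"
        by (intro sum_mono ab)
      also have "\<dots> = ((\<Sum>i\<in>I. \<Sum>k\<in>I. (?A i k x)\<^sup>2) + (\<Sum>i\<in>I. \<Sum>k\<in>I. (?A k i x)\<^sup>2)) / 2"
        by (simp add: sum_divide_distrib[symmetric] sum.distrib)
      also have "(\<Sum>i\<in>I. \<Sum>k\<in>I. (?A i k x)\<^sup>2) = (\<Sum>i\<in>I. \<Sum>k\<in>I. (?A k i x)\<^sup>2)"
        by (rule sum.swap)
      finally show ?case using elim by simp
    qed
  qed simp
  also have "\<dots> = (\<integral>x. G x \<partial>\<mu>)" using \<eta> by simp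
  also have "(\<Sum>i\<in>I. c * (\<integral>x. (f i (T i (- \<eta>) x))\<^sup>2 \<partial>\<mu>)) = c * (\<integral>x. (\<Sum>i\<in>I. (f i (T i (- \<eta>) x))\<^sup>2) \<partial>\<mu>)"
    using sh by (subst Bochner_Integration.integral_sum) (auto simp: sum_distrib_left)
  also have "\<dots> \<le> 2 * (\<integral>x. 2 * (\<Sum>i\<in>I. (f i x)\<^sup>2) + 2 * G x \<partial>\<mu>)"
  proof (rule mult_mono[OF c(2)])
    show "(\<integral>x. (\<Sum>i\<in>I. (f i (T i (- \<eta>) x))\<^sup>2) \<partial>\<mu>) \<le> (\<integral>x. 2 * (\<Sum>i\<in>I. (f i x)\<^sup>2) + 2 * G x \<partial>\<mu>)"
    proof (rule integral_mono_AE)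
      show "AE x in \<mu>. (\<Sum>i\<in>I. (f i (T i (- \<eta>) x))\<^sup>2) \<le> 2 * (\<Sum>i\<in>I. (f i x)\<^sup>2) + 2 * G x"
        using lip G0
      proof eventually_elim
        case (elim x)
        have ab: "b\<^sup>2 \<le> 2 * a\<^sup>2 + 2 * (a - b)\<^sup>2" for a b :: real
          using zero_le_power2[of "2 * a - b"] by (simp add: power2_eq_square algebra_simps)
        have "(\<Sum>i\<in>I. (f i (T i (- \<eta>) x))\<^sup>2) \<le> (\<Sum>i\<in>I. 2 * (f i x)\<^sup>2 + 2 * (?A i i x)\<^sup>2)"
          by (intro sum_mono ab)
        also have "\<dots> = 2 * (\<Sum>i\<in>I. (f i x)\<^sup>2) + 2 * (\<Sum>i\<in>I. (?A i i x)\<^sup>2)"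
          by (simp add: sum.distrib sum_distrib_left)
        also have "(\<Sum>k\<in>I. (?A k k x)\<^sup>2) \<le> (\<Sum>k\<in>I. \<Sum>i\<in>I. (?A i k x)\<^sup>2)"
          using finite_I by (intro sum_mono member_le_sum[where f = "\<lambda>i. (?A i _ x)\<^sup>2"]) auto
        also have "\<dots> \<le> \<eta>\<^sup>2 * G x" by (rule elim)
        also have "\<dots> \<le> G x" using \<eta> elim by (simp add: mult_left_le_one_le power_le_one)
        finally show ?case by simp
      qed
    qed (use sh f2 G in auto)
    show "0 \<le> (\<integral>x. (\<Sum>i\<in>I. (f i (T i (- \<eta>) x))\<^sup>2) \<partial>\<mu>)"
      by (intro integral_nonneg_AE) (auto intro!: sum_nonneg)
  qed (use c in auto)
  also have "(\<integral>x. 2 * (\<Sum>i\<in>I. (f i x)\<^sup>2) + 2 * G x \<partial>\<mu>) = 2 * (\<integral>x. (\<Sum>i\<in>I. (f i x)\<^sup>2) \<partial>\<mu>) + 2 * (\<integral>x. G x \<partial>\<mu>)"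
    using f2 G by simp
  finally show "(\<integral>x. (\<Sum>i\<in>I. quot \<eta> i (f i) x)\<^sup>2 \<partial>\<mu>) \<le> 4 * (\<integral>x. (\<Sum>i\<in>I. (f i x)\<^sup>2) \<partial>\<mu>) + 5 * (\<integral>x. G x \<partial>\<mu>)"
    by simp
qed

text \<open>The bound for finite shifts is uniform in \<open>\<eta>\<close>, so Fatou's lemma along
  \<open>\<eta> = 1 / Suc m\<close> carries it to the pointwise limit of the quotients.\<close>

theorem stein_second_order:
  fixes f d :: "'i \<Rightarrow> 'e \<Rightarrow> real"
  assumes f: "\<And>i. i \<in> I \<Longrightarrow> f i \<in> borel_measurable \<mu>"
    and f2: "\<And>i. i \<in> I \<Longrightarrow> integrable \<mu> (\<lambda>x. (f i x)\<^sup>2)"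
    and G: "integrable \<mu> G"
    and lip: "\<And>\<eta>. 0 < \<eta> \<Longrightarrow> \<eta> \<le> 1 \<Longrightarrow>
       AE x in \<mu>. (\<Sum>k\<in>I. \<Sum>i\<in>I. (f i x - f i (T k (- \<eta>) x))\<^sup>2) \<le> \<eta>\<^sup>2 * G x"
    and der: "AE x in \<mu>. \<forall>i\<in>I. (\<lambda>m. (f i (T i (1 / real (Suc m)) x) - f i x) * real (Suc m)) \<longlonglongrightarrow> d i x"
  shows "(\<integral>\<^sup>+x. ennreal ((\<Sum>i\<in>I. z i x * f i x - d i x)\<^sup>2) \<partial>\<mu>) \<le>
     ennreal (4 * (\<integral>x. (\<Sum>i\<in>I. (f i x)\<^sup>2) \<partial>\<mu>) + 5 * (\<integral>x. G x \<partial>\<mu>))"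
proof -
  define u where "u = (\<lambda>m x. (\<Sum>i\<in>I. quot (1 / real (Suc m)) i (f i) x)\<^sup>2)"
  note qb = stein_quot_bound[OF f f2 G _ _ lip]
  have iu: "integrable \<mu> (u m)" for m unfolding u_def by (rule qb(1)) auto
  have u0: "0 \<le> u m x" for m x by (simp add: u_def)
  have "AE x in \<mu>. ennreal ((\<Sum>i\<in>I. z i x * f i x - d i x)\<^sup>2) \<le> liminf (\<lambda>m. ennreal (u m x))"
    using der
  proof eventually_elim
    case (elim x)
    have "(\<lambda>m. u m x) \<longlonglongrightarrow> (\<Sum>i\<in>I. d i x - z i x * f i x)\<^sup>2"
      unfolding u_def using elim by (intro tendsto_intros quot_tendsto) auto
    also have "(\<Sum>i\<in>I. d i x - z i x * f i x)\<^sup>2 = (\<Sum>i\<in>I. z i x * f i x - d i x)\<^sup>2"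
      by (simp add: sum_subtractf power2_commute)
    finally have "(\<lambda>m. ennreal (u m x)) \<longlonglongrightarrow> ennreal ((\<Sum>i\<in>I. z i x * f i x - d i x)\<^sup>2)"
      by (rule tendsto_ennrealI)
    from lim_imp_Liminf[OF _ this] show ?case by simp
  qed
  then have "(\<integral>\<^sup>+x. ennreal ((\<Sum>i\<in>I. z i x * f i x - d i x)\<^sup>2) \<partial>\<mu>) \<le> (\<integral>\<^sup>+x. liminf (\<lambda>m. ennreal (u m x)) \<partial>\<mu>)"
    by (rule nn_integral_mono_AE)
  also have "\<dots> \<le> liminf (\<lambda>m. \<integral>\<^sup>+x. ennreal (u m x) \<partial>\<mu>)"
    using iu by (intro nn_integral_liminf) auto
  also have "\<dots> \<le> liminf (\<lambda>m::nat. ennreal (4 * (\<integral>x. (\<Sum>i\<in>I. (f i x)\<^sup>2) \<partial>\<mu>) + 5 * (\<integral>x. G x \<partial>\<mu>)))"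
  proof (intro Liminf_mono always_eventually allI)
    fix m
    have "(\<integral>\<^sup>+x. ennreal (u m x) \<partial>\<mu>) = ennreal (\<integral>x. u m x \<partial>\<mu>)"
      using iu u0 by (intro nn_integral_eq_integral) auto
    also have "\<dots> \<le> ennreal (4 * (\<integral>x. (\<Sum>i\<in>I. (f i x)\<^sup>2) \<partial>\<mu>) + 5 * (\<integral>x. G x \<partial>\<mu>))"
      unfolding u_def by (intro ennreal_leI qb(2)) auto
    finally show "(\<integral>\<^sup>+x. ennreal (u m x) \<partial>\<mu>) \<le> ennreal (4 * (\<integral>x. (\<Sum>i\<in>I. (f i x)\<^sup>2) \<partial>\<mu>) + 5 * (\<integral>x. G x \<partial>\<mu>))" .
  qed
  finally show ?thesis by (simp add: Liminf_const)
qed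

text \<open>Shifting the constant 1 by 1 and by -1 yields the exponential moments of
  \<open>z i\<close>, and \<open>y\<^sup>2 \<le> exp y + exp (- y)\<close>. The constant 4 rounds up
  \<open>2 * exp (1/2)\<close>.\<close>

lemma z_square_integrable:
  assumes i: "i \<in> I"
  shows "integrable \<mu> (\<lambda>x. (z i x)\<^sup>2)" and "(\<integral>x. (z i x)\<^sup>2 \<partial>\<mu>) \<le> 4"
proof -
  note [measurable] = z_measurable[OF i]
  have w: "integrable \<mu> (weight i \<eta>)" "(\<integral>x. weight i \<eta> x \<partial>\<mu>) = 1" for \<eta>
    using integral_shift[OF i, of "\<lambda>_. 1" \<eta>] by (auto simp: prob_space)
  let ?E = "\<lambda>x. exp (1/2) * (weight i 1 x + weight i (-1) x)"
  have b: "(z i x)\<^sup>2 \<le> ?E x" for x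
  proof -
    have *: "t\<^sup>2 \<le> exp t + exp (- t)" if "0 \<le> t" for t :: real
    proof -
      have "1 + t + t\<^sup>2 / 2 \<le> exp t" using that by (rule exp_lower_Taylor_quadratic)
      moreover have "1 - t \<le> exp (- t)" using exp_ge_add_one_self[of "- t"] by simp
      moreover have "t\<^sup>2 / 2 \<le> exp t - 1 - t" using calculation by simp
      moreover have "t\<^sup>2 / 2 \<le> 2 + t\<^sup>2 / 2" by simp
      moreover have "t\<^sup>2 \<le> exp t"
      proof -
        have "1 + t/2 + (t/2)\<^sup>2 / 2 \<le> exp (t/2)" using that by (intro exp_lower_Taylor_quadratic) auto
        moreover have "t \<le> 1 + t/2 + (t/2)\<^sup>2 / 2"
          using zero_le_power2[of "t - 2"] by (simp add: power2_eq_square field_simps)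
        ultimately have "t \<le> exp (t/2)" by linarith
        then have "t\<^sup>2 \<le> (exp (t/2))\<^sup>2" using that by (intro power_mono)
        then show ?thesis by (simp add: power2_eq_square exp_add[symmetric])
      qed
      ultimately show ?thesis using exp_gt_zero[of "- t"] by linarith
    qed
    have "(z i x)\<^sup>2 \<le> exp (z i x) + exp (- z i x)"
      using *[of "z i x"] *[of "- z i x"] by (cases "0 \<le> z i x") auto
    also have "\<dots> = ?E x" by (simp add: weight_def algebra_simps exp_add[symmetric])
    finally show ?thesis .
  qed
  show I: "integrable \<mu> (\<lambda>x. (z i x)\<^sup>2)"
  proof (rule Bochner_Integration.integrable_bound)
    show "integrable \<mu> ?E" using w by auto
    have "(z i x)\<^sup>2 \<le> \<bar>?E x\<bar>" for x using b[of x] by linarith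
    then show "AE x in \<mu>. norm ((z i x)\<^sup>2) \<le> norm (?E x)" by simp
  qed simp
  have "(\<integral>x. (z i x)\<^sup>2 \<partial>\<mu>) \<le> (\<integral>x. ?E x \<partial>\<mu>)"
    using I b w by (intro integral_mono) auto
  also have "\<dots> = 2 * exp (1/2)" using w by simp
  also have "\<dots> \<le> 2 * (1 + 1/2 + (1/2)\<^sup>2)" by (intro mult_left_mono exp_bound) auto
  finally show "(\<integral>x. (z i x)\<^sup>2 \<partial>\<mu>) \<le> 4" by (simp add: power2_eq_square)
qed

end

subsection \<open>Orthogonal components and Gram--Schmidt\<close>

text \<open>Vectors are functions on \<open>nat\<close> of which the first \<open>n\<close> values
  are read, so that one type serves all dimensions.\<close>

definition ip :: "nat \<Rightarrow> (nat \<Rightarrow> real) \<Rightarrow> (nat \<Rightarrow> real) \<Rightarrow> real" where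
  "ip n u v = (\<Sum>i<n. u i * v i)"

abbreviation nrm :: "nat \<Rightarrow> (nat \<Rightarrow> real) \<Rightarrow> real" where
  "nrm n u \<equiv> L2_set u {..<n}"

lemma ip_commute: "ip n u v = ip n v u"
  by (simp add: ip_def mult.commute)

lemma ip_diff_left: "ip n (\<lambda>i. u i - v i) w = ip n u w - ip n v w"
  and ip_add_left: "ip n (\<lambda>i. u i + v i) w = ip n u w + ip n v w"
  and ip_scale_left: "ip n (\<lambda>i. a * u i) w = a * ip n u w"
  and ip_uminus_left: "ip n (\<lambda>i. - u i) w = - ip n u w"
  by (simp_all add: ip_def algebra_simps sum_subtractf sum.distrib sum_distrib_left sum_negf)

lemma ip_diff_right: "ip n w (\<lambda>i. u i - v i) = ip n w u - ip n w v"
  and ip_add_right: "ip n w (\<lambda>i. u i + v i) = ip n w u + ip n w v"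
  and ip_scale_right: "ip n w (\<lambda>i. a * u i) = a * ip n w u"
  and ip_uminus_right: "ip n w (\<lambda>i. - u i) = - ip n w u"
  by (simp_all add: ip_def algebra_simps sum_subtractf sum.distrib sum_distrib_left sum_negf)

lemmas ip_linear = ip_diff_left ip_diff_right ip_add_left ip_add_right ip_scale_left ip_scale_right
  ip_uminus_left ip_uminus_right

lemma ip_sum_left: "ip n (\<lambda>i. \<Sum>k\<in>A. g k * c k i) v = (\<Sum>k\<in>A. g k * ip n (c k) v)"
proof -
  have "ip n (\<lambda>i. \<Sum>k\<in>A. g k * c k i) v = (\<Sum>i<n. \<Sum>k\<in>A. g k * (c k i * v i))"
    by (simp add: ip_def sum_distrib_right mult.assoc)
  also have "\<dots> = (\<Sum>k\<in>A. \<Sum>i<n. g k * (c k i * v i))" by (rule sum.swap)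
  finally show ?thesis by (simp add: ip_def sum_distrib_left)
qed

lemma ip_cong: "(\<And>i. i < n \<Longrightarrow> u i = u' i) \<Longrightarrow> (\<And>i. i < n \<Longrightarrow> v i = v' i) \<Longrightarrow> ip n u v = ip n u' v'"
  by (simp add: ip_def)

lemma nrm_sq: "(nrm n u)\<^sup>2 = ip n u u"
  by (simp add: L2_set_def ip_def sum_nonneg power2_eq_square)

lemma ip_self_nonneg: "0 \<le> ip n u u"
  by (simp add: nrm_sq[symmetric])

lemma ip_self_eq_0: "ip n u u = 0 \<longleftrightarrow> (\<forall>i<n. u i = 0)"
  by (auto simp: ip_def sum_nonneg_eq_0_iff)

lemma ip_le_nrm: "\<bar>ip n u v\<bar> \<le> nrm n u * nrm n v"
proof -
  have "\<bar>ip n u v\<bar> \<le> (\<Sum>i<n. \<bar>u i\<bar> * \<bar>v i\<bar>)"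
    unfolding ip_def by (rule order_trans[OF sum_abs]) (simp add: abs_mult)
  also have "\<dots> \<le> nrm n u * nrm n v" by (rule L2_set_mult_ineq)
  finally show ?thesis .
qed

lemma nrm_nonneg [simp]: "0 \<le> nrm n u" by (rule L2_set_nonneg)

lemma nrm_scale: "nrm n (\<lambda>i. a * u i) = \<bar>a\<bar> * nrm n u"
proof -
  have "(\<Sum>i<n. (a * u i)\<^sup>2) = a\<^sup>2 * (\<Sum>i<n. (u i)\<^sup>2)"
    by (simp add: power_mult_distrib sum_distrib_left)
  then show ?thesis by (simp add: L2_set_def real_sqrt_mult)
qed

lemma nrm_add: "nrm n (\<lambda>i. u i + v i) \<le> nrm n u + nrm n v"
  by (rule L2_set_triangle_ineq)

lemma nrm_diff_commute: "nrm n (\<lambda>i. u i - v i) = nrm n (\<lambda>i. v i - u i)"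
  by (simp add: L2_set_def power2_commute)

lemma nrm_diff: "nrm n (\<lambda>i. u i - v i) \<le> nrm n u + nrm n v"
  using nrm_add[where n=n and u=u and v="\<lambda>i. - v i"] nrm_scale[where n=n and a="-1" and u=v] by simp

lemma nrm_cong: "(\<And>i. i < n \<Longrightarrow> u i = v i) \<Longrightarrow> nrm n u = nrm n v"
  by (rule L2_set_cong) auto

lemma nrm_triangle_diff: "\<bar>nrm n u - nrm n v\<bar> \<le> nrm n (\<lambda>i. u i - v i)"
  using nrm_add[where n=n and u=v and v="\<lambda>i. u i - v i"] nrm_add[where n=n and u=u and v="\<lambda>i. v i - u i"]
    nrm_diff_commute[where n=n and u=u and v=v]
  by simp

lemma abs_le_nrm: "i < n \<Longrightarrow> \<bar>u i\<bar> \<le> nrm n u"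
  using member_le_L2_set[of "{..<n}" i "\<lambda>i. \<bar>u i\<bar>"] by (simp add: L2_set_def)

abbreviation unit_vec' :: "nat \<Rightarrow> nat \<Rightarrow> real" where
  "unit_vec' i \<equiv> (\<lambda>l. if l = i then 1 else 0)"

lemma ip_unit: "i < n \<Longrightarrow> ip n (unit_vec' i) v = v i" "i < n \<Longrightarrow> ip n v (unit_vec' i) = v i"
  by (simp_all add: ip_def if_distrib if_distribR cong: if_cong)

text \<open>Since \<open>x / 0 = 0\<close>, columns that depend on the later ones in the list are skipped.\<close>

fun orth_comp :: "nat \<Rightarrow> (nat \<Rightarrow> nat \<Rightarrow> real) \<Rightarrow> nat list \<Rightarrow> (nat \<Rightarrow> real) \<Rightarrow> nat \<Rightarrow> real" where
  "orth_comp n c [] v = v"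
| "orth_comp n c (k # ks) v =
     (\<lambda>i. orth_comp n c ks v i -
        ip n (orth_comp n c ks (c k)) v / ip n (orth_comp n c ks (c k)) (orth_comp n c ks (c k)) *
          orth_comp n c ks (c k) i)"

lemma orth_comp_cong:
  "(\<And>k. k \<in> set ks \<Longrightarrow> c k = c' k) \<Longrightarrow> orth_comp n c ks v = orth_comp n c' ks v"
  by (induction ks arbitrary: v) auto

lemma orth_comp_linear:
  "orth_comp n c ks (\<lambda>i. a * u i + b * v i) = (\<lambda>i. a * orth_comp n c ks u i + b * orth_comp n c ks v i)"
  by (induction ks) (auto simp: ip_linear algebra_simps add_divide_distrib)

lemma orth_comp_scale: "orth_comp n c ks (\<lambda>i. a * u i) = (\<lambda>i. a * orth_comp n c ks u i)"
  using orth_comp_linear[of n c ks a u 0 u] by simp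

lemma orth_comp_add: "orth_comp n c ks (\<lambda>i. u i + v i) = (\<lambda>i. orth_comp n c ks u i + orth_comp n c ks v i)"
  using orth_comp_linear[of n c ks 1 u 1 v] by simp

lemma orth_comp_diff: "orth_comp n c ks (\<lambda>i. u i - v i) = (\<lambda>i. orth_comp n c ks u i - orth_comp n c ks v i)"
  using orth_comp_linear[of n c ks 1 u "-1" v] by simp

text \<open>Each step subtracts the symmetric rank one map
  \<open>v \<mapsto> (ip n y v / ip n y y) * y\<close>.\<close>

lemma orth_comp_self_adjoint: "ip n (orth_comp n c ks u) v = ip n u (orth_comp n c ks v)"
proof (induction ks)
  case (Cons k ks)
  define y where "y = orth_comp n c ks (c k)"
  have "ip n (orth_comp n c (k # ks) u) v = ip n (orth_comp n c ks u) v - ip n y u / ip n y y * ip n y v"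
    by (simp add: y_def[symmetric] ip_linear del: times_divide_eq_left)
  also have "\<dots> = ip n u (orth_comp n c ks v) - ip n y v / ip n y y * ip n u y"
    using Cons ip_commute[of n y u] by simp
  also have "\<dots> = ip n u (orth_comp n c (k # ks) v)"
    by (simp add: y_def[symmetric] ip_linear del: times_divide_eq_left)
  finally show ?case .
qed simp

lemma orth_comp_fixed:
  "(\<And>m. m \<in> set ks \<Longrightarrow> ip n (c m) v = 0) \<Longrightarrow> orth_comp n c ks v = v"
proof (induction ks)
  case (Cons k ks)
  then have "orth_comp n c ks v = v" "ip n (c k) v = 0" by auto
  moreover have "ip n (orth_comp n c ks (c k)) v = ip n (c k) (orth_comp n c ks v)"
    by (rule orth_comp_self_adjoint)
  ultimately show ?case by simp
qed simp

text \<open>Gram--Schmidt. If column \<open>k\<close> depends on the later ones, \<open>y\<close>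
  vanishes on the first \<open>n\<close> coordinates and nothing is subtracted; orthogonality to
  \<open>c k\<close> then comes from \<open>ip n y v = 0\<close>.\<close>

lemma orth_comp_orthogonal: "m \<in> set ks \<Longrightarrow> ip n (c m) (orth_comp n c ks v) = 0"
proof (induction ks arbitrary: m v)
  case (Cons k ks)
  define y where "y = orth_comp n c ks (c k)"
  have yy: "ip n (c k) y = ip n y y"
    using Cons.IH orth_comp_fixed[of ks n c y] unfolding y_def
    by (metis orth_comp_self_adjoint)
  have kv: "ip n (c k) (orth_comp n c ks v) = ip n y v"
    by (simp add: y_def orth_comp_self_adjoint)
  have e: "ip n (c m) (orth_comp n c (k # ks) v) =
      ip n (c m) (orth_comp n c ks v) - ip n y v / ip n y y * ip n (c m) y"
    by (simp add: y_def[symmetric] ip_linear del: times_divide_eq_left)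
  show ?case
  proof (cases "m \<in> set ks")
    case True
    then show ?thesis unfolding e using Cons.IH by (simp add: y_def)
  next
    case False
    then have "m = k" using Cons.prems by simp
    show ?thesis
    proof (cases "ip n y y = 0")
      case True
      then have "ip n y v = 0" using ip_self_eq_0[of n y] by (simp add: ip_def)
      then show ?thesis unfolding e using \<open>m = k\<close> kv by simp
    next
      case False
      then show ?thesis unfolding e using \<open>m = k\<close> kv yy by simp
    qed
  qed
qed simp

lemma orth_comp_idem: "orth_comp n c ks (orth_comp n c ks v) = orth_comp n c ks v"
  by (rule orth_comp_fixed) (rule orth_comp_orthogonal)

lemma ip_orth_comp_orth_comp: "ip n (orth_comp n c ks u) (orth_comp n c ks v) = ip n u (orth_comp n c ks v)"
  by (simp add: orth_comp_self_adjoint orth_comp_idem)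

lemma nrm_orth_comp_le: "nrm n (orth_comp n c ks v) \<le> nrm n v"
proof -
  let ?w = "orth_comp n c ks v"
  have "nrm n ?w * nrm n ?w = ip n v ?w"
    using nrm_sq[where n=n and u="?w"] by (simp add: power2_eq_square ip_orth_comp_orth_comp)
  also have "\<dots> \<le> nrm n v * nrm n ?w" using ip_le_nrm[of n v ?w] by simp
  finally have *: "nrm n ?w * nrm n ?w \<le> nrm n v * nrm n ?w" .
  show ?thesis
  proof (cases "nrm n ?w = 0")
    case False
    then have "0 < nrm n ?w" using nrm_nonneg[where n=n and u="?w"] by linarith
    with * show ?thesis by (rule mult_right_le_imp_le)
  qed simp
qed

lemma orth_comp_span: "\<exists>g. \<forall>i. v i - orth_comp n c ks v i = (\<Sum>m\<in>set ks. g m * c m i)"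
proof (induction ks arbitrary: v)
  case (Cons k ks)
  define y where "y = orth_comp n c ks (c k)"
  define b where "b = ip n y v / ip n y y"
  obtain g where g: "\<And>i. v i - orth_comp n c ks v i = (\<Sum>m\<in>set ks. g m * c m i)"
    using Cons by blast
  obtain g' where g': "\<And>i. c k i - y i = (\<Sum>m\<in>set ks. g' m * c m i)"
    unfolding y_def using Cons by blast
  \<comment> \<open>Column \<open>k\<close> enters with weight \<open>b\<close>, and expanding
    \<open>y\<close> over \<open>ks\<close> changes the other weights by \<open>- b * g'\<close>.
    The membership test also covers a \<open>k\<close> that recurs in \<open>ks\<close>.\<close>
  define g2 where "g2 = (\<lambda>m. (if m \<in> set ks then g m - b * g' m else 0) + (if m = k then b else 0))"
  have "v i - orth_comp n c (k # ks) v i = (\<Sum>m\<in>set (k # ks). g2 m * c m i)" for i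
  proof -
    have "v i - orth_comp n c (k # ks) v i = (v i - orth_comp n c ks v i) - b * (c k i - y i) + b * c k i"
      by (simp add: y_def[symmetric] b_def[symmetric] algebra_simps)
    also have "\<dots> = (\<Sum>m\<in>set ks. (g m - b * g' m) * c m i) + b * c k i"
      unfolding g g' by (simp add: left_diff_distrib sum_subtractf sum_distrib_left mult.assoc)
    also have "(\<Sum>m\<in>set ks. (g m - b * g' m) * c m i) =
       (\<Sum>m\<in>set (k # ks). (if m \<in> set ks then g m - b * g' m else 0) * c m i)"
      by (rule sum.mono_neutral_cong_left) auto
    also have "b * c k i = (\<Sum>m\<in>set (k # ks). (if m = k then b else 0) * c m i)"
    proof -
      have "(\<Sum>m\<in>set (k # ks). (if m = k then b else 0) * c m i) = (\<Sum>m\<in>set (k # ks). if m = k then b * c k i else 0)"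
        by (rule sum.cong) auto
      also have "\<dots> = b * c k i" by (subst sum.delta) auto
      finally show ?thesis by simp
    qed
    finally show ?thesis by (simp only: g2_def distrib_right sum.distrib)
  qed
  then show ?case by blast
qed simp

section \<open>Traces of the projections and linear independence of the columns\<close>

definition orth_trace :: "nat \<Rightarrow> (nat \<Rightarrow> nat \<Rightarrow> real) \<Rightarrow> nat list \<Rightarrow> real" where
  "orth_trace n c ks = (\<Sum>i<n. orth_comp n c ks (unit_vec' i) i)"

text \<open>A rank one projection has trace 1; for a dependent column nothing is removed.\<close>

lemma orth_trace_Cons:
  "orth_trace n c (k # ks) = orth_trace n c ks -
     (if ip n (orth_comp n c ks (c k)) (orth_comp n c ks (c k)) = 0 then 0 else 1)"
proof -
  define y where "y = orth_comp n c ks (c k)"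
  have "(\<Sum>i<n. ip n y (unit_vec' i) / ip n y y * y i) = (\<Sum>i<n. y i * y i) / ip n y y"
    by (simp add: ip_unit sum_divide_distrib)
  also have "\<dots> = (if ip n y y = 0 then 0 else 1)" by (simp add: ip_def[symmetric])
  finally show ?thesis by (simp add: orth_trace_def y_def[symmetric] sum_subtractf)
qed

lemma orth_trace_ge: "real n - real (length ks) \<le> orth_trace n c ks"
  by (induction ks) (auto simp: orth_trace_Cons, simp add: orth_trace_def)

definition others :: "nat \<Rightarrow> nat \<Rightarrow> nat list" where
  "others p k = filter (\<lambda>m. m \<noteq> k) [0..<p]"

lemma set_others: "set (others p k) = {..<p} - {k}"
  by (auto simp: others_def)

lemma length_others: "k < p \<Longrightarrow> length (others p k) = p - 1"
  using distinct_card[of "others p k"] by (simp add: set_others others_def[of p k, THEN arg_cong[of _ _ distinct]])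

text \<open>Linear independence in metric form: each column has a positive distance to the span of
  the others. These distances are the constants in the bounds on coefficients below.\<close>

definition indep_cols :: "nat \<Rightarrow> nat \<Rightarrow> (nat \<Rightarrow> nat \<Rightarrow> real) \<Rightarrow> bool" where
  "indep_cols n p c \<longleftrightarrow> (\<forall>k<p. nrm n (orth_comp n c (others p k) (c k)) \<noteq> 0)"

text \<open>Otherwise column \<open>k\<close> would lie in the span of \<open>ks\<close> and be
  orthogonal to its own projection off all other columns.\<close>

lemma indep_cols_orth_comp:
  assumes "indep_cols n p c" "set ks \<subseteq> {..<p}" "k < p" "k \<notin> set ks"
  shows "ip n (orth_comp n c ks (c k)) (orth_comp n c ks (c k)) \<noteq> 0"
proof
  assume 0: "ip n (orth_comp n c ks (c k)) (orth_comp n c ks (c k)) = 0"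
  obtain g where g: "\<And>i. c k i - orth_comp n c ks (c k) i = (\<Sum>m\<in>set ks. g m * c m i)"
    using orth_comp_span by blast
  let ?y = "orth_comp n c (others p k) (c k)"
  have "ip n ?y ?y = ip n (c k) ?y" by (rule ip_orth_comp_orth_comp)
  also have "\<dots> = ip n (\<lambda>i. \<Sum>m\<in>set ks. g m * c m i) ?y"
    using 0 g by (intro ip_cong) (auto simp: ip_self_eq_0 g[symmetric])
  also have "\<dots> = 0"
  proof -
    have "ip n (c m) ?y = 0" if "m \<in> set ks" for m
      using that assms by (intro orth_comp_orthogonal) (auto simp: set_others)
    then show ?thesis by (simp add: ip_sum_left)
  qed
  finally have "nrm n ?y = 0" by (simp add: nrm_sq[symmetric])
  with assms show False by (auto simp: indep_cols_def)
qed

lemma orth_trace_eq: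
  assumes "indep_cols n p c" "set ks \<subseteq> {..<p}" "distinct ks"
  shows "orth_trace n c ks = real n - real (length ks)"
  using assms(2,3)
proof (induction ks)
  case Nil
  show ?case by (simp add: orth_trace_def)
next
  case (Cons k ks)
  then show ?case
    using indep_cols_orth_comp[OF assms(1), of ks k] by (simp add: orth_trace_Cons)
qed

definition lin :: "nat \<Rightarrow> (nat \<Rightarrow> nat \<Rightarrow> real) \<Rightarrow> (nat \<Rightarrow> real) \<Rightarrow> nat \<Rightarrow> real" where
  "lin p c h i = (\<Sum>k<p. h k * c k i)"

lemma lin_diff: "lin p c (\<lambda>k. g k - h k) i = lin p c g i - lin p c h i"
  by (simp add: lin_def left_diff_distrib sum_subtractf)

lemma ip_lin: "ip n v (lin p c h) = (\<Sum>k<p. h k * ip n (c k) v)"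
  using ip_sum_left[of n h c "{..<p}" v] by (simp add: lin_def[abs_def] ip_commute)

text \<open>The projection kills every term but the \<open>j\<close>-th. The difference of the two
  sides is orthogonal to itself, which settles the first \<open>n\<close> coordinates.\<close>

lemma orth_comp_lin:
  assumes "j < p" "i < n"
  shows "orth_comp n c (others p j) (lin p c h) i = h j * orth_comp n c (others p j) (c j) i"
proof -
  let ?O = "orth_comp n c (others p j)"
  define v where "v = (\<lambda>i. ?O (lin p c h) i - h j * ?O (c j) i)"
  have v: "v = ?O (\<lambda>i. lin p c h i - h j * c j i)"
    unfolding v_def by (simp add: orth_comp_diff orth_comp_scale)
  have "ip n v v = ip n (\<lambda>i. lin p c h i - h j * c j i) v"
    unfolding v by (rule ip_orth_comp_orth_comp)
  also have "\<dots> = (\<Sum>k<p. h k * ip n (c k) v) - h j * ip n (c j) v"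
    by (simp add: ip_linear ip_commute[of n "lin p c h"] ip_lin)
  also have "(\<Sum>k<p. h k * ip n (c k) v) = (\<Sum>k\<in>{j}. h k * ip n (c k) v)"
    using assms by (intro sum.mono_neutral_right) (auto simp: v orth_comp_orthogonal set_others)
  finally have "ip n v v = 0" by simp
  then show ?thesis using assms by (simp add: ip_self_eq_0 v_def)
qed

text \<open>Projections contract norms. This recovers a coefficient from fitted values; uniqueness,
  continuity and measurability of the minimizer rest on it.\<close>

lemma coef_le_nrm_lin:
  assumes "j < p"
  shows "\<bar>h j\<bar> * nrm n (orth_comp n c (others p j) (c j)) \<le> nrm n (lin p c h)"
proof -
  have "\<bar>h j\<bar> * nrm n (orth_comp n c (others p j) (c j)) = nrm n (\<lambda>i. h j * orth_comp n c (others p j) (c j) i)"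
    by (simp add: nrm_scale)
  also have "\<dots> = nrm n (orth_comp n c (others p j) (lin p c h))"
    using assms by (intro nrm_cong) (simp add: orth_comp_lin)
  also have "\<dots> \<le> nrm n (lin p c h)" by (rule nrm_orth_comp_le)
  finally show ?thesis .
qed

subsection \<open>Optimality and stability of the Lasso\<close>

definition l1 :: "nat \<Rightarrow> (nat \<Rightarrow> real) \<Rightarrow> real" where
  "l1 p t = (\<Sum>k<p. \<bar>t k\<bar>)"

text \<open>For the response \<open>Y = X \<theta> + \<xi>\<close> this is \<open>Y - X t\<close>.
  Noise and parameter are kept separate because shifts of the design leave both fixed.\<close>

definition lres :: "nat \<Rightarrow> (nat \<Rightarrow> nat \<Rightarrow> real) \<Rightarrow> (nat \<Rightarrow> real) \<Rightarrow> (nat \<Rightarrow> real) \<Rightarrow> (nat \<Rightarrow> real) \<Rightarrow> nat \<Rightarrow> real" where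
  "lres p c \<xi> \<theta> t = (\<lambda>i. \<xi> i - lin p c (\<lambda>k. t k - \<theta> k) i)"

definition lobj :: "nat \<Rightarrow> nat \<Rightarrow> real \<Rightarrow> (nat \<Rightarrow> nat \<Rightarrow> real) \<Rightarrow> (nat \<Rightarrow> real) \<Rightarrow> (nat \<Rightarrow> real) \<Rightarrow> (nat \<Rightarrow> real) \<Rightarrow> real" where
  "lobj n p lam c \<xi> \<theta> t = ip n (lres p c \<xi> \<theta> t) (lres p c \<xi> \<theta> t) / (2 * real n) + lam * l1 p t"

definition lmin :: "nat \<Rightarrow> nat \<Rightarrow> real \<Rightarrow> (nat \<Rightarrow> nat \<Rightarrow> real) \<Rightarrow> (nat \<Rightarrow> real) \<Rightarrow> (nat \<Rightarrow> real) \<Rightarrow> (nat \<Rightarrow> real) \<Rightarrow> bool" where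
  "lmin n p lam c \<xi> \<theta> t \<longleftrightarrow> (\<forall>t'. lobj n p lam c \<xi> \<theta> t \<le> lobj n p lam c \<xi> \<theta> t')"

lemma l1_nonneg: "0 \<le> l1 p t" by (simp add: l1_def sum_nonneg)

lemma lin_add_scale: "lin p c (\<lambda>k. g k + e * h k) i = lin p c g i + e * lin p c h i"
  by (simp add: lin_def distrib_right sum.distrib sum_distrib_left mult.assoc)

lemma lobj_cong: "(\<And>k. k < p \<Longrightarrow> t k = t' k) \<Longrightarrow> lobj n p lam c \<xi> \<theta> t = lobj n p lam c \<xi> \<theta> t'"
proof -
  assume e: "\<And>k. k < p \<Longrightarrow> t k = t' k"
  then have "lres p c \<xi> \<theta> t = lres p c \<xi> \<theta> t'" by (auto simp: lres_def lin_def)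
  with e show ?thesis by (simp add: lobj_def l1_def)
qed

lemma lres_diff: "lres p c \<xi> \<theta> t' i = lres p c \<xi> \<theta> t i - lin p c (\<lambda>k. t' k - t k) i"
proof -
  have "lin p c (\<lambda>k. t' k - \<theta> k) i = lin p c (\<lambda>k. (t k - \<theta> k) + 1 * (t' k - t k)) i" by simp
  also have "\<dots> = lin p c (\<lambda>k. t k - \<theta> k) i + 1 * lin p c (\<lambda>k. t' k - t k) i" by (rule lin_add_scale)
  finally show ?thesis by (simp add: lres_def)
qed

lemma lobj_diff:
  assumes "0 < n"
  shows "lobj n p lam c \<xi> \<theta> t' - lobj n p lam c \<xi> \<theta> t =
    - ip n (lres p c \<xi> \<theta> t) (lin p c (\<lambda>k. t' k - t k)) / real n
    + ip n (lin p c (\<lambda>k. t' k - t k)) (lin p c (\<lambda>k. t' k - t k)) / (2 * real n) + lam * (l1 p t' - l1 p t)"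
proof -
  let ?r = "lres p c \<xi> \<theta> t" and ?d = "lin p c (\<lambda>k. t' k - t k)"
  have "lres p c \<xi> \<theta> t' = (\<lambda>i. ?r i - ?d i)" by (rule ext) (rule lres_diff)
  then have "ip n (lres p c \<xi> \<theta> t') (lres p c \<xi> \<theta> t') = ip n ?r ?r - 2 * ip n ?r ?d + ip n ?d ?d"
    by (simp add: ip_linear ip_commute[of n ?d ?r])
  moreover have "(a - 2 * b + q) / (2 * real n) + lam * x - (a / (2 * real n) + lam * y) =
      - b / real n + q / (2 * real n) + lam * (x - y)" for a b q x y :: real
    using assms by (simp add: field_simps)
  ultimately show ?thesis by (simp only: lobj_def)
qed

text \<open>First-order condition without subgradients: compare with
  \<open>t + e * (t' - t)\<close>, use convexity of the penalty, divide by \<open>e\<close> and let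
  \<open>e\<close> tend to 0.\<close>

lemma lmin_variational:
  assumes n: "0 < n" and lam: "0 < lam" and m: "lmin n p lam c \<xi> \<theta> t"
  shows "ip n (lres p c \<xi> \<theta> t) (lin p c (\<lambda>k. t' k - t k)) \<le> real n * lam * (l1 p t' - l1 p t)"
proof -
  let ?r = "lres p c \<xi> \<theta> t" and ?d = "lin p c (\<lambda>k. t' k - t k)"
  let ?q = "ip n ?d ?d"
  have *: "ip n ?r ?d \<le> real n * lam * (l1 p t' - l1 p t) + e * (?q / 2)" if e: "0 < e" "e \<le> 1" for e
  proof -
    define s where "s = (\<lambda>k. t k + e * (t' k - t k))"
    have d: "lin p c (\<lambda>k. s k - t k) = (\<lambda>i. e * ?d i)"
      using lin_add_scale[of p c "\<lambda>_. 0" e "\<lambda>k. t' k - t k"] by (auto simp: s_def lin_def)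
    have "l1 p s \<le> (1 - e) * l1 p t + e * l1 p t'"
    proof -
      have "\<bar>s k\<bar> \<le> (1 - e) * \<bar>t k\<bar> + e * \<bar>t' k\<bar>" for k
      proof -
        have "s k = (1 - e) * t k + e * t' k" by (simp add: s_def algebra_simps)
        then have "\<bar>s k\<bar> \<le> \<bar>(1 - e) * t k\<bar> + \<bar>e * t' k\<bar>" by simp
        then show ?thesis using e by (simp add: abs_mult)
      qed
      then have "l1 p s \<le> (\<Sum>k<p. (1 - e) * \<bar>t k\<bar> + e * \<bar>t' k\<bar>)" unfolding l1_def by (intro sum_mono)
      then show ?thesis by (simp add: l1_def sum.distrib sum_distrib_left)
    qed
    then have "l1 p s - l1 p t \<le> e * (l1 p t' - l1 p t)" by (simp add: algebra_simps)
    then have l: "lam * (l1 p s - l1 p t) \<le> e * lam * (l1 p t' - l1 p t)"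
      using lam by (simp add: mult.assoc mult.left_commute)
    have "0 \<le> lobj n p lam c \<xi> \<theta> s - lobj n p lam c \<xi> \<theta> t" using m by (simp add: lmin_def)
    also have "\<dots> = - (e * ip n ?r ?d) / real n + e * e * ?q / (2 * real n) + lam * (l1 p s - l1 p t)"
      by (simp add: lobj_diff[OF n, of p lam c \<xi> \<theta> s t] d ip_linear mult.assoc)
    also have "\<dots> \<le> - (e * ip n ?r ?d) / real n + e * e * ?q / (2 * real n) + e * lam * (l1 p t' - l1 p t)"
      using l by simp
    also have "\<dots> = (e / real n) * (- ip n ?r ?d + e * (?q / 2) + real n * lam * (l1 p t' - l1 p t))"
      using n by (simp add: field_simps)
    finally have "(e / real n) * 0 \<le> (e / real n) * (- ip n ?r ?d + e * (?q / 2) + real n * lam * (l1 p t' - l1 p t))"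
      by simp
    then have "0 \<le> - ip n ?r ?d + e * (?q / 2) + real n * lam * (l1 p t' - l1 p t)"
      by (rule mult_left_le_imp_le) (use e n in simp)
    then show ?thesis by linarith
  qed
  have "(\<lambda>m. real n * lam * (l1 p t' - l1 p t) + (1 / real (Suc m)) * (?q / 2)) \<longlonglongrightarrow>
      real n * lam * (l1 p t' - l1 p t) + 0 * (?q / 2)"
    using LIMSEQ_inverse_real_of_nat by (intro tendsto_intros) (simp add: inverse_eq_divide)
  moreover have "ip n ?r ?d \<le> real n * lam * (l1 p t' - l1 p t) + (1 / real (Suc m)) * (?q / 2)" for m
    by (rule *) auto
  ultimately show ?thesis using LIMSEQ_le_const[of _ "real n * lam * (l1 p t' - l1 p t) + 0 * (?q / 2)" "ip n ?r ?d"]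
    by auto
qed

text \<open>The quadratic part is expanded exactly, so the variational inequality leaves the whole
  squared distance of fitted values as a gap.\<close>

lemma lmin_strong_convexity:
  assumes n: "0 < n" and lam: "0 < lam" and m: "lmin n p lam c \<xi> \<theta> t"
  shows "lobj n p lam c \<xi> \<theta> t + (nrm n (lin p c (\<lambda>k. t' k - t k)))\<^sup>2 / (2 * real n) \<le> lobj n p lam c \<xi> \<theta> t'"
proof -
  have "ip n (lres p c \<xi> \<theta> t) (lin p c (\<lambda>k. t' k - t k)) / real n \<le> lam * (l1 p t' - l1 p t)"
    using lmin_variational[OF assms, of t'] n by (simp add: field_simps)
  then show ?thesis using lobj_diff[OF n, of p lam c \<xi> \<theta> t' t] by (simp add: nrm_sq)
qed

lemma lmin_unique:
  assumes n: "0 < n" and lam: "0 < lam" and ind: "indep_cols n p c"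
    and t: "lmin n p lam c \<xi> \<theta> t" and t': "lmin n p lam c \<xi> \<theta> t'" and k: "k < p"
  shows "t' k = t k"
proof -
  let ?d = "lin p c (\<lambda>k. t' k - t k)"
  have "lobj n p lam c \<xi> \<theta> t' \<le> lobj n p lam c \<xi> \<theta> t" using t' by (simp add: lmin_def)
  with lmin_strong_convexity[OF n lam t, of t'] have "(nrm n ?d)\<^sup>2 / (2 * real n) \<le> 0" by linarith
  then have "nrm n ?d = 0" using n by (simp add: divide_le_0_iff)
  with coef_le_nrm_lin[OF k, of "\<lambda>k. t' k - t k" n c] ind k
  show ?thesis using nrm_nonneg[where n=n and u="orth_comp n c (others p k) (c k)"]
    by (auto simp: indep_cols_def mult_le_0_iff)
qed

text \<open>The coordinates from \<open>p\<close> on are pinned to 0, so the search takes place in a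
  box that is compact in the product topology.\<close>

lemma lmin_exists:
  assumes n: "0 < n" and lam: "0 < lam"
  shows "\<exists>t. lmin n p lam c \<xi> \<theta> t"
proof -
  let ?F = "lobj n p lam c \<xi> \<theta>"
  \<comment> \<open>Outside the box a single penalty term already exceeds the objective at
    0.\<close>
  define B where "B = ?F (\<lambda>_. 0) / lam"
  define K where "K = PiE UNIV (\<lambda>k. if k < p then {-B..B} else {0})"
  have F0: "0 \<le> ?F t" for t using lam n by (auto simp: lobj_def l1_nonneg ip_self_nonneg)
  have B0: "0 \<le> B" using F0 lam by (simp add: B_def)
  have "compactin (product_topology (\<lambda>_. euclidean) UNIV) K"
    unfolding K_def compactin_PiE by auto
  then have "compact K" by (simp add: euclidean_product_topology)
  moreover have "(\<lambda>_. 0) \<in> K" using B0 by (auto simp: K_def PiE_def)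
  moreover have "continuous_on K ?F"
    unfolding lobj_def[abs_def] lres_def ip_def lin_def l1_def
    by (intro continuous_intros continuous_on_subset[OF continuous_on_product_coordinates]) (use n in auto)
  ultimately obtain t where t: "t \<in> K" "\<And>s. s \<in> K \<Longrightarrow> ?F t \<le> ?F s"
    using continuous_attains_inf[of K ?F] by blast
  have "?F t \<le> ?F s" for s
  proof -
    define s' where "s' = (\<lambda>k. if k < p then s k else 0)"
    have e: "?F s = ?F s'" by (rule lobj_cong) (simp add: s'_def)
    show ?thesis
    proof (cases "s' \<in> K")
      case True
      then show ?thesis using t e by simp
    next
      case False
      then obtain k where k: "k < p" "B < \<bar>s k\<bar>"
        by (fastforce simp: K_def s'_def PiE_def Pi_def split: if_splits)
      have "?F t \<le> ?F (\<lambda>_. 0)" using t \<open>(\<lambda>_. 0) \<in> K\<close> by blast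
      also have "\<dots> = lam * B" using lam by (simp add: B_def)
      also have "\<dots> \<le> lam * \<bar>s k\<bar>" using k lam by simp
      also have "\<dots> \<le> lam * l1 p s" unfolding l1_def
        using lam k by (intro mult_left_mono member_le_sum) auto
      also have "\<dots> \<le> ?F s" using n by (simp add: lobj_def ip_self_nonneg)
      finally show ?thesis .
    qed
  qed
  then show ?thesis unfolding lmin_def by blast
qed

lemma lin_single: "k < p \<Longrightarrow> lin p c (\<lambda>m. if m = k then a else 0) i = a * c k i"
  by (simp add: lin_def if_distribR if_distrib cong: if_cong)

lemma l1_update:
  assumes "k < p"
  shows "l1 p (\<lambda>m. if m = k then a else t m) = l1 p t + \<bar>a\<bar> - \<bar>t k\<bar>"
proof -
  have "l1 p (\<lambda>m. if m = k then a else t m) = \<bar>a\<bar> + (\<Sum>m\<in>{..<p} - {k}. \<bar>t m\<bar>)"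
    unfolding l1_def using assms by (subst sum.remove[of _ k]) auto
  moreover have "l1 p t = \<bar>t k\<bar> + (\<Sum>m\<in>{..<p} - {k}. \<bar>t m\<bar>)"
    unfolding l1_def using assms by (subst sum.remove[of _ k]) auto
  ultimately show ?thesis by simp
qed

text \<open>The variational inequality along one coordinate. The steps \<open>a = 1, -1\<close>
  bound the subgradient, and \<open>a = t k, - t k\<close> determine it at a nonzero
  coefficient.\<close>

lemma lmin_coordinate:
  assumes n: "0 < n" and lam: "0 < lam" and m: "lmin n p lam c \<xi> \<theta> t" and k: "k < p"
  shows "a * ip n (c k) (lres p c \<xi> \<theta> t) \<le> real n * lam * (\<bar>t k + a\<bar> - \<bar>t k\<bar>)"
proof -
  let ?t' = "\<lambda>m. if m = k then t k + a else t m"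
  have "(\<lambda>m. ?t' m - t m) = (\<lambda>m. if m = k then a else 0)" by auto
  then have "lin p c (\<lambda>m. ?t' m - t m) = (\<lambda>i. a * c k i)" using k by (auto simp: lin_single)
  then show ?thesis
    using lmin_variational[OF n lam m, of ?t'] l1_update[OF k, of "t k + a" t] k
    by (simp add: ip_linear ip_commute)
qed

lemma lmin_subgradient_bound:
  assumes "0 < n" "0 < lam" "lmin n p lam c \<xi> \<theta> t" "k < p"
  shows "\<bar>ip n (c k) (lres p c \<xi> \<theta> t)\<bar> \<le> real n * lam"
proof -
  let ?g = "ip n (c k) (lres p c \<xi> \<theta> t)"
  have nl: "0 \<le> real n * lam" using assms by simp
  have "1 * ?g \<le> real n * lam * (\<bar>t k + 1\<bar> - \<bar>t k\<bar>)" by (rule lmin_coordinate[OF assms])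
  also have "\<dots> \<le> real n * lam * 1" by (rule mult_left_mono[OF _ nl]) simp
  finally have 1: "?g \<le> real n * lam" by simp
  have "(-1) * ?g \<le> real n * lam * (\<bar>t k + (-1)\<bar> - \<bar>t k\<bar>)" by (rule lmin_coordinate[OF assms])
  also have "\<dots> \<le> real n * lam * 1" by (rule mult_left_mono[OF _ nl]) simp
  finally show ?thesis using 1 by simp
qed

lemma lmin_subgradient_eq:
  assumes "0 < n" "0 < lam" "lmin n p lam c \<xi> \<theta> t" "k < p" "t k \<noteq> 0"
  shows "ip n (c k) (lres p c \<xi> \<theta> t) = real n * lam * sgn (t k)"
proof -
  let ?g = "ip n (c k) (lres p c \<xi> \<theta> t)"
  have "t k * ?g \<le> real n * lam * (\<bar>t k + t k\<bar> - \<bar>t k\<bar>)" by (rule lmin_coordinate[OF assms(1-4)])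
  moreover have "\<bar>t k + t k\<bar> - \<bar>t k\<bar> = \<bar>t k\<bar>" by simp
  moreover have "(- t k) * ?g \<le> real n * lam * (\<bar>t k + (- t k)\<bar> - \<bar>t k\<bar>)" by (rule lmin_coordinate[OF assms(1-4)])
  ultimately have "t k * ?g = real n * lam * \<bar>t k\<bar>" by simp
  also have "\<dots> = t k * (real n * lam * sgn (t k))" by (simp add: abs_sgn[of "t k"] mult_ac)
  finally show ?thesis using assms(5) by simp
qed

text \<open>Comes from comparing the minimum with the objective at \<open>\<theta>\<close>. It
  depends on noise and parameter but not on the design, hence is constant along the shifts of
  Stein's identity.\<close>

definition noise_bound :: "nat \<Rightarrow> nat \<Rightarrow> real \<Rightarrow> (nat \<Rightarrow> real) \<Rightarrow> (nat \<Rightarrow> real) \<Rightarrow> real" where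
  "noise_bound n p lam \<xi> \<theta> = nrm n \<xi> + sqrt (ip n \<xi> \<xi> + 2 * real n * lam * l1 p \<theta>)"

lemma noise_bound_nonneg: "0 < lam \<Longrightarrow> 0 \<le> noise_bound n p lam \<xi> \<theta>"
  by (simp add: noise_bound_def ip_self_nonneg l1_nonneg)

lemma noise_bound_sq:
  assumes "0 < lam"
  shows "(noise_bound n p lam \<xi> \<theta>)\<^sup>2 \<le> 4 * ip n \<xi> \<xi> + 4 * real n * lam * l1 p \<theta>"
proof -
  have ab: "(a + b)\<^sup>2 \<le> 2 * a\<^sup>2 + 2 * b\<^sup>2" for a b :: real
    using zero_le_power2[of "a - b"] by (simp add: power2_eq_square algebra_simps)
  have "0 \<le> ip n \<xi> \<xi> + 2 * real n * lam * l1 p \<theta>" using assms by (simp add: ip_self_nonneg l1_nonneg)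
  then show ?thesis
    using ab[of "nrm n \<xi>" "sqrt (ip n \<xi> \<xi> + 2 * real n * lam * l1 p \<theta>)"]
    by (simp add: noise_bound_def nrm_sq)
qed

lemma lmin_bounds:
  assumes n: "0 < n" and lam: "0 < lam" and m: "lmin n p lam c \<xi> \<theta> t"
  shows "nrm n (lres p c \<xi> \<theta> t) \<le> noise_bound n p lam \<xi> \<theta>"
    and "nrm n (lin p c (\<lambda>k. t k - \<theta> k)) \<le> noise_bound n p lam \<xi> \<theta>"
proof -
  let ?r = "lres p c \<xi> \<theta> t"
  have "lobj n p lam c \<xi> \<theta> t \<le> lobj n p lam c \<xi> \<theta> \<theta>" using m by (simp add: lmin_def)
  moreover have "lres p c \<xi> \<theta> \<theta> = \<xi>" by (auto simp: lres_def lin_def)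
  ultimately have "ip n ?r ?r / (2 * real n) + lam * l1 p t \<le> ip n \<xi> \<xi> / (2 * real n) + lam * l1 p \<theta>"
    by (simp add: lobj_def)
  moreover have "0 \<le> lam * l1 p t" using lam by (simp add: l1_nonneg)
  ultimately have "ip n ?r ?r / (2 * real n) \<le> ip n \<xi> \<xi> / (2 * real n) + lam * l1 p \<theta>" by linarith
  then have "ip n ?r ?r \<le> ip n \<xi> \<xi> + 2 * real n * lam * l1 p \<theta>" using n by (simp add: field_simps)
  then have "nrm n ?r \<le> sqrt (ip n \<xi> \<xi> + 2 * real n * lam * l1 p \<theta>)"
    by (intro real_le_rsqrt) (simp add: nrm_sq)
  then have 1: "nrm n \<xi> + nrm n ?r \<le> noise_bound n p lam \<xi> \<theta>" by (simp add: noise_bound_def)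
  then show "nrm n ?r \<le> noise_bound n p lam \<xi> \<theta>" using nrm_nonneg[where n=n and u=\<xi>] by linarith
  have "nrm n (lin p c (\<lambda>k. t k - \<theta> k)) = nrm n (\<lambda>i. \<xi> i - ?r i)"
    by (intro nrm_cong) (simp add: lres_def)
  also have "\<dots> \<le> nrm n \<xi> + nrm n ?r" by (rule nrm_diff)
  finally show "nrm n (lin p c (\<lambda>k. t k - \<theta> k)) \<le> noise_bound n p lam \<xi> \<theta>" using 1 by linarith
qed

section \<open>Stability of the Lasso residual under a change of one column\<close>

lemma lin_change_column:
  assumes "j < p" "\<And>k. k \<noteq> j \<Longrightarrow> c' k = c k" "c' j = (\<lambda>i. c j i + w i)"
  shows "lin p c' h i = lin p c h i + h j * w i"
proof -
  have "c' k i = c k i + (if k = j then w i else 0)" for k using assms(2)[of k] assms(3) by auto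
  then have "lin p c' h i = (\<Sum>k<p. h k * c k i + (if k = j then h k * w i else 0))"
    unfolding lin_def by (intro sum.cong) (auto simp: algebra_simps)
  then show ?thesis using assms(1) by (simp add: sum.distrib lin_def)
qed

text \<open>Adding the variational inequalities of both minimizers cancels the penalties and bounds
  \<open>R\<^sup>2\<close> by two terms linear in \<open>w\<close>. One of them contains the change
  of coefficient \<open>j\<close>, which is bounded in turn by projecting the residuals off the
  other columns, at the price of a division by \<open>\<nu>\<close>. A quadratic inequality for
  \<open>R * \<nu>\<close> remains.\<close>

lemma lmin_stability:
  assumes n: "0 < n" and lam: "0 < lam" and j: "j < p"
    and c': "\<And>k. k \<noteq> j \<Longrightarrow> c' k = c k" "c' j = (\<lambda>i. c j i + w i)"
    and t: "lmin n p lam c \<xi> \<theta> t" and t': "lmin n p lam c' \<xi> \<theta> t'"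
    and \<nu>: "0 \<le> \<nu>" "\<nu> \<le> nrm n (orth_comp n c (others p j) (c j))"
       "\<nu> \<le> nrm n (orth_comp n c' (others p j) (c' j))"
  shows "nrm n (\<lambda>i. lres p c' \<xi> \<theta> t' i - lres p c \<xi> \<theta> t i) * \<nu> \<le> 3 * noise_bound n p lam \<xi> \<theta> * nrm n w"
proof -
  define r where "r = lres p c \<xi> \<theta> t"
  define r' where "r' = lres p c' \<xi> \<theta> t'"
  define h where "h = (\<lambda>k. t k - \<theta> k)"
  define h' where "h' = (\<lambda>k. t' k - \<theta> k)"
  define M where "M = noise_bound n p lam \<xi> \<theta>"
  define W where "W = nrm n w"
  define R where "R = nrm n (\<lambda>i. r' i - r i)"
  let ?O = "orth_comp n c (others p j)"
  have O': "orth_comp n c' (others p j) = ?O"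
    by (intro ext, rule fun_cong[OF orth_comp_cong]) (auto simp: set_others c')
  define y where "y = ?O (c j)"
  define y' where "y' = ?O (c' j)"
  have M0: "0 \<le> M" unfolding M_def by (rule noise_bound_nonneg[OF lam])
  have W0: "0 \<le> W" by (simp add: W_def)
  have R0: "0 \<le> R" by (simp add: R_def)
  have rM: "nrm n r \<le> M" unfolding r_def M_def by (rule lmin_bounds[OF n lam t])
  have lcc: "lin p c' g i = lin p c g i + g j * w i" for g i
    by (rule lin_change_column[where c=c and c'=c' and w=w, OF j]) (use c' in auto)
  have ri: "r i = \<xi> i - lin p c h i" for i by (simp add: r_def lres_def h_def)
  have r'i: "r' i = \<xi> i - lin p c h' i - h' j * w i" for i
    using lcc[of h' i] by (simp add: r'_def lres_def h'_def)
  have hM: "\<bar>h j\<bar> * nrm n y \<le> M"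
    using coef_le_nrm_lin[OF j, of h n c] lmin_bounds(2)[OF n lam t] by (simp add: y_def M_def h_def)
  have v1: "ip n r (lin p c (\<lambda>k. t' k - t k)) \<le> real n * lam * (l1 p t' - l1 p t)"
    unfolding r_def by (rule lmin_variational[OF n lam t])
  have v2: "ip n r' (lin p c' (\<lambda>k. t k - t' k)) \<le> real n * lam * (l1 p t - l1 p t')"
    unfolding r'_def by (rule lmin_variational[OF n lam t'])
  have d1: "lin p c (\<lambda>k. t' k - t k) = (\<lambda>i. r i - r' i - h' j * w i)"
  proof
    fix i
    have "lin p c (\<lambda>k. t' k - t k) i = lin p c (\<lambda>k. h' k - h k) i" by (simp add: h_def h'_def)
    then show "lin p c (\<lambda>k. t' k - t k) i = r i - r' i - h' j * w i" by (simp add: lin_diff ri r'i)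
  qed
  have d2: "lin p c' (\<lambda>k. t k - t' k) = (\<lambda>i. r' i - r i + h j * w i)"
  proof
    fix i
    have "lin p c' (\<lambda>k. t k - t' k) i = lin p c' (\<lambda>k. h k - h' k) i" by (simp add: h_def h'_def)
    then show "lin p c' (\<lambda>k. t k - t' k) i = r' i - r i + h j * w i"
      by (simp add: lin_diff ri r'i lcc)
  qed
  have "ip n r (\<lambda>i. r i - r' i - h' j * w i) + ip n r' (\<lambda>i. r' i - r i + h j * w i) \<le> 0"
    using v1 v2 unfolding d1 d2 by (simp add: right_diff_distrib)
  moreover have "R\<^sup>2 = ip n r r - 2 * ip n r r' + ip n r' r'"
    unfolding R_def by (simp add: nrm_sq ip_linear ip_commute[of n r' r])
  moreover have "ip n r (\<lambda>i. r i - r' i - h' j * w i) = ip n r r - ip n r r' - h' j * ip n r w"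
    by (simp add: ip_linear)
  moreover have "ip n r' (\<lambda>i. r' i - r i + h j * w i) = ip n r' r' - ip n r r' + h j * ip n r' w"
    by (simp add: ip_linear ip_commute[of n r' r])
  moreover have "ip n (\<lambda>i. r' i - r i) w = ip n r' w - ip n r w" by (simp add: ip_linear)
  ultimately have "R\<^sup>2 \<le> (h' j - h j) * ip n r w - h j * ip n (\<lambda>i. r' i - r i) w"
    by (simp add: left_diff_distrib right_diff_distrib)
  also have "\<dots> \<le> \<bar>h' j - h j\<bar> * (M * W) + \<bar>h j\<bar> * (R * W)"
  proof -
    have "\<bar>ip n r w\<bar> \<le> M * W"
      using ip_le_nrm[of n r w] mult_right_mono[OF rM W0] by (simp add: W_def)
    then have "\<bar>(h' j - h j) * ip n r w\<bar> \<le> \<bar>h' j - h j\<bar> * (M * W)"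
      unfolding abs_mult by (rule mult_left_mono) simp
    moreover have "\<bar>h j * ip n (\<lambda>i. r' i - r i) w\<bar> \<le> \<bar>h j\<bar> * (R * W)"
      unfolding abs_mult R_def W_def by (rule mult_left_mono[OF ip_le_nrm]) simp
    ultimately show ?thesis by linarith
  qed
  finally have R2: "R\<^sup>2 \<le> \<bar>h' j - h j\<bar> * (M * W) + \<bar>h j\<bar> * (R * W)" .
  \<comment> \<open>After the projection the residual difference shows only the change of column
    \<open>j\<close> and of its coefficient.\<close>
  have "\<bar>h' j - h j\<bar> * nrm n y' \<le> R + \<bar>h j\<bar> * W"
  proof -
    have y'y: "y' = (\<lambda>i. y i + ?O w i)" unfolding y_def y'_def c'(2) by (rule orth_comp_add)
    have Or: "?O (\<lambda>i. r i - r' i) i = (h' j - h j) * y' i + h j * ?O w i" if i: "i < n" for i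
    proof -
      have "(\<lambda>i. r i - r' i) = (\<lambda>i. (lin p c h' i - lin p c h i) + h' j * w i)" by (auto simp: ri r'i)
      then have "?O (\<lambda>i. r i - r' i) i = ?O (lin p c h') i - ?O (lin p c h) i + h' j * ?O w i"
        by (simp add: orth_comp_add orth_comp_diff orth_comp_scale)
      also have "\<dots> = h' j * y i - h j * y i + h' j * ?O w i"
        using orth_comp_lin[OF j i] by (simp add: y_def)
      finally show ?thesis by (simp add: y'y algebra_simps)
    qed
    have "\<bar>h' j - h j\<bar> * nrm n y' = nrm n (\<lambda>i. (h' j - h j) * y' i)" by (simp add: nrm_scale)
    also have "\<dots> = nrm n (\<lambda>i. ?O (\<lambda>i. r i - r' i) i - h j * ?O w i)"
      using Or by (intro nrm_cong) simp
    also have "\<dots> \<le> nrm n (?O (\<lambda>i. r i - r' i)) + nrm n (\<lambda>i. h j * ?O w i)" by (rule nrm_diff)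
    also have "nrm n (?O (\<lambda>i. r i - r' i)) \<le> R"
      unfolding R_def nrm_diff_commute[where u=r'] by (rule nrm_orth_comp_le)
    also have "nrm n (\<lambda>i. h j * ?O w i) \<le> \<bar>h j\<bar> * W"
      unfolding nrm_scale W_def by (intro mult_left_mono nrm_orth_comp_le) simp
    finally show ?thesis by simp
  qed
  moreover have "\<bar>h' j - h j\<bar> * \<nu> \<le> \<bar>h' j - h j\<bar> * nrm n y'"
    using \<nu>(3) by (intro mult_left_mono) (simp_all add: y'_def O')
  ultimately have dh: "\<bar>h' j - h j\<bar> * \<nu> \<le> R + \<bar>h j\<bar> * W" by linarith
  have hnu: "\<bar>h j\<bar> * \<nu> \<le> M"
  proof -
    have "\<bar>h j\<bar> * \<nu> \<le> \<bar>h j\<bar> * nrm n y" using \<nu>(2) by (intro mult_left_mono) (simp_all add: y_def)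
    then show ?thesis using hM by linarith
  qed
  define x where "x = R * \<nu>"
  define e where "e = M * W"
  have e0: "0 \<le> e" using M0 W0 by (simp add: e_def)
  have x0: "0 \<le> x" using R0 \<nu> by (simp add: x_def)
  have "x\<^sup>2 = R\<^sup>2 * \<nu>\<^sup>2" by (simp add: x_def power_mult_distrib)
  also have "\<dots> \<le> (\<bar>h' j - h j\<bar> * (M * W) + \<bar>h j\<bar> * (R * W)) * \<nu>\<^sup>2"
    by (intro mult_right_mono R2) simp
  also have "\<dots> = (\<bar>h' j - h j\<bar> * \<nu>) * \<nu> * e + (\<bar>h j\<bar> * \<nu>) * (x * W)"
    by (simp add: e_def x_def power2_eq_square algebra_simps)
  also have "\<dots> \<le> (R + \<bar>h j\<bar> * W) * \<nu> * e + M * (x * W)"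
    using dh hnu e0 x0 W0 \<nu> by (intro add_mono mult_right_mono) auto
  also have "(R + \<bar>h j\<bar> * W) * \<nu> * e = x * e + (\<bar>h j\<bar> * \<nu>) * W * e"
    by (simp add: x_def algebra_simps)
  also have "\<dots> \<le> x * e + M * W * e"
    using hnu e0 W0 by (intro add_mono mult_right_mono) auto
  \<comment> \<open>Hence \<open>x \<le> (1 + sqrt 2) * e\<close>, rounded up to
    \<open>3 * e\<close>.\<close>
  finally have "x\<^sup>2 \<le> 2 * (x * e) + e\<^sup>2" by (simp add: e_def power2_eq_square algebra_simps)
  then have "(x - e)\<^sup>2 \<le> 2 * e\<^sup>2" by (simp add: power2_eq_square algebra_simps)
  also have "\<dots> \<le> (2 * e)\<^sup>2" by (simp add: power_mult_distrib)
  finally have "x - e \<le> 2 * e" by (rule power2_le_imp_le) (use e0 in simp)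
  then show ?thesis by (simp add: x_def e_def R_def M_def W_def r_def r'_def mult_ac)
qed

section \<open>Damping of the residual where column \<open>j\<close> nearly depends on the
  others\<close>

lemma damping_lipschitz:
  fixes s t m :: real
  assumes "0 \<le> s" "0 \<le> t" "0 < m"
  shows "\<bar>t\<^sup>2 / (m + t\<^sup>2) - s\<^sup>2 / (m + s\<^sup>2)\<bar> \<le> \<bar>t - s\<bar> / sqrt m"
proof -
  define q where "q = sqrt m"
  have q: "0 < q" "m = q\<^sup>2" using assms by (auto simp: q_def)
  have d: "0 < (q\<^sup>2 + t\<^sup>2) * (q\<^sup>2 + s\<^sup>2)" using q by (intro mult_pos_pos add_pos_nonneg) auto
  have "t\<^sup>2 / (m + t\<^sup>2) - s\<^sup>2 / (m + s\<^sup>2) = (t - s) * (q\<^sup>2 * (t + s) / ((q\<^sup>2 + t\<^sup>2) * (q\<^sup>2 + s\<^sup>2)))"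
    using q d by (simp add: field_simps power2_eq_square)
  moreover have "q\<^sup>2 * (t + s) / ((q\<^sup>2 + t\<^sup>2) * (q\<^sup>2 + s\<^sup>2)) \<le> 1 / q"
  proof -
    have "2 * (q * t) \<le> q\<^sup>2 + t\<^sup>2" "2 * (q * s) \<le> q\<^sup>2 + s\<^sup>2"
      using sum_squares_bound[of q t] sum_squares_bound[of q s] by simp_all
    then have "q * (t + s) \<le> q\<^sup>2 + t\<^sup>2 + s\<^sup>2" 
      using zero_le_power2[of t] zero_le_power2[of s] zero_le_power2[of q]
      unfolding distrib_left by linarith
    then have "q\<^sup>2 * (q * (t + s)) \<le> q\<^sup>2 * (q\<^sup>2 + t\<^sup>2 + s\<^sup>2)" by (intro mult_left_mono) auto
    also have "\<dots> \<le> (q\<^sup>2 + t\<^sup>2) * (q\<^sup>2 + s\<^sup>2)" by (simp add: algebra_simps)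
    finally show ?thesis using q d by (simp add: divide_le_eq le_divide_eq mult_ac)
  qed
  moreover have "0 \<le> q\<^sup>2 * (t + s) / ((q\<^sup>2 + t\<^sup>2) * (q\<^sup>2 + s\<^sup>2))"
    using assms d by (intro divide_nonneg_pos mult_nonneg_nonneg) auto
  ultimately have "\<bar>t\<^sup>2 / (m + t\<^sup>2) - s\<^sup>2 / (m + s\<^sup>2)\<bar> \<le> \<bar>t - s\<bar> * (1 / q)"
    by (simp only: abs_mult) (intro mult_left_mono, simp_all)
  then show ?thesis by (simp add: q_def)
qed

text \<open>With \<open>s\<^sup>2\<close> in the role of \<open>N\<close>. For small
  \<open>s\<close> it is dominated by \<open>s / (2 * sqrt n)\<close>, which absorbs the
  \<open>1 / \<nu>\<close> of \<open>lmin_stability\<close>; for \<open>s\<^sup>2\<close> of order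
  \<open>n\<close> it stays away from 0.\<close>

definition damping :: "nat \<Rightarrow> real \<Rightarrow> real" where
  "damping n s = s\<^sup>2 / (real n + s\<^sup>2)"

lemma damping_bounds: "0 \<le> damping n s" "damping n s \<le> 1"
proof -
  have "0 \<le> real n + s\<^sup>2" by simp
  then show "0 \<le> damping n s" unfolding damping_def by (intro divide_nonneg_nonneg) auto
  show "damping n s \<le> 1"
  proof (cases "real n + s\<^sup>2 = 0")
    case False
    with \<open>0 \<le> real n + s\<^sup>2\<close> have "0 < real n + s\<^sup>2" by linarith
    then show ?thesis by (simp add: damping_def)
  qed (simp add: damping_def)
qed

lemma damping_le:
  assumes "0 < n" "0 \<le> s"
  shows "damping n s \<le> s / (2 * sqrt (real n))"
proof -
  define q where "q = sqrt (real n)"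
  have q: "0 < q" "real n = q\<^sup>2" using assms by (auto simp: q_def)
  have d: "0 < q\<^sup>2 + s\<^sup>2" using q by (intro add_pos_nonneg) auto
  have "s * (2 * (q * s)) \<le> s * (q\<^sup>2 + s\<^sup>2)"
    using sum_squares_bound[of q s] assms by (intro mult_left_mono) auto
  then show ?thesis
    unfolding damping_def q_def[symmetric] q(2) using d q
    by (simp add: field_simps power2_eq_square)
qed

text \<open>In the difference of products the change of the residual carries the damping at the
  smaller norm, where \<open>damping_le\<close> cancels the \<open>1 / \<nu>\<close> of
  \<open>lmin_stability\<close>, and the change of the damping carries a residual of norm at most
  \<open>noise_bound\<close>. The constants add up to 3/2 + 1, which is below 3.\<close>

lemma damped_residual_lipschitz:
  fixes cc :: real
  assumes n: "0 < n" and lam: "0 < lam" and j: "j < p" and cc: "0 < cc"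
    and c': "\<And>k. k \<noteq> j \<Longrightarrow> c' k = c k" "c' j = (\<lambda>i. c j i + w i)"
    and t: "lmin n p lam c \<xi> \<theta> t" and t': "lmin n p lam c' \<xi> \<theta> t'"
  defines "s \<equiv> sqrt cc * nrm n (orth_comp n c (others p j) (c j))"
    and "s' \<equiv> sqrt cc * nrm n (orth_comp n c' (others p j) (c' j))"
  shows "nrm n (\<lambda>i. damping n s' * lres p c' \<xi> \<theta> t' i - damping n s * lres p c \<xi> \<theta> t i)
      \<le> 3 * noise_bound n p lam \<xi> \<theta> * (sqrt cc * nrm n w) / sqrt (real n)"
proof -
  define r where "r = lres p c \<xi> \<theta> t"
  define r' where "r' = lres p c' \<xi> \<theta> t'"
  define M where "M = noise_bound n p lam \<xi> \<theta>"
  define R where "R = nrm n (\<lambda>i. r' i - r i)"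
  define U where "U = sqrt cc * nrm n w"
  define q where "q = sqrt (real n)"
  have q: "0 < q" using n by (simp add: q_def)
  have M0: "0 \<le> M" unfolding M_def by (rule noise_bound_nonneg[OF lam])
  have U0: "0 \<le> U" using cc by (simp add: U_def)
  have R0: "0 \<le> R" by (simp add: R_def)
  have s0: "0 \<le> s" "0 \<le> s'" using cc by (simp_all add: s_def s'_def)
  have rM: "nrm n r \<le> M" "nrm n r' \<le> M"
    unfolding r_def r'_def M_def by (rule lmin_bounds[OF n lam t] lmin_bounds[OF n lam t'])+
  have O': "orth_comp n c' (others p j) = orth_comp n c (others p j)"
    by (intro ext, rule fun_cong[OF orth_comp_cong]) (auto simp: set_others c')
  have ss: "\<bar>s' - s\<bar> \<le> U"
  proof -
    let ?O = "orth_comp n c (others p j)"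
    have "\<bar>nrm n (?O (c' j)) - nrm n (?O (c j))\<bar> \<le> nrm n (\<lambda>i. ?O (c' j) i - ?O (c j) i)"
      by (rule nrm_triangle_diff)
    also have "\<dots> = nrm n (?O w)" by (simp add: c' orth_comp_add)
    also have "\<dots> \<le> nrm n w" by (rule nrm_orth_comp_le)
    finally have "sqrt cc * \<bar>nrm n (?O (c' j)) - nrm n (?O (c j))\<bar> \<le> U"
      unfolding U_def using cc by (intro mult_left_mono) auto
    moreover have "s' - s = sqrt cc * (nrm n (?O (c' j)) - nrm n (?O (c j)))"
      by (simp add: s_def s'_def O' right_diff_distrib)
    ultimately show ?thesis using cc by (simp add: abs_mult)
  qed
  have dd: "\<bar>damping n s' - damping n s\<bar> \<le> U / q"
  proof -
    have "\<bar>damping n s' - damping n s\<bar> \<le> \<bar>s' - s\<bar> / q"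
      unfolding damping_def q_def by (rule damping_lipschitz) (use s0 n in auto)
    also have "\<dots> \<le> U / q" using ss q by (intro divide_right_mono) auto
    finally show ?thesis .
  qed
  \<comment> \<open>The smaller of the two distances, since \<open>lmin_stability\<close> asks for a
    common lower bound.\<close>
  define \<nu> where "\<nu> = min s s' / sqrt cc"
  have \<nu>0: "0 \<le> \<nu>" using s0 cc by (simp add: \<nu>_def)
  have "R * \<nu> \<le> 3 * M * nrm n w"
    unfolding R_def M_def r_def r'_def
  proof (rule lmin_stability[where c=c and c'=c' and w=w, OF n lam j c' t t' \<nu>0])
    have "\<nu> \<le> s / sqrt cc" "\<nu> \<le> s' / sqrt cc"
      unfolding \<nu>_def using cc by (intro divide_right_mono; simp)+
    then show "\<nu> \<le> nrm n (orth_comp n c (others p j) (c j))"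
        "\<nu> \<le> nrm n (orth_comp n c' (others p j) (c' j))"
      using cc by (simp_all add: s_def s'_def)
  qed
  then have "sqrt cc * (R * \<nu>) \<le> sqrt cc * (3 * M * nrm n w)"
    using cc by (intro mult_left_mono) auto
  then have Rmin: "R * min s s' \<le> 3 * M * U" using cc by (simp add: \<nu>_def U_def mult_ac)
  have key: "damping n (min s s') * R \<le> 3 / 2 * M * U / q"
  proof -
    have "damping n (min s s') * R \<le> min s s' / (2 * q) * R"
      unfolding q_def using R0 by (intro mult_right_mono damping_le n) (use s0 in auto)
    also have "\<dots> = R * min s s' / (2 * q)" by simp
    also have "\<dots> \<le> 3 * M * U / (2 * q)" using Rmin q by (intro divide_right_mono) auto
    finally show ?thesis by simp
  qed
  \<comment> \<open>A difference of products splits in two ways; the case distinction picks the one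
    that puts the smaller damping factor in front of \<open>R\<close>.\<close>
  have fin: "nrm n (\<lambda>i. damping n s' * r' i - damping n s * r i) \<le> damping n (min s s') * R + \<bar>damping n s' - damping n s\<bar> * M"
  proof (cases "s \<le> s'")
    case True
    have "nrm n (\<lambda>i. damping n s' * r' i - damping n s * r i) =
        nrm n (\<lambda>i. damping n s * (r' i - r i) + (damping n s' - damping n s) * r' i)"
      by (intro nrm_cong) (simp add: algebra_simps)
    also have "\<dots> \<le> nrm n (\<lambda>i. damping n s * (r' i - r i)) + nrm n (\<lambda>i. (damping n s' - damping n s) * r' i)"
      by (rule nrm_add)
    also have "\<dots> = damping n s * R + \<bar>damping n s' - damping n s\<bar> * nrm n r'"
      by (simp add: nrm_scale damping_bounds R_def)
    also have "\<dots> \<le> damping n s * R + \<bar>damping n s' - damping n s\<bar> * M"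
      by (intro add_left_mono mult_left_mono rM) auto
    finally show ?thesis using True by (simp add: min_absorb1)
  next
    case False
    have "nrm n (\<lambda>i. damping n s' * r' i - damping n s * r i) =
        nrm n (\<lambda>i. damping n s' * (r' i - r i) + (damping n s' - damping n s) * r i)"
      by (intro nrm_cong) (simp add: algebra_simps)
    also have "\<dots> \<le> nrm n (\<lambda>i. damping n s' * (r' i - r i)) + nrm n (\<lambda>i. (damping n s' - damping n s) * r i)"
      by (rule nrm_add)
    also have "\<dots> = damping n s' * R + \<bar>damping n s' - damping n s\<bar> * nrm n r"
      by (simp add: nrm_scale damping_bounds R_def)
    also have "\<dots> \<le> damping n s' * R + \<bar>damping n s' - damping n s\<bar> * M"
      by (intro add_left_mono mult_left_mono rM) auto
    finally show ?thesis using False by (simp add: min_absorb2)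
  qed
  also have "\<dots> \<le> 3 / 2 * M * U / q + U / q * M"
    using M0 by (intro add_mono key mult_right_mono dd)
  also have "\<dots> = 5 / 2 * (M * U / q)" using q by (simp add: field_simps)
  also have "\<dots> \<le> 3 * (M * U / q)" using M0 U0 q by (intro mult_right_mono) auto
  finally show ?thesis by (simp add: r_def r'_def M_def U_def q_def mult.assoc)
qed

subsection \<open>Derivative of the Lasso residual in one column\<close>

definition active :: "nat \<Rightarrow> (nat \<Rightarrow> real) \<Rightarrow> nat list" where
  "active p t = filter (\<lambda>k. t k \<noteq> 0) [0..<p]"

lemma set_active: "set (active p t) = {k. k < p \<and> t k \<noteq> 0}" by (auto simp: active_def)

text \<open>
  \<open>dual_col n p c t j\<close> lies in the span of the active columns and is dual to column \<open>j\<close>; it is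
  the rank one contribution to the derivative of the Lasso residual in column \<open>j\<close>.
\<close>

definition dual_col :: "nat \<Rightarrow> nat \<Rightarrow> (nat \<Rightarrow> nat \<Rightarrow> real) \<Rightarrow> (nat \<Rightarrow> real) \<Rightarrow> nat \<Rightarrow> nat \<Rightarrow> real" where
  "dual_col n p c t j i = (if t j \<noteq> 0 then
     let y = orth_comp n c (filter (\<lambda>k. k \<noteq> j) (active p t)) (c j) in y i / ip n y y else 0)"

lemma dual_col_span:
  assumes "j < p"
  shows "\<exists>g. \<forall>i. dual_col n p c t j i = (\<Sum>m\<in>set (active p t). g m * c m i)"
proof (cases "t j = 0")
  case True
  then show ?thesis by (intro exI[of _ "\<lambda>_. 0"]) (simp add: dual_col_def)
next
  case False
  let ?ks = "filter (\<lambda>k. k \<noteq> j) (active p t)"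
  define y where "y = orth_comp n c ?ks (c j)"
  obtain g where g: "\<And>i. c j i - y i = (\<Sum>m\<in>set ?ks. g m * c m i)"
    unfolding y_def using orth_comp_span by blast
  define g' where "g' = (\<lambda>m. (if m = j then 1 else - g m) / ip n y y)"
  have S: "set (active p t) = insert j (set ?ks)" using False assms by (auto simp: set_active)
  have "dual_col n p c t j i = (\<Sum>m\<in>set (active p t). g' m * c m i)" for i
  proof -
    have "dual_col n p c t j i = (c j i - (\<Sum>m\<in>set ?ks. g m * c m i)) / ip n y y"
      using False g[of i] by (simp add: dual_col_def y_def[symmetric] Let_def)
    also have "\<dots> = g' j * c j i + (\<Sum>m\<in>set ?ks. g' m * c m i)"
    proof -
      have "(\<Sum>m\<in>set ?ks. g' m * c m i) = (\<Sum>m\<in>set ?ks. - (g m * c m i / ip n y y))"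
        by (rule sum.cong) (auto simp: g'_def)
      then show ?thesis by (simp add: g'_def diff_divide_distrib sum_divide_distrib sum_negf)
    qed
    also have "\<dots> = (\<Sum>m\<in>set (active p t). g' m * c m i)" unfolding S by (subst sum.insert) auto
    finally show ?thesis .
  qed
  then show ?thesis by blast
qed

lemma ip_dual_col:
  assumes ind: "indep_cols n p c" and j: "j < p" and k: "k \<in> set (active p t)"
  shows "ip n (c k) (dual_col n p c t j) = (if k = j then 1 else 0)"
proof (cases "t j = 0")
  case True
  with k have "k \<noteq> j" by (auto simp: set_active)
  with True show ?thesis by (simp add: dual_col_def ip_def)
next
  case False
  let ?ks = "filter (\<lambda>k. k \<noteq> j) (active p t)"
  define y where "y = orth_comp n c ?ks (c j)"
  have yy: "ip n y y \<noteq> 0"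
    unfolding y_def using indep_cols_orth_comp[OF ind _ j, of ?ks] by (auto simp: set_active)
  have "dual_col n p c t j = (\<lambda>i. (1 / ip n y y) * y i)"
    using False by (auto simp: dual_col_def y_def Let_def)
  then have "ip n (c k) (dual_col n p c t j) = ip n (c k) y / ip n y y" by (simp only: ip_scale_right) simp
  moreover have "ip n (c k) y = (if k = j then ip n y y else 0)"
    using k orth_comp_orthogonal[of k ?ks n c "c j"] ip_orth_comp_orth_comp[of n c ?ks "c j" "c j"]
    by (auto simp: y_def)
  ultimately show ?thesis using yy by simp
qed

text \<open>The norm is the reciprocal of the distance from column \<open>j\<close> to the other
  active columns, which is at least its distance to all other columns.\<close>

lemma nrm_dual_col_le:
  assumes ind: "indep_cols n p c" and j: "j < p"
  shows "nrm n (dual_col n p c t j) * nrm n (orth_comp n c (others p j) (c j)) \<le> 1"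
proof (cases "t j = 0")
  case True
  then have "nrm n (dual_col n p c t j) = nrm n (\<lambda>_. 0)" by (intro nrm_cong) (simp add: dual_col_def)
  then show ?thesis by (simp add: L2_set_def)
next
  case False
  let ?q = "dual_col n p c t j" and ?z = "orth_comp n c (others p j) (c j)"
  obtain g where g: "\<And>i. ?q i = (\<Sum>m\<in>set (active p t). g m * c m i)" using dual_col_span[OF j] by blast
  have jA: "j \<in> set (active p t)" using False j by (simp add: set_active)
  let ?ks = "filter (\<lambda>k. k \<noteq> j) (active p t)"
  define y where "y = orth_comp n c ?ks (c j)"
  have yy: "ip n y y \<noteq> 0"
    unfolding y_def using indep_cols_orth_comp[OF ind _ j, of ?ks] by (auto simp: set_active)
  have q: "?q = (\<lambda>i. (1 / ip n y y) * y i)"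
    using False by (auto simp: dual_col_def y_def Let_def)
  have ny: "nrm n y \<noteq> 0" using yy by (simp add: nrm_sq[symmetric])
  have nz: "0 < nrm n y" using ny nrm_nonneg[where n=n and u=y] by linarith
  have "nrm n ?q = 1 / nrm n y"
    unfolding q nrm_scale using nz by (simp add: nrm_sq[symmetric] power2_eq_square)
  moreover have "nrm n ?z \<le> nrm n y"
  proof -
    obtain b where b: "\<And>i. c j i - y i = (\<Sum>m\<in>set ?ks. b m * c m i)"
      unfolding y_def using orth_comp_span by blast
    have "ip n (c m) ?z = 0" if "m \<in> set ?ks" for m
      using that by (intro orth_comp_orthogonal) (auto simp: set_others set_active)
    then have "ip n (\<lambda>i. \<Sum>m\<in>set ?ks. b m * c m i) ?z = 0" by (simp add: ip_sum_left)
    moreover have "(\<lambda>i. c j i - y i) = (\<lambda>i. \<Sum>m\<in>set ?ks. b m * c m i)" by (rule ext) (rule b)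
    ultimately have "ip n (\<lambda>i. c j i - y i) ?z = 0" by simp
    then have "ip n (c j) ?z = ip n y ?z" by (simp add: ip_linear)
    then have "nrm n ?z * nrm n ?z = ip n y ?z"
      by (simp add: nrm_sq[unfolded power2_eq_square] ip_orth_comp_orth_comp)
    also have "\<dots> \<le> nrm n y * nrm n ?z" using ip_le_nrm[of n y ?z] by linarith
    finally have *: "nrm n ?z * nrm n ?z \<le> nrm n y * nrm n ?z" .
    show ?thesis
    proof (cases "nrm n ?z = 0")
      case False
      then have "0 < nrm n ?z" using nrm_nonneg[where n=n and u="?z"] by linarith
      with * show ?thesis by (rule mult_right_le_imp_le)
    qed simp
  qed
  ultimately show ?thesis using nz by simp
qed

text \<open>Exact for finite \<open>w\<close>, because projection and dual column belong to the old
  design while coefficient and residual belong to the new one. The difference \<open>D\<close> of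
  the two sides lies in the span of the active columns, and the stationarity equations before and
  after, with equal signs, make it orthogonal to that span.\<close>

lemma lres_perturb:
  assumes n: "0 < n" and lam: "0 < lam" and j: "j < p" and ind: "indep_cols n p c"
    and c': "\<And>k. k \<noteq> j \<Longrightarrow> c' k = c k" "c' j = (\<lambda>i. c j i + w i)"
    and t: "lmin n p lam c \<xi> \<theta> t" and t': "lmin n p lam c' \<xi> \<theta> t'"
    and sg: "\<And>k. k < p \<Longrightarrow> sgn (t' k) = sgn (t k)"
    and i: "i < n"
  shows "lres p c' \<xi> \<theta> t' i - lres p c \<xi> \<theta> t i =
    - ((t' j - \<theta> j) * orth_comp n c (active p t) w i + ip n (lres p c' \<xi> \<theta> t') w * dual_col n p c t j i)"
proof -
  define r where "r = lres p c \<xi> \<theta> t"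
  define r' where "r' = lres p c' \<xi> \<theta> t'"
  let ?A = "set (active p t)" and ?O = "orth_comp n c (active p t)" and ?q = "dual_col n p c t j"
  define a where "a = t' j - \<theta> j"
  define D where "D = (\<lambda>i. r' i - r i + a * ?O w i + ip n r' w * ?q i)"
  have fin: "finite ?A" by simp
  have t0: "t' k = 0 \<longleftrightarrow> t k = 0" if "k < p" for k using sg[OF that] by (metis sgn_0_0)
  have lcc: "lin p c' g i = lin p c g i + g j * w i" for g i
    by (rule lin_change_column[where c=c and c'=c' and w=w, OF j]) (use c' in auto)
  have rr: "r' i - r i = - (\<Sum>m\<in>?A. (t' m - t m) * c m i) - a * w i" for i
  proof -
    have "r' i - r i = - (lin p c (\<lambda>k. t' k - \<theta> k) i - lin p c (\<lambda>k. t k - \<theta> k) i) - a * w i"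
      by (simp add: r_def r'_def lres_def lcc a_def)
    also have "lin p c (\<lambda>k. t' k - \<theta> k) i - lin p c (\<lambda>k. t k - \<theta> k) i = (\<Sum>m<p. (t' m - t m) * c m i)"
      by (simp add: lin_def sum_subtractf[symmetric] left_diff_distrib)
    also have "\<dots> = (\<Sum>m\<in>?A. (t' m - t m) * c m i)"
      by (rule sum.mono_neutral_right) (auto simp: set_active t0)
    finally show ?thesis .
  qed
  obtain g1 where g1: "\<And>i. w i - ?O w i = (\<Sum>m\<in>?A. g1 m * c m i)" using orth_comp_span by blast
  obtain g2 where g2: "\<And>i. ?q i = (\<Sum>m\<in>?A. g2 m * c m i)" using dual_col_span[OF j] by blast
  define g where "g = (\<lambda>m. - (t' m - t m) - a * g1 m + ip n r' w * g2 m)"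
  have Dg: "D = (\<lambda>i. \<Sum>m\<in>?A. g m * c m i)"
  proof
    fix i
    have "D i = - (\<Sum>m\<in>?A. (t' m - t m) * c m i) - a * (w i - ?O w i) + ip n r' w * ?q i"
      by (simp add: D_def rr right_diff_distrib)
    also have "\<dots> = (\<Sum>m\<in>?A. g m * c m i)"
      unfolding g1 g2 g_def
      by (simp add: sum_negf[symmetric] sum_distrib_left sum_subtractf[symmetric] sum.distrib[symmetric] algebra_simps)
    finally show "D i = (\<Sum>m\<in>?A. g m * c m i)" .
  qed
  \<comment> \<open>Only the stationarity equation of column \<open>j\<close> changes, by
    \<open>ip n r' w\<close>, and the dual column compensates exactly this.\<close>
  have "ip n (c k) D = 0" if k: "k \<in> ?A" for k
  proof -
    have kp: "k < p" "t k \<noteq> 0" "t' k \<noteq> 0" using k t0 by (auto simp: set_active)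
    have e: "ip n (c k) r = real n * lam * sgn (t k)"
      unfolding r_def by (rule lmin_subgradient_eq[OF n lam t kp(1,2)])
    have "ip n (c' k) r' = real n * lam * sgn (t k)"
      unfolding r'_def using lmin_subgradient_eq[OF n lam t' kp(1,3)] sg[OF kp(1)] by simp
    moreover have "ip n (c' k) r' = ip n (c k) r' + (if k = j then ip n w r' else 0)"
      using c'(1)[of k] c'(2) by (simp add: ip_linear)
    ultimately have e': "ip n (c k) r' = real n * lam * sgn (t k) - (if k = j then ip n r' w else 0)"
      by (simp add: ip_commute)
    have "ip n (c k) D = ip n (c k) r' - ip n (c k) r + a * ip n (c k) (?O w) + ip n r' w * ip n (c k) ?q"
      unfolding D_def by (simp add: ip_linear)
    then show ?thesis
      using e e' ip_dual_col[OF ind j k] orth_comp_orthogonal[OF k] by simp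
  qed
  then have "ip n D D = 0" by (subst (1) Dg) (simp add: ip_sum_left)
  then have "D i = 0" using i by (simp add: ip_self_eq_0)
  then show ?thesis by (simp add: D_def r_def r'_def a_def)
qed

text \<open>For small perturbations the signs are constant: nonzero coefficients keep theirs by
  continuity of the minimizer, and zero coefficients stay zero because their subgradient is strictly
  inside its bounds. Then \<open>lres_perturb\<close> holds eventually and only convergence of
  \<open>tm\<close> and \<open>rm\<close> is left.\<close>

lemma lres_derivative:
  fixes \<beta> :: "nat \<Rightarrow> real"
  assumes n: "0 < n" and lam: "0 < lam" and j: "j < p" and ind: "indep_cols n p c"
    and cm: "\<And>m k. k \<noteq> j \<Longrightarrow> cm m k = c k" "\<And>m. cm m j = (\<lambda>l. c j l + \<beta> m * unit_vec' i l)"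
    and t: "lmin n p lam c \<xi> \<theta> t" and tm: "\<And>m. lmin n p lam (cm m) \<xi> \<theta> (tm m)"
    and \<beta>: "\<beta> \<longlonglongrightarrow> 0" "\<And>m. \<beta> m \<noteq> 0"
    and strict: "\<And>k. k < p \<Longrightarrow> t k = 0 \<Longrightarrow> \<bar>ip n (c k) (lres p c \<xi> \<theta> t)\<bar> < real n * lam"
    and i: "i < n"
  shows "(\<lambda>m. (lres p (cm m) \<xi> \<theta> (tm m) i - lres p c \<xi> \<theta> t i) / \<beta> m) \<longlonglongrightarrow>
    - ((t j - \<theta> j) * orth_comp n c (active p t) (unit_vec' i) i + lres p c \<xi> \<theta> t i * dual_col n p c t j i)"
proof -
  define r where "r = lres p c \<xi> \<theta> t"
  define rm where "rm = (\<lambda>m. lres p (cm m) \<xi> \<theta> (tm m))"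
  define M where "M = noise_bound n p lam \<xi> \<theta>"
  have M0: "0 \<le> M" unfolding M_def by (rule noise_bound_nonneg[OF lam])
  define R where "R = (\<lambda>m. nrm n (\<lambda>l. rm m l - r l))"
  let ?O = "orth_comp n c (others p j)"
  \<comment> \<open>Half the distance, so that it bounds the distances of both designs from below
    once \<open>\<bar>\<beta> m\<bar> \<le> \<nu>\<close>.\<close>
  define \<nu> where "\<nu> = nrm n (?O (c j)) / 2"
  have \<nu>: "0 < \<nu>" using ind j nrm_nonneg[where n=n and u="?O (c j)"] by (auto simp: indep_cols_def \<nu>_def less_le)
  have uu: "nrm n (unit_vec' i) = 1" 
  proof -
    have "(nrm n (unit_vec' i))\<^sup>2 = 1" using i by (simp only: nrm_sq ip_unit) simp
    then show ?thesis using nrm_nonneg[where n=n and u="unit_vec' i"] by (simp add: power2_eq_1_iff)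
  qed
  have O': "orth_comp n (cm m) (others p j) = ?O" for m
    by (intro ext, rule fun_cong[OF orth_comp_cong]) (auto simp: set_others cm)
  have ev: "\<forall>\<^sub>F m in sequentially. \<bar>\<beta> m\<bar> \<le> \<nu>"
    using \<beta>(1) \<nu> by (auto simp: tendsto_iff dist_real_def elim!: eventually_mono allE[of _ \<nu>])
  have evn: "\<nu> \<le> nrm n (orth_comp n (cm m) (others p j) (cm m j))" if "\<bar>\<beta> m\<bar> \<le> \<nu>" for m
  proof -
    have "?O (cm m j) = (\<lambda>l. ?O (c j) l + \<beta> m * ?O (unit_vec' i) l)"
      by (simp add: cm(2) orth_comp_add orth_comp_scale)
    then have "\<bar>nrm n (?O (cm m j)) - nrm n (?O (c j))\<bar> \<le> \<bar>\<beta> m\<bar> * nrm n (?O (unit_vec' i))"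
      using nrm_triangle_diff[where n=n and u="?O (cm m j)" and v="?O (c j)"] by (simp add: nrm_scale)
    also have "\<dots> \<le> \<bar>\<beta> m\<bar> * 1"
      using nrm_orth_comp_le[of n c "others p j" "unit_vec' i"] uu by (intro mult_left_mono) auto
    finally show ?thesis using that by (simp add: O' \<nu>_def)
  qed
  have stab: "\<forall>\<^sub>F m in sequentially. R m * \<nu> \<le> 3 * M * \<bar>\<beta> m\<bar>"
    using ev
  proof eventually_elim
    case (elim m)
    have "R m * \<nu> \<le> 3 * M * nrm n (\<lambda>l. \<beta> m * unit_vec' i l)"
      unfolding R_def M_def r_def rm_def
      by (rule lmin_stability[where c=c and c'="cm m" and w="\<lambda>l. \<beta> m * unit_vec' i l", OF n lam j _ _ t tm])
        (use cm \<nu> evn[OF elim] in \<open>auto simp: \<nu>_def\<close>)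
    then show ?case by (simp only: nrm_scale uu mult_1_right)
  qed
  have R: "R \<longlonglongrightarrow> 0"
  proof (rule tendsto_sandwich)
    show "\<forall>\<^sub>F m in sequentially. 0 \<le> R m" by (simp add: R_def)
    show "\<forall>\<^sub>F m in sequentially. R m \<le> 3 * M * \<bar>\<beta> m\<bar> / \<nu>"
      using stab by eventually_elim (use \<nu> in \<open>simp add: field_simps\<close>)
    have "(\<lambda>m. 3 * M * \<bar>\<beta> m\<bar> / \<nu>) \<longlonglongrightarrow> 3 * M * \<bar>0\<bar> / \<nu>" by (intro tendsto_intros \<beta>(1)) (use \<nu> in auto)
    then show "(\<lambda>m. 3 * M * \<bar>\<beta> m\<bar> / \<nu>) \<longlonglongrightarrow> 0" by simp
  qed simp
  have rl: "(\<lambda>m. rm m l) \<longlonglongrightarrow> r l" if "l < n" for l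
  proof -
    have "(\<lambda>m. rm m l - r l) \<longlonglongrightarrow> 0"
    proof (rule Lim_null_comparison[OF always_eventually R], rule allI)
      show "norm (rm m l - r l) \<le> R m" for m
        unfolding R_def real_norm_def by (rule abs_le_nrm[OF that])
    qed
    then show ?thesis by (simp add: LIM_zero_iff)
  qed
  have hb: "\<forall>\<^sub>F m in sequentially. \<bar>tm m j - \<theta> j\<bar> \<le> M / \<nu>"
    using ev
  proof eventually_elim
    case (elim m)
    have "\<bar>tm m j - \<theta> j\<bar> * \<nu> \<le> \<bar>tm m j - \<theta> j\<bar> * nrm n (orth_comp n (cm m) (others p j) (cm m j))"
      using evn[OF elim] by (intro mult_left_mono) auto
    also have "\<dots> \<le> M"
      using coef_le_nrm_lin[OF j, of "\<lambda>k. tm m k - \<theta> k" n "cm m"] lmin_bounds(2)[OF n lam tm, of m]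
      by (simp add: M_def)
    finally show ?case using \<nu> by (simp add: field_simps)
  qed
  have tk: "(\<lambda>m. tm m k) \<longlonglongrightarrow> t k" if k: "k < p" for k
  proof -
    define \<nu>k where "\<nu>k = nrm n (orth_comp n c (others p k) (c k))"
    have \<nu>k: "0 < \<nu>k" using ind k nrm_nonneg[where n=n and u="orth_comp n c (others p k) (c k)"]
      by (auto simp: indep_cols_def \<nu>k_def less_le)
    have "(\<lambda>m. tm m k - t k) \<longlonglongrightarrow> 0"
    proof (rule Lim_null_comparison)
      show "\<forall>\<^sub>F m in sequentially. norm (tm m k - t k) \<le> (R m + M / \<nu> * \<bar>\<beta> m\<bar>) / \<nu>k"
        using hb
      proof eventually_elim
        case (elim m)
        have lcc: "lin p (cm m) g l = lin p c g l + g j * (\<beta> m * unit_vec' i l)" for g l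
          by (rule lin_change_column[where c=c and c'="cm m", OF j]) (use cm in auto)
        have d: "lin p c (\<lambda>k. tm m k - t k) l = - (rm m l - r l) - (tm m j - \<theta> j) * \<beta> m * unit_vec' i l" for l
        proof -
          have "lin p c (\<lambda>k. tm m k - t k) l = lin p c (\<lambda>k. (tm m k - \<theta> k) - (t k - \<theta> k)) l" by simp
          also have "\<dots> = lin p c (\<lambda>k. tm m k - \<theta> k) l - lin p c (\<lambda>k. t k - \<theta> k) l" by (rule lin_diff)
          finally show ?thesis by (simp add: rm_def r_def lres_def lcc)
        qed
        have "\<bar>tm m k - t k\<bar> * \<nu>k \<le> nrm n (lin p c (\<lambda>k. tm m k - t k))"
          unfolding \<nu>k_def by (rule coef_le_nrm_lin[OF k])
        also have "\<dots> = nrm n (\<lambda>l. (-1) * (rm m l - r l) - ((tm m j - \<theta> j) * \<beta> m) * unit_vec' i l)"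
          by (intro nrm_cong) (simp add: d)
        also have "\<dots> \<le> nrm n (\<lambda>l. (-1) * (rm m l - r l)) + nrm n (\<lambda>l. ((tm m j - \<theta> j) * \<beta> m) * unit_vec' i l)"
          by (rule nrm_diff)
        also have "\<dots> = R m + \<bar>tm m j - \<theta> j\<bar> * \<bar>\<beta> m\<bar>"
          by (simp only: nrm_scale uu R_def) (simp add: abs_mult)
        also have "\<dots> \<le> R m + M / \<nu> * \<bar>\<beta> m\<bar>" by (intro add_left_mono mult_right_mono elim) auto
        finally show ?case using \<nu>k by (simp add: le_divide_eq)
      qed
      have "(\<lambda>m. (R m + M / \<nu> * \<bar>\<beta> m\<bar>) / \<nu>k) \<longlonglongrightarrow> (0 + M / \<nu> * \<bar>0\<bar>) / \<nu>k"
        by (intro tendsto_intros R \<beta>(1)) (use \<nu>k in auto)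
      then show "(\<lambda>m. (R m + M / \<nu> * \<bar>\<beta> m\<bar>) / \<nu>k) \<longlonglongrightarrow> 0" by simp
    qed
    then show ?thesis by (simp add: LIM_zero_iff)
  qed
  have sgk: "\<forall>\<^sub>F m in sequentially. sgn (tm m k) = sgn (t k)" if k: "k < p" for k
  proof (cases "t k = 0")
    case False
    then have "\<forall>\<^sub>F m in sequentially. dist (tm m k) (t k) < \<bar>t k\<bar>"
      using tk[OF k] by (auto simp: tendsto_iff)
    then show ?thesis
      by eventually_elim (auto simp: dist_real_def sgn_if split: if_splits)
  next
    case True
    have cl: "(\<lambda>m. cm m k l) \<longlonglongrightarrow> c k l" for l
    proof (cases "k = j")
      case True
      have "(\<lambda>m. c j l + \<beta> m * unit_vec' i l) \<longlonglongrightarrow> c j l + 0 * unit_vec' i l"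
        by (intro tendsto_intros \<beta>(1))
      with True show ?thesis by (simp add: cm)
    qed (simp add: cm)
    have "(\<lambda>m. \<bar>ip n (cm m k) (rm m)\<bar>) \<longlonglongrightarrow> \<bar>ip n (c k) r\<bar>"
      unfolding ip_def by (intro tendsto_intros cl rl) auto
    moreover have "\<bar>ip n (c k) r\<bar> < real n * lam" using strict[OF k True] by (simp add: r_def)
    ultimately have "\<forall>\<^sub>F m in sequentially. \<bar>ip n (cm m k) (rm m)\<bar> < real n * lam"
      by (rule order_tendstoD(2))
    then show ?thesis
    proof eventually_elim
      case (elim m)
      have "tm m k = 0"
      proof (rule ccontr)
        assume "tm m k \<noteq> 0"
        from lmin_subgradient_eq[OF n lam tm k this] elim
        have "\<bar>real n * lam * sgn (tm m k)\<bar> < real n * lam" by (simp add: rm_def)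
        with \<open>tm m k \<noteq> 0\<close> show False using n lam by (simp add: abs_mult abs_sgn_eq)
      qed
      with True show ?case by simp
    qed
  qed
  then have "\<forall>\<^sub>F m in sequentially. \<forall>k\<in>{..<p}. sgn (tm m k) = sgn (t k)"
    by (intro eventually_ball_finite) auto
  then have "\<forall>\<^sub>F m in sequentially. - ((tm m j - \<theta> j) * orth_comp n c (active p t) (unit_vec' i) i + rm m i * dual_col n p c t j i)
     = (rm m i - r i) / \<beta> m"
  proof eventually_elim
    case (elim m)
    have "rm m i - r i = - ((tm m j - \<theta> j) * orth_comp n c (active p t) (\<lambda>l. \<beta> m * unit_vec' i l) i +
        ip n (rm m) (\<lambda>l. \<beta> m * unit_vec' i l) * dual_col n p c t j i)"
      unfolding rm_def r_def
      by (rule lres_perturb[OF n lam j ind _ _ t tm _ i]) (use cm elim in auto)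
    also have "ip n (rm m) (\<lambda>l. \<beta> m * unit_vec' i l) = \<beta> m * rm m i"
      unfolding ip_scale_right using i by (simp only: ip_unit)
    also have "orth_comp n c (active p t) (\<lambda>l. \<beta> m * unit_vec' i l) = (\<lambda>l. \<beta> m * orth_comp n c (active p t) (unit_vec' i) l)"
      by (rule orth_comp_scale)
    finally show ?case using \<beta>(2)[of m] by (simp add: field_simps)
  qed
  moreover have "(\<lambda>m. - ((tm m j - \<theta> j) * orth_comp n c (active p t) (unit_vec' i) i + rm m i * dual_col n p c t j i)) \<longlonglongrightarrow>
     - ((t j - \<theta> j) * orth_comp n c (active p t) (unit_vec' i) i + r i * dual_col n p c t j i)"
    by (intro tendsto_intros tk[OF j] rl[OF i])
  ultimately have "(\<lambda>m. (rm m i - r i) / \<beta> m) \<longlonglongrightarrow>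
     - ((t j - \<theta> j) * orth_comp n c (active p t) (unit_vec' i) i + r i * dual_col n p c t j i)"
    by (rule Lim_transform_eventually[rotated])
  then show ?thesis by (simp add: rm_def r_def)
qed

subsection \<open>Product law of the data\<close>

definition quad_form :: "nat \<Rightarrow> (nat \<Rightarrow> nat \<Rightarrow> real) \<Rightarrow> (nat \<Rightarrow> real) \<Rightarrow> real" where
  "quad_form p P v = (\<Sum>k<p. \<Sum>l<p. v k * P k l * v l)"

text \<open>\<open>K\<close> stays abstract: the Gaussian integral is never evaluated. Total mass 1
  is assumed in the locale below and later read off from the law of the data.\<close>

definition row_law :: "nat \<Rightarrow> (nat \<Rightarrow> nat \<Rightarrow> real) \<Rightarrow> real \<Rightarrow> (nat \<Rightarrow> real) measure" where
  "row_law p P K = density (Pi\<^sub>M {..<p} (\<lambda>_. lborel)) (\<lambda>v. ennreal (K * exp (- quad_form p P v / 2)))"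

definition noise_law :: "real \<Rightarrow> real measure" where
  "noise_law s = density lborel (\<lambda>x. ennreal (normal_density 0 s x))"

definition data_law :: "nat \<Rightarrow> nat \<Rightarrow> (nat \<Rightarrow> nat \<Rightarrow> real) \<Rightarrow> real \<Rightarrow> real \<Rightarrow> (nat \<Rightarrow> (nat \<Rightarrow> real) \<times> real) measure" where
  "data_law n p P K s = Pi\<^sub>M {..<n} (\<lambda>_. row_law p P K \<Otimes>\<^sub>M noise_law s)"

lemma quad_form_shift:
  assumes j: "j < p" and sym: "\<And>k l. k < p \<Longrightarrow> l < p \<Longrightarrow> P k l = P l k"
  shows "quad_form p P (v(j := v j + a)) = quad_form p P v + 2 * a * (\<Sum>k<p. P j k * v k) + a\<^sup>2 * P j j"
proof -
  have e: "(v(j := v j + a)) k = v k + (if k = j then a else 0)" for k by simp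
  have "quad_form p P (v(j := v j + a)) =
     (\<Sum>k<p. \<Sum>l<p. v k * P k l * v l + v k * P k l * (if l = j then a else 0)
        + (if k = j then a else 0) * P k l * v l + (if k = j then a else 0) * P k l * (if l = j then a else 0))"
    unfolding quad_form_def e by (intro sum.cong refl) (simp add: algebra_simps)
  also have "\<dots> = quad_form p P v + (\<Sum>k<p. \<Sum>l<p. v k * P k l * (if l = j then a else 0))
       + (\<Sum>k<p. \<Sum>l<p. (if k = j then a else 0) * P k l * v l)
       + (\<Sum>k<p. \<Sum>l<p. (if k = j then a else 0) * P k l * (if l = j then a else 0))"
    by (simp add: quad_form_def sum.distrib)
  also have "(\<Sum>k<p. \<Sum>l<p. v k * P k l * (if l = j then a else 0)) = a * (\<Sum>k<p. P j k * v k)"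
  proof -
    have "(\<Sum>l<p. v k * P k l * (if l = j then a else 0)) = a * (P j k * v k)" if "k < p" for k
    proof -
      have "(\<Sum>l<p. v k * P k l * (if l = j then a else 0)) = (\<Sum>l<p. if l = j then v k * P k l * a else 0)"
        by (rule sum.cong) auto
      then show ?thesis using j sym[OF that j] by simp
    qed
    then show ?thesis by (simp add: sum_distrib_left)
  qed
  also have "(\<Sum>k<p. \<Sum>l<p. (if k = j then a else 0) * P k l * v l) = a * (\<Sum>k<p. P j k * v k)"
  proof -
    have "(\<Sum>k<p. \<Sum>l<p. (if k = j then a else 0) * P k l * v l) = (\<Sum>k<p. if k = j then (\<Sum>l<p. a * P k l * v l) else 0)"
      by (rule sum.cong) auto
    then show ?thesis using j by (simp add: sum_distrib_left mult.assoc)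
  qed
  also have "(\<Sum>k<p. \<Sum>l<p. (if k = j then a else 0) * P k l * (if l = j then a else 0)) = a\<^sup>2 * P j j"
  proof -
    have inner: "(\<Sum>l<p. b * P k l * (if l = j then a else 0)) = b * P k j * a" for b k
    proof -
      have "(\<Sum>l<p. b * P k l * (if l = j then a else 0)) = (\<Sum>l<p. if l = j then b * P k l * a else 0)"
        by (rule sum.cong) auto
      then show ?thesis using j by simp
    qed
    have "(\<Sum>k<p. (if k = j then a else 0) * P k j * a) = (\<Sum>k<p. if k = j then a * P k j * a else 0)"
      by (rule sum.cong) auto
    then show ?thesis unfolding inner using j by (simp add: power2_eq_square)
  qed
  finally have "quad_form p P (v(j := v j + a)) = quad_form p P v + a * (\<Sum>k<p. P j k * v k) +
     a * (\<Sum>k<p. P j k * v k) + a\<^sup>2 * P j j" .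
  then show ?thesis by (rule trans) simp
qed

lemma sets_row_law [measurable_cong]: "sets (row_law p P K) = sets (Pi\<^sub>M {..<p} (\<lambda>_. lborel))"
  by (simp add: row_law_def)

lemma sets_noise_law [measurable_cong]: "sets (noise_law s) = sets borel"
  by (simp add: noise_law_def)

lemma space_row_law: "space (row_law p P K) = space (Pi\<^sub>M {..<p} (\<lambda>_. lborel))"
  by (simp add: row_law_def)

lemma space_noise_law [simp]: "space (noise_law s) = UNIV"
  by (simp add: noise_law_def)

lemma sets_data_law: "sets (data_law n p P K s) = sets (Pi\<^sub>M {..<n} (\<lambda>_. Pi\<^sub>M {..<p} (\<lambda>_. borel) \<Otimes>\<^sub>M borel))"
  unfolding data_law_def by (intro sets_PiM_cong sets_pair_measure_cong) (auto simp: sets_row_law sets_noise_law intro!: sets_PiM_cong)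

lemma data_law_measurable_row:
  "i < n \<Longrightarrow> (\<lambda>x. x i) \<in> measurable (data_law n p P K s) (row_law p P K \<Otimes>\<^sub>M noise_law s)"
  unfolding data_law_def by (rule measurable_component_singleton) simp

lemma data_law_measurable_col [measurable]:
  assumes "i < n" "k < p"
  shows "(\<lambda>x. fst (x i) k) \<in> borel_measurable (data_law n p P K s)"
proof -
  have "(\<lambda>v. v k) \<in> measurable (row_law p P K) lborel"
    unfolding measurable_cong_sets[OF sets_row_law refl] using assms by (intro measurable_component_singleton) simp
  then have "(\<lambda>v. v k) \<in> borel_measurable (row_law p P K)" by simp
  then show ?thesis
    by (rule measurable_compose[OF measurable_compose[OF data_law_measurable_row[OF assms(1)] measurable_fst]])
qed

lemma data_law_measurable_noise [measurable]:
  assumes "i < n"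
  shows "(\<lambda>x. snd (x i)) \<in> borel_measurable (data_law n p P K s)"
proof -
  have "(\<lambda>x. snd (x i)) \<in> measurable (data_law n p P K s) (noise_law s)"
    using data_law_measurable_row[OF assms] by (rule measurable_compose[OF _ measurable_snd])
  then show ?thesis by (simp add: measurable_cong_sets[OF refl sets_noise_law])
qed

lemma lborel_PiM_sigma_finite: "product_sigma_finite (\<lambda>_::nat. lborel :: real measure)"
  by (rule product_sigma_finite.intro) (rule sigma_finite_lborel)

text \<open>Puts one coordinate innermost, where Lebesgue measure is invariant under translations
  and ignores single points.\<close>

lemma nn_integral_row_split:
  assumes k: "k < p" and f: "f \<in> borel_measurable (row_law p P K)"
  shows "(\<integral>\<^sup>+v. f v \<partial>row_law p P K) =
    (\<integral>\<^sup>+v. (\<integral>\<^sup>+t. ennreal (K * exp (- quad_form p P (v(k := t)) / 2)) * f (v(k := t)) \<partial>lborel) \<partial>Pi\<^sub>M ({..<p} - {k}) (\<lambda>_. lborel))"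
proof -
  interpret product_sigma_finite "\<lambda>_::nat. lborel :: real measure" by (rule lborel_PiM_sigma_finite)
  have I: "insert k ({..<p} - {k}) = {..<p}" using k by auto
  have q: "quad_form p P \<in> borel_measurable (Pi\<^sub>M {..<p} (\<lambda>_. lborel))"
    unfolding quad_form_def[abs_def] by measurable
  have fm: "f \<in> borel_measurable (Pi\<^sub>M {..<p} (\<lambda>_. lborel))"
    using f by (simp add: measurable_cong_sets[OF sets_row_law refl])
  note [measurable] = q fm
  have "(\<integral>\<^sup>+v. f v \<partial>row_law p P K) =
      (\<integral>\<^sup>+v. ennreal (K * exp (- quad_form p P v / 2)) * f v \<partial>Pi\<^sub>M {..<p} (\<lambda>_. lborel))"
    unfolding row_law_def by (rule nn_integral_density) measurable
  also have "\<dots> = (\<integral>\<^sup>+v. ennreal (K * exp (- quad_form p P v / 2)) * f v \<partial>Pi\<^sub>M (insert k ({..<p} - {k})) (\<lambda>_. lborel))"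
    by (simp only: I)
  also have "\<dots> = (\<integral>\<^sup>+v. (\<integral>\<^sup>+t. ennreal (K * exp (- quad_form p P (v(k := t)) / 2)) * f (v(k := t)) \<partial>lborel) \<partial>Pi\<^sub>M ({..<p} - {k}) (\<lambda>_. lborel))"
    by (rule product_nn_integral_insert) (simp, simp, unfold I, measurable)
  finally show ?thesis .
qed

text \<open>The weight is the quotient of the Gaussian densities at the shifted and the original
  point, so the claim reduces to translation invariance in coordinate \<open>j\<close>.\<close>

lemma row_law_cameron_martin:
  assumes j: "j < p" and sym: "\<And>k l. k < p \<Longrightarrow> l < p \<Longrightarrow> P k l = P l k"
    and f: "f \<in> borel_measurable (row_law p P K)"
  shows "(\<integral>\<^sup>+v. f (v(j := v j + a)) * ennreal (exp (- a * (\<Sum>k<p. P j k * v k) - a\<^sup>2 * P j j / 2)) \<partial>row_law p P K)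
     = (\<integral>\<^sup>+v. f v \<partial>row_law p P K)"
proof -
  have fm: "f \<in> borel_measurable (Pi\<^sub>M {..<p} (\<lambda>_. lborel))"
    using f by (simp add: measurable_cong_sets[OF sets_row_law refl])
  note [measurable] = fm
  have sh: "(\<lambda>v. v(j := v j + a)) \<in> measurable (Pi\<^sub>M {..<p} (\<lambda>_. lborel :: real measure)) (Pi\<^sub>M {..<p} (\<lambda>_. lborel))"
    using j by (intro measurable_fun_upd[where J="{..<p}"]) (auto intro!: measurable_compose[OF _ borel_measurable_add])
  note [measurable] = sh
  let ?d = "\<lambda>v. ennreal (K * exp (- quad_form p P v / 2))"
  let ?w = "\<lambda>v. ennreal (exp (- a * (\<Sum>k<p. P j k * v k) - a\<^sup>2 * P j j / 2))"
  have dw: "?d v * (f (v(j := v j + a)) * ?w v) = ?d (v(j := v j + a)) * f (v(j := v j + a))" for v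
  proof -
    have "?d v * ?w v = ennreal (K * exp (- quad_form p P v / 2) * exp (- a * (\<Sum>k<p. P j k * v k) - a\<^sup>2 * P j j / 2))"
      by (simp add: ennreal_mult'')
    also have "K * exp (- quad_form p P v / 2) * exp (- a * (\<Sum>k<p. P j k * v k) - a\<^sup>2 * P j j / 2) =
        K * exp (- quad_form p P (v(j := v j + a)) / 2)"
    proof -
      have q: "quad_form p P (v(j := v j + a)) = quad_form p P v + 2 * a * (\<Sum>k<p. P j k * v k) + a\<^sup>2 * P j j"
        by (rule quad_form_shift[OF j sym])
      have "- quad_form p P (v(j := v j + a)) / 2 = - quad_form p P v / 2 + (- a * (\<Sum>k<p. P j k * v k) - a\<^sup>2 * P j j / 2)"
        unfolding q by (simp add: field_simps)
      then show ?thesis by (simp only: exp_add mult.assoc)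
    qed
    finally show ?thesis by (simp add: mult_ac)
  qed
  have "(\<integral>\<^sup>+v. f (v(j := v j + a)) * ?w v \<partial>row_law p P K) =
    (\<integral>\<^sup>+v. (\<integral>\<^sup>+t. ?d (v(j := t)) * (f ((v(j := t))(j := (v(j := t)) j + a)) * ?w (v(j := t))) \<partial>lborel) \<partial>Pi\<^sub>M ({..<p} - {j}) (\<lambda>_. lborel))"
    by (rule nn_integral_row_split[OF j]) measurable
  also have "\<dots> = (\<integral>\<^sup>+v. (\<integral>\<^sup>+t. ?d (v(j := t)) * f (v(j := t)) \<partial>lborel) \<partial>Pi\<^sub>M ({..<p} - {j}) (\<lambda>_. lborel))"
  proof (rule nn_integral_cong)
    fix v assume v: "v \<in> space (Pi\<^sub>M ({..<p} - {j}) (\<lambda>_. lborel :: real measure))"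
    have up: "(\<lambda>t. v(j := t)) \<in> measurable lborel (Pi\<^sub>M {..<p} (\<lambda>_. lborel))"
      using j v by (intro measurable_fun_upd[where J="{..<p} - {j}"]) (auto simp: insert_absorb)
    have q: "quad_form p P \<in> borel_measurable (Pi\<^sub>M {..<p} (\<lambda>_. lborel))"
      unfolding quad_form_def[abs_def] by measurable
    note [measurable] = up q
    have "(\<integral>\<^sup>+t. ?d (v(j := t)) * (f ((v(j := t))(j := (v(j := t)) j + a)) * ?w (v(j := t))) \<partial>lborel) =
        (\<integral>\<^sup>+t. ?d (v(j := a + 1 * t)) * f (v(j := a + 1 * t)) \<partial>lborel)"
      unfolding dw by (simp add: add.commute)
    also have "\<dots> = (\<integral>\<^sup>+t. ?d (v(j := t)) * f (v(j := t)) \<partial>lborel)"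
    proof -
      have gm: "(\<lambda>t. ?d (v(j := t)) * f (v(j := t))) \<in> borel_measurable lborel" by measurable
      show ?thesis
        using nn_integral_real_affine[of "\<lambda>t. ?d (v(j := t)) * f (v(j := t))" 1 a] gm by simp
    qed
    finally show "(\<integral>\<^sup>+t. ?d (v(j := t)) * (f ((v(j := t))(j := (v(j := t)) j + a)) * ?w (v(j := t))) \<partial>lborel) =
       (\<integral>\<^sup>+t. ?d (v(j := t)) * f (v(j := t)) \<partial>lborel)" .
  qed
  also have "\<dots> = (\<integral>\<^sup>+v. f v \<partial>row_law p P K)" by (rule nn_integral_row_split[OF j f, symmetric])
  finally show ?thesis .
qed

section \<open>Fubini and null sets for the data law\<close>

locale gaussian_data_law =
  fixes n p :: nat and P :: "nat \<Rightarrow> nat \<Rightarrow> real" and K s :: real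
  assumes prob_row: "prob_space (row_law p P K)" and s: "0 < s"
begin

abbreviation "\<rho> \<equiv> row_law p P K \<Otimes>\<^sub>M noise_law s"
abbreviation "\<mu> \<equiv> data_law n p P K s"

lemma prob_noise: "prob_space (noise_law s)"
  unfolding noise_law_def using s by (rule prob_space_normal_density)

lemma prob_\<rho>: "prob_space \<rho>"
  by (intro prob_space_pair prob_row prob_noise)

lemma prob_\<mu>: "prob_space \<mu>"
  unfolding data_law_def by (rule prob_space_PiM) (rule prob_\<rho>)

lemma nn_integral_data_split:
  assumes i: "i < n" and f: "f \<in> borel_measurable \<mu>"
  shows "(\<integral>\<^sup>+x. f x \<partial>\<mu>) = (\<integral>\<^sup>+x. (\<integral>\<^sup>+y. f (x(i := y)) \<partial>\<rho>) \<partial>Pi\<^sub>M ({..<n} - {i}) (\<lambda>_. \<rho>))"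
proof -
  interpret product_prob_space "\<lambda>_::nat. \<rho>"
    by (rule product_prob_spaceI) (rule prob_\<rho>)
  have I: "insert i ({..<n} - {i}) = {..<n}" using i by auto
  show ?thesis
    using product_nn_integral_insert[of "{..<n} - {i}" i f] f
    unfolding I data_law_def by simp
qed

lemma data_upd_measurable:
  assumes "i < n" "x \<in> space (Pi\<^sub>M ({..<n} - {i}) (\<lambda>_. \<rho>))"
  shows "(\<lambda>y. x(i := y)) \<in> measurable \<rho> \<mu>"
  unfolding data_law_def using assms
  by (intro measurable_fun_upd[where J="{..<n} - {i}"]) (auto simp: insert_absorb)

lemma nn_integral_\<rho>:
  assumes f: "f \<in> borel_measurable \<rho>"
  shows "(\<integral>\<^sup>+y. f y \<partial>\<rho>) = (\<integral>\<^sup>+e. (\<integral>\<^sup>+v. f (v, e) \<partial>row_law p P K) \<partial>noise_law s)"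
    and "(\<integral>\<^sup>+y. f y \<partial>\<rho>) = (\<integral>\<^sup>+v. (\<integral>\<^sup>+e. f (v, e) \<partial>noise_law s) \<partial>row_law p P K)"
proof -
  interpret a: prob_space "row_law p P K" by (rule prob_row)
  interpret b: prob_space "noise_law s" by (rule prob_noise)
  interpret pair_prob_space "row_law p P K" "noise_law s" ..
  show "(\<integral>\<^sup>+y. f y \<partial>\<rho>) = (\<integral>\<^sup>+e. (\<integral>\<^sup>+v. f (v, e) \<partial>row_law p P K) \<partial>noise_law s)"
    using nn_integral_snd[OF f] by simp
  show "(\<integral>\<^sup>+y. f y \<partial>\<rho>) = (\<integral>\<^sup>+v. (\<integral>\<^sup>+e. f (v, e) \<partial>noise_law s) \<partial>row_law p P K)"
    using b.nn_integral_fst[OF f] by simp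
qed

text \<open>By Fubini, since every line in the noise direction \<open>i\<close> meets the set in at
  most one point and the normal law has no atoms.\<close>

lemma null_noise_slices:
  assumes A: "A \<in> sets \<mu>" and i: "i < n"
    and one: "\<And>x e e'. x \<in> space \<mu> \<Longrightarrow> x(i := (fst (x i), e)) \<in> A \<Longrightarrow> x(i := (fst (x i), e')) \<in> A \<Longrightarrow> e = e'"
  shows "A \<in> null_sets \<mu>"
proof -
  have "emeasure \<mu> A = (\<integral>\<^sup>+x. indicator A x \<partial>\<mu>)" using A by simp
  also have "\<dots> = (\<integral>\<^sup>+x. (\<integral>\<^sup>+y. indicator A (x(i := y)) \<partial>\<rho>) \<partial>Pi\<^sub>M ({..<n} - {i}) (\<lambda>_. \<rho>))"
    using A by (intro nn_integral_data_split[OF i]) auto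
  also have "\<dots> = (\<integral>\<^sup>+x. 0 \<partial>Pi\<^sub>M ({..<n} - {i}) (\<lambda>_. \<rho>))"
  proof (rule nn_integral_cong)
    fix x assume x: "x \<in> space (Pi\<^sub>M ({..<n} - {i}) (\<lambda>_. \<rho>))"
    note up = data_upd_measurable[OF i x]
    have "(\<integral>\<^sup>+y. indicator A (x(i := y)) \<partial>\<rho>) =
      (\<integral>\<^sup>+v. (\<integral>\<^sup>+e. indicator A (x(i := (v, e))) \<partial>noise_law s) \<partial>row_law p P K)"
      using A up by (intro nn_integral_\<rho>(2)) (auto intro: measurable_compose)
    also have "\<dots> = (\<integral>\<^sup>+v. 0 \<partial>row_law p P K)"
    proof (rule nn_integral_cong)
      fix v assume v: "v \<in> space (row_law p P K)"
      have sp: "x(i := (v, e)) \<in> space \<mu>" for e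
        using measurable_space[OF up, of "(v, e)"] v by (simp add: space_pair_measure)
      have "AE e in lborel. x(i := (v, e)) \<notin> A"
      proof (cases "\<exists>e. x(i := (v, e)) \<in> A")
        case True
        then obtain e0 where e0: "x(i := (v, e0)) \<in> A" ..
        have "e = e0" if "x(i := (v, e)) \<in> A" for e
          using one[OF sp, of e e e0] that e0 by simp
        then show ?thesis using AE_lborel_singleton[of e0] by (auto elim: eventually_mono)
      qed simp
      then have "AE e in noise_law s. x(i := (v, e)) \<notin> A"
        unfolding noise_law_def by (subst AE_density) (auto elim: eventually_mono)
      then have "(\<integral>\<^sup>+e. indicator A (x(i := (v, e))) \<partial>noise_law s) = (\<integral>\<^sup>+e. 0 \<partial>noise_law s)"
        by (intro nn_integral_cong_AE) (auto elim: eventually_mono)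
      then show "(\<integral>\<^sup>+e. indicator A (x(i := (v, e))) \<partial>noise_law s) = 0" by simp
    qed
    finally show "(\<integral>\<^sup>+y. indicator A (x(i := y)) \<partial>\<rho>) = 0" by simp
  qed
  finally show ?thesis using A by auto
qed

text \<open>The same along one entry of the design, with the row density in place of the normal
  one.\<close>

lemma null_column_slices:
  assumes A: "A \<in> sets \<mu>" and i: "i < n" and k: "k < p"
    and one: "\<And>x t t'. x \<in> space \<mu> \<Longrightarrow> x(i := ((fst (x i))(k := t), snd (x i))) \<in> A \<Longrightarrow>
       x(i := ((fst (x i))(k := t'), snd (x i))) \<in> A \<Longrightarrow> t = t'"
  shows "A \<in> null_sets \<mu>"
proof -
  have "emeasure \<mu> A = (\<integral>\<^sup>+x. indicator A x \<partial>\<mu>)" using A by simp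
  also have "\<dots> = (\<integral>\<^sup>+x. (\<integral>\<^sup>+y. indicator A (x(i := y)) \<partial>\<rho>) \<partial>Pi\<^sub>M ({..<n} - {i}) (\<lambda>_. \<rho>))"
    using A by (intro nn_integral_data_split[OF i]) auto
  also have "\<dots> = (\<integral>\<^sup>+x. 0 \<partial>Pi\<^sub>M ({..<n} - {i}) (\<lambda>_. \<rho>))"
  proof (rule nn_integral_cong)
    fix x assume x: "x \<in> space (Pi\<^sub>M ({..<n} - {i}) (\<lambda>_. \<rho>))"
    note up = data_upd_measurable[OF i x]
    have fm: "(\<lambda>y. indicator A (x(i := y)) :: ennreal) \<in> borel_measurable \<rho>"
      using A up by (auto intro: measurable_compose)
    have "(\<integral>\<^sup>+y. indicator A (x(i := y)) \<partial>\<rho>) =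
      (\<integral>\<^sup>+e. (\<integral>\<^sup>+v. indicator A (x(i := (v, e))) \<partial>row_law p P K) \<partial>noise_law s)"
      by (rule nn_integral_\<rho>(1)[OF fm])
    also have "\<dots> = (\<integral>\<^sup>+e. 0 \<partial>noise_law s)"
    proof (rule nn_integral_cong)
      fix e
      have "(\<integral>\<^sup>+v. indicator A (x(i := (v, e))) \<partial>row_law p P K) =
        (\<integral>\<^sup>+v. (\<integral>\<^sup>+t. ennreal (K * exp (- quad_form p P (v(k := t)) / 2)) * indicator A (x(i := (v(k := t), e))) \<partial>lborel)
           \<partial>Pi\<^sub>M ({..<p} - {k}) (\<lambda>_. lborel))"
      proof (rule nn_integral_row_split[OF k])
        have "(\<lambda>v. (v, e)) \<in> measurable (row_law p P K) \<rho>" by (rule measurable_Pair2') simp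
        from measurable_compose[OF this fm] show "(\<lambda>v. indicator A (x(i := (v, e))) :: ennreal) \<in> borel_measurable (row_law p P K)" .
      qed
      also have "\<dots> = (\<integral>\<^sup>+v. 0 \<partial>Pi\<^sub>M ({..<p} - {k}) (\<lambda>_. lborel :: real measure))"
      proof (rule nn_integral_cong)
        fix v assume v: "v \<in> space (Pi\<^sub>M ({..<p} - {k}) (\<lambda>_. lborel :: real measure))"
        have vs: "v(k := t) \<in> space (row_law p P K)" for t
          using v k by (auto simp: space_row_law space_PiM PiE_def extensional_def)
        have sp: "x(i := (v(k := t), e)) \<in> space \<mu>" for t
          using measurable_space[OF up, of "(v(k := t), e)"] vs by (simp add: space_pair_measure)
        have "AE t in lborel. x(i := (v(k := t), e)) \<notin> A"
        proof (cases "\<exists>t. x(i := (v(k := t), e)) \<in> A")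
          case True
          then obtain t0 where t0: "x(i := (v(k := t0), e)) \<in> A" ..
          have "t = t0" if "x(i := (v(k := t), e)) \<in> A" for t
            using one[OF sp, of t t t0] that t0 by simp
          then show ?thesis using AE_lborel_singleton[of t0] by (auto elim: eventually_mono)
        qed simp
        then have "(\<integral>\<^sup>+t. ennreal (K * exp (- quad_form p P (v(k := t)) / 2)) * indicator A (x(i := (v(k := t), e))) \<partial>lborel) = (\<integral>\<^sup>+t. 0 \<partial>(lborel :: real measure))"
          by (intro nn_integral_cong_AE) (auto elim: eventually_mono)
        then show "(\<integral>\<^sup>+t. ennreal (K * exp (- quad_form p P (v(k := t)) / 2)) * indicator A (x(i := (v(k := t), e))) \<partial>lborel) = 0"
          by simp
      qed
      finally show "(\<integral>\<^sup>+v. indicator A (x(i := (v, e))) \<partial>row_law p P K) = 0" by simp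
    qed
    finally show "(\<integral>\<^sup>+y. indicator A (x(i := y)) \<partial>\<rho>) = 0" by simp
  qed
  finally show ?thesis using A by auto
qed

end

subsection \<open>Measurability and almost sure regularity of the Lasso\<close>

definition dcol :: "(nat \<Rightarrow> (nat \<Rightarrow> real) \<times> real) \<Rightarrow> nat \<Rightarrow> nat \<Rightarrow> real" where
  "dcol x k i = fst (x i) k"

definition noise :: "(nat \<Rightarrow> (nat \<Rightarrow> real) \<times> real) \<Rightarrow> nat \<Rightarrow> real" where
  "noise x i = snd (x i)"

lemma ip_measurable:
  assumes "\<And>i. i < n \<Longrightarrow> (\<lambda>x. u x i) \<in> borel_measurable M" "\<And>i. i < n \<Longrightarrow> (\<lambda>x. v x i) \<in> borel_measurable M"
  shows "(\<lambda>x. ip n (u x) (v x)) \<in> borel_measurable M"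
  unfolding ip_def using assms by (intro borel_measurable_sum borel_measurable_times) auto

lemma nrm_measurable:
  assumes "\<And>i. i < n \<Longrightarrow> (\<lambda>x. u x i) \<in> borel_measurable M"
  shows "(\<lambda>x. nrm n (u x)) \<in> borel_measurable M"
proof -
  have "(\<lambda>x. sqrt (ip n (u x) (u x))) \<in> borel_measurable M" by (measurable; intro ip_measurable assms)
  moreover have "sqrt (ip n (u x) (u x)) = nrm n (u x)" for x by (simp add: nrm_sq[symmetric])
  ultimately show ?thesis by simp
qed

lemma orth_comp_measurable:
  assumes c: "\<And>k i. k \<in> set ks \<Longrightarrow> i < n \<Longrightarrow> (\<lambda>x. c x k i) \<in> borel_measurable M"
    and v: "\<And>i. i < n \<Longrightarrow> (\<lambda>x. v x i) \<in> borel_measurable M" and i: "i < n"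
  shows "(\<lambda>x. orth_comp n (c x) ks (v x) i) \<in> borel_measurable M"
  using c v i
proof (induction ks arbitrary: v i)
  case (Cons k ks)
  have y: "(\<lambda>x. orth_comp n (c x) ks (c x k) i) \<in> borel_measurable M" if "i < n" for i
    using Cons.prems(1) that by (intro Cons.IH) auto
  have "(\<lambda>x. orth_comp n (c x) ks (v x) i) \<in> borel_measurable M"
    using Cons.prems by (intro Cons.IH) auto
  then show ?case
    using Cons.prems(2,3) y
    by (auto intro!: borel_measurable_diff borel_measurable_times borel_measurable_divide ip_measurable)
qed simp

lemma lin_measurable:
  assumes "\<And>k. k < p \<Longrightarrow> (\<lambda>x. c x k i) \<in> borel_measurable M" "\<And>k. k < p \<Longrightarrow> (\<lambda>x. h x k) \<in> borel_measurable M"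
  shows "(\<lambda>x. lin p (c x) (h x) i) \<in> borel_measurable M"
  unfolding lin_def using assms by (intro borel_measurable_sum borel_measurable_times) auto

lemma lres_measurable:
  assumes "\<And>k. k < p \<Longrightarrow> (\<lambda>x. c x k i) \<in> borel_measurable M" "\<And>k. k < p \<Longrightarrow> (\<lambda>x. t x k) \<in> borel_measurable M"
    "(\<lambda>x. \<xi> x i) \<in> borel_measurable M"
  shows "(\<lambda>x. lres p (c x) (\<xi> x) \<theta> (t x) i) \<in> borel_measurable M"
  unfolding lres_def using assms by (intro borel_measurable_diff lin_measurable) auto

lemma lobj_measurable:
  assumes "\<And>k i. k < p \<Longrightarrow> i < n \<Longrightarrow> (\<lambda>x. c x k i) \<in> borel_measurable M"
    "\<And>i. i < n \<Longrightarrow> (\<lambda>x. \<xi> x i) \<in> borel_measurable M"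
  shows "(\<lambda>x. lobj n p lam (c x) (\<xi> x) \<theta> t) \<in> borel_measurable M"
proof -
  have "(\<lambda>x. ip n (lres p (c x) (\<xi> x) \<theta> t) (lres p (c x) (\<xi> x) \<theta> t)) \<in> borel_measurable M"
    using assms by (intro ip_measurable lres_measurable[where t = "\<lambda>_. t"]) auto
  then show ?thesis unfolding lobj_def by measurable
qed

text \<open>A countable family, dense in the first \<open>p\<close> coordinates, that reduces
  minimality to countably many comparisons.\<close>

definition rat_vec :: "rat list \<Rightarrow> nat \<Rightarrow> real" where
  "rat_vec l k = (if k < length l then of_rat (l ! k) else 0)"

text \<open>Approximation from above, so that \<open>a \<le> t k\<close> passes to the approximating
  vectors.\<close>

lemma rat_vec_approx:
  fixes t :: "nat \<Rightarrow> real"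
  obtains L where "\<And>m k. k < p \<Longrightarrow> t k \<le> rat_vec (L m) k" "\<And>k. k < p \<Longrightarrow> (\<lambda>m. rat_vec (L m) k) \<longlonglongrightarrow> t k"
proof -
  have "\<exists>q. t k < of_rat q \<and> of_rat q < t k + 1 / real (Suc m)" for k m
    using of_rat_dense[of "t k" "t k + 1 / real (Suc m)"] by auto
  then obtain q where q: "\<And>k m. t k < of_rat (q k m)" "\<And>k m. of_rat (q k m) < t k + 1 / real (Suc m)" by metis
  define L where "L = (\<lambda>m. map (\<lambda>k. q k m) [0..<p])"
  have L: "rat_vec (L m) k = of_rat (q k m)" if "k < p" for m k
    using that by (simp add: rat_vec_def L_def)
  show thesis
  proof (rule that)
    show "t k \<le> rat_vec (L m) k" if "k < p" for m k using q(1)[of k m] by (simp add: L[OF that])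
    show "(\<lambda>m. rat_vec (L m) k) \<longlonglongrightarrow> t k" if k: "k < p" for k
    proof (rule tendsto_sandwich)
      show "\<forall>\<^sub>F m in sequentially. t k \<le> rat_vec (L m) k" using q(1) by (simp add: L[OF k] less_imp_le)
      show "\<forall>\<^sub>F m in sequentially. rat_vec (L m) k \<le> t k + 1 / real (Suc m)"
        using q(2) by (auto simp: L[OF k] less_imp_le simp del: of_nat_Suc intro!: always_eventually)
      have "(\<lambda>m. t k + 1 / real (Suc m)) \<longlonglongrightarrow> t k + 0"
        using LIMSEQ_inverse_real_of_nat by (intro tendsto_intros) (simp add: inverse_eq_divide)
      then show "(\<lambda>m. t k + 1 / real (Suc m)) \<longlonglongrightarrow> t k" by simp
    qed simp
  qed
qed

lemma lobj_tendsto: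
  assumes n: "0 < n" and t: "\<And>k. k < p \<Longrightarrow> (\<lambda>m. tm m k) \<longlonglongrightarrow> t k"
  shows "(\<lambda>m. lobj n p lam c \<xi> \<theta> (tm m)) \<longlonglongrightarrow> lobj n p lam c \<xi> \<theta> t"
  unfolding lobj_def ip_def lres_def lin_def l1_def
  by (intro tendsto_intros t) (use n in auto)

text \<open>Describes the minimizer through countably many values of the objective, whence its
  measurability. If \<open>t k < a\<close>, strong convexity separates the minimum from all values
  with \<open>a \<le> t' k\<close>; if \<open>a \<le> t k\<close>, rational vectors above
  \<open>t\<close> come arbitrarily close to the minimum and exclude any gap.\<close>

lemma lmin_less_iff:
  assumes n: "0 < n" and lam: "0 < lam" and ind: "indep_cols n p c" and t: "lmin n p lam c \<xi> \<theta> t" and k: "k < p"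
  shows "t k < a \<longleftrightarrow> (\<exists>l m. \<forall>l'. a \<le> rat_vec l' k \<longrightarrow>
     lobj n p lam c \<xi> \<theta> (rat_vec l) + 1 / real (Suc m) \<le> lobj n p lam c \<xi> \<theta> (rat_vec l'))"
proof
  let ?F = "lobj n p lam c \<xi> \<theta>"
  obtain L where L: "\<And>m k. k < p \<Longrightarrow> t k \<le> rat_vec (L m) k" "\<And>k. k < p \<Longrightarrow> (\<lambda>m. rat_vec (L m) k) \<longlonglongrightarrow> t k"
    using rat_vec_approx[of p t] by blast
  have FL: "(\<lambda>m. ?F (rat_vec (L m))) \<longlonglongrightarrow> ?F t" by (rule lobj_tendsto[OF n L(2)])
  {
    assume a: "t k < a"
    define \<nu> where "\<nu> = nrm n (orth_comp n c (others p k) (c k))"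
    have \<nu>: "0 < \<nu>" using ind k nrm_nonneg[where n=n and u="orth_comp n c (others p k) (c k)"]
      by (auto simp: indep_cols_def \<nu>_def less_le)
    \<comment> \<open>Moving coefficient \<open>k\<close> by at least \<open>a - t k\<close> moves
      the fitted values by at least \<open>(a - t k) * \<nu>\<close>.\<close>
    define \<gamma> where "\<gamma> = ((a - t k) * \<nu>)\<^sup>2 / (2 * real n)"
    have g: "0 < \<gamma>" using a \<nu> n by (simp add: \<gamma>_def)
    have gap: "?F t + \<gamma> \<le> ?F t'" if "a \<le> t' k" for t'
    proof -
      have "(a - t k) * \<nu> \<le> \<bar>t' k - t k\<bar> * \<nu>" using that a \<nu> by (intro mult_right_mono) auto
      also have "\<dots> \<le> nrm n (lin p c (\<lambda>k. t' k - t k))"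
        unfolding \<nu>_def by (rule coef_le_nrm_lin[OF k, of "\<lambda>k. t' k - t k"])
      finally have "((a - t k) * \<nu>)\<^sup>2 \<le> (nrm n (lin p c (\<lambda>k. t' k - t k)))\<^sup>2"
        using a \<nu> by (intro power_mono) auto
      then have "\<gamma> \<le> (nrm n (lin p c (\<lambda>k. t' k - t k)))\<^sup>2 / (2 * real n)"
        unfolding \<gamma>_def by (intro divide_right_mono) auto
      then show ?thesis using lmin_strong_convexity[OF n lam t, of t'] by linarith
    qed
    obtain m where m: "1 / real (Suc m) < \<gamma> / 2" using g nat_approx_posE[of "\<gamma> / 2"] by (metis half_gt_zero)
    have "\<forall>\<^sub>F m in sequentially. ?F (rat_vec (L m)) < ?F t + \<gamma> / 2"
      using FL by (rule order_tendstoD(2)) (use g in simp)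
    then obtain r where r: "?F (rat_vec (L r)) < ?F t + \<gamma> / 2"
      by (auto simp: eventually_sequentially)
    have "?F (rat_vec (L r)) + 1 / real (Suc m) \<le> ?F (rat_vec l')" if "a \<le> rat_vec l' k" for l'
      using gap[of "rat_vec l'"] that r m by linarith
    then show "\<exists>l m. \<forall>l'. a \<le> rat_vec l' k \<longrightarrow> ?F (rat_vec l) + 1 / real (Suc m) \<le> ?F (rat_vec l')"
      by blast
  }
  assume "\<exists>l m. \<forall>l'. a \<le> rat_vec l' k \<longrightarrow> ?F (rat_vec l) + 1 / real (Suc m) \<le> ?F (rat_vec l')"
  then obtain l m where lm: "\<And>l'. a \<le> rat_vec l' k \<Longrightarrow> ?F (rat_vec l) + 1 / real (Suc m) \<le> ?F (rat_vec l')"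
    by blast
  show "t k < a"
  proof (rule ccontr)
    assume "\<not> t k < a"
    then have "?F (rat_vec l) + 1 / real (Suc m) \<le> ?F (rat_vec (L r))" for r
      using L(1)[OF k, of r] by (intro lm) linarith
    then have "?F (rat_vec l) + 1 / real (Suc m) \<le> ?F t"
      using LIMSEQ_le_const[OF FL] by blast
    moreover have "?F t \<le> ?F (rat_vec l)" using t by (simp add: lmin_def)
    moreover have "0 < 1 / real (Suc m)" by simp
    ultimately show False by linarith
  qed
qed

locale lasso_design = gaussian_data_law n p P K s for n p P K s +
  fixes \<theta> :: "nat \<Rightarrow> real" and lam :: real
  assumes pn: "p < n" and lam: "0 < lam" 
begin

lemma n: "0 < n" using pn by simp

definition full :: "(nat \<Rightarrow> (nat \<Rightarrow> real) \<times> real) \<Rightarrow> bool" where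
  "full x \<longleftrightarrow> indep_cols n p (dcol x)"

text \<open>On a full design the minimizer is unique, so the choice is harmless; elsewhere, on a
  null event, the value 0 keeps \<open>est\<close> measurable.\<close>

definition est :: "(nat \<Rightarrow> (nat \<Rightarrow> real) \<times> real) \<Rightarrow> nat \<Rightarrow> real" where
  "est x = (if full x then (SOME t. lmin n p lam (dcol x) (noise x) \<theta> t) else (\<lambda>_. 0))"

definition resid :: "(nat \<Rightarrow> (nat \<Rightarrow> real) \<times> real) \<Rightarrow> nat \<Rightarrow> real" where
  "resid x = lres p (dcol x) (noise x) \<theta> (est x)"

lemma est: "full x \<Longrightarrow> lmin n p lam (dcol x) (noise x) \<theta> (est x)"
  using someI_ex[OF lmin_exists[OF n lam]] by (simp add: est_def)

lemma est_unique: "full x \<Longrightarrow> lmin n p lam (dcol x) (noise x) \<theta> t \<Longrightarrow> k < p \<Longrightarrow> t k = est x k"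
  using lmin_unique[OF n lam _ est] by (simp add: full_def)

lemma col_measurable [measurable]: "k < p \<Longrightarrow> i < n \<Longrightarrow> (\<lambda>x. dcol x k i) \<in> borel_measurable \<mu>"
  unfolding dcol_def by (rule data_law_measurable_col)

lemma noise_measurable [measurable]: "i < n \<Longrightarrow> (\<lambda>x. noise x i) \<in> borel_measurable \<mu>"
  unfolding noise_def by (rule data_law_measurable_noise)

lemma orth_col_measurable:
  "set ks \<subseteq> {..<p} \<Longrightarrow> k < p \<Longrightarrow> i < n \<Longrightarrow> (\<lambda>x. orth_comp n (dcol x) ks (dcol x k) i) \<in> borel_measurable \<mu>"
  by (intro orth_comp_measurable col_measurable) auto

lemma full_measurable [measurable]: "Measurable.pred \<mu> full"
proof -
  have "(\<lambda>x. nrm n (orth_comp n (dcol x) (others p k) (dcol x k))) \<in> borel_measurable \<mu>" if "k < p" for k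
    using that by (intro nrm_measurable orth_col_measurable) (auto simp: set_others)
  note [measurable] = this
  have "Measurable.pred \<mu> (\<lambda>x. \<forall>k\<in>{..<p}. nrm n (orth_comp n (dcol x) (others p k) (dcol x k)) \<noteq> 0)"
    by measurable
  then show ?thesis by (simp add: full_def[abs_def] indep_cols_def Ball_def)
qed

lemma est_measurable [measurable]:
  assumes k: "k < p"
  shows "(\<lambda>x. est x k) \<in> borel_measurable \<mu>"
proof (rule borel_measurableI_less)
  fix a
  have L: "(\<lambda>x. lobj n p lam (dcol x) (noise x) \<theta> t) \<in> borel_measurable \<mu>" for t
    by (intro lobj_measurable col_measurable noise_measurable)
  have "Measurable.pred \<mu> (\<lambda>x. lobj n p lam (dcol x) (noise x) \<theta> t + e \<le> lobj n p lam (dcol x) (noise x) \<theta> t')" for t t' and e :: real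
    unfolding pred_def using L by (intro borel_measurable_le borel_measurable_add) auto
  then have Q: "Measurable.pred \<mu> (\<lambda>x. \<exists>l m. \<forall>l'. a \<le> rat_vec l' k \<longrightarrow>
     lobj n p lam (dcol x) (noise x) \<theta> (rat_vec l) + 1 / real (Suc m) \<le> lobj n p lam (dcol x) (noise x) \<theta> (rat_vec l'))"
    (is "Measurable.pred \<mu> ?Q") by (intro pred_intros_countable pred_intros_imp')
  have "{x \<in> space \<mu>. est x k < a} = {x \<in> space \<mu>. full x \<and> ?Q x} \<union> {x \<in> space \<mu>. \<not> full x \<and> 0 < a}"
  proof -
    have "est x k < a \<longleftrightarrow> ?Q x" if "full x" for x
      using that by (intro lmin_less_iff[OF n lam _ est k]) (simp_all add: full_def)
    moreover have "est x k < a \<longleftrightarrow> 0 < a" if "\<not> full x" for x using that by (simp add: est_def)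
    ultimately show ?thesis by blast
  qed
  also have "\<dots> \<in> sets \<mu>"
  proof (rule sets.Un)
    have "Measurable.pred \<mu> (\<lambda>x. full x \<and> ?Q x)" by (rule pred_intros_logic(3)[OF full_measurable Q])
    then show "{x \<in> space \<mu>. full x \<and> ?Q x} \<in> sets \<mu>" by (simp only: pred_def)
    show "{x \<in> space \<mu>. \<not> full x \<and> 0 < a} \<in> sets \<mu>" by measurable
  qed
  finally show "{x \<in> space \<mu>. est x k < a} \<in> sets \<mu>" .
qed

lemma resid_measurable [measurable]: "i < n \<Longrightarrow> (\<lambda>x. resid x i) \<in> borel_measurable \<mu>"
  unfolding resid_def by (intro lres_measurable col_measurable noise_measurable est_measurable)

text \<open>Coordinate \<open>i\<close> of the projected column \<open>k\<close> is affine in the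
  entry \<open>(i, k)\<close>, hence vanishes for at most one value if its slope is nonzero. Some
  slope is nonzero because the slopes add up to the trace of the projection, which is at least
  \<open>n - (p - 1) > 0\<close>.\<close>

lemma AE_full: "AE x in \<mu>. full x"
proof -
  let ?O = "\<lambda>x k. orth_comp n (dcol x) (others p k)"
  define A where "A = (\<lambda>k i. {x \<in> space \<mu>. nrm n (?O x k (dcol x k)) = 0 \<and> ?O x k (unit_vec' i) i \<noteq> 0})"
  have "A k i \<in> null_sets \<mu>" if k: "k < p" and i: "i < n" for k i
  proof (rule null_column_slices[OF _ i k])
    have [measurable]: "(\<lambda>x. nrm n (?O x k (dcol x k))) \<in> borel_measurable \<mu>"
      using k by (intro nrm_measurable orth_col_measurable) (auto simp: set_others)
    have [measurable]: "(\<lambda>x. ?O x k (unit_vec' i) i) \<in> borel_measurable \<mu>"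
      using k i by (intro orth_comp_measurable) (auto simp: set_others)
    show "A k i \<in> sets \<mu>" unfolding A_def by measurable
  next
    fix x :: "nat \<Rightarrow> (nat \<Rightarrow> real) \<times> real" and t t' :: real
    define y where "y = (\<lambda>t. x(i := ((fst (x i))(k := t), snd (x i))))"
    assume "x(i := ((fst (x i))(k := t), snd (x i))) \<in> A k i" "x(i := ((fst (x i))(k := t'), snd (x i))) \<in> A k i"
    then have ty: "y t \<in> A k i" "y t' \<in> A k i" by (simp_all add: y_def)
    have O: "?O (y t) k = ?O x k" for t
      by (intro ext, rule fun_cong[OF orth_comp_cong]) (auto simp: set_others y_def dcol_def fun_eq_iff)
    have c: "dcol (y t) k = (\<lambda>l. dcol x k l + (t - dcol x k i) * unit_vec' i l)" for t
      by (auto simp: y_def dcol_def)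
    have "?O x k (dcol (y t) k) i = ?O x k (dcol x k) i + (t - dcol x k i) * ?O x k (unit_vec' i) i" for t
      unfolding c by (simp only: orth_comp_add orth_comp_scale)
    moreover have "?O x k (dcol (y t) k) i = 0" "?O x k (dcol (y t') k) i = 0"
      using ty abs_le_nrm[OF i, of "?O x k (dcol (y t) k)"] abs_le_nrm[OF i, of "?O x k (dcol (y t') k)"]
      by (auto simp: A_def O)
    ultimately have "(t - dcol x k i) * ?O x k (unit_vec' i) i = (t' - dcol x k i) * ?O x k (unit_vec' i) i"
      by (metis add_left_imp_eq)
    moreover have "?O x k (unit_vec' i) i \<noteq> 0" using ty by (simp add: A_def O)
    ultimately show "t = t'" by simp
  qed
  then have "(\<Union>k\<in>{..<p}. \<Union>i\<in>{..<n}. A k i) \<in> null_sets \<mu>"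
    by (intro null_sets_UN') auto
  then show ?thesis
  proof (rule AE_I', safe)
    fix x assume x: "x \<in> space \<mu>" and "\<not> full x"
    then obtain k where k: "k < p" "nrm n (?O x k (dcol x k)) = 0" by (auto simp: full_def indep_cols_def)
    have "\<exists>i<n. ?O x k (unit_vec' i) i \<noteq> 0"
    proof (rule ccontr)
      assume "\<not> ?thesis"
      then have "orth_trace n (dcol x) (others p k) = 0" by (simp add: orth_trace_def)
      with orth_trace_ge[of n "others p k" "dcol x"] length_others[OF k(1)] k pn show False by simp
    qed
    with k x show "x \<in> (\<Union>k\<in>{..<p}. \<Union>i\<in>{..<n}. A k i)" by (auto simp: A_def)
  qed
qed

text \<open>Let \<open>v\<close> be the part of column \<open>k\<close> orthogonal to the active
  columns. For a fixed sign pattern and a fixed value of the subgradient, stationarity determines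
  \<open>ip n v (noise x)\<close> from the design, so the noise lies in a hyperplane. As
  \<open>v\<close> is nonzero on a full design, \<open>null_noise_slices\<close> applies, and there
  are finitely many patterns.\<close>

lemma AE_strict:
  "AE x in \<mu>. \<forall>k<p. est x k = 0 \<longrightarrow> \<bar>ip n (dcol x k) (resid x)\<bar> < real n * lam"
proof -
  define Pat where "Pat = PiE {..<p} (\<lambda>_. {-1, 0, 1 :: real})"
  have fin: "finite Pat" unfolding Pat_def by (intro finite_PiE) auto
  define A where "A = (\<lambda>k i pat e. {x \<in> space \<mu>. full x \<and> (\<forall>m\<in>{..<p}. sgn (est x m) = pat m) \<and>
     ip n (dcol x k) (resid x) = e \<and> orth_comp n (dcol x) (active p pat) (dcol x k) i \<noteq> 0})"
  have null: "A k i pat e \<in> null_sets \<mu>" if k: "k < p" and i: "i < n" for k i pat e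
  proof (rule null_noise_slices[OF _ i])
    have "(\<lambda>x. ip n (dcol x k) (resid x)) \<in> borel_measurable \<mu>"
      using k by (intro ip_measurable) auto
    moreover have "(\<lambda>x. orth_comp n (dcol x) (active p pat) (dcol x k) i) \<in> borel_measurable \<mu>"
      using k i by (intro orth_col_measurable) (auto simp: set_active)
    moreover have "Measurable.pred \<mu> (\<lambda>x. \<forall>m\<in>{..<p}. sgn (est x m) = pat m)"
      by measurable
    ultimately show "A k i pat e \<in> sets \<mu>" unfolding A_def by measurable
  next
    fix x :: "nat \<Rightarrow> (nat \<Rightarrow> real) \<times> real" and t t' :: real
    define y where "y = (\<lambda>t. x(i := (fst (x i), t)))"
    assume "x(i := (fst (x i), t)) \<in> A k i pat e" "x(i := (fst (x i), t')) \<in> A k i pat e"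
    then have ty: "y t \<in> A k i pat e" "y t' \<in> A k i pat e" by (simp_all add: y_def)
    have c: "dcol (y t) = dcol x" for t by (intro ext) (auto simp: y_def dcol_def)
    let ?A = "active p pat"
    define v where "v = orth_comp n (dcol x) ?A (dcol x k)"
    obtain g where g: "\<And>i. dcol x k i - v i = (\<Sum>m\<in>set ?A. g m * dcol x m i)"
      unfolding v_def using orth_comp_span by blast
    \<comment> \<open>The right side depends on design and pattern only: active columns are
      orthogonal to \<open>v\<close>, and inactive ones have coefficient 0.\<close>
    have key: "ip n v (noise (y t)) = e - (\<Sum>m\<in>set ?A. g m * (real n * lam * pat m)) - (\<Sum>m<p. \<theta> m * ip n v (dcol x m))"
      if yA: "y t \<in> A k i pat e" for t
    proof -
      define r where "r = resid (y t)"
      have f: "full (y t)" and pat: "\<And>m. m < p \<Longrightarrow> sgn (est (y t) m) = pat m" and ek: "ip n (dcol x k) r = e"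
        using yA by (auto simp: A_def c r_def)
      have "v = (\<lambda>i. dcol x k i - (\<Sum>m\<in>set ?A. g m * dcol x m i))" by (auto simp: g[symmetric])
      then have "ip n v r = ip n (dcol x k) r - (\<Sum>m\<in>set ?A. g m * ip n (dcol x m) r)"
        by (simp add: ip_linear ip_sum_left)
      also have "(\<Sum>m\<in>set ?A. g m * ip n (dcol x m) r) = (\<Sum>m\<in>set ?A. g m * (real n * lam * pat m))"
      proof (rule sum.cong)
        fix m assume "m \<in> set ?A"
        then have m: "m < p" "est (y t) m \<noteq> 0" using pat[of m] by (auto simp: set_active)
        show "g m * ip n (dcol x m) r = g m * (real n * lam * pat m)"
          using lmin_subgradient_eq[OF n lam est[OF f] m] pat[OF m(1)] by (simp add: c r_def resid_def)
      qed simp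
      finally have 1: "ip n v r = e - (\<Sum>m\<in>set ?A. g m * (real n * lam * pat m))" using ek by simp
      have "ip n v r = ip n v (noise (y t)) - ip n v (lin p (dcol x) (\<lambda>k. est (y t) k - \<theta> k))"
        unfolding r_def resid_def lres_def c by (simp add: ip_linear)
      also have "ip n v (lin p (dcol x) (\<lambda>k. est (y t) k - \<theta> k)) = (\<Sum>m<p. (est (y t) m - \<theta> m) * ip n v (dcol x m))"
        by (simp add: ip_lin ip_commute)
      also have "\<dots> = (\<Sum>m<p. - (\<theta> m * ip n v (dcol x m)))"
      proof (rule sum.cong)
        fix m assume m: "m \<in> {..<p}"
        have "est (y t) m * ip n v (dcol x m) = 0"
        proof (cases "m \<in> set ?A")
          case True
          then show ?thesis unfolding v_def by (simp add: ip_commute[of n _ "dcol x m"] orth_comp_orthogonal)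
        next
          case False
          then show ?thesis using m pat[of m] by (auto simp: set_active sgn_0_0)
        qed
        then show "(est (y t) m - \<theta> m) * ip n v (dcol x m) = - (\<theta> m * ip n v (dcol x m))"
          by (simp add: left_diff_distrib)
      qed simp
      finally show ?thesis using 1 by (simp add: sum_negf)
    qed
    have ny: "noise (y t) = (\<lambda>l. noise x l + (t - noise x i) * unit_vec' i l)" for t
      by (auto simp: y_def noise_def)
    have "ip n v (noise (y t)) = ip n v (noise x) + (t - noise x i) * v i" for t
      unfolding ny using i by (simp only: ip_linear ip_unit)
    with key[OF ty(1)] key[OF ty(2)] have "(t - noise x i) * v i = (t' - noise x i) * v i"
      by (metis add_left_imp_eq)
    moreover have "v i \<noteq> 0" using ty by (simp add: A_def v_def c)
    ultimately show "t = t'" by simp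
  qed
  have N: "(\<Union>k\<in>{..<p}. \<Union>i\<in>{..<n}. \<Union>pat\<in>Pat. \<Union>e\<in>{real n * lam, - (real n * lam)}. A k i pat e) \<in> null_sets \<mu>"
    using fin null by (intro null_sets_UN' countable_finite) auto
  have "AE x in \<mu>. x \<notin> (\<Union>k\<in>{..<p}. \<Union>i\<in>{..<n}. \<Union>pat\<in>Pat. \<Union>e\<in>{real n * lam, - (real n * lam)}. A k i pat e)"
    by (rule AE_not_in[OF N])
  then show ?thesis
    using AE_full AE_space
  proof eventually_elim
    case (elim x)
    show ?case
    proof (intro allI impI, rule ccontr)
      fix k assume k: "k < p" "est x k = 0" and "\<not> \<bar>ip n (dcol x k) (resid x)\<bar> < real n * lam"
      with lmin_subgradient_bound[OF n lam est[OF elim(2)] k(1)]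
      have e: "\<bar>ip n (dcol x k) (resid x)\<bar> = real n * lam" by (simp add: resid_def)
      define pat where "pat = (\<lambda>m\<in>{..<p}. sgn (est x m))"
      have pat: "pat \<in> Pat" by (auto simp: Pat_def pat_def PiE_def Pi_def sgn_if)
      have "k \<notin> set (active p pat)" using k by (simp add: set_active pat_def)
      then have "ip n (orth_comp n (dcol x) (active p pat) (dcol x k)) (orth_comp n (dcol x) (active p pat) (dcol x k)) \<noteq> 0"
        using elim(2) k by (intro indep_cols_orth_comp) (auto simp: full_def set_active)
      then obtain i where i: "i < n" "orth_comp n (dcol x) (active p pat) (dcol x k) i \<noteq> 0"
        by (auto simp: ip_self_eq_0)
      have "x \<in> A k i pat (ip n (dcol x k) (resid x))"
        using elim(2,3) i by (simp add: A_def pat_def)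
      moreover have "ip n (dcol x k) (resid x) \<in> {real n * lam, - (real n * lam)}" using e by (auto simp: abs_if split: if_splits)
      ultimately show False using elim(1) k i pat by blast
    qed
  qed
qed

end

subsection \<open>Deviation of one debiased coordinate\<close>

locale lasso_coordinate = lasso_design n p P K s \<theta> lam for n p P K s \<theta> lam +
  fixes j :: nat
  assumes j: "j < p" and sym: "\<And>k l. k < p \<Longrightarrow> l < p \<Longrightarrow> P k l = P l k" and Pjj: "0 < P j j"
begin

definition b :: real where "b = 1 / sqrt (P j j)"

text \<open>Moves entry \<open>(i, j)\<close> of the design; the scale \<open>b\<close> makes
  \<open>score i\<close> move by exactly \<open>\<eta>\<close>, since
  \<open>b\<^sup>2 * P j j = 1\<close>.\<close>

definition flow :: "nat \<Rightarrow> real \<Rightarrow> (nat \<Rightarrow> (nat \<Rightarrow> real) \<times> real) \<Rightarrow> nat \<Rightarrow> (nat \<Rightarrow> real) \<times> real" where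
  "flow i \<eta> x = x(i := ((fst (x i))(j := fst (x i) j + b * \<eta>), snd (x i)))"

text \<open>A linear combination of the design columns in which column \<open>j\<close> has
  coefficient \<open>b * P j j = sqrt (P j j)\<close>.\<close>

definition score :: "nat \<Rightarrow> (nat \<Rightarrow> (nat \<Rightarrow> real) \<times> real) \<Rightarrow> real" where
  "score i x = b * (\<Sum>k<p. P j k * fst (x i) k)"

lemma b_pos: "0 < b" using Pjj by (simp add: b_def)
lemma b_sq: "b\<^sup>2 * P j j = 1" using Pjj by (simp add: b_def power_divide)
lemma sqrt_b: "sqrt (P j j) * b = 1" using Pjj by (simp add: b_def)
lemma b_Pjj: "b * P j j = sqrt (P j j)" using Pjj by (simp add: b_def real_div_sqrt)

lemma flow_measurable:
  assumes i: "i < n"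
  shows "flow i \<eta> \<in> measurable \<mu> \<mu>"
proof -
  have up: "(\<lambda>v. v(j := v j + b * \<eta>)) \<in> measurable (row_law p P K) (row_law p P K)"
    unfolding measurable_cong_sets[OF sets_row_law sets_row_law] using j
    by (intro measurable_fun_upd[where J="{..<p}"]) (auto intro!: measurable_compose[OF _ borel_measurable_add])
  have "(\<lambda>y. ((fst y)(j := fst y j + b * \<eta>), snd y)) \<in> measurable \<rho> \<rho>"
    by (intro measurable_Pair measurable_compose[OF measurable_fst up] measurable_snd)
  then have "(\<lambda>x. ((fst (x i))(j := fst (x i) j + b * \<eta>), snd (x i))) \<in> measurable \<mu> \<rho>"
    by (rule measurable_compose[OF data_law_measurable_row[OF i]])
  then show ?thesis
    unfolding data_law_def flow_def[abs_def] using i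
    by (intro measurable_fun_upd[where J="{..<n}"]) auto
qed

lemma score_measurable:
  assumes i: "i < n"
  shows "score i \<in> borel_measurable \<mu>"
  unfolding score_def[abs_def]
  by (intro borel_measurable_times borel_measurable_sum data_law_measurable_col[OF i]) auto

lemma flow_cameron_martin:
  assumes i: "i < n" and f: "f \<in> borel_measurable \<mu>"
  shows "(\<integral>\<^sup>+x. f (flow i \<eta> x) * ennreal (exp (- \<eta> * score i x - \<eta>\<^sup>2 / 2)) \<partial>\<mu>) = (\<integral>\<^sup>+x. f x \<partial>\<mu>)"
proof -
  note [measurable] = flow_measurable[OF i] score_measurable[OF i] f
  let ?w = "\<lambda>x. ennreal (exp (- \<eta> * score i x - \<eta>\<^sup>2 / 2))"
  have "(\<integral>\<^sup>+x. f (flow i \<eta> x) * ?w x \<partial>\<mu>) =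
     (\<integral>\<^sup>+x. (\<integral>\<^sup>+y. f (flow i \<eta> (x(i := y))) * ?w (x(i := y)) \<partial>\<rho>) \<partial>Pi\<^sub>M ({..<n} - {i}) (\<lambda>_. \<rho>))"
    by (rule nn_integral_data_split[OF i]) measurable
  also have "\<dots> = (\<integral>\<^sup>+x. (\<integral>\<^sup>+y. f (x(i := y)) \<partial>\<rho>) \<partial>Pi\<^sub>M ({..<n} - {i}) (\<lambda>_. \<rho>))"
  proof (rule nn_integral_cong)
    fix x assume x: "x \<in> space (Pi\<^sub>M ({..<n} - {i}) (\<lambda>_. \<rho>))"
    note up = data_upd_measurable[OF i x]
    have g: "(\<lambda>y. f (x(i := y))) \<in> borel_measurable \<rho>" by (rule measurable_compose[OF up f])
    have gw: "(\<lambda>y. f (flow i \<eta> (x(i := y))) * ?w (x(i := y))) \<in> borel_measurable \<rho>"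
      by (rule measurable_compose[OF up]) measurable
    have "(\<integral>\<^sup>+y. f (flow i \<eta> (x(i := y))) * ?w (x(i := y)) \<partial>\<rho>) =
      (\<integral>\<^sup>+e. (\<integral>\<^sup>+v. f (flow i \<eta> (x(i := (v, e)))) * ?w (x(i := (v, e))) \<partial>row_law p P K) \<partial>noise_law s)"
      by (rule nn_integral_\<rho>(1)[OF gw])
    also have "\<dots> = (\<integral>\<^sup>+e. (\<integral>\<^sup>+v. f (x(i := (v, e))) \<partial>row_law p P K) \<partial>noise_law s)"
    proof (rule nn_integral_cong)
      fix e
      have ge: "(\<lambda>v. f (x(i := (v, e)))) \<in> borel_measurable (row_law p P K)"
        by (rule measurable_compose[OF measurable_Pair2' g]) simp
      have "(b * \<eta>)\<^sup>2 * P j j = \<eta>\<^sup>2" using b_sq by (simp add: power_mult_distrib mult_ac)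
      then have "ennreal (exp (- (b * \<eta>) * (\<Sum>k<p. P j k * v k) - (b * \<eta>)\<^sup>2 * P j j / 2)) = ?w (x(i := (v, e)))" for v
        by (simp add: score_def mult_ac)
      then show "(\<integral>\<^sup>+v. f (flow i \<eta> (x(i := (v, e)))) * ?w (x(i := (v, e))) \<partial>row_law p P K) =
          (\<integral>\<^sup>+v. f (x(i := (v, e))) \<partial>row_law p P K)"
        using row_law_cameron_martin[OF j sym ge, of "b * \<eta>"] by (simp add: flow_def)
    qed
    also have "\<dots> = (\<integral>\<^sup>+y. f (x(i := y)) \<partial>\<rho>)" by (rule nn_integral_\<rho>(1)[OF g, symmetric])
    finally show "(\<integral>\<^sup>+y. f (flow i \<eta> (x(i := y))) * ?w (x(i := y)) \<partial>\<rho>) = (\<integral>\<^sup>+y. f (x(i := y)) \<partial>\<rho>)" .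
  qed
  also have "\<dots> = (\<integral>\<^sup>+x. f x \<partial>\<mu>)" by (rule nn_integral_data_split[OF i f, symmetric])
  finally show ?thesis .
qed

sublocale gaussian_shift \<mu> "{..<n}" flow score
proof (rule gaussian_shift.intro[OF prob_\<mu> gaussian_shift_axioms.intro])
  show "finite {..<n}" by simp
  fix i k \<eta> \<zeta> x assume i: "i \<in> {..<n}"
  show "flow i \<eta> \<in> measurable \<mu> \<mu>" using i by (intro flow_measurable) simp
  show "score i \<in> borel_measurable \<mu>" using i by (intro score_measurable) simp
  show "flow i \<eta> (flow k \<zeta> x) = flow k \<zeta> (flow i \<eta> x)"
    by (cases "i = k") (auto simp: flow_def fun_upd_twist add_ac)
  show "flow i \<eta> (flow i (- \<eta>) x) = x"
    by (auto simp: flow_def)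
  show "score i (flow k \<eta> x) = score i x + (if i = k then \<eta> else 0)"
  proof (cases "i = k")
    case True
    have "(\<Sum>m<p. P j m * ((fst (x k))(j := fst (x k) j + b * \<eta>)) m) =
        (\<Sum>m<p. P j m * fst (x k) m + (if m = j then P j m * (b * \<eta>) else 0))"
      by (intro sum.cong) (auto simp: algebra_simps)
    also have "\<dots> = (\<Sum>m<p. P j m * fst (x k) m) + P j j * (b * \<eta>)"
      using j by (simp add: sum.distrib)
    finally have "(\<Sum>m<p. P j m * ((fst (x k))(j := fst (x k) j + b * \<eta>)) m) = (\<Sum>m<p. P j m * fst (x k) m) + P j j * (b * \<eta>)" .
    moreover have "b * (P j j * (b * \<eta>)) = \<eta>" using b_sq by (simp add: power2_eq_square mult_ac)
    ultimately show ?thesis using True by (simp add: score_def flow_def distrib_left del: fun_upd_apply) (simp add: score_def flow_def distrib_left)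
  qed (simp add: score_def flow_def)
  show "distr (density \<mu> (\<lambda>x. ennreal (exp (- \<eta> * score i x - \<eta>\<^sup>2 / 2)))) \<mu> (flow i \<eta>) = \<mu>"
  proof (rule measure_eqI)
    have i': "i < n" using i by simp
    note [measurable] = flow_measurable[OF i'] score_measurable[OF i']
    let ?w = "\<lambda>x. ennreal (exp (- \<eta> * score i x - \<eta>\<^sup>2 / 2))"
    fix A assume "A \<in> sets (distr (density \<mu> ?w) \<mu> (flow i \<eta>))"
    then have A[measurable]: "A \<in> sets \<mu>" by simp
    have "emeasure (distr (density \<mu> ?w) \<mu> (flow i \<eta>)) A = emeasure (density \<mu> ?w) (flow i \<eta> -` A \<inter> space \<mu>)"
      by (subst emeasure_distr) auto
    also have "\<dots> = (\<integral>\<^sup>+x. ?w x * indicator (flow i \<eta> -` A \<inter> space \<mu>) x \<partial>\<mu>)"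
      by (rule emeasure_density) measurable
    also have "\<dots> = (\<integral>\<^sup>+x. indicator A (flow i \<eta> x) * ?w x \<partial>\<mu>)"
      by (intro nn_integral_cong) (auto simp: indicator_def)
    also have "\<dots> = (\<integral>\<^sup>+x. indicator A x \<partial>\<mu>)" by (rule flow_cameron_martin[OF i']) measurable
    also have "\<dots> = emeasure \<mu> A" by simp
    finally show "emeasure (distr (density \<mu> ?w) \<mu> (flow i \<eta>)) A = emeasure \<mu> A" .
  qed simp
qed

section \<open>The part of the score vector orthogonal to the other columns\<close>

definition Oj :: "(nat \<Rightarrow> (nat \<Rightarrow> real) \<times> real) \<Rightarrow> (nat \<Rightarrow> real) \<Rightarrow> nat \<Rightarrow> real" where
  "Oj x = orth_comp n (dcol x) (others p j)"

text \<open>Equals the projected score vector, by \<open>Oj_score\<close>. Flows leave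
  \<open>Oj\<close> fixed, so in this form it is visibly affine in the shift.\<close>

definition perp :: "(nat \<Rightarrow> (nat \<Rightarrow> real) \<times> real) \<Rightarrow> nat \<Rightarrow> real" where
  "perp x = (\<lambda>i. sqrt (P j j) * Oj x (dcol x j) i)"

abbreviation "sz x \<equiv> nrm n (perp x)"

lemma sz_eq: "sz x = sqrt (P j j) * nrm n (orth_comp n (dcol x) (others p j) (dcol x j))"
  unfolding perp_def nrm_scale Oj_def using Pjj by simp

lemma flow_col: "k \<noteq> j \<Longrightarrow> dcol (flow i \<eta> x) k = dcol x k"
  "dcol (flow i \<eta> x) j = (\<lambda>l. dcol x j l + (b * \<eta>) * unit_vec' i l)"
  by (auto simp: dcol_def flow_def fun_eq_iff)

lemma flow_noise: "noise (flow i \<eta> x) = noise x"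
  by (auto simp: noise_def flow_def)

lemma flow_Oj: "Oj (flow i \<eta> x) = Oj x"
  unfolding Oj_def by (intro ext, rule fun_cong[OF orth_comp_cong]) (auto simp: set_others flow_col)

lemma flow_perp: "perp (flow i \<eta> x) = (\<lambda>l. perp x l + \<eta> * Oj x (unit_vec' i) l)"
proof -
  have "Oj x (\<lambda>l. dcol x j l + (b * \<eta>) * unit_vec' i l) = (\<lambda>l. Oj x (dcol x j) l + (b * \<eta>) * Oj x (unit_vec' i) l)"
    unfolding Oj_def by (simp only: orth_comp_add orth_comp_scale)
  moreover have "sqrt (P j j) * (a + (b * \<eta>) * u) = sqrt (P j j) * a + \<eta> * u" for a u
    using sqrt_b by (simp add: distrib_left mult.assoc[symmetric])
  ultimately show ?thesis by (simp add: perp_def flow_Oj flow_col)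
qed

lemma score_lin: "score i x = lin p (dcol x) (\<lambda>k. b * P j k) i"
  by (simp add: score_def lin_def dcol_def sum_distrib_left mult.assoc)

lemma Oj_score: "i < n \<Longrightarrow> Oj x (\<lambda>l. score l x) i = perp x i"
  unfolding score_lin Oj_def perp_def using orth_comp_lin[OF j, of i n "dcol x" "\<lambda>k. b * P j k"]
  by (simp add: b_Pjj)

lemma Oj_perp: "Oj x (perp x) = perp x"
  unfolding perp_def Oj_def by (simp add: orth_comp_scale orth_comp_idem)

lemma ip_score_perp: "ip n (\<lambda>l. score l x) (perp x) = (sz x)\<^sup>2"
proof -
  have "ip n (\<lambda>l. score l x) (perp x) = ip n (Oj x (\<lambda>l. score l x)) (perp x)"
    using Oj_perp[of x] unfolding Oj_def by (metis orth_comp_self_adjoint)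
  also have "\<dots> = ip n (perp x) (perp x)" by (intro ip_cong) (auto simp: Oj_score)
  finally show ?thesis by (simp add: nrm_sq)
qed

lemma sz_le_score: "(sz x)\<^sup>2 \<le> (\<Sum>i<n. (score i x)\<^sup>2)"
proof -
  have "sz x = nrm n (Oj x (\<lambda>l. score l x))" by (intro nrm_cong) (simp add: Oj_score)
  also have "\<dots> \<le> nrm n (\<lambda>l. score l x)" unfolding Oj_def by (rule nrm_orth_comp_le)
  finally have "(sz x)\<^sup>2 \<le> (nrm n (\<lambda>l. score l x))\<^sup>2" by (intro power_mono) auto
  also have "\<dots> = (\<Sum>i<n. (score i x)\<^sup>2)" unfolding nrm_sq ip_def by (simp add: power2_eq_square)
  finally show ?thesis .
qed

lemma perp_measurable [measurable]: "i < n \<Longrightarrow> (\<lambda>x. perp x i) \<in> borel_measurable \<mu>"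
  unfolding perp_def Oj_def
  by (intro borel_measurable_times borel_measurable_const orth_col_measurable) (auto simp: set_others j)

lemma sz_measurable [measurable]: "(\<lambda>x. sz x) \<in> borel_measurable \<mu>"
  by (intro nrm_measurable perp_measurable)

lemma nrm_unit: "i < n \<Longrightarrow> nrm n (unit_vec' i) = 1"
proof -
  assume i: "i < n"
  have "(nrm n (unit_vec' i))\<^sup>2 = 1" using i by (simp only: nrm_sq ip_unit) simp
  then show ?thesis using nrm_nonneg[where n=n and u="unit_vec' i"] by (simp add: power2_eq_1_iff)
qed

lemma nrm_Oj_unit: "i < n \<Longrightarrow> nrm n (Oj x (unit_vec' i)) \<le> 1"
  using nrm_orth_comp_le[of n "dcol x" "others p j" "unit_vec' i"] nrm_unit[of i] by (simp add: Oj_def)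

text \<open>Stein's bound for the field \<open>perp\<close>: its pairing with the score is
  \<open>(sz x)\<^sup>2\<close>, and its divergence is the trace of \<open>Oj\<close>, the number of
  degrees of freedom. Each of the \<open>n\<close> shifts moves \<open>perp\<close> by at most
  \<open>\<eta>\<close>, so \<open>G = n\<close>, and
  \<open>4 * 4 * n + 5 * n = 21 * n\<close>.\<close>

lemma chi_square_bound:
  "(\<integral>\<^sup>+x. ennreal (((sz x)\<^sup>2 - orth_trace n (dcol x) (others p j))\<^sup>2) \<partial>\<mu>) \<le> ennreal (21 * real n)"
proof -
  let ?f = "\<lambda>i x. perp x i" and ?d = "\<lambda>i x. Oj x (unit_vec' i) i"
  have z2: "integrable \<mu> (\<lambda>x. \<Sum>i<n. (score i x)\<^sup>2)" using z_square_integrable(1) by auto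
  have f2: "integrable \<mu> (\<lambda>x. (perp x i)\<^sup>2)" if i: "i < n" for i
  proof (rule Bochner_Integration.integrable_bound[OF z2])
    show "(\<lambda>x. (perp x i)\<^sup>2) \<in> borel_measurable \<mu>" using i by measurable
    have "(perp x i)\<^sup>2 \<le> (\<Sum>i<n. (score i x)\<^sup>2)" for x
    proof -
      have "(perp x i)\<^sup>2 \<le> (sz x)\<^sup>2" using abs_le_nrm[OF i, of "perp x"] by (metis abs_le_square_iff abs_of_nonneg nrm_nonneg)
      then show ?thesis using sz_le_score[of x] by linarith
    qed
    then show "AE x in \<mu>. norm ((perp x i)\<^sup>2) \<le> norm (\<Sum>i<n. (score i x)\<^sup>2)" by (simp add: sum_nonneg)
  qed
  have sum_f2: "(\<Sum>i<n. (perp x i)\<^sup>2) = (sz x)\<^sup>2" for x unfolding nrm_sq ip_def by (simp add: power2_eq_square)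
  have "(\<integral>\<^sup>+x. ennreal ((\<Sum>i\<in>{..<n}. score i x * ?f i x - ?d i x)\<^sup>2) \<partial>\<mu>) \<le>
     ennreal (4 * (\<integral>x. (\<Sum>i\<in>{..<n}. (?f i x)\<^sup>2) \<partial>\<mu>) + 5 * (\<integral>x. real n \<partial>\<mu>))"
  proof (rule stein_second_order)
    show "integrable \<mu> (\<lambda>x. real n)" by simp
    show "AE x in \<mu>. (\<Sum>k\<in>{..<n}. \<Sum>i\<in>{..<n}. (perp x i - perp (flow k (- \<eta>) x) i)\<^sup>2) \<le> \<eta>\<^sup>2 * real n" for \<eta>
    proof (rule AE_I2)
      fix x
      have "(\<Sum>i\<in>{..<n}. (perp x i - perp (flow k (- \<eta>) x) i)\<^sup>2) \<le> \<eta>\<^sup>2" if k: "k < n" for k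
      proof -
        have "(\<Sum>i\<in>{..<n}. (perp x i - perp (flow k (- \<eta>) x) i)\<^sup>2) = \<eta>\<^sup>2 * (nrm n (Oj x (unit_vec' k)))\<^sup>2"
          unfolding flow_perp nrm_sq ip_def by (simp add: power2_eq_square sum_distrib_left mult_ac)
        also have "\<dots> \<le> \<eta>\<^sup>2 * 1" using nrm_Oj_unit[OF k, of x] by (intro mult_left_mono power_le_one) auto
        finally show ?thesis by simp
      qed
      then have "(\<Sum>k\<in>{..<n}. \<Sum>i\<in>{..<n}. (perp x i - perp (flow k (- \<eta>) x) i)\<^sup>2) \<le> (\<Sum>k\<in>{..<n}. \<eta>\<^sup>2)"
        by (intro sum_mono) auto
      then show "(\<Sum>k\<in>{..<n}. \<Sum>i\<in>{..<n}. (perp x i - perp (flow k (- \<eta>) x) i)\<^sup>2) \<le> \<eta>\<^sup>2 * real n"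
        by (simp add: mult.commute)
    qed
    show "AE x in \<mu>. \<forall>i\<in>{..<n}. (\<lambda>m. (perp (flow i (1 / real (Suc m)) x) i - perp x i) * real (Suc m)) \<longlonglongrightarrow> Oj x (unit_vec' i) i"
      by (simp add: flow_perp del: of_nat_Suc)
  qed (use f2 in auto)
  also have "(\<lambda>x. (\<Sum>i\<in>{..<n}. score i x * ?f i x - ?d i x)) = (\<lambda>x. (sz x)\<^sup>2 - orth_trace n (dcol x) (others p j))"
    by (simp add: ip_score_perp[symmetric] ip_def sum_subtractf orth_trace_def Oj_def)
  also have "4 * (\<integral>x. (\<Sum>i\<in>{..<n}. (?f i x)\<^sup>2) \<partial>\<mu>) + 5 * (\<integral>x. real n \<partial>\<mu>) \<le> 21 * real n"
  proof -
    have "(\<integral>x. (\<Sum>i\<in>{..<n}. (?f i x)\<^sup>2) \<partial>\<mu>) \<le> (\<integral>x. (\<Sum>i<n. (score i x)\<^sup>2) \<partial>\<mu>)"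
    proof (rule integral_mono)
      show "integrable \<mu> (\<lambda>x. \<Sum>i\<in>{..<n}. (?f i x)\<^sup>2)" using f2 by auto
      show "(\<Sum>i\<in>{..<n}. (?f i x)\<^sup>2) \<le> (\<Sum>i<n. (score i x)\<^sup>2)" for x
        unfolding sum_f2 by (rule sz_le_score)
    qed (rule z2)
    also have "\<dots> = (\<Sum>i<n. \<integral>x. (score i x)\<^sup>2 \<partial>\<mu>)"
      using z_square_integrable(1) by (intro Bochner_Integration.integral_sum) auto
    also have "\<dots> \<le> (\<Sum>i<n. 4)" using z_square_integrable(2) by (intro sum_mono) auto
    finally show ?thesis by (simp add: prob_space)
  qed
  finally show ?thesis by (auto intro: order_trans ennreal_leI)
qed

lemma noise_second_moment:
  assumes i: "i < n"
  shows "integrable \<mu> (\<lambda>x. (noise x i)\<^sup>2)" and "(\<integral>x. (noise x i)\<^sup>2 \<partial>\<mu>) = s\<^sup>2"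
proof -
  have bi: "has_bochner_integral lborel (\<lambda>x. normal_density 0 s x * x\<^sup>2) (s\<^sup>2)"
    using normal_moment_even[of s 0 1] s by (simp add: field_simps power2_eq_square fact_numeral)
  have "(\<integral>\<^sup>+e. ennreal (e\<^sup>2) \<partial>noise_law s) = (\<integral>\<^sup>+e. ennreal (normal_density 0 s e * e\<^sup>2) \<partial>lborel)"
    unfolding noise_law_def by (subst nn_integral_density) (auto simp: ennreal_mult'')
  also have "\<dots> = ennreal (s\<^sup>2)" using bi by (intro nn_integral_eq_integrable[THEN iffD2]) (auto simp: has_bochner_integral_iff)
  finally have C: "(\<integral>\<^sup>+e. ennreal (e\<^sup>2) \<partial>noise_law s) = ennreal (s\<^sup>2)" .
  interpret r: prob_space "row_law p P K" by (rule prob_row)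
  have "(\<lambda>x. ennreal ((noise x i)\<^sup>2)) \<in> borel_measurable \<mu>" using noise_measurable[OF i] by measurable
  then have "(\<integral>\<^sup>+x. ennreal ((noise x i)\<^sup>2) \<partial>\<mu>) =
      (\<integral>\<^sup>+x. (\<integral>\<^sup>+y. ennreal ((noise (x(i := y)) i)\<^sup>2) \<partial>\<rho>) \<partial>Pi\<^sub>M ({..<n} - {i}) (\<lambda>_. \<rho>))"
    by (rule nn_integral_data_split[OF i])
  also have "\<dots> = (\<integral>\<^sup>+x. (\<integral>\<^sup>+y. ennreal ((snd y)\<^sup>2) \<partial>\<rho>) \<partial>Pi\<^sub>M ({..<n} - {i}) (\<lambda>_. \<rho>))"
    by (simp add: noise_def)
  also have "(\<integral>\<^sup>+y. ennreal ((snd y)\<^sup>2) \<partial>\<rho>) = (\<integral>\<^sup>+v. (\<integral>\<^sup>+e. ennreal (e\<^sup>2) \<partial>noise_law s) \<partial>row_law p P K)"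
    by (subst nn_integral_\<rho>(2)) (auto intro: measurable_compose[OF measurable_snd])
  also have "\<dots> = ennreal (s\<^sup>2)" by (simp add: C r.emeasure_space_1)
  also have "(\<integral>\<^sup>+x. ennreal (s\<^sup>2) \<partial>Pi\<^sub>M ({..<n} - {i}) (\<lambda>_. \<rho>)) = ennreal (s\<^sup>2)"
    using prob_space.emeasure_space_1[OF prob_space_PiM[of "{..<n} - {i}" "\<lambda>_. \<rho>", OF prob_\<rho>]] by simp
  finally have *: "(\<integral>\<^sup>+x. ennreal ((noise x i)\<^sup>2) \<partial>\<mu>) = ennreal (s\<^sup>2)" .
  show I: "integrable \<mu> (\<lambda>x. (noise x i)\<^sup>2)"
    using * noise_measurable[OF i] by (intro integrableI_nonneg) auto
  show "(\<integral>x. (noise x i)\<^sup>2 \<partial>\<mu>) = s\<^sup>2"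
    using * noise_measurable[OF i] by (subst integral_eq_nn_integral) auto
qed

text \<open>Majorant of the squared \<open>noise_bound\<close>, linear in the squared noise, so that
  its mean \<open>W0\<close> is explicit.\<close>

definition W :: "(nat \<Rightarrow> (nat \<Rightarrow> real) \<times> real) \<Rightarrow> real" where
  "W x = 4 * ip n (noise x) (noise x) + 4 * real n * lam * l1 p \<theta>"

definition W0 :: real where
  "W0 = 4 * real n * s\<^sup>2 + 4 * real n * lam * l1 p \<theta>"

lemma W: "integrable \<mu> W" "(\<integral>x. W x \<partial>\<mu>) = W0"
proof -
  have 1: "ip n (noise x) (noise x) = (\<Sum>i<n. (noise x i)\<^sup>2)" for x by (simp add: ip_def power2_eq_square)
  have i: "integrable \<mu> (\<lambda>x. \<Sum>i<n. (noise x i)\<^sup>2)" using noise_second_moment(1) by auto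
  have "(\<integral>x. (\<Sum>i<n. (noise x i)\<^sup>2) \<partial>\<mu>) = (\<Sum>i<n. s\<^sup>2)"
    using noise_second_moment by (subst Bochner_Integration.integral_sum) auto
  with i show "integrable \<mu> W" "(\<integral>x. W x \<partial>\<mu>) = W0"
    unfolding W_def[abs_def] 1 W0_def by (simp_all add: prob_space)
qed

lemma noise_bound_le_W: "(noise_bound n p lam (noise x) \<theta>)\<^sup>2 \<le> W x"
  unfolding W_def by (rule noise_bound_sq[OF lam])

section \<open>Second moment and tail of the debiased error\<close>

definition deb :: "(nat \<Rightarrow> (nat \<Rightarrow> real) \<times> real) \<Rightarrow> real" where
  "deb x = ip n (\<lambda>l. score l x) (resid x) + b * (est x j - \<theta> j) * (real n - real (length (active p (est x))))"

lemma deb_measurable [measurable]: "deb \<in> borel_measurable \<mu>"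
proof -
  have "real (length (active p (est x))) = (\<Sum>k<p. if est x k \<noteq> 0 then 1 else 0)" for x
  proof -
    have "length (active p (est x)) = card {k. k < p \<and> est x k \<noteq> 0}"
      using distinct_card[of "active p (est x)"] by (simp add: set_active) (simp add: active_def)
    also have "real \<dots> = (\<Sum>k\<in>{k \<in> {..<p}. est x k \<noteq> 0}. 1)" by simp
    also have "\<dots> = (\<Sum>k<p. if est x k \<noteq> 0 then 1 else 0)" by (rule sum.inter_filter) simp
    finally show ?thesis .
  qed
  then have e: "deb = (\<lambda>x. ip n (\<lambda>l. score l x) (resid x) + b * (est x j - \<theta> j) * (real n - (\<Sum>k<p. if est x k \<noteq> 0 then 1 else 0)))"
    by (auto simp: deb_def)
  have [measurable]: "(\<lambda>x. ip n (\<lambda>l. score l x) (resid x)) \<in> borel_measurable \<mu>"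
    by (intro ip_measurable resid_measurable z_measurable) auto
  have [measurable]: "(\<lambda>x. \<Sum>k<p. if est x k \<noteq> 0 then 1 else (0::real)) \<in> borel_measurable \<mu>"
    by (intro borel_measurable_sum) (auto intro!: measurable_If borel_measurable_const predE)
  note [measurable] = est_measurable[OF j]
  show ?thesis unfolding e by measurable
qed

text \<open>\<open>perp\<close> moves affinely, so \<open>(sz x)\<^sup>2\<close> is a quadratic
  polynomial in the shift and no norm has to be differentiated.\<close>

lemma damping_derivative:
  assumes i: "i < n"
  shows "(\<lambda>m. (damping n (sz (flow i (1 / real (Suc m)) x)) - damping n (sz x)) * real (Suc m)) \<longlonglongrightarrow>
     2 * real n * perp x i / (real n + (sz x)\<^sup>2)\<^sup>2"
    and "(\<lambda>m. damping n (sz (flow i (1 / real (Suc m)) x))) \<longlonglongrightarrow> damping n (sz x)"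
proof -
  define e where "e = Oj x (unit_vec' i)"
  define N where "N = (\<lambda>\<eta>. (sz x)\<^sup>2 + 2 * \<eta> * perp x i + \<eta>\<^sup>2 * (nrm n e)\<^sup>2)"
  have ipe: "ip n (perp x) e = perp x i"
  proof -
    have "ip n (perp x) e = ip n (Oj x (perp x)) (unit_vec' i)"
      unfolding e_def Oj_def by (rule orth_comp_self_adjoint[symmetric])
    then show ?thesis unfolding Oj_perp using i by (simp only: ip_unit)
  qed
  have szN: "(sz (flow i \<eta> x))\<^sup>2 = N \<eta>" for \<eta>
    unfolding flow_perp N_def e_def[symmetric] nrm_sq
    by (simp add: ip_linear ipe ip_commute[of n e "perp x"] power2_eq_square algebra_simps)
  have dN: "damping n (sz (flow i \<eta> x)) = N \<eta> / (real n + N \<eta>)" for \<eta>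
    by (simp add: damping_def szN)
  have d0: "damping n (sz x) = N 0 / (real n + N 0)" by (simp add: damping_def N_def)
  have pos: "real n + (sz x)\<^sup>2 \<noteq> 0" using n zero_le_power2[of "sz x"] by (simp add: add_nonneg_eq_0_iff)
  have D: "((\<lambda>\<eta>. N \<eta> / (real n + N \<eta>)) has_field_derivative (2 * real n * perp x i / (real n + (sz x)\<^sup>2)\<^sup>2)) (at 0)"
    unfolding N_def using pos
    by (auto intro!: derivative_eq_intros simp: power2_eq_square field_simps)
  have sq: "filterlim (\<lambda>m. 1 / real (Suc m)) (at 0) sequentially"
    using LIMSEQ_inverse_real_of_nat by (auto simp: filterlim_at inverse_eq_divide)
  have "((\<lambda>h. (N (0 + h) / (real n + N (0 + h)) - N 0 / (real n + N 0)) / h) \<longlongrightarrow> 2 * real n * perp x i / (real n + (sz x)\<^sup>2)\<^sup>2) (at 0)"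
    using D by (simp add: DERIV_def)
  from filterlim_compose[OF this sq]
  show "(\<lambda>m. (damping n (sz (flow i (1 / real (Suc m)) x)) - damping n (sz x)) * real (Suc m)) \<longlonglongrightarrow>
     2 * real n * perp x i / (real n + (sz x)\<^sup>2)\<^sup>2"
    by (simp add: dN d0 del: of_nat_Suc)
  have "((\<lambda>\<eta>. N \<eta> / (real n + N \<eta>)) \<longlongrightarrow> N 0 / (real n + N 0)) (at 0)"
    using DERIV_isCont[OF D] by (simp add: isCont_def)
  from filterlim_compose[OF this sq]
  show "(\<lambda>m. damping n (sz (flow i (1 / real (Suc m)) x))) \<longlonglongrightarrow> damping n (sz x)"
    by (simp add: dN d0)
qed

definition fA :: "nat \<Rightarrow> (nat \<Rightarrow> (nat \<Rightarrow> real) \<times> real) \<Rightarrow> real" where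
  "fA i x = damping n (sz x) * resid x i"

text \<open>Derivative of \<open>fA i\<close> along \<open>flow i\<close> by the product rule; the
  factor \<open>b\<close> is the speed of the flow in \<open>lres_derivative\<close>.\<close>

definition dA :: "nat \<Rightarrow> (nat \<Rightarrow> (nat \<Rightarrow> real) \<times> real) \<Rightarrow> real" where
  "dA i x = damping n (sz x) * (b * - ((est x j - \<theta> j) * orth_comp n (dcol x) (active p (est x)) (unit_vec' i) i
       + resid x i * dual_col n p (dcol x) (est x) j i))
     + 2 * real n * perp x i / (real n + (sz x)\<^sup>2)\<^sup>2 * resid x i"

text \<open>Strictness is needed at \<open>x\<close>, independence of the columns at
  \<open>x\<close> and at countably many shifted points, which \<open>AE_shift\<close>
  supplies.\<close>

lemma fA_derivative:
  "AE x in \<mu>. \<forall>i\<in>{..<n}. (\<lambda>m. (fA i (flow i (1 / real (Suc m)) x) - fA i x) * real (Suc m)) \<longlonglongrightarrow> dA i x"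
proof -
  have "AE x in \<mu>. \<forall>i\<in>{..<n}. \<forall>m::nat. full (flow i (1 / real (Suc m)) x)"
    using AE_shift[OF _ AE_full] by (auto simp: AE_finite_all AE_all_countable)
  then show ?thesis using AE_full AE_strict
  proof eventually_elim
    case (elim x)
    show ?case
    proof
      fix i assume i': "i \<in> {..<n}"
      then have i: "i < n" by simp
      let ?x = "\<lambda>m. flow i (1 / real (Suc m)) x"
      have "(\<lambda>m. (lres p (dcol (?x m)) (noise x) \<theta> (est (?x m)) i - lres p (dcol x) (noise x) \<theta> (est x) i) / (b * (1 / real (Suc m)))) \<longlonglongrightarrow>
        - ((est x j - \<theta> j) * orth_comp n (dcol x) (active p (est x)) (unit_vec' i) i
           + lres p (dcol x) (noise x) \<theta> (est x) i * dual_col n p (dcol x) (est x) j i)"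
      proof (rule lres_derivative[OF n lam j])
        show "indep_cols n p (dcol x)" using elim by (simp add: full_def)
        show "lmin n p lam (dcol x) (noise x) \<theta> (est x)" by (rule est) (rule elim)
        show "lmin n p lam (dcol (?x m)) (noise x) \<theta> (est (?x m))" for m
          using est[of "?x m"] elim(1) i' by (simp add: flow_noise)
        show "(\<lambda>m. b * (1 / real (Suc m))) \<longlonglongrightarrow> 0"
        proof -
          have "(\<lambda>m. b * (1 / real (Suc m))) \<longlonglongrightarrow> b * 0"
            using LIMSEQ_inverse_real_of_nat by (intro tendsto_intros) (simp add: inverse_eq_divide)
          then show ?thesis by simp
        qed
        show "b * (1 / real (Suc m)) \<noteq> 0" for m using b_pos by simp
        show "\<bar>ip n (dcol x k) (lres p (dcol x) (noise x) \<theta> (est x))\<bar> < real n * lam" if "k < p" "est x k = 0" for k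
          using elim(3) that by (simp add: resid_def)
      qed (simp_all add: flow_col i)
      then have "(\<lambda>m. b * ((lres p (dcol (?x m)) (noise x) \<theta> (est (?x m)) i - lres p (dcol x) (noise x) \<theta> (est x) i) / (b * (1 / real (Suc m))))) \<longlonglongrightarrow>
        b * - ((est x j - \<theta> j) * orth_comp n (dcol x) (active p (est x)) (unit_vec' i) i
           + lres p (dcol x) (noise x) \<theta> (est x) i * dual_col n p (dcol x) (est x) j i)"
        by (intro tendsto_intros)
      then have R: "(\<lambda>m. (resid (?x m) i - resid x i) * real (Suc m)) \<longlonglongrightarrow>
        b * - ((est x j - \<theta> j) * orth_comp n (dcol x) (active p (est x)) (unit_vec' i) i
           + resid x i * dual_col n p (dcol x) (est x) j i)"
        using b_pos by (simp add: resid_def flow_noise del: of_nat_Suc)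
      have "(\<lambda>m. damping n (sz (?x m)) * ((resid (?x m) i - resid x i) * real (Suc m))
         + (damping n (sz (?x m)) - damping n (sz x)) * real (Suc m) * resid x i) \<longlonglongrightarrow> dA i x"
        unfolding dA_def by (intro tendsto_intros R damping_derivative[OF i])
      moreover have "damping n (sz (?x m)) * ((resid (?x m) i - resid x i) * real (Suc m))
         + (damping n (sz (?x m)) - damping n (sz x)) * real (Suc m) * resid x i =
          (fA i (?x m) - fA i x) * real (Suc m)" for m
        by (simp add: fA_def algebra_simps del: of_nat_Suc)
      ultimately show "(\<lambda>m. (fA i (?x m) - fA i x) * real (Suc m)) \<longlonglongrightarrow> dA i x" by simp
    qed
  qed
qed

lemma resid_le: "full x \<Longrightarrow> nrm n (resid x) \<le> noise_bound n p lam (noise x) \<theta>"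
  unfolding resid_def by (rule lmin_bounds(1)[OF n lam est])

text \<open>The flow leaves the noise and hence \<open>noise_bound\<close> unchanged. The factor
  \<open>1 / sqrt n\<close> of \<open>damped_residual_lipschitz\<close> offsets the summation over
  \<open>n\<close> shifts.\<close>

lemma fA_lipschitz:
  assumes \<eta>: "0 < \<eta>"
  shows "AE x in \<mu>. (\<Sum>k\<in>{..<n}. \<Sum>i\<in>{..<n}. (fA i x - fA i (flow k (- \<eta>) x))\<^sup>2) \<le> \<eta>\<^sup>2 * (9 * W x)"
proof -
  have "AE x in \<mu>. \<forall>k\<in>{..<n}. full (flow k (- \<eta>) x)"
    using AE_shift[OF _ AE_full] by (auto simp: AE_finite_all)
  then show ?thesis using AE_full
  proof eventually_elim
    case (elim x)
    define M where "M = noise_bound n p lam (noise x) \<theta>"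
    have M0: "0 \<le> M" unfolding M_def by (rule noise_bound_nonneg[OF lam])
    have "(\<Sum>i\<in>{..<n}. (fA i x - fA i (flow k (- \<eta>) x))\<^sup>2) \<le> 9 * W x * \<eta>\<^sup>2 / real n" if k': "k \<in> {..<n}" for k
    proof -
      have k: "k < n" using k' by simp
      let ?y = "flow k (- \<eta>) x"
      have e1: "lmin n p lam (dcol x) (noise x) \<theta> (est x)" by (rule est) (rule elim)
      have e2: "lmin n p lam (dcol ?y) (noise x) \<theta> (est ?y)"
        using est[of ?y] elim(1) k' by (simp add: flow_noise)
      have "nrm n (\<lambda>i. fA i ?y - fA i x) \<le> 3 * M * (sqrt (P j j) * nrm n (\<lambda>l. (b * - \<eta>) * unit_vec' k l)) / sqrt (real n)"
        using damped_residual_lipschitz[where c="dcol x" and c'="dcol ?y" and w="\<lambda>l. (b * - \<eta>) * unit_vec' k l",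
            OF n lam j Pjj _ _ e1 e2]
        by (simp add: fA_def sz_eq resid_def flow_noise M_def flow_col)
      also have "sqrt (P j j) * nrm n (\<lambda>l. (b * - \<eta>) * unit_vec' k l) = \<eta>"
      proof -
        have "nrm n (\<lambda>l. (b * - \<eta>) * unit_vec' k l) = b * \<eta>"
          unfolding nrm_scale using nrm_unit[OF k] b_pos \<eta> by (simp add: abs_mult)
        then show ?thesis using sqrt_b by (simp add: mult.assoc[symmetric])
      qed
      finally have "(nrm n (\<lambda>i. fA i ?y - fA i x))\<^sup>2 \<le> (3 * M * \<eta> / sqrt (real n))\<^sup>2"
        by (intro power_mono) auto
      also have "\<dots> = 9 * M\<^sup>2 * \<eta>\<^sup>2 / real n" by (simp add: power_divide power_mult_distrib)
      also have "\<dots> \<le> 9 * W x * \<eta>\<^sup>2 / real n"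
        using noise_bound_le_W[of x] by (intro divide_right_mono mult_right_mono) (auto simp: M_def)
      finally have "(nrm n (\<lambda>i. fA i ?y - fA i x))\<^sup>2 \<le> 9 * W x * \<eta>\<^sup>2 / real n" .
      moreover have "(\<Sum>i\<in>{..<n}. (fA i x - fA i ?y)\<^sup>2) = (nrm n (\<lambda>i. fA i ?y - fA i x))\<^sup>2"
        by (simp add: L2_set_def sum_nonneg power2_commute)
      ultimately show ?thesis by simp
    qed
    then have "(\<Sum>k\<in>{..<n}. \<Sum>i\<in>{..<n}. (fA i x - fA i (flow k (- \<eta>) x))\<^sup>2) \<le> (\<Sum>k\<in>{..<n}. 9 * W x * \<eta>\<^sup>2 / real n)"
      by (intro sum_mono)
    then show ?case using n by (simp add: mult_ac)
  qed
qed

lemma fA_sum_sq: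
  assumes "full x"
  shows "(\<Sum>i\<in>{..<n}. (fA i x)\<^sup>2) \<le> W x"
proof -
  have "(\<Sum>i\<in>{..<n}. (fA i x)\<^sup>2) = (nrm n (\<lambda>i. damping n (sz x) * resid x i))\<^sup>2"
    by (simp add: L2_set_def sum_nonneg fA_def)
  also have "\<dots> = (damping n (sz x) * nrm n (resid x))\<^sup>2" by (simp add: nrm_scale damping_bounds)
  also have "\<dots> \<le> (1 * noise_bound n p lam (noise x) \<theta>)\<^sup>2"
    using resid_le[OF assms] damping_bounds by (intro power_mono mult_mono) auto
  also have "\<dots> \<le> W x" using noise_bound_le_W[of x] by simp
  finally show ?thesis .
qed

text \<open>\<open>49 = 4 + 5 * 9\<close>, from \<open>fA_sum_sq\<close> and
  \<open>fA_lipschitz\<close>.\<close>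

lemma stein_fA:
  "(\<integral>\<^sup>+x. ennreal ((\<Sum>i\<in>{..<n}. score i x * fA i x - dA i x)\<^sup>2) \<partial>\<mu>) \<le> ennreal (49 * W0)"
proof -
  have fm: "fA i \<in> borel_measurable \<mu>" if "i < n" for i
    unfolding fA_def[abs_def] damping_def using that by measurable
  have f2: "integrable \<mu> (\<lambda>x. (fA i x)\<^sup>2)" if i: "i < n" for i
  proof (rule Bochner_Integration.integrable_bound[OF W(1)])
    show "(\<lambda>x. (fA i x)\<^sup>2) \<in> borel_measurable \<mu>" using fm[OF i] by measurable
    show "AE x in \<mu>. norm ((fA i x)\<^sup>2) \<le> norm (W x)"
      using AE_full
    proof eventually_elim
      case (elim x)
      have "(fA i x)\<^sup>2 \<le> (\<Sum>i\<in>{..<n}. (fA i x)\<^sup>2)" using i by (intro member_le_sum) auto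
      then show ?case using fA_sum_sq[OF elim] by simp
    qed
  qed
  have "(\<integral>\<^sup>+x. ennreal ((\<Sum>i\<in>{..<n}. score i x * fA i x - dA i x)\<^sup>2) \<partial>\<mu>) \<le>
     ennreal (4 * (\<integral>x. (\<Sum>i\<in>{..<n}. (fA i x)\<^sup>2) \<partial>\<mu>) + 5 * (\<integral>x. 9 * W x \<partial>\<mu>))"
  proof (rule stein_second_order)
    show "integrable \<mu> (\<lambda>x. 9 * W x)" using W(1) by auto
  qed (use fm f2 fA_lipschitz fA_derivative in auto)
  also have "\<dots> \<le> ennreal (49 * W0)"
  proof (rule ennreal_leI)
    have "(\<integral>x. (\<Sum>i\<in>{..<n}. (fA i x)\<^sup>2) \<partial>\<mu>) \<le> (\<integral>x. W x \<partial>\<mu>)"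
      using f2 W(1) AE_full fA_sum_sq by (intro integral_mono_AE) (auto elim: eventually_mono)
    then show "4 * (\<integral>x. (\<Sum>i\<in>{..<n}. (fA i x)\<^sup>2) \<partial>\<mu>) + 5 * (\<integral>x. 9 * W x \<partial>\<mu>) \<le> 49 * W0"
      using W by simp
  qed
  finally show ?thesis .
qed

text \<open>The projection orthogonal to the active columns has trace \<open>n\<close> minus their
  number. This completes the pairing of score and residual to \<open>deb\<close>; the dual column
  and the derivative of the damping leave remainders.\<close>

lemma deb_identity:
  assumes f: "full x"
  shows "(\<Sum>i\<in>{..<n}. score i x * fA i x - dA i x) = damping n (sz x) * deb x
     + damping n (sz x) * (b * ip n (resid x) (dual_col n p (dcol x) (est x) j))
     - 2 * real n * ip n (perp x) (resid x) / (real n + (sz x)\<^sup>2)\<^sup>2"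
proof -
  let ?\<psi> = "damping n (sz x)" and ?q = "dual_col n p (dcol x) (est x) j"
  let ?h = "est x j - \<theta> j" and ?O = "orth_comp n (dcol x) (active p (est x))"
  have tr: "(\<Sum>i<n. ?O (unit_vec' i) i) = real n - real (length (active p (est x)))"
  proof -
    have "orth_trace n (dcol x) (active p (est x)) = real n - real (length (active p (est x)))"
      using f by (intro orth_trace_eq[where p=p]) (auto simp: full_def set_active, simp add: active_def)
    then show ?thesis by (simp add: orth_trace_def)
  qed
  have "(\<Sum>i\<in>{..<n}. score i x * fA i x - dA i x) =
     (\<Sum>i<n. ?\<psi> * (score i x * resid x i) + ?\<psi> * (b * ?h) * ?O (unit_vec' i) i + ?\<psi> * b * (resid x i * ?q i)
        - 2 * real n / (real n + (sz x)\<^sup>2)\<^sup>2 * (perp x i * resid x i))"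
    by (intro sum.cong refl) (simp add: fA_def dA_def algebra_simps)
  also have "\<dots> = ?\<psi> * ip n (\<lambda>l. score l x) (resid x) + ?\<psi> * (b * ?h) * (\<Sum>i<n. ?O (unit_vec' i) i)
     + ?\<psi> * b * ip n (resid x) ?q - 2 * real n / (real n + (sz x)\<^sup>2)\<^sup>2 * ip n (perp x) (resid x)"
    by (simp only: sum_subtractf sum.distrib sum_distrib_left[symmetric] ip_def)
  finally show ?thesis unfolding tr deb_def by (simp add: algebra_simps)
qed

text \<open>The remainders are at most \<open>M / 2\<close> and \<open>M\<close>: in the first the
  damping cancels the norm of the dual column, and the second uses
  \<open>2 * n * sz x \<le> (n + (sz x)\<^sup>2)\<^sup>2\<close>. Squaring their sum gives
  \<open>2 * (3/2)\<^sup>2 \<le> 5\<close>.\<close>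

lemma deb_pointwise:
  assumes f: "full x"
  shows "(damping n (sz x) * deb x)\<^sup>2 \<le> 2 * (\<Sum>i\<in>{..<n}. score i x * fA i x - dA i x)\<^sup>2 + 5 * W x"
proof -
  define T where "T = (\<Sum>i\<in>{..<n}. score i x * fA i x - dA i x)"
  define M where "M = noise_bound n p lam (noise x) \<theta>"
  define q where "q = dual_col n p (dcol x) (est x) j"
  let ?\<psi> = "damping n (sz x)"
  have M0: "0 \<le> M" unfolding M_def by (rule noise_bound_nonneg[OF lam])
  have rM: "nrm n (resid x) \<le> M" using resid_le[OF f] by (simp add: M_def)
  have rn: "1 \<le> sqrt (real n)" using n by simp
  have "nrm n (orth_comp n (dcol x) (others p j) (dcol x j)) \<noteq> 0" using f j by (auto simp: full_def indep_cols_def)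
  then have ypos: "0 < nrm n (orth_comp n (dcol x) (others p j) (dcol x j))"
    using nrm_nonneg[where n=n and u="orth_comp n (dcol x) (others p j) (dcol x j)"] by linarith
  then have szpos: "0 < sz x" unfolding sz_eq using Pjj by simp
  have bq: "b * nrm n q * sz x \<le> 1"
  proof -
    have "b * nrm n q * sz x = nrm n q * nrm n (orth_comp n (dcol x) (others p j) (dcol x j))"
    proof -
      have "b * nrm n q * (sqrt (P j j) * y) = (sqrt (P j j) * b) * (nrm n q * y)" for y by (simp only: mult_ac)
      then show ?thesis unfolding sz_eq sqrt_b by simp
    qed
    also have "\<dots> \<le> 1" unfolding q_def using f by (intro nrm_dual_col_le j) (simp add: full_def)
    finally show ?thesis .
  qed
  have e1: "\<bar>?\<psi> * (b * ip n (resid x) q)\<bar> \<le> M / 2"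
  proof -
    have "\<bar>?\<psi> * (b * ip n (resid x) q)\<bar> = ?\<psi> * b * \<bar>ip n (resid x) q\<bar>"
      using damping_bounds b_pos by (simp add: abs_mult)
    also have "\<dots> \<le> ?\<psi> * b * (nrm n (resid x) * nrm n q)"
      using damping_bounds b_pos by (intro mult_left_mono ip_le_nrm mult_nonneg_nonneg) auto
    also have "\<dots> \<le> (sz x / (2 * sqrt (real n))) * b * (M * nrm n q)"
      using damping_bounds b_pos rM M0 n szpos by (intro mult_mono damping_le) auto
    also have "\<dots> = M / (2 * sqrt (real n)) * (b * nrm n q * sz x)" by simp
    also have "\<dots> \<le> M / (2 * sqrt (real n)) * 1" using bq M0 by (intro mult_left_mono) auto
    also have "\<dots> \<le> M / 2" using M0 rn mult_left_mono[OF rn M0] by (simp add: field_simps)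
    finally show ?thesis .
  qed
  have e2: "\<bar>2 * real n * ip n (perp x) (resid x) / (real n + (sz x)\<^sup>2)\<^sup>2\<bar> \<le> M"
  proof -
    define N where "N = real n + (sz x)\<^sup>2"
    have N: "0 < N" "real n \<le> N" using n by (auto simp: N_def add_pos_nonneg)
    have "2 * sz x \<le> N"
    proof -
      have "2 * sz x \<le> 1 + (sz x)\<^sup>2" using sum_squares_bound[of 1 "sz x"] by simp
      also have "\<dots> \<le> N" using n by (simp add: N_def)
      finally show ?thesis .
    qed
    then have "real n * (2 * sz x) \<le> N * N" using N by (intro mult_mono) auto
    then have k: "2 * real n * sz x / N\<^sup>2 \<le> 1" using N by (simp add: power2_eq_square divide_le_eq mult_ac)
    have "\<bar>2 * real n * ip n (perp x) (resid x) / N\<^sup>2\<bar> = 2 * real n / N\<^sup>2 * \<bar>ip n (perp x) (resid x)\<bar>"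
      by (simp add: abs_mult)
    also have "\<dots> \<le> 2 * real n / N\<^sup>2 * (sz x * nrm n (resid x))" by (intro mult_left_mono ip_le_nrm) auto
    also have "\<dots> \<le> 2 * real n / N\<^sup>2 * (sz x * M)" using rM by (intro mult_left_mono) auto
    also have "\<dots> = (2 * real n * sz x / N\<^sup>2) * M" by simp
    also have "\<dots> \<le> 1 * M" using k M0 by (intro mult_right_mono) auto
    finally show ?thesis by (simp add: N_def)
  qed
  define e where "e = 2 * real n * ip n (perp x) (resid x) / (real n + (sz x)\<^sup>2)\<^sup>2 - ?\<psi> * (b * ip n (resid x) q)"
  have "\<bar>e\<bar> \<le> M + M / 2" unfolding e_def by (rule order_trans[OF abs_triangle_ineq4 add_mono[OF e2 e1]])
  then have "\<bar>e\<bar> \<le> 3 / 2 * M" by simp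
  then have "e\<^sup>2 \<le> (3 / 2 * M)\<^sup>2" by (metis abs_ge_zero power2_abs power_mono)
  also have "\<dots> \<le> 9 / 4 * W x" using noise_bound_le_W[of x] by (simp add: M_def power_mult_distrib power2_eq_square)
  finally have e: "e\<^sup>2 \<le> 9 / 4 * W x" .
  have "?\<psi> * deb x = T + e" using deb_identity[OF f] by (simp add: T_def e_def q_def)
  then have "(?\<psi> * deb x)\<^sup>2 \<le> 2 * T\<^sup>2 + 2 * e\<^sup>2"
    using zero_le_power2[of "T - e"] by (simp add: power2_eq_square algebra_simps)
  also have "\<dots> \<le> 2 * T\<^sup>2 + 5 * W x"
    using e order_trans[OF zero_le_power2 noise_bound_le_W[of x]] by simp
  finally show ?thesis by (simp add: T_def)
qed

text \<open>\<open>103 = 2 * 49 + 5\<close>, by \<open>deb_pointwise\<close> and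
  \<open>stein_fA\<close>.\<close>

lemma deb_damped_second_moment:
  "(\<integral>\<^sup>+x. ennreal ((damping n (sz x) * deb x)\<^sup>2) \<partial>\<mu>) \<le> ennreal (103 * W0)"
proof -
  let ?u = "\<lambda>x. (damping n (sz x) * deb x)\<^sup>2"
  \<comment> \<open>Measurability of \<open>dA\<close> is not at hand, so additivity of the integral
    is applied to a measurable function below the squared Stein sum.\<close>
  define v where "v = (\<lambda>x. max 0 (?u x - 5 * W x) / 2)"
  have um[measurable]: "?u \<in> borel_measurable \<mu>" unfolding damping_def by measurable
  have [measurable]: "W \<in> borel_measurable \<mu>" using W(1) by auto
  have vm[measurable]: "v \<in> borel_measurable \<mu>" unfolding v_def by measurable
  have "(\<integral>\<^sup>+x. ennreal (v x) \<partial>\<mu>) \<le> (\<integral>\<^sup>+x. ennreal ((\<Sum>i\<in>{..<n}. score i x * fA i x - dA i x)\<^sup>2) \<partial>\<mu>)"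
  proof (rule nn_integral_mono_AE)
    show "AE x in \<mu>. ennreal (v x) \<le> ennreal ((\<Sum>i\<in>{..<n}. score i x * fA i x - dA i x)\<^sup>2)"
      using AE_full
    proof eventually_elim
      case (elim x)
      show ?case using deb_pointwise[OF elim] by (intro ennreal_leI) (auto simp: v_def)
    qed
  qed
  also note stein_fA
  finally have v: "(\<integral>\<^sup>+x. ennreal (v x) \<partial>\<mu>) \<le> ennreal (49 * W0)" .
  have W0': "0 \<le> W x" for x using order_trans[OF zero_le_power2 noise_bound_le_W[of x]] .
  have W00: "0 \<le> W0" using W(2) W0' by (metis integral_nonneg_AE always_eventually)
  have "(\<integral>\<^sup>+x. ennreal (?u x) \<partial>\<mu>) \<le> (\<integral>\<^sup>+x. 2 * ennreal (v x) + 5 * ennreal (W x) \<partial>\<mu>)"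
  proof (rule nn_integral_mono)
    fix x
    have "?u x \<le> 2 * v x + 5 * W x" by (auto simp: v_def)
    then have "ennreal (?u x) \<le> ennreal (2 * v x + 5 * W x)" by (rule ennreal_leI)
    also have "\<dots> = ennreal (2 * v x) + ennreal (5 * W x)"
      using W0'[of x] by (intro ennreal_plus) (simp_all add: v_def)
    also have "ennreal (2 * v x) = 2 * ennreal (v x)"
      by (subst ennreal_mult) (simp_all add: v_def)
    also have "ennreal (5 * W x) = 5 * ennreal (W x)"
      using W0'[of x] by (subst ennreal_mult) simp_all
    finally show "ennreal (?u x) \<le> 2 * ennreal (v x) + 5 * ennreal (W x)" .
  qed
  also have "\<dots> = 2 * (\<integral>\<^sup>+x. ennreal (v x) \<partial>\<mu>) + 5 * (\<integral>\<^sup>+x. ennreal (W x) \<partial>\<mu>)"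
    by (simp add: nn_integral_add nn_integral_cmult)
  also have "(\<integral>\<^sup>+x. ennreal (W x) \<partial>\<mu>) = ennreal W0"
    using W W0' by (subst nn_integral_eq_integral) auto
  also have "2 * (\<integral>\<^sup>+x. ennreal (v x) \<partial>\<mu>) + 5 * ennreal W0 \<le> 2 * ennreal (49 * W0) + 5 * ennreal W0"
    using v by (intro add_right_mono mult_left_mono) auto
  also have "2 * ennreal (49 * W0) = ennreal (2 * (49 * W0))" using W00 by (subst (2) ennreal_mult) auto
  also have "5 * ennreal W0 = ennreal (5 * W0)" using W00 by (subst ennreal_mult) auto
  also have "ennreal (2 * (49 * W0)) + ennreal (5 * W0) = ennreal (2 * (49 * W0) + 5 * W0)"
    using W00 by (intro ennreal_plus[symmetric]) auto
  finally show ?thesis by simp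
qed

text \<open>Two Markov bounds undo the damping. Where \<open>(sz x)\<^sup>2\<close> is within
  \<open>(n - p) / 2\<close> of its trace, which is at least \<open>n - p\<close>, the damping is at
  least \<open>(n - p) / (3 * n)\<close>, and there the damped second moment controls
  \<open>deb\<close>.\<close>

theorem deb_tail:
  assumes Kc: "0 < Kc"
  shows "\<exists>B\<in>sets \<mu>. emeasure \<mu> B \<le> ennreal (84 * real n / (real n - real p)\<^sup>2
       + 9 * (real n)\<^sup>2 * (103 * W0) / (Kc\<^sup>2 * (real n - real p) ^ 4)) \<and>
     (\<forall>x\<in>space \<mu> - B. full x \<and> \<bar>deb x\<bar> \<le> Kc * (real n - real p))"
proof -
  define g where "g = real n - real p"
  have g: "0 < g" "g \<le> real n" using pn by (simp_all add: g_def)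
  let ?tr = "\<lambda>x. orth_trace n (dcol x) (others p j)"
  let ?u1 = "\<lambda>x. ((sz x)\<^sup>2 - ?tr x)\<^sup>2" and ?u2 = "\<lambda>x. (damping n (sz x) * deb x)\<^sup>2"
  have [measurable]: "?tr \<in> borel_measurable \<mu>"
    unfolding orth_trace_def by (intro borel_measurable_sum orth_comp_measurable col_measurable) (auto simp: set_others)
  have [measurable]: "?u2 \<in> borel_measurable \<mu>" unfolding damping_def by measurable
  \<comment> \<open>\<open>c1\<close> and \<open>c2\<close> are the inverse squares of the Markov
    levels: \<open>g / 2\<close> for the norm, and \<open>Kc * g\<close> times the damping bound
    \<open>g / (3 * n)\<close> for the error.\<close>
  define c1 where "c1 = 4 / g\<^sup>2"
  define c2 where "c2 = 9 * (real n)\<^sup>2 / (Kc\<^sup>2 * g ^ 4)"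
  have c: "0 < c1" "0 < c2" using g n Kc by (auto simp: c1_def c2_def)
  define B1 where "B1 = {x \<in> space \<mu>. 1 \<le> ennreal c1 * ennreal (?u1 x)}"
  define B2 where "B2 = {x \<in> space \<mu>. 1 \<le> ennreal c2 * ennreal (?u2 x)}"
  define B3 where "B3 = {x \<in> space \<mu>. \<not> full x}"
  have [measurable]: "B1 \<in> sets \<mu>" "B2 \<in> sets \<mu>" "B3 \<in> sets \<mu>"
    unfolding B1_def B2_def B3_def by measurable
  have W00: "0 \<le> W0"
    using W(2) order_trans[OF zero_le_power2 noise_bound_le_W] by (metis integral_nonneg_AE always_eventually)
  have mk: "emeasure \<mu> {x \<in> space \<mu>. 1 \<le> ennreal cc * ennreal (u x)} \<le> ennreal (cc * bb)"
    if "u \<in> borel_measurable \<mu>" "(\<integral>\<^sup>+x. ennreal (u x) \<partial>\<mu>) \<le> ennreal bb" "0 < cc" "0 \<le> bb" for u cc bb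
  proof -
    have "emeasure \<mu> ({x \<in> space \<mu>. 1 \<le> ennreal cc * ennreal (u x)}) \<le> ennreal cc * (\<integral>\<^sup>+x. ennreal (u x) * indicator (space \<mu>) x \<partial>\<mu>)"
      using nn_integral_Markov_inequality[of "\<lambda>x. ennreal (u x)" "space \<mu>" \<mu> "ennreal cc"] that(1) by (simp add: Int_def conj_commute)
    also have "(\<integral>\<^sup>+x. ennreal (u x) * indicator (space \<mu>) x \<partial>\<mu>) = (\<integral>\<^sup>+x. ennreal (u x) \<partial>\<mu>)"
      by (intro nn_integral_cong) auto
    also have "ennreal cc * \<dots> \<le> ennreal cc * ennreal bb" using that by (intro mult_left_mono) auto
    finally show ?thesis using that by (simp add: ennreal_mult)
  qed
  have b1: "emeasure \<mu> B1 \<le> ennreal (c1 * (21 * real n))"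
    unfolding B1_def by (rule mk[OF _ chi_square_bound c(1)]) auto
  have b2: "emeasure \<mu> B2 \<le> ennreal (c2 * (103 * W0))"
    unfolding B2_def by (rule mk[OF _ deb_damped_second_moment c(2)]) (use W00 in auto)
  have "B3 \<in> null_sets \<mu>" using AE_full by (simp add: B3_def AE_iff_null)
  then have b3: "emeasure \<mu> B3 = 0" by auto
  have "emeasure \<mu> (B1 \<union> B2 \<union> B3) \<le> emeasure \<mu> B1 + emeasure \<mu> B2 + emeasure \<mu> B3"
    by (intro order_trans[OF emeasure_subadditive] add_mono emeasure_subadditive) auto
  also have "\<dots> \<le> ennreal (c1 * (21 * real n)) + ennreal (c2 * (103 * W0))" using b1 b2 b3 by (simp add: add_mono)
  also have "\<dots> = ennreal (c1 * (21 * real n) + c2 * (103 * W0))" using c W00 by (simp add: ennreal_plus)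
  also have "c1 * (21 * real n) + c2 * (103 * W0) = 84 * real n / (real n - real p)\<^sup>2
       + 9 * (real n)\<^sup>2 * (103 * W0) / (Kc\<^sup>2 * (real n - real p) ^ 4)" by (simp add: c1_def c2_def g_def)
  finally have em: "emeasure \<mu> (B1 \<union> B2 \<union> B3) \<le> ennreal (84 * real n / (real n - real p)\<^sup>2
       + 9 * (real n)\<^sup>2 * (103 * W0) / (Kc\<^sup>2 * (real n - real p) ^ 4))" .
  have "full x \<and> \<bar>deb x\<bar> \<le> Kc * (real n - real p)" if x: "x \<in> space \<mu> - (B1 \<union> B2 \<union> B3)" for x
  proof
    show "full x" using x by (simp add: B3_def)
    have "\<not> 1 \<le> ennreal (c1 * ?u1 x)" using x c by (simp add: B1_def ennreal_mult)
    then have "c1 * ?u1 x < 1" by (metis ennreal_1 ennreal_leI not_le)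
    then have "((sz x)\<^sup>2 - ?tr x)\<^sup>2 < (g / 2)\<^sup>2" using g by (simp add: c1_def field_simps power2_eq_square)
    then have "\<bar>(sz x)\<^sup>2 - ?tr x\<bar> < g / 2" using g power2_less_imp_less[of "\<bar>(sz x)\<^sup>2 - ?tr x\<bar>" "g / 2"] by simp
    moreover have "g \<le> ?tr x" using orth_trace_ge[of n "others p j" "dcol x"] length_others[OF j] by (simp add: g_def)
    ultimately have N: "g / 2 \<le> (sz x)\<^sup>2" by linarith
    have \<psi>: "g / (3 * real n) \<le> damping n (sz x)"
    proof -
      have d: "0 < real n + (sz x)\<^sup>2" using n by (simp add: add_pos_nonneg)
      \<comment> \<open>\<open>g \<le> n\<close> is used for one term,
        \<open>g \<le> 2 * (sz x)\<^sup>2\<close> for the other.\<close>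
      have "g * (real n + (sz x)\<^sup>2) \<le> g * real n + real n * (sz x)\<^sup>2"
        using g by (simp add: distrib_left mult_right_mono)
      also have "\<dots> \<le> 2 * (sz x)\<^sup>2 * real n + real n * (sz x)\<^sup>2" using N n by (intro add_right_mono mult_right_mono) auto
      finally have "g * (real n + (sz x)\<^sup>2) \<le> (sz x)\<^sup>2 * (3 * real n)" by (simp add: mult_ac)
      then show ?thesis using d n by (simp add: damping_def divide_le_eq le_divide_eq mult_ac)
    qed
    have "\<not> 1 \<le> ennreal (c2 * ?u2 x)" using x c by (simp add: B2_def ennreal_mult)
    then have u2: "c2 * ?u2 x < 1" by (metis ennreal_1 ennreal_leI not_le)
    show "\<bar>deb x\<bar> \<le> Kc * (real n - real p)"
    proof (rule ccontr)
      assume "\<not> \<bar>deb x\<bar> \<le> Kc * (real n - real p)"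
      then have "Kc * g \<le> \<bar>deb x\<bar>" by (simp add: g_def)
      then have "(g / (3 * real n)) * (Kc * g) \<le> damping n (sz x) * \<bar>deb x\<bar>"
        using \<psi> g n Kc damping_bounds by (intro mult_mono) auto
      then have "((g / (3 * real n)) * (Kc * g))\<^sup>2 \<le> (damping n (sz x) * \<bar>deb x\<bar>)\<^sup>2"
        using g n Kc by (intro power_mono) auto
      then have "((g / (3 * real n)) * (Kc * g))\<^sup>2 \<le> ?u2 x" by (simp add: power_mult_distrib)
      then have "c2 * ((g / (3 * real n)) * (Kc * g))\<^sup>2 \<le> c2 * ?u2 x" using c by (intro mult_left_mono) auto
      moreover have "c2 * ((g / (3 * real n)) * (Kc * g))\<^sup>2 = 1"
        using g n Kc by (simp add: c2_def field_simps power2_eq_square power4_eq_xxxx)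
      ultimately show False using u2 by linarith
    qed
  qed
  then show ?thesis using em by (intro bexI[of _ "B1 \<union> B2 \<union> B3"]) auto
qed

end

subsection \<open>From random matrices to the product law\<close>

text \<open>A kernel vector would annihilate the quadratic form, so the determinant is nonzero and
  \<open>mat_inverse\<close> returns a value.\<close>

lemma pos_def_precision:
  assumes S: "pos_def_mat p S"
  shows "precision_mat S \<in> carrier_mat p p" and "S * precision_mat S = 1\<^sub>m p" and "precision_mat S * S = 1\<^sub>m p"
proof -
  have Sc: "S \<in> carrier_mat p p" using S by (simp add: pos_def_mat_def)
  have "Determinant.det S \<noteq> 0"
  proof
    assume "Determinant.det S = 0"
    then obtain v where v: "v \<in> carrier_vec p" "v \<noteq> 0\<^sub>v p" "S *\<^sub>v v = 0\<^sub>v p"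
      using det_0_iff_vec_prod_zero_field[OF Sc] by blast
    then have "0 < scalar_prod v (S *\<^sub>v v)" using S unfolding pos_def_mat_def by blast
    then show False using v by simp
  qed
  then have "S \<in> Units (ring_mat TYPE(real) p ())" by (rule det_non_zero_imp_unit[OF Sc])
  then have "mat_inverse S \<noteq> None"
    using mat_inverse(1)[OF Sc, where b="()"] by blast
  then obtain B where B: "mat_inverse S = Some B" by blast
  from mat_inverse(2)[OF Sc B] B
  show "precision_mat S \<in> carrier_mat p p" "S * precision_mat S = 1\<^sub>m p" "precision_mat S * S = 1\<^sub>m p"
    by (auto simp: precision_mat_def)
qed

lemma precision_mat_symmetric:
  assumes S: "pos_def_mat p S" and k: "k < p" "l < p"
  shows "precision_mat S $$ (k, l) = precision_mat S $$ (l, k)"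
proof -
  let ?P = "precision_mat S"
  note P = pos_def_precision[OF S]
  have Sc: "S \<in> carrier_mat p p" and St: "transpose_mat S = S" using S by (simp_all add: pos_def_mat_def)
  have Pt: "transpose_mat ?P \<in> carrier_mat p p" using P by simp
  have "transpose_mat ?P * S = transpose_mat (S * ?P)"
    using transpose_mult[OF Sc P(1)] St by simp
  also have "\<dots> = 1\<^sub>m p" using P by simp
  finally have e: "transpose_mat ?P * S = 1\<^sub>m p" .
  have "transpose_mat ?P = transpose_mat ?P * (S * ?P)" using P Pt by simp
  also have "\<dots> = transpose_mat ?P * S * ?P" using Pt Sc P(1) by (simp add: assoc_mult_mat[of _ p p _ p _ p])
  also have "\<dots> = ?P" using e P(1) by simp
  finally have "transpose_mat ?P $$ (l, k) = ?P $$ (l, k)" by simp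
  then show ?thesis using k P(1) by simp
qed

text \<open>The diagonal entry is the quadratic form of \<open>S\<close> at column \<open>j\<close>
  of the inverse.\<close>

lemma precision_mat_diag_pos:
  assumes S: "pos_def_mat p S" and j: "j < p"
  shows "0 < precision_mat S $$ (j, j)"
proof -
  let ?P = "precision_mat S"
  note P = pos_def_precision[OF S]
  have Sc: "S \<in> carrier_mat p p" using S by (simp add: pos_def_mat_def)
  define w where "w = ?P *\<^sub>v unit_vec p j"
  have w: "w \<in> carrier_vec p" using P by (simp add: w_def)
  have Sw: "S *\<^sub>v w = unit_vec p j"
    unfolding w_def using P Sc by (simp add: assoc_mult_mat_vec[symmetric, of _ p p _ p])
  have "w \<noteq> 0\<^sub>v p"
  proof
    assume "w = 0\<^sub>v p"
    then have "vec_index (unit_vec p j :: real vec) j = vec_index (S *\<^sub>v 0\<^sub>v p) j" using Sw by simp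
    also have "\<dots> = 0" using Sc j by simp
    finally show False using j by simp
  qed
  then have "0 < scalar_prod w (S *\<^sub>v w)" using S w by (simp add: pos_def_mat_def)
  also have "\<dots> = vec_index w j" unfolding Sw using w j by simp
  also have "\<dots> = ?P $$ (j, j)" using P j by (simp add: w_def)
  finally show ?thesis .
qed

lemma mvn_law_eq_row_law:
  assumes S: "pos_def_mat p S"
  shows "mvn_law p S = row_law p (\<lambda>k l. precision_mat S $$ (k, l)) (1 / sqrt ((2 * pi) ^ p * Determinant.det S))"
proof -
  let ?P = "precision_mat S"
  have P: "?P \<in> carrier_mat p p" by (rule pos_def_precision[OF S])
  have "scalar_prod (Matrix.vec p x) (?P *\<^sub>v Matrix.vec p x) = quad_form p (\<lambda>k l. ?P $$ (k, l)) x" for x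
    using P by (auto simp: scalar_prod_def quad_form_def sum_distrib_left lessThan_atLeast0 mult.assoc intro!: sum.cong)
  then show ?thesis by (simp add: mvn_law_def row_law_def Let_def)
qed

definition data_map :: "nat \<Rightarrow> nat \<Rightarrow> ('w \<Rightarrow> real mat) \<Rightarrow> ('w \<Rightarrow> real vec) \<Rightarrow> 'w \<Rightarrow> nat \<Rightarrow> (nat \<Rightarrow> real) \<times> real" where
  "data_map m p X \<xi> \<omega> = (\<lambda>i\<in>{..<m}. (design_row p X i \<omega>, vec_index (\<xi> \<omega>) i))"

lemma data_map_components:
  assumes "i < m"
  shows "k < p \<Longrightarrow> dcol (data_map m p X \<xi> \<omega>) k i = X \<omega> $$ (i, k)" and "noise (data_map m p X \<xi> \<omega>) i = vec_index (\<xi> \<omega>) i"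
  using assms by (simp_all add: data_map_def dcol_def noise_def design_row_def)

text \<open>That \<open>row_law\<close> has mass 1 is read off from the first observation: its joint
  law with the noise is a probability and the noise factor has mass 1. This replaces the evaluation
  of a multivariate Gaussian integral.\<close>

lemma data_map_law:
  assumes M: "prob_space M" and S: "pos_def_mat p S" and g: "gaussian_data M m p S s X \<xi>" and m: "0 < m" and s: "0 < s"
  defines "P \<equiv> (\<lambda>k l. precision_mat S $$ (k, l))" and "K \<equiv> 1 / sqrt ((2 * pi) ^ p * Determinant.det S)"
  shows "prob_space (row_law p P K)"
    and "data_map m p X \<xi> \<in> measurable M (data_law m p P K s)"
    and "distr M (data_law m p P K s) (data_map m p X \<xi>) = data_law m p P K s"
proof -
  interpret prob_space M by (rule M)
  let ?B = "Pi\<^sub>M {..<p} (\<lambda>_. borel) \<Otimes>\<^sub>M (borel :: real measure)"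
  let ?Z = "\<lambda>i \<omega>. (design_row p X i \<omega>, vec_index (\<xi> \<omega>) i)"
  have iv: "indep_vars (\<lambda>_. ?B) ?Z {..<m}" using g by (simp add: gaussian_data_def)
  then have rv: "random_variable ?B (?Z i)" if "i < m" for i using that by (simp add: indep_vars_def)
  have law: "distr M ?B (?Z i) = row_law p P K \<Otimes>\<^sub>M noise_law s" if "i < m" for i
    using g that mvn_law_eq_row_law[OF S] by (simp add: gaussian_data_def P_def K_def noise_law_def)
  interpret N: prob_space "noise_law s" unfolding noise_law_def using s by (rule prob_space_normal_density)
  have "prob_space (distr M ?B (?Z 0))" using rv m by (intro prob_space_distr) auto
  then have "emeasure (row_law p P K \<Otimes>\<^sub>M noise_law s) (space (row_law p P K) \<times> space (noise_law s)) = 1"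
    using law[of 0] m prob_space.emeasure_space_1 by (fastforce simp: space_pair_measure)
  then have "emeasure (row_law p P K) (space (row_law p P K)) * emeasure (noise_law s) (space (noise_law s)) = 1"
    by (subst (asm) N.emeasure_pair_measure_Times) auto
  then show "prob_space (row_law p P K)" by (intro prob_spaceI) (simp only: N.emeasure_space_1 mult_1_right)
  have sets: "sets (Pi\<^sub>M {..<m} (\<lambda>_. ?B)) = sets (data_law m p P K s)" by (simp add: sets_data_law)
  have meas: "data_map m p X \<xi> \<in> measurable M (Pi\<^sub>M {..<m} (\<lambda>_. ?B))"
    unfolding data_map_def[abs_def] using rv by (intro measurable_restrict) auto
  then show "data_map m p X \<xi> \<in> measurable M (data_law m p P K s)"
    using sets by (simp add: measurable_cong_sets[OF refl sets])
  have "distr M (Pi\<^sub>M {..<m} (\<lambda>_. ?B)) (data_map m p X \<xi>) = Pi\<^sub>M {..<m} (\<lambda>i. distr M ?B (?Z i))"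
    unfolding data_map_def[abs_def] using iv rv m
    by (subst indep_vars_iff_distr_eq_PiM'[symmetric]) auto
  also have "\<dots> = data_law m p P K s"
    unfolding data_law_def by (rule PiM_cong) (auto simp: law)
  finally show "distr M (data_law m p P K s) (data_map m p X \<xi>) = data_law m p P K s"
    using distr_cong[OF refl sets[symmetric], of M "data_map m p X \<xi>" "data_map m p X \<xi>"] by simp
qed

lemma response_residual:
  assumes "A \<in> carrier_mat m p" "x \<in> carrier_vec m" "\<theta> \<in> carrier_vec p" "t \<in> carrier_vec p" "i < m"
  shows "vec_index (response A \<theta> x - A *\<^sub>v t) i = vec_index x i - (\<Sum>k<p. (vec_index t k - vec_index \<theta> k) * A $$ (i, k))"
proof -
  have "(\<Sum>k<p. (vec_index t k - vec_index \<theta> k) * A $$ (i, k)) =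
     (\<Sum>k<p. A $$ (i, k) * vec_index t k) - (\<Sum>k<p. A $$ (i, k) * vec_index \<theta> k)"
    by (simp add: sum_subtractf[symmetric] algebra_simps)
  then show ?thesis using assms by (simp add: response_def scalar_prod_def lessThan_atLeast0)
qed

lemma debiased_coordinate:
  assumes A: "A \<in> carrier_mat m p" and x: "x \<in> carrier_vec m" and \<theta>: "\<theta> \<in> carrier_vec p" and t: "t \<in> carrier_vec p"
    and P: "precision_mat S \<in> carrier_mat p p" and j: "j < p"
  shows "vec_index (debiased S A (response A \<theta> x) t) j = vec_index t j + debias_factor m t / real m *
     (\<Sum>k<p. precision_mat S $$ (j, k) * (\<Sum>i<m. A $$ (i, k) *
        (vec_index x i - (\<Sum>l<p. (vec_index t l - vec_index \<theta> l) * A $$ (i, l)))))"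
proof -
  let ?r = "response A \<theta> x - A *\<^sub>v t"
  have r: "?r \<in> carrier_vec m" using A x \<theta> t by (simp add: response_def)
  have "vec_index (transpose_mat A *\<^sub>v ?r) k = (\<Sum>i<m. A $$ (i, k) *
        (vec_index x i - (\<Sum>l<p. (vec_index t l - vec_index \<theta> l) * A $$ (i, l))))" if k: "k < p" for k
  proof -
    have "vec_index (transpose_mat A *\<^sub>v ?r) k = (\<Sum>i<m. A $$ (i, k) * vec_index ?r i)"
      using A r k by (simp add: scalar_prod_def lessThan_atLeast0 carrier_vecD[OF r])
    then show ?thesis using response_residual[OF A x \<theta> t] by simp
  qed
  then have "vec_index (precision_mat S *\<^sub>v (transpose_mat A *\<^sub>v ?r)) j =
     (\<Sum>k<p. precision_mat S $$ (j, k) * (\<Sum>i<m. A $$ (i, k) *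
        (vec_index x i - (\<Sum>l<p. (vec_index t l - vec_index \<theta> l) * A $$ (i, l)))))"
    using A P j by (simp add: scalar_prod_def lessThan_atLeast0)
  then show ?thesis using A P t j by (simp add: debiased_def)
qed

lemma debiased_carrier:
  assumes "A \<in> carrier_mat m p" "precision_mat S \<in> carrier_mat p p"
  shows "debiased S A y t \<in> carrier_vec p"
  using assms by (intro carrier_vecI) (simp add: debiased_def)

lemma is_lasso_carrier: "is_lasso lam A y t \<Longrightarrow> A \<in> carrier_mat m p \<Longrightarrow> t \<in> carrier_vec p"
  by (simp add: is_lasso_def is_arg_min_def)

lemma lasso_objective_eq_lobj:
  assumes A: "X \<omega> \<in> carrier_mat m p" and x: "\<xi> \<omega> \<in> carrier_vec m" and \<theta>: "\<theta> \<in> carrier_vec p" and t: "t \<in> carrier_vec p"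
  shows "lasso_objective lam (X \<omega>) (response (X \<omega>) \<theta> (\<xi> \<omega>)) t =
     lobj m p lam (dcol (data_map m p X \<xi> \<omega>)) (noise (data_map m p X \<xi> \<omega>)) (vec_index \<theta>) (vec_index t)"
proof -
  let ?r = "response (X \<omega>) \<theta> (\<xi> \<omega>) - X \<omega> *\<^sub>v t"
  let ?l = "lres p (dcol (data_map m p X \<xi> \<omega>)) (noise (data_map m p X \<xi> \<omega>)) (vec_index \<theta>) (vec_index t)"
  have r: "?r \<in> carrier_vec m" using A x \<theta> t by (simp add: response_def)
  have "vec_index ?r i = ?l i" if i: "i < m" for i
    using response_residual[OF A x \<theta> t i] i by (simp add: lres_def lin_def data_map_components)
  then have "norm2_sq ?r = ip m ?l ?l"
    using r by (simp add: norm2_sq_def scalar_prod_def ip_def lessThan_atLeast0 carrier_vecD[OF r] del: index_minus_vec)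
  then show ?thesis using A t by (simp add: lasso_objective_def lobj_def norm1_def l1_def)
qed

lemma is_lasso_imp_lmin:
  assumes A: "X \<omega> \<in> carrier_mat m p" and x: "\<xi> \<omega> \<in> carrier_vec m" and \<theta>: "\<theta> \<in> carrier_vec p"
    and l: "is_lasso lam (X \<omega>) (response (X \<omega>) \<theta> (\<xi> \<omega>)) t"
  shows "lmin m p lam (dcol (data_map m p X \<xi> \<omega>)) (noise (data_map m p X \<xi> \<omega>)) (vec_index \<theta>) (vec_index t)"
  unfolding lmin_def
proof
  fix t'
  let ?F = "lobj m p lam (dcol (data_map m p X \<xi> \<omega>)) (noise (data_map m p X \<xi> \<omega>)) (vec_index \<theta>)"
  have t: "t \<in> carrier_vec p" by (rule is_lasso_carrier[OF l A])
  have "lasso_objective lam (X \<omega>) (response (X \<omega>) \<theta> (\<xi> \<omega>)) t \<le> lasso_objective lam (X \<omega>) (response (X \<omega>) \<theta> (\<xi> \<omega>)) (Matrix.vec p t')"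
    using l A by (auto simp: is_lasso_def is_arg_min_def not_less)
  then have "?F (vec_index t) \<le> ?F (vec_index (Matrix.vec p t'))"
    by (simp add: lasso_objective_eq_lobj[of X \<omega> m p \<xi> \<theta> _ lam, OF A x \<theta>] t)
  also have "\<dots> = ?F t'" by (rule lobj_cong) simp
  finally show "?F (vec_index t) \<le> ?F t'" .
qed

lemma debiased_measurable:
  assumes M: "prob_space M" and S: "pos_def_mat p S" and g: "gaussian_data M m p S s X \<xi>" and \<theta>: "\<theta> \<in> carrier_vec p"
    and th: "\<And>j. j < p \<Longrightarrow> (\<lambda>\<omega>. vec_index (\<theta>h \<omega>) j) \<in> borel_measurable M"
    and l: "\<And>\<omega>. \<omega> \<in> space M \<Longrightarrow> is_lasso lam (X \<omega>) (response (X \<omega>) \<theta> (\<xi> \<omega>)) (\<theta>h \<omega>)"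
    and j: "j < p"
  shows "(\<lambda>\<omega>. vec_index (debiased S (X \<omega>) (response (X \<omega>) \<theta> (\<xi> \<omega>)) (\<theta>h \<omega>)) j) \<in> borel_measurable M"
proof -
  interpret prob_space M by (rule M)
  let ?B = "Pi\<^sub>M {..<p} (\<lambda>_. borel) \<Otimes>\<^sub>M (borel :: real measure)"
  have A: "\<omega> \<in> space M \<Longrightarrow> X \<omega> \<in> carrier_mat m p" "\<omega> \<in> space M \<Longrightarrow> \<xi> \<omega> \<in> carrier_vec m" for \<omega>
    using g by (auto simp: gaussian_data_def)
  have rv: "(\<lambda>\<omega>. (design_row p X i \<omega>, vec_index (\<xi> \<omega>) i)) \<in> measurable M ?B" if "i < m" for i
    using g that by (simp add: gaussian_data_def indep_vars_def)
  have xm: "(\<lambda>\<omega>. vec_index (\<xi> \<omega>) i) \<in> borel_measurable M" if "i < m" for i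
    using measurable_compose[OF rv[OF that] measurable_snd] by simp
  have Am: "(\<lambda>\<omega>. X \<omega> $$ (i, k)) \<in> borel_measurable M" if "i < m" "k < p" for i k
  proof -
    have "(\<lambda>v. v k) \<in> borel_measurable (Pi\<^sub>M {..<p} (\<lambda>_. borel :: real measure))"
      using that by (intro measurable_component_singleton) simp
    from measurable_compose[OF measurable_compose[OF rv[OF that(1)] measurable_fst] this]
    show ?thesis using that by (simp add: design_row_def)
  qed
  have t: "\<theta>h \<omega> \<in> carrier_vec p" if "\<omega> \<in> space M" for \<omega>
    by (rule is_lasso_carrier[OF l[OF that] A(1)[OF that]])
  have P: "precision_mat S \<in> carrier_mat p p" by (rule pos_def_precision[OF S])
  define nz where "nz = (\<lambda>\<omega>. \<Sum>k<p. if vec_index (\<theta>h \<omega>) k \<noteq> 0 then 1 else (0::real))"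
  have nz: "real (norm0 (\<theta>h \<omega>)) = nz \<omega>" if "\<omega> \<in> space M" for \<omega>
  proof -
    have "real (norm0 (\<theta>h \<omega>)) = (\<Sum>k\<in>{k \<in> {..<p}. vec_index (\<theta>h \<omega>) k \<noteq> 0}. 1)"
      using t[OF that] by (simp add: norm0_def)
    also have "\<dots> = nz \<omega>" unfolding nz_def by (rule sum.inter_filter) simp
    finally show ?thesis .
  qed
  have nzm: "nz \<in> borel_measurable M" unfolding nz_def
    using th by (intro borel_measurable_sum) (auto intro!: measurable_If borel_measurable_const predE)
  have "(\<lambda>\<omega>. vec_index (\<theta>h \<omega>) j + 1 / (1 - nz \<omega> / real m) / real m *
     (\<Sum>k<p. precision_mat S $$ (j, k) * (\<Sum>i<m. X \<omega> $$ (i, k) *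
        (vec_index (\<xi> \<omega>) i - (\<Sum>l<p. (vec_index (\<theta>h \<omega>) l - vec_index \<theta> l) * X \<omega> $$ (i, l)))))) \<in> borel_measurable M"
    using th[OF j] nzm
    by (intro borel_measurable_add borel_measurable_times borel_measurable_divide borel_measurable_diff borel_measurable_sum
      borel_measurable_const xm Am th) (use j in auto)
  then show ?thesis
    by (subst measurable_cong[where g = "\<lambda>\<omega>. vec_index (\<theta>h \<omega>) j + 1 / (1 - nz \<omega> / real m) / real m *
     (\<Sum>k<p. precision_mat S $$ (j, k) * (\<Sum>i<m. X \<omega> $$ (i, k) *
        (vec_index (\<xi> \<omega>) i - (\<Sum>l<p. (vec_index (\<theta>h \<omega>) l - vec_index \<theta> l) * X \<omega> $$ (i, l)))))"])
      (simp_all add: debiased_coordinate[OF A \<theta> t P j] debias_factor_def nz)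
qed

text \<open>Transports \<open>deb_tail\<close> from the product law to \<open>M\<close>. On a full
  design uniqueness identifies \<open>\<theta>h\<close> with \<open>est\<close>, and the error of
  coordinate \<open>j\<close> is \<open>sqrt (P j j) / V * deb\<close> with
  \<open>V \<ge> m - p\<close>.\<close>

theorem debiased_tail:
  assumes M: "prob_space M" and S: "pos_def_mat p S" and g: "gaussian_data M m p S s X \<xi>" and \<theta>: "\<theta> \<in> carrier_vec p"
    and th: "\<And>j. j < p \<Longrightarrow> (\<lambda>\<omega>. vec_index (\<theta>h \<omega>) j) \<in> borel_measurable M"
    and l: "\<And>\<omega>. \<omega> \<in> space M \<Longrightarrow> is_lasso lam (X \<omega>) (response (X \<omega>) \<theta> (\<xi> \<omega>)) (\<theta>h \<omega>)"
    and j: "j < p" and pm: "p < m" and s: "0 < s" and lam: "0 < lam" and Kc: "0 < Kc"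
  shows "1 - (84 * real m / (real m - real p)\<^sup>2 + 9 * (real m)\<^sup>2 *
       (103 * (4 * real m * s\<^sup>2 + 4 * real m * lam * norm1 \<theta>)) / (Kc\<^sup>2 * (real m - real p) ^ 4))
     \<le> measure M {\<omega> \<in> space M. \<bar>vec_index (debiased S (X \<omega>) (response (X \<omega>) \<theta> (\<xi> \<omega>)) (\<theta>h \<omega>)) j - vec_index \<theta> j\<bar>
          \<le> Kc * sqrt (precision_mat S $$ (j, j))}"
    (is "1 - ?e \<le> measure M ?G")
proof -
  interpret prob_space M by (rule M)
  define P where "P = (\<lambda>k l. precision_mat S $$ (k, l))"
  define K where "K = 1 / sqrt ((2 * pi) ^ p * Determinant.det S)"
  note law = data_map_law[OF M S g _ s, folded P_def K_def]
  have m: "0 < m" using pm by simp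
  have Pjj: "0 < P j j" using precision_mat_diag_pos[OF S j] by (simp add: P_def)
  interpret L: lasso_coordinate m p P K s "vec_index \<theta>" lam j
  proof -
    have sy: "P k l = P l k" if "k < p" "l < p" for k l using precision_mat_symmetric[OF S that] by (simp add: P_def)
    show "lasso_coordinate m p P K s lam j"
      by (intro lasso_coordinate.intro lasso_design.intro gaussian_data_law.intro lasso_design_axioms.intro
        lasso_coordinate_axioms.intro law(1)[OF m] s pm lam j Pjj sy)
  qed
  let ?\<Phi> = "data_map m p X \<xi>"
  have W0: "L.W0 = 4 * real m * s\<^sup>2 + 4 * real m * lam * norm1 \<theta>"
    using \<theta> by (simp add: L.W0_def l1_def norm1_def)
  obtain B where B: "B \<in> sets (data_law m p P K s)" "emeasure (data_law m p P K s) B \<le> ennreal ?e"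
    and good: "\<And>x. x \<in> space (data_law m p P K s) - B \<Longrightarrow> L.full x \<and> \<bar>L.deb x\<bar> \<le> Kc * (real m - real p)"
    using L.deb_tail[OF Kc] unfolding W0 by blast
  have e0: "0 \<le> ?e"
  proof -
    have "0 \<le> norm1 \<theta>" by (simp add: norm1_def sum_nonneg)
    then show ?thesis using pm lam by simp
  qed
  have "measure M (?\<Phi> -` B \<inter> space M) \<le> ?e"
  proof -
    have "emeasure M (?\<Phi> -` B \<inter> space M) = emeasure (distr M (data_law m p P K s) ?\<Phi>) B"
      using law(2)[OF m] B by (simp add: emeasure_distr)
    also have "\<dots> \<le> ennreal ?e" using B by (simp add: law(3)[OF m])
    finally show ?thesis using e0 by (simp add: emeasure_eq_measure)
  qed
  moreover have "measure M (space M - (?\<Phi> -` B \<inter> space M)) = 1 - measure M (?\<Phi> -` B \<inter> space M)"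
    using law(2)[OF m] B by (intro prob_compl measurable_sets)
  moreover have "measure M (space M - (?\<Phi> -` B \<inter> space M)) \<le> measure M ?G"
  proof (rule finite_measure_mono)
    have dm: "(\<lambda>\<omega>. vec_index (debiased S (X \<omega>) (response (X \<omega>) \<theta> (\<xi> \<omega>)) (\<theta>h \<omega>)) j) \<in> borel_measurable M"
      by (rule debiased_measurable[OF M S g \<theta> th l j])
    show "?G \<in> sets M" using dm by measurable
    show "space M - (?\<Phi> -` B \<inter> space M) \<subseteq> ?G"
    proof
      fix \<omega> assume \<omega>: "\<omega> \<in> space M - (?\<Phi> -` B \<inter> space M)"
      then have w: "\<omega> \<in> space M" by simp
      define x where "x = ?\<Phi> \<omega>"
      have A: "X \<omega> \<in> carrier_mat m p" and xc: "\<xi> \<omega> \<in> carrier_vec m" using g w by (auto simp: gaussian_data_def)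
      have t: "\<theta>h \<omega> \<in> carrier_vec p" by (rule is_lasso_carrier[OF l[OF w] A])
      have "x \<in> space (data_law m p P K s) - B"
        using \<omega> measurable_space[OF law(2)[OF m] w] by (auto simp: x_def)
      from good[OF this] have full: "L.full x" and deb: "\<bar>L.deb x\<bar> \<le> Kc * (real m - real p)" by auto
      have "lmin m p lam (dcol x) (noise x) (vec_index \<theta>) (vec_index (\<theta>h \<omega>))"
        unfolding x_def by (rule is_lasso_imp_lmin[where X=X and \<xi>=\<xi>, OF A xc \<theta> l[OF w]])
      then have eq: "vec_index (\<theta>h \<omega>) k = L.est x k" if "k < p" for k
        using L.est_unique[OF full _ that] by simp
      define V where "V = real m - real (length (active p (L.est x)))"
      have n0: "norm0 (\<theta>h \<omega>) = length (active p (L.est x))"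
      proof -
        have "length (active p (L.est x)) = card {k. k < p \<and> L.est x k \<noteq> 0}"
          using distinct_card[of "active p (L.est x)"] by (simp add: set_active) (simp add: active_def)
        also have "{k. k < p \<and> L.est x k \<noteq> 0} = {k. k < p \<and> vec_index (\<theta>h \<omega>) k \<noteq> 0}"
          using eq by auto
        finally show ?thesis using t by (simp add: norm0_def)
      qed
      have V: "real m - real p \<le> V" "0 < V"
      proof -
        have "length (active p (L.est x)) \<le> p"
          using length_filter_le[of _ "[0..<p]"] by (simp add: active_def)
        then show "real m - real p \<le> V" by (simp add: V_def)
        then show "0 < V" using pm by simp
      qed
      \<comment> \<open>At most \<open>p < m\<close> coefficients are nonzero, so the default value
        of the division does not occur.\<close>
      have d: "debias_factor m (\<theta>h \<omega>) / real m = 1 / V"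
        using m V by (simp add: debias_factor_def n0 V_def field_simps)
      have res: "L.resid x i = vec_index (\<xi> \<omega>) i - (\<Sum>l<p. (vec_index (\<theta>h \<omega>) l - vec_index \<theta> l) * X \<omega> $$ (i, l))" if "i < m" for i
        using that eq by (simp add: L.resid_def lres_def lin_def x_def data_map_components)
      have "(\<Sum>k<p. precision_mat S $$ (j, k) * (\<Sum>i<m. X \<omega> $$ (i, k) *
          (vec_index (\<xi> \<omega>) i - (\<Sum>l<p. (vec_index (\<theta>h \<omega>) l - vec_index \<theta> l) * X \<omega> $$ (i, l)))))
         = (\<Sum>k<p. \<Sum>i<m. P j k * (X \<omega> $$ (i, k) * L.resid x i))"
        by (simp add: res P_def sum_distrib_left)
      also have "\<dots> = (\<Sum>i<m. \<Sum>k<p. P j k * (X \<omega> $$ (i, k) * L.resid x i))" by (rule sum.swap)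
      also have "\<dots> = (\<Sum>i<m. sqrt (P j j) * (L.score i x * L.resid x i))"
      proof (rule sum.cong)
        fix i assume i: "i \<in> {..<m}"
        have "L.score i x = L.b * (\<Sum>k<p. P j k * X \<omega> $$ (i, k))"
          using i by (simp add: L.score_def x_def data_map_components[unfolded dcol_def])
        then have "sqrt (P j j) * (L.score i x * L.resid x i) = (sqrt (P j j) * L.b) * ((\<Sum>k<p. P j k * X \<omega> $$ (i, k)) * L.resid x i)"
          by simp
        then show "(\<Sum>k<p. P j k * (X \<omega> $$ (i, k) * L.resid x i)) = sqrt (P j j) * (L.score i x * L.resid x i)"
          unfolding L.sqrt_b by (simp add: sum_distrib_right mult.assoc)
      qed simp
      also have "\<dots> = sqrt (P j j) * ip m (\<lambda>l. L.score l x) (L.resid x)" by (simp add: ip_def sum_distrib_left)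
      finally have "vec_index (debiased S (X \<omega>) (response (X \<omega>) \<theta> (\<xi> \<omega>)) (\<theta>h \<omega>)) j - vec_index \<theta> j =
         (L.est x j - vec_index \<theta> j) + 1 / V * (sqrt (P j j) * ip m (\<lambda>l. L.score l x) (L.resid x))"
        using debiased_coordinate[OF A xc \<theta> t pos_def_precision(1)[OF S] j] d eq[OF j] by simp
      \<comment> \<open>\<open>sqrt (P j j) * b = 1\<close> puts estimation error and correction
        over the common denominator \<open>V\<close>.\<close>
      also have "\<dots> = sqrt (P j j) / V * L.deb x"
      proof -
        have "sqrt (P j j) * (L.b * (L.est x j - vec_index \<theta> j) * V) = (L.est x j - vec_index \<theta> j) * V"
          using L.sqrt_b by (simp add: mult.assoc[symmetric])
        then have "sqrt (P j j) * L.deb x = sqrt (P j j) * ip m (\<lambda>l. L.score l x) (L.resid x) + (L.est x j - vec_index \<theta> j) * V"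
          unfolding L.deb_def V_def[symmetric] by (simp add: distrib_left)
        then show ?thesis using V by (simp add: field_simps)
      qed
      finally have D: "vec_index (debiased S (X \<omega>) (response (X \<omega>) \<theta> (\<xi> \<omega>)) (\<theta>h \<omega>)) j - vec_index \<theta> j = sqrt (P j j) / V * L.deb x" .
      have "\<bar>sqrt (P j j) / V * L.deb x\<bar> = sqrt (P j j) / V * \<bar>L.deb x\<bar>" using V Pjj by (simp add: abs_mult)
      also have "\<dots> \<le> sqrt (P j j) / V * (Kc * V)"
      proof (rule mult_left_mono)
        have "Kc * (real m - real p) \<le> Kc * V" using V(1) Kc by (intro mult_left_mono) auto
        then show "\<bar>L.deb x\<bar> \<le> Kc * V" using deb by linarith
      qed (use V Pjj in auto)
      also have "\<dots> = Kc * sqrt (P j j)" using V by simp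
      finally show "\<omega> \<in> ?G" using w D by (simp add: P_def)
    qed
  qed
  ultimately show ?thesis by linarith
qed

subsection \<open>Levy--Prokhorov distance to the point mass and the limit law\<close>

text \<open>Continuous stand-in for the indicator of a half-line; it lies between those of
  \<open>{b..}\<close> and \<open>{a..}\<close>, so weak convergence can squeeze tail
  fractions.\<close>

definition ramp :: "real \<Rightarrow> real \<Rightarrow> real \<Rightarrow> real" where
  "ramp a b t = min 1 (max 0 ((t - a) / (b - a)))"

lemma ramp_bounds: "0 \<le> ramp a b t" "ramp a b t \<le> 1"
  by (auto simp: ramp_def)

lemma ramp_eq_0: "a < b \<Longrightarrow> t \<le> a \<Longrightarrow> ramp a b t = 0"
proof -
  assume "a < b" "t \<le> a"
  then have "(t - a) / (b - a) \<le> 0" by (simp add: divide_le_0_iff)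
  then show ?thesis by (simp add: ramp_def)
qed

lemma ramp_eq_1: "a < b \<Longrightarrow> b \<le> t \<Longrightarrow> ramp a b t = 1"
  by (auto simp: ramp_def min_def max_def field_simps)

lemma continuous_on_ramp [continuous_intros]:
  "a < b \<Longrightarrow> continuous_on S f \<Longrightarrow> continuous_on S (\<lambda>x. ramp a b (f x))"
  unfolding ramp_def by (intro continuous_intros) auto

lemma ramp_le_indicator: "a < b \<Longrightarrow> ramp a b t \<le> indicator {a..} t"
  using ramp_bounds[of a b t] ramp_eq_0[of a b t] by (auto simp: indicator_def)

lemma indicator_le_ramp: "a < b \<Longrightarrow> indicator {b..} t \<le> ramp a b t"
  using ramp_bounds[of a b t] ramp_eq_1[of a b t] by (auto simp: indicator_def)

lemma integral_empirical_measure: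
  fixes f :: "'a::topological_space \<Rightarrow> real"
  assumes "f \<in> borel_measurable borel"
  shows "(\<integral>x. f x \<partial>empirical_measure m x) = (\<Sum>j<m. f (x j)) / real m"
proof -
  have "x \<in> measurable (uniform_count_measure {..<m}) borel"
    by (auto simp: measurable_def)
  then have "(\<integral>y. f y \<partial>empirical_measure m x) = (\<integral>j. f (x j) \<partial>uniform_count_measure {..<m})"
    unfolding empirical_measure_def using assms by (rule integral_distr)
  then show ?thesis by (simp add: integral_uniform_count_measure)
qed

lemma measure_empirical_measure:
  assumes "A \<in> sets borel" "0 < m"
  shows "measure (empirical_measure m x) A = real (card {j. j < m \<and> x j \<in> A}) / real m"
proof -
  have x: "x \<in> measurable (uniform_count_measure {..<m}) borel" by (auto simp: measurable_def)
  have "measure (empirical_measure m x) A = measure (uniform_count_measure {..<m}) (x -` A \<inter> space (uniform_count_measure {..<m}))"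
    unfolding empirical_measure_def using x assms by (intro measure_distr) auto
  also have "\<dots> = real (card {j. j < m \<and> x j \<in> A}) / real m"
    using assms by (subst measure_uniform_count_measure) (auto simp: Int_def conj_commute space_uniform_count_measure)
  finally show ?thesis .
qed

lemma prob_space_empirical_measure: "0 < m \<Longrightarrow> prob_space (empirical_measure m x)"
  unfolding empirical_measure_def
  by (intro prob_space.prob_space_distr prob_space_uniform_count_measure) (auto simp: measurable_def)

text \<open>Against a point mass the critical set is the tail
  \<open>{x. e \<le> \<bar>x\<bar>}\<close>, whose open \<open>e\<close>-neighbourhood just misses
  0; a set with a point closer to 0 has a neighbourhood of mass 1. In the reverse inequality, the
  neighbourhood of a set containing 0 covers the complement of the tail.\<close>

lemma LP_dist_return_0:
  fixes \<mu> :: "real measure"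
  assumes "prob_space \<mu>" and s: "sets \<mu> = sets borel"
  shows "LP_dist \<mu> (return borel 0) = Inf {e. 0 < e \<and> measure \<mu> {x. e \<le> \<bar>x\<bar>} \<le> e}"
proof -
  interpret prob_space \<mu> by fact
  have ret: "measure (return borel (0::real)) A = indicator A 0" if "A \<in> sets borel" for A
    using that by (simp add: measure_return)
  have opn: "(\<Union>a\<in>A. ball a e) \<in> sets borel" for A :: "real set" and e by (intro borel_open open_UN) auto
  have tail: "{x. e \<le> \<bar>x\<bar>} \<in> sets borel" for e :: real by measurable
  have "(\<forall>A\<in>sets borel. measure \<mu> A \<le> measure (return borel 0) (\<Union>a\<in>A. ball a e) + e \<and>
     measure (return borel 0) A \<le> measure \<mu> (\<Union>a\<in>A. ball a e) + e) \<longleftrightarrow> measure \<mu> {x. e \<le> \<bar>x\<bar>} \<le> e" (is "?l \<longleftrightarrow> ?r")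
    if e: "0 < e" for e
  proof
    assume ?l
    then have "measure \<mu> {x. e \<le> \<bar>x\<bar>} \<le> measure (return borel 0) (\<Union>a\<in>{x. e \<le> \<bar>x\<bar>}. ball a e) + e"
      using tail by blast
    also have "measure (return borel 0) (\<Union>a\<in>{x. e \<le> \<bar>x\<bar>}. ball a e) = 0"
      by (subst ret[OF opn]) (auto simp: indicator_def dist_real_def)
    finally show ?r by simp
  next
    assume r: ?r
    show ?l
    proof (intro ballI conjI)
      fix A :: "real set" assume A: "A \<in> sets borel"
      show "measure \<mu> A \<le> measure (return borel 0) (\<Union>a\<in>A. ball a e) + e"
      proof (cases "\<exists>a\<in>A. \<bar>a\<bar> < e")
        case True
        then have "measure (return borel 0) (\<Union>a\<in>A. ball a e) = 1"
          by (subst ret[OF opn]) (auto simp: indicator_def dist_real_def)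
        then show ?thesis using e prob_le_1[of A] by linarith
      next
        case False
        then have "measure \<mu> A \<le> measure \<mu> {x. e \<le> \<bar>x\<bar>}"
          using tail s by (intro finite_measure_mono) auto
        then show ?thesis using r measure_nonneg[of "return borel 0" "\<Union>a\<in>A. ball a e"] by linarith
      qed
      show "measure (return borel 0) A \<le> measure \<mu> (\<Union>a\<in>A. ball a e) + e"
      proof (cases "0 \<in> A")
        case True
        have "measure \<mu> (space \<mu> - {x. e \<le> \<bar>x\<bar>}) = 1 - measure \<mu> {x. e \<le> \<bar>x\<bar>}"
          using tail s by (intro prob_compl) simp
        moreover have "measure \<mu> (space \<mu> - {x. e \<le> \<bar>x\<bar>}) \<le> measure \<mu> (\<Union>a\<in>A. ball a e)"
          using True s opn by (intro finite_measure_mono) (auto simp: dist_real_def intro!: bexI[of _ 0])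
        ultimately show ?thesis using r ret[OF A] True by simp
      next
        case False
        then show ?thesis using ret[OF A] e measure_nonneg[of \<mu> "\<Union>a\<in>A. ball a e"] by simp
      qed
    qed
  qed
  then show ?thesis unfolding LP_dist_def by (intro arg_cong[of _ _ Inf]) auto
qed

lemma LP_norm_eq:
  assumes "0 < m"
  shows "LP_norm m x = Inf {e. 0 < e \<and> real (card {j. j < m \<and> e \<le> \<bar>x j\<bar>}) / real m \<le> e}"
  unfolding LP_norm_def
  using measure_empirical_measure[OF _ assms, of _ x]
  by (subst LP_dist_return_0[OF prob_space_empirical_measure[OF assms]]) (simp_all add: empirical_measure_def)

lemma mean_le:
  fixes f :: "nat \<Rightarrow> real"
  assumes "\<And>j. j < m \<Longrightarrow> f j \<le> (if Q j then 1 else 0)"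
  shows "(\<Sum>j<m. f j) / real m \<le> real (card {j. j < m \<and> Q j}) / real m"
proof -
  have "(\<Sum>j<m. f j) \<le> (\<Sum>j<m. if Q j then 1 else 0)" using assms by (intro sum_mono) auto
  also have "\<dots> = real (card {j. j < m \<and> Q j})" by (simp add: sum.If_cases Int_def)
  finally show ?thesis by (intro divide_right_mono) auto
qed

lemma le_mean:
  fixes f :: "nat \<Rightarrow> real"
  assumes "\<And>j. j < m \<Longrightarrow> (if Q j then 1 else 0) \<le> f j"
  shows "real (card {j. j < m \<and> Q j}) / real m \<le> (\<Sum>j<m. f j) / real m"
proof -
  have "real (card {j. j < m \<and> Q j}) = (\<Sum>j<m. if Q j then 1 else 0)" by (simp add: sum.If_cases Int_def)
  also have "\<dots> \<le> (\<Sum>j<m. f j)" using assms by (intro sum_mono) auto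
  finally show ?thesis by (intro divide_right_mono) auto
qed

text \<open>Levy--Prokhorov distance between the law of \<open>\<Upsilon>\<close> and the point mass
  at 0, in the form of \<open>LP_dist_return_0\<close>.\<close>

definition limit_LP :: "(real \<times> real) measure \<Rightarrow> real" where
  "limit_LP \<kappa> = Inf {e. 0 < e \<and> measure \<kappa> {y. e \<le> \<bar>snd y\<bar>} \<le> e}"

text \<open>The tail crosses the diagonal at the infimum; strict inequalities on both sides leave
  room for ramps in the limit.\<close>

lemma limit_LP_properties:
  assumes "prob_space \<kappa>" and s: "sets \<kappa> = sets borel"
  shows "0 \<le> limit_LP \<kappa>"
    and "limit_LP \<kappa> < b \<Longrightarrow> measure \<kappa> {y. b \<le> \<bar>snd y\<bar>} < b"
    and "0 < a \<Longrightarrow> a < limit_LP \<kappa> \<Longrightarrow> a < measure \<kappa> {y. a \<le> \<bar>snd y\<bar>}"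
proof -
  interpret prob_space \<kappa> by fact
  let ?S = "{e. 0 < e \<and> measure \<kappa> {y. e \<le> \<bar>snd y\<bar>} \<le> e}"
  have "measure \<kappa> {y. 1 \<le> \<bar>snd y\<bar>} \<le> 1" by (rule prob_le_1)
  then have ne: "1 \<in> ?S" by simp
  have bdd: "bdd_below ?S" by (rule bdd_belowI[of _ 0]) auto
  show "0 \<le> limit_LP \<kappa>" unfolding limit_LP_def using ne by (intro cInf_greatest) (blast, simp)
  show "measure \<kappa> {y. b \<le> \<bar>snd y\<bar>} < b" if "limit_LP \<kappa> < b"
  proof -
    have "?S \<noteq> {}" using ne by (metis empty_iff)
    from cInf_lessD[OF this that[unfolded limit_LP_def]] obtain e where e: "e \<in> ?S" "e < b" by (elim bexE)
    have "{y :: real \<times> real. e \<le> \<bar>snd y\<bar>} \<in> sets borel"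
      by (intro borel_closed closed_Collect_le continuous_intros)
    then have "measure \<kappa> {y. b \<le> \<bar>snd y\<bar>} \<le> measure \<kappa> {y. e \<le> \<bar>snd y\<bar>}"
      using e s by (intro finite_measure_mono) auto
    then show ?thesis using e by simp
  qed
  show "a < measure \<kappa> {y. a \<le> \<bar>snd y\<bar>}" if a: "0 < a" "a < limit_LP \<kappa>"
  proof (rule ccontr)
    assume "\<not> ?thesis"
    then have "a \<in> ?S" using a by simp
    then have "limit_LP \<kappa> \<le> a" unfolding limit_LP_def using bdd by (rule cInf_lower)
    with a show False by simp
  qed
qed

section \<open>Integrals against the limit law\<close>

lemma sdl_law_map_measurable:
  fixes \<kappa> :: "(real \<times> real) measure"
  assumes "sets \<kappa> = sets borel"
  shows "(\<lambda>((a, u), z). (a, sqrt u * z, u)) \<in> measurable (\<kappa> \<Otimes>\<^sub>M density lborel (\<lambda>z. ennreal (std_normal_density z))) borel"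
proof -
  let ?f = "\<lambda>x :: (real \<times> real) \<times> real. (fst (fst x), sqrt (snd (fst x)) * snd x, snd (fst x))"
  have s1: "sets (\<kappa> \<Otimes>\<^sub>M density lborel (\<lambda>z. ennreal (std_normal_density z))) = sets ((borel \<Otimes>\<^sub>M borel) \<Otimes>\<^sub>M borel)"
    using assms by (intro sets_pair_measure_cong) (simp_all only: borel_prod sets_density sets_lborel)
  have s2: "sets (borel :: (real \<times> real \<times> real) measure) = sets (borel \<Otimes>\<^sub>M (borel \<Otimes>\<^sub>M borel))"
    by (subst borel_prod, subst borel_prod) (rule refl)
  have "?f \<in> measurable ((borel \<Otimes>\<^sub>M borel) \<Otimes>\<^sub>M borel) (borel \<Otimes>\<^sub>M (borel \<Otimes>\<^sub>M borel))"
    by measurable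
  then have "?f \<in> measurable (\<kappa> \<Otimes>\<^sub>M density lborel (\<lambda>z. ennreal (std_normal_density z))) borel"
    unfolding measurable_cong_sets[OF s1 s2] .
  moreover have "(\<lambda>((a, u), z). (a, sqrt u * z, u)) = ?f" by auto
  ultimately show ?thesis by simp
qed

context
  fixes \<kappa> :: "(real \<times> real) measure"
  assumes pk: "prob_space \<kappa>" and sk: "sets \<kappa> = sets borel"
begin

abbreviation (input) "gauss \<equiv> density lborel (\<lambda>z. ennreal (std_normal_density z))"

lemma prob_gauss: "prob_space gauss"
  by (rule prob_space_normal_density) simp

lemma prob_kg: "prob_space (\<kappa> \<Otimes>\<^sub>M gauss)"
  by (intro prob_space_pair pk prob_gauss)

lemma integral_sdl_law:
  fixes F :: "real \<times> real \<times> real \<Rightarrow> real"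
  assumes "F \<in> borel_measurable borel"
  shows "(\<integral>x. F x \<partial>sdl_law \<kappa>) = (\<integral>y. F (fst (fst y), sqrt (snd (fst y)) * snd y, snd (fst y)) \<partial>(\<kappa> \<Otimes>\<^sub>M gauss))"
proof -
  have "(\<integral>x. F x \<partial>sdl_law \<kappa>) = (\<integral>y. F (case y of ((a, u), z) \<Rightarrow> (a, sqrt u * z, u)) \<partial>(\<kappa> \<Otimes>\<^sub>M gauss))"
    unfolding sdl_law_def by (subst integral_distr[OF sdl_law_map_measurable[OF sk]]) (use assms in \<open>simp_all add: case_prod_beta\<close>)
  then show ?thesis by (simp add: case_prod_beta)
qed

lemma integral_kappa_fst:
  fixes f :: "real \<times> real \<Rightarrow> real"
  assumes f: "f \<in> borel_measurable borel" and b: "\<And>y. \<bar>f y\<bar> \<le> c"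
  shows "(\<integral>y. f (fst y) \<partial>(\<kappa> \<Otimes>\<^sub>M gauss)) = (\<integral>y. f y \<partial>\<kappa>)"
proof -
  interpret k: prob_space \<kappa> by (rule pk)
  interpret g: prob_space gauss by (rule prob_gauss)
  interpret kg: pair_sigma_finite \<kappa> gauss ..
  have fm: "f \<in> borel_measurable \<kappa>" using f sk by (simp cong: measurable_cong_sets)
  then have "(\<lambda>y. f (fst y)) \<in> borel_measurable (\<kappa> \<Otimes>\<^sub>M gauss)" by measurable
  then have I: "integrable (\<kappa> \<Otimes>\<^sub>M gauss) (\<lambda>y. f (fst y))"
    using b prob_space.finite_measure[OF prob_kg] by (intro finite_measure.integrable_const_bound[where B=c]) auto
  have "(\<integral>y. f (fst y) \<partial>(\<kappa> \<Otimes>\<^sub>M gauss)) = (\<integral>y. (\<integral>z. f (fst (y, z)) \<partial>gauss) \<partial>\<kappa>)"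
    by (rule kg.integral_fst'[symmetric, OF I])
  then show ?thesis using g.prob_space by simp
qed

lemma gauss_second_moment: "integrable (\<kappa> \<Otimes>\<^sub>M gauss) (\<lambda>y. (snd y)\<^sup>2)" "(\<integral>y. (snd y)\<^sup>2 \<partial>(\<kappa> \<Otimes>\<^sub>M gauss)) = 1"
proof -
  interpret k: prob_space \<kappa> by (rule pk)
  interpret g: prob_space gauss by (rule prob_gauss)
  interpret kg: pair_sigma_finite \<kappa> gauss ..
  have 1: "has_bochner_integral lborel (\<lambda>x. std_normal_density x * x ^ (2 * 1)) (fact (2 * 1) / (2 ^ 1 * fact 1))"
    by (rule std_normal_moment_even)
  then have "(\<integral>\<^sup>+z. ennreal (std_normal_density z * z\<^sup>2) \<partial>lborel) = ennreal 1"
    by (intro nn_integral_eq_integrable[THEN iffD2]) (auto simp: has_bochner_integral_iff fact_numeral)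
  moreover have "(\<integral>\<^sup>+z. ennreal (z\<^sup>2) \<partial>gauss) = (\<integral>\<^sup>+z. ennreal (std_normal_density z * z\<^sup>2) \<partial>lborel)"
    by (subst nn_integral_density) (auto simp: ennreal_mult'')
  moreover have "(\<integral>\<^sup>+y. ennreal ((snd y)\<^sup>2) \<partial>(\<kappa> \<Otimes>\<^sub>M gauss)) = (\<integral>\<^sup>+y. (\<integral>\<^sup>+z. ennreal (z\<^sup>2) \<partial>gauss) \<partial>\<kappa>)"
    by (subst g.nn_integral_fst[symmetric]) auto
  ultimately have *: "(\<integral>\<^sup>+y. ennreal ((snd y)\<^sup>2) \<partial>(\<kappa> \<Otimes>\<^sub>M gauss)) = 1"
    by (simp add: k.emeasure_space_1)
  show "integrable (\<kappa> \<Otimes>\<^sub>M gauss) (\<lambda>y. (snd y)\<^sup>2)"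
    using * by (intro integrableI_nonneg) auto
  show "(\<integral>y. (snd y)\<^sup>2 \<partial>(\<kappa> \<Otimes>\<^sub>M gauss)) = 1"
    using * by (subst integral_eq_nn_integral) auto
qed

end

text \<open>
  If a fraction \<open>V\<close> of false discoveries and \<open>m\<close> of missed signals occur among \<open>k\<close> signals, then
  \<open>V / (V + k - m) \<le> (V + m) / k\<close>, because \<open>V k \<le> V k + V\<^sup>2 + m (k - m)\<close>.
\<close>

lemma selection_error_bound:
  assumes \<theta>: "\<theta> \<in> carrier_vec p" and v: "v \<in> carrier_vec p" and t: "0 < t" and k: "0 < norm0 \<theta>"
  shows "real (card {j \<in> selected t v. vec_index \<theta> j = 0}) / real (max (card (selected t v)) 1)
     + (1 - real (card {j \<in> selected t v. vec_index \<theta> j \<noteq> 0}) / real (card {j. j < dim_vec \<theta> \<and> vec_index \<theta> j \<noteq> 0}))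
    \<le> (3 * real (card {j. j < p \<and> t \<le> \<bar>vec_index v j - vec_index \<theta> j\<bar>})
        + 2 * (real (norm0 \<theta>) - real (card {j. j < p \<and> 2 * t < \<bar>vec_index \<theta> j\<bar>}))) / real (norm0 \<theta>)"
proof -
  define sel where "sel = selected t v"
  define N where "N = {j. j < p \<and> vec_index \<theta> j \<noteq> 0}"
  define A where "A = {j \<in> sel. vec_index \<theta> j = 0}"
  define T where "T = {j \<in> sel. vec_index \<theta> j \<noteq> 0}"
  define D where "D = {j. j < p \<and> t \<le> \<bar>vec_index v j - vec_index \<theta> j\<bar>}"
  define E where "E = {j. j < p \<and> 2 * t < \<bar>vec_index \<theta> j\<bar>}"
  have sel: "sel = {j. j < p \<and> t \<le> \<bar>vec_index v j\<bar>}" using v by (simp add: sel_def selected_def)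
  have fin: "finite sel" "finite N" "finite A" "finite T" "finite D" "finite E"
    by (auto simp: sel N_def A_def T_def D_def E_def)
  have kN: "norm0 \<theta> = card N" using \<theta> by (simp add: norm0_def N_def)
  have AT: "card sel = card A + card T"
  proof -
    have "sel = A \<union> T" "A \<inter> T = {}" by (auto simp: A_def T_def)
    then show ?thesis using fin by (simp add: card_Un_disjoint)
  qed
  \<comment> \<open>A selected null coordinate consists of error only.\<close>
  have "A \<subseteq> D" by (auto simp: A_def D_def sel)
  then have AD: "card A \<le> card D" using fin by (intro card_mono) auto
  have TN: "T \<subseteq> N" by (auto simp: T_def N_def sel)
  have EN: "E \<subseteq> N" using t by (auto simp: E_def N_def)
  \<comment> \<open>A missed signal above \<open>2 * t\<close> must have an error of at least
    \<open>t\<close>, as its estimate is below \<open>t\<close>.\<close>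
  have "N - T \<subseteq> D \<union> (N - E)" by (auto simp: N_def T_def D_def E_def sel)
  then have "card (N - T) \<le> card (D \<union> (N - E))" using fin by (intro card_mono) auto
  also have "\<dots> \<le> card D + card (N - E)" by (rule card_Un_le)
  finally have miss: "card (N - T) \<le> card D + card (N - E)" .
  define kk where "kk = real (card N)"
  define VV where "VV = real (card A)"
  define m where "m = real (card (N - T))"
  have kpos: "0 < kk" using k by (simp add: kk_def kN)
  have m: "real (card T) = kk - m" "m \<le> kk" "0 \<le> m"
    using TN fin card_mono[OF fin(2) TN] by (auto simp: m_def kk_def card_Diff_subset of_nat_diff)
  have V0: "0 \<le> VV" by (simp add: VV_def)
  have fdp: "VV / real (max (card sel) 1) \<le> (VV + m) / kk"
  proof (cases "card sel = 0")
    case True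
    then have "VV = 0" using AT by (simp add: VV_def)
    then show ?thesis using kpos m by simp
  next
    case False
    then have R: "real (max (card sel) 1) = VV + kk - m" "0 < VV + kk - m"
      using AT m by (auto simp: VV_def max_def)
    have "VV * kk \<le> (VV + m) * (VV + kk - m)"
    proof -
      have "(VV + m) * (VV + kk - m) = VV * kk + VV * VV + m * (kk - m)" by (simp add: algebra_simps)
      moreover have "0 \<le> m * (kk - m)" "0 \<le> VV * VV" using m V0 by auto
      ultimately show ?thesis by linarith
    qed
    then have "VV / (VV + kk - m) \<le> (VV + m) / kk" using R(2) kpos by (simp add: frac_le_eq divide_le_eq le_divide_eq mult_ac)
    then show ?thesis unfolding R(1) .
  qed
  have "VV / real (max (card sel) 1) + (1 - (kk - m) / kk) \<le> (VV + m) / kk + m / kk"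
    using fdp kpos by (simp add: diff_divide_distrib)
  also have "\<dots> = (VV + 2 * m) / kk" by (simp add: add_divide_distrib[symmetric])
  also have "\<dots> \<le> (3 * real (card D) + 2 * (kk - real (card E))) / kk"
  proof (rule divide_right_mono)
    have "real (card (N - E)) = kk - real (card E)"
      using EN fin card_mono[OF fin(2) EN] by (simp add: kk_def card_Diff_subset of_nat_diff)
    moreover have "m \<le> real (card D) + real (card (N - E))" using miss by (simp add: m_def)
    moreover have "VV \<le> real (card D)" using AD by (simp add: VV_def)
    ultimately show "VV + 2 * m \<le> 3 * real (card D) + 2 * (kk - real (card E))" by argo
  qed (use kpos in simp)
  finally have "VV / real (max (card sel) 1) + (1 - (kk - m) / kk) \<le> (3 * real (card D) + 2 * (kk - real (card E))) / kk" .
  moreover have "{j. j < dim_vec \<theta> \<and> vec_index \<theta> j \<noteq> 0} = N" using \<theta> by (simp add: N_def)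
  ultimately show ?thesis
    using m(1) by (simp add: VV_def A_def T_def D_def E_def sel_def kN kk_def)
qed

subsection \<open>Consequences of weak convergence\<close>

lemma weakly_converges_mean:
  fixes F :: "'a::topological_space \<Rightarrow> real"
  assumes "weakly_converges (\<lambda>p. empirical_measure p (x p)) \<nu>" "continuous_on UNIV F" "\<And>y. \<bar>F y\<bar> \<le> B"
  shows "(\<lambda>p. (\<Sum>j<p. F (x p j)) / real p) \<longlonglongrightarrow> (\<integral>y. F y \<partial>\<nu>)"
proof -
  have "bounded (range F)" using assms(3) by (intro boundedI[of _ B]) auto
  then have "(\<lambda>p. \<integral>y. F y \<partial>empirical_measure p (x p)) \<longlonglongrightarrow> (\<integral>y. F y \<partial>\<nu>)"
    using assms by (simp add: weakly_converges_def)
  moreover have "F \<in> borel_measurable borel" using assms(2) by (rule borel_measurable_continuous_onI)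
  ultimately show ?thesis by (simp add: integral_empirical_measure)
qed

lemma ramp_measurable [measurable]: "f \<in> borel_measurable M \<Longrightarrow> (\<lambda>x. ramp a b (f x)) \<in> borel_measurable M"
  unfolding ramp_def
  by (intro borel_measurable_min borel_measurable_max borel_measurable_const borel_measurable_divide borel_measurable_diff)

lemma ramp_integrable:
  assumes "prob_space M" "f \<in> borel_measurable M"
  shows "integrable M (\<lambda>x. ramp a b (f x))"
  using assms ramp_bounds prob_space.finite_measure[OF assms(1)]
  by (intro finite_measure.integrable_const_bound[where B=1]) auto

lemma ramp_integral_bounds:
  assumes M: "prob_space M" and f: "f \<in> borel_measurable M" and ab: "a < b"
  shows "(\<integral>x. ramp a b (f x) \<partial>M) \<le> measure M {x \<in> space M. a \<le> f x}"
    and "measure M {x \<in> space M. b \<le> f x} \<le> (\<integral>x. ramp a b (f x) \<partial>M)"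
proof -
  interpret prob_space M by fact
  note [measurable] = f
  have m: "measure M {x \<in> space M. e \<le> f x} = (\<integral>x. indicator {x \<in> space M. e \<le> f x} x \<partial>M)" for e
    by (simp add: Int_absorb1)
  have i: "integrable M (indicator {x \<in> space M. e \<le> f x} :: _ \<Rightarrow> real)" for e
    by (intro integrable_real_indicator) (auto simp: emeasure_eq_measure)
  show "(\<integral>x. ramp a b (f x) \<partial>M) \<le> measure M {x \<in> space M. a \<le> f x}"
    unfolding m using ramp_le_indicator[OF ab] by (intro integral_mono ramp_integrable M f i) (auto simp: indicator_def)
  show "measure M {x \<in> space M. b \<le> f x} \<le> (\<integral>x. ramp a b (f x) \<partial>M)"
    unfolding m using indicator_le_ramp[OF ab] by (intro integral_mono ramp_integrable M f i) (auto simp: indicator_def)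
qed

text \<open>The square root of the library is odd. Working with
  \<open>\<bar>\<Upsilon>\<bar>\<close> avoids deriving \<open>\<Upsilon> \<ge> 0\<close> for the
  limit.\<close>

lemma sqrt_sq_abs: "(sqrt x)\<^sup>2 = \<bar>x\<bar>"
proof (cases "0 \<le> x")
  case False
  then have "sqrt x = - sqrt (- x)" by (simp add: real_sqrt_minus)
  then show ?thesis using False by simp
qed simp

context
  fixes \<kappa> :: "(real \<times> real) measure" and a w u :: "nat \<Rightarrow> nat \<Rightarrow> real"
  assumes pk: "prob_space \<kappa>" and sk: "sets \<kappa> = sets borel"
    and wc: "weakly_converges (\<lambda>p. empirical_measure p (\<lambda>j. (a p j, w p j, u p j))) (sdl_law \<kappa>)"
begin

lemma space_kappa: "space \<kappa> = UNIV"
  using sets_eq_imp_space_eq[OF sk] by simp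

lemma kappa_borel: "f \<in> borel_measurable borel \<Longrightarrow> f \<in> borel_measurable \<kappa>"
  using sk by (simp cong: measurable_cong_sets)

lemma mean_limit_u:
  assumes "continuous_on UNIV g" "\<And>y. \<bar>g y\<bar> \<le> B"
  shows "(\<lambda>p. (\<Sum>j<p. g (u p j)) / real p) \<longlonglongrightarrow> (\<integral>y. g (snd y) \<partial>\<kappa>)"
proof -
  have c: "continuous_on UNIV (\<lambda>x :: real \<times> real \<times> real. g (snd (snd x)))"
    by (rule continuous_on_compose2[OF assms(1)]) (auto intro!: continuous_intros)
  have gm: "g \<in> borel_measurable borel" using assms(1) by (rule borel_measurable_continuous_onI)
  have "(\<integral>x. g (snd (snd x)) \<partial>sdl_law \<kappa>) = (\<integral>y. g (snd y) \<partial>\<kappa>)"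
    using gm assms(2)
    by (subst integral_sdl_law[OF pk sk borel_measurable_continuous_onI[OF c]])
      (auto intro!: integral_kappa_fst[OF pk sk, where f = "\<lambda>y. g (snd y)"] measurable_compose[OF _ gm] simp: borel_prod[symmetric])
  with weakly_converges_mean[OF wc c, of B] assms(2) show ?thesis by simp
qed

lemma mean_limit_a:
  assumes "continuous_on UNIV g" "\<And>y. \<bar>g y\<bar> \<le> B"
  shows "(\<lambda>p. (\<Sum>j<p. g (a p j)) / real p) \<longlonglongrightarrow> (\<integral>y. g (fst y) \<partial>\<kappa>)"
proof -
  have c: "continuous_on UNIV (\<lambda>x :: real \<times> real \<times> real. g (fst x))"
    by (rule continuous_on_compose2[OF assms(1)]) (auto intro!: continuous_intros)
  have gm: "g \<in> borel_measurable borel" using assms(1) by (rule borel_measurable_continuous_onI)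
  have "(\<integral>x. g (fst x) \<partial>sdl_law \<kappa>) = (\<integral>y. g (fst y) \<partial>\<kappa>)"
    using gm assms(2)
    by (subst integral_sdl_law[OF pk sk borel_measurable_continuous_onI[OF c]])
      (auto intro!: integral_kappa_fst[OF pk sk, where f = "\<lambda>y. g (fst y)"] measurable_compose[OF _ gm] simp: borel_prod[symmetric])
  with weakly_converges_mean[OF wc c, of B] assms(2) show ?thesis by simp
qed

lemma tail_u_bounds:
  assumes "\<alpha> < \<beta>"
  shows "(\<integral>y. ramp \<alpha> \<beta> \<bar>snd y\<bar> \<partial>\<kappa>) \<le> measure \<kappa> {y. \<alpha> \<le> \<bar>snd y\<bar>}"
    and "measure \<kappa> {y. \<beta> \<le> \<bar>snd y\<bar>} \<le> (\<integral>y. ramp \<alpha> \<beta> \<bar>snd y\<bar> \<partial>\<kappa>)"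
proof -
  have "(\<lambda>y. \<bar>snd y\<bar>) \<in> borel_measurable \<kappa>"
    by (intro kappa_borel borel_measurable_continuous_onI continuous_intros)
  from ramp_integral_bounds[OF pk this assms]
  show "(\<integral>y. ramp \<alpha> \<beta> \<bar>snd y\<bar> \<partial>\<kappa>) \<le> measure \<kappa> {y. \<alpha> \<le> \<bar>snd y\<bar>}"
    "measure \<kappa> {y. \<beta> \<le> \<bar>snd y\<bar>} \<le> (\<integral>y. ramp \<alpha> \<beta> \<bar>snd y\<bar> \<partial>\<kappa>)"
    by (simp_all add: space_kappa)
qed

text \<open>Weak convergence controls tail fractions only at continuity points of the limit; ramps
  placed on either side of \<open>L\<close> squeeze the level instead.\<close>

lemma LP_norm_limit: "(\<lambda>p. LP_norm p (u p)) \<longlonglongrightarrow> limit_LP \<kappa>"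
proof -
  define L where "L = limit_LP \<kappa>"
  define F where "F = (\<lambda>p e. real (card {j. j < p \<and> e \<le> \<bar>u p j\<bar>}) / real p)"
  note LPp = limit_LP_properties[OF pk sk, folded L_def]
  have lim: "(\<lambda>p. (\<Sum>j<p. ramp \<alpha> \<beta> \<bar>u p j\<bar>) / real p) \<longlonglongrightarrow> (\<integral>y. ramp \<alpha> \<beta> \<bar>snd y\<bar> \<partial>\<kappa>)" if "\<alpha> < \<beta>" for \<alpha> \<beta>
    using that ramp_bounds by (intro mean_limit_u[where B=1] continuous_intros) auto
  have Fmono: "F p e' \<le> F p e" if "e \<le> e'" for p e e'
    unfolding F_def using that by (intro divide_right_mono of_nat_mono card_mono) auto
  have up: "\<forall>\<^sub>F p in sequentially. LP_norm p (u p) \<le> L + e" if e: "0 < e" for e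
  proof -
    have "(\<integral>y. ramp (L + e / 2) (L + e) \<bar>snd y\<bar> \<partial>\<kappa>) \<le> measure \<kappa> {y. L + e / 2 \<le> \<bar>snd y\<bar>}"
      using e by (intro tail_u_bounds) simp
    also have "\<dots> < L + e / 2" using e by (intro LPp(2)) simp
    finally have "\<forall>\<^sub>F p in sequentially. (\<Sum>j<p. ramp (L + e / 2) (L + e) \<bar>u p j\<bar>) / real p < L + e"
      using e by (intro order_tendstoD(2)[OF lim]) auto
    then show ?thesis using eventually_gt_at_top[of 0]
    proof eventually_elim
      case (elim p)
      have "F p (L + e) \<le> (\<Sum>j<p. ramp (L + e / 2) (L + e) \<bar>u p j\<bar>) / real p"
        unfolding F_def using e by (intro le_mean) (auto simp: ramp_eq_1 ramp_bounds)
      then have "L + e \<in> {e. 0 < e \<and> F p e \<le> e}" using elim e LPp(1) by auto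
      then have "Inf {e. 0 < e \<and> F p e \<le> e} \<le> L + e" by (intro cInf_lower bdd_belowI[of _ 0]) auto
      then show ?case using LP_norm_eq[OF elim(2), of "u p"] by (simp add: F_def)
    qed
  qed
  have low: "\<forall>\<^sub>F p in sequentially. L - e \<le> LP_norm p (u p)" if e: "0 < e" for e
  \<comment> \<open>The infimum runs over positive numbers, so a level at or below 0 is a trivial
    lower bound.\<close>
  proof (cases "0 < L - e")
    case False
    show ?thesis using eventually_gt_at_top[of 0]
    proof eventually_elim
      case (elim p)
      have "F p 1 \<le> 1"
        unfolding F_def using elim card_mono[of "{..<p}" "{j. j < p \<and> 1 \<le> \<bar>u p j\<bar>}"] by (auto simp: divide_le_eq_1)
      then have "0 \<le> Inf {e. 0 < e \<and> F p e \<le> e}" by (intro cInf_greatest) (auto intro!: exI[of _ 1])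
      then show ?case using False LP_norm_eq[OF elim, of "u p"] by (simp add: F_def)
    qed
  next
    case True
    have "L - e / 2 < measure \<kappa> {y. L - e / 2 \<le> \<bar>snd y\<bar>}" using e True by (intro LPp(3)) auto
    also have "\<dots> \<le> (\<integral>y. ramp (L - e) (L - e / 2) \<bar>snd y\<bar> \<partial>\<kappa>)" using e by (intro tail_u_bounds) simp
    finally have "\<forall>\<^sub>F p in sequentially. L - e < (\<Sum>j<p. ramp (L - e) (L - e / 2) \<bar>u p j\<bar>) / real p"
      using e by (intro order_tendstoD(1)[OF lim]) auto
    then show ?thesis using eventually_gt_at_top[of 0]
    proof eventually_elim
      case (elim p)
      have "(\<Sum>j<p. ramp (L - e) (L - e / 2) \<bar>u p j\<bar>) / real p \<le> F p (L - e)"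
        unfolding F_def using e by (intro mean_le) (auto simp: ramp_eq_0 ramp_bounds)
      then have gt: "L - e < F p (L - e)" using elim by linarith
      have "F p 1 \<le> 1"
        unfolding F_def using elim card_mono[of "{..<p}" "{j. j < p \<and> 1 \<le> \<bar>u p j\<bar>}"] by (auto simp: divide_le_eq_1)
      moreover have "L - e \<le> x" if "0 < x" "F p x \<le> x" for x
      proof (rule ccontr)
        assume "\<not> L - e \<le> x"
        then have "F p (L - e) \<le> F p x" by (intro Fmono) simp
        with gt that \<open>\<not> L - e \<le> x\<close> show False by linarith
      qed
      ultimately have "L - e \<le> Inf {e. 0 < e \<and> F p e \<le> e}" by (intro cInf_greatest) (auto intro!: exI[of _ 1])
      then show ?case using LP_norm_eq[OF elim(2), of "u p"] by (simp add: F_def)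
    qed
  qed
  have "(\<lambda>p. LP_norm p (u p)) \<longlonglongrightarrow> L"
  proof (rule tendstoI)
    fix e :: real assume e: "0 < e"
    have "\<forall>\<^sub>F p in sequentially. LP_norm p (u p) \<le> L + e / 2" "\<forall>\<^sub>F p in sequentially. L - e / 2 \<le> LP_norm p (u p)"
      using e by (intro up low; simp)+
    then show "\<forall>\<^sub>F p in sequentially. dist (LP_norm p (u p)) L < e"
      by eventually_elim (use e in \<open>auto simp: dist_real_def\<close>)
  qed
  then show ?thesis by (simp add: L_def)
qed

text \<open>Either \<open>\<bar>\<Upsilon>\<bar>\<close> is at least \<open>2 * t ^ 4\<close>, or
  noise above \<open>t / 2\<close> forces
  \<open>1 \<le> 8 * \<tau>\<^sup>2 * t\<^sup>2 * Z\<^sup>2\<close>, and \<open>Z\<^sup>2\<close>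
  has mean 1. With \<open>t ^ 4 = L\<close> the level \<open>2 * t ^ 4\<close> is strictly above
  \<open>L\<close>, as the tail bound requires.\<close>

lemma large_noise_integral:
  assumes t: "0 < t"
  shows "(\<integral>x. ramp (t / 2) t (\<bar>\<tau>\<bar> * \<bar>fst (snd x)\<bar>) \<partial>sdl_law \<kappa>) \<le> measure \<kappa> {y. 2 * t ^ 4 \<le> \<bar>snd y\<bar>} + 8 * \<tau>\<^sup>2 * t\<^sup>2"
proof -
  let ?F = "\<lambda>x :: real \<times> real \<times> real. ramp (t / 2) t (\<bar>\<tau>\<bar> * \<bar>fst (snd x)\<bar>)"
  let ?K = "\<kappa> \<Otimes>\<^sub>M density lborel (\<lambda>z. ennreal (std_normal_density z))"
  have c: "continuous_on UNIV ?F" using t by (intro continuous_intros) auto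
  have Fm: "?F \<in> borel_measurable borel" by (rule borel_measurable_continuous_onI[OF c])
  interpret K: prob_space ?K by (rule prob_kg[OF pk sk])
  have kb: "f \<in> borel_measurable \<kappa>" if "f \<in> borel_measurable borel" for f :: "real \<times> real \<Rightarrow> real"
    by (rule kappa_borel[OF that])
  let ?ind = "\<lambda>y :: real \<times> real. indicator {y. 2 * t ^ 4 \<le> \<bar>snd y\<bar>} y :: real"
  have "{y :: real \<times> real. 2 * t ^ 4 \<le> \<bar>snd y\<bar>} \<in> sets borel"
    by (intro borel_closed closed_Collect_le continuous_intros)
  then have im: "?ind \<in> borel_measurable borel" by simp
  have indK: "(\<lambda>y. ?ind (fst y)) \<in> borel_measurable ?K"
    by (rule measurable_compose[OF measurable_fst kb[OF im]])
  have iK: "integrable ?K (\<lambda>y. ?ind (fst y))"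
    using indK by (intro K.integrable_const_bound[where B=1]) (auto simp: indicator_def)
  have uK: "(\<lambda>y. snd (fst y)) \<in> borel_measurable ?K"
    by (rule measurable_compose[OF measurable_fst kb]) (auto intro!: borel_measurable_continuous_onI continuous_intros)
  note [measurable] = uK
  have pw: "?F (fst (fst y), sqrt (snd (fst y)) * snd y, snd (fst y)) \<le> ?ind (fst y) + 8 * \<tau>\<^sup>2 * t\<^sup>2 * (snd y)\<^sup>2" for y
  proof (cases "2 * t ^ 4 \<le> \<bar>snd (fst y)\<bar>")
    case True
    then show ?thesis using ramp_bounds(2)[of "t / 2" t "\<bar>\<tau>\<bar> * \<bar>sqrt (snd (fst y)) * snd y\<bar>"] by (simp add: indicator_def add_increasing2)
  next
    case False
    define W where "W = \<bar>\<tau>\<bar> * \<bar>sqrt (snd (fst y)) * snd y\<bar>"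
    show ?thesis
    proof (cases "W \<le> t / 2")
      case True
      then show ?thesis using t ramp_eq_0[of "t / 2" t W] by (simp add: W_def)
    next
      case W: False
      have "(t / 2)\<^sup>2 \<le> W\<^sup>2" using W t by (intro power_mono) auto
      also have "W\<^sup>2 = \<tau>\<^sup>2 * (\<bar>snd (fst y)\<bar> * (snd y)\<^sup>2)"
        by (simp add: W_def power_mult_distrib sqrt_sq_abs)
      also have "\<dots> \<le> \<tau>\<^sup>2 * (2 * t ^ 4 * (snd y)\<^sup>2)"
        using False by (intro mult_left_mono mult_right_mono) auto
      also have "\<dots> = t\<^sup>2 * (2 * \<tau>\<^sup>2 * t\<^sup>2 * (snd y)\<^sup>2)" by (simp add: power2_eq_square power4_eq_xxxx)
      finally have "t\<^sup>2 * 1 \<le> t\<^sup>2 * (8 * \<tau>\<^sup>2 * t\<^sup>2 * (snd y)\<^sup>2)" by (simp add: power_divide)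
      then have "1 \<le> 8 * \<tau>\<^sup>2 * t\<^sup>2 * (snd y)\<^sup>2" using t by (simp add: mult_le_cancel_left_pos)
      then show ?thesis using ramp_bounds(2)[of "t / 2" t W] by (simp add: W_def indicator_def)
    qed
  qed
  have z2: "integrable ?K (\<lambda>y. 8 * \<tau>\<^sup>2 * t\<^sup>2 * (snd y)\<^sup>2)"
    using gauss_second_moment(1)[OF pk sk] by auto
  have "(\<integral>x. ?F x \<partial>sdl_law \<kappa>) = (\<integral>y. ?F (fst (fst y), sqrt (snd (fst y)) * snd y, snd (fst y)) \<partial>?K)"
    by (rule integral_sdl_law[OF pk sk Fm])
  also have "\<dots> \<le> (\<integral>y. ?ind (fst y) + 8 * \<tau>\<^sup>2 * t\<^sup>2 * (snd y)\<^sup>2 \<partial>?K)"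
  proof (rule integral_mono)
    show "integrable ?K (\<lambda>y. ?F (fst (fst y), sqrt (snd (fst y)) * snd y, snd (fst y)))"
      using ramp_bounds by (intro K.integrable_const_bound[where B=1]) auto
  qed (use pw iK z2 in auto)
  also have "\<dots> = (\<integral>y. ?ind y \<partial>\<kappa>) + 8 * \<tau>\<^sup>2 * t\<^sup>2"
    using iK z2 integral_kappa_fst[OF pk sk im, of 1] gauss_second_moment[OF pk sk] by (simp add: indicator_def)
  also have "(\<integral>y. ?ind y \<partial>\<kappa>) = measure \<kappa> {y. 2 * t ^ 4 \<le> \<bar>snd y\<bar>}"
    by (simp add: space_kappa)
  finally show ?thesis .
qed

lemma sdl_tail_limit:
  assumes t: "0 < t"
  shows "(\<lambda>p. (\<Sum>j<p. ramp (t / 2) t (\<bar>\<tau>\<bar> * \<bar>w p j\<bar>)) / real p) \<longlonglongrightarrow>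
    (\<integral>x. ramp (t / 2) t (\<bar>\<tau>\<bar> * \<bar>fst (snd x)\<bar>) \<partial>sdl_law \<kappa>)"
proof -
  have c: "continuous_on UNIV (\<lambda>x :: real \<times> real \<times> real. ramp (t / 2) t (\<bar>\<tau>\<bar> * \<bar>fst (snd x)\<bar>))"
    using t by (intro continuous_intros) auto
  from weakly_converges_mean[OF wc c, of 1] ramp_bounds show ?thesis by simp
qed

end

subsection \<open>False discoveries and power\<close>

text \<open>The limit of \<open>selection_error_bound\<close> at \<open>t = root 4 L\<close>:
  \<open>2 * L + 8 * \<tau>\<^sup>2 * t\<^sup>2\<close> bounds the fraction of large errors, and the
  difference of measures is the mass of nonzero signals below \<open>3 * t\<close>. The value 2 is
  the trivial bound for FDR + (1 - PWR).\<close>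

definition err_const :: "real \<Rightarrow> real measure \<Rightarrow> real \<Rightarrow> real" where
  "err_const L \<mu> \<tau> = (if 0 < L \<and> nonzero_law \<mu> then
     (3 * (2 * L + 8 * \<tau>\<^sup>2 * (root 4 L)\<^sup>2) +
      2 * (measure \<mu> {x. 0 < \<bar>x\<bar>} - measure \<mu> {x. 3 * root 4 L \<le> \<bar>x\<bar>})) / measure \<mu> {x. 0 < \<bar>x\<bar>}
     else 2)"

text \<open>Allows a bound on \<open>\<tau>\<close> to replace \<open>\<tau>\<close> in the second
  half of the theorem.\<close>

lemma err_const_mono:
  assumes "\<bar>\<tau>\<bar> \<le> \<tau>'"
  shows "err_const L \<mu> \<tau> \<le> err_const L \<mu> \<tau>'"
proof (cases "0 < L \<and> nonzero_law \<mu>")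
  case True
  have "\<tau>\<^sup>2 \<le> \<tau>'\<^sup>2" using assms by (metis abs_ge_zero power2_abs power_mono)
  then show ?thesis using True unfolding err_const_def
    by (auto intro!: divide_right_mono add_mono mult_left_mono mult_right_mono)
qed (auto simp: err_const_def)

text \<open>The mass of weak nonzero signals vanishes by continuity of the measure from below; the
  other terms are powers of \<open>L\<close>.\<close>

lemma err_const_tendsto:
  assumes nz: "nonzero_law \<mu>"
  shows "((\<lambda>L. err_const L \<mu> \<tau>) \<longlongrightarrow> 0) (at_right 0)"
proof -
  interpret prob_space \<mu> using nz by (simp add: nonzero_law_def)
  have s: "sets \<mu> = sets borel" using nz by (simp add: nonzero_law_def)
  define \<pi> where "\<pi> = measure \<mu> {x. 0 < \<bar>x\<bar>}"
  have \<pi>: "0 < \<pi>" using nz by (simp add: nonzero_law_def \<pi>_def)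
  have sets: "{x :: real. r \<le> \<bar>x\<bar>} \<in> sets \<mu>" for r unfolding s by measurable
  have r0: "((\<lambda>L. root 4 L) \<longlongrightarrow> 0) (at_right (0::real))"
  proof -
    have "((\<lambda>L. root 4 L) \<longlongrightarrow> root 4 0) (at_right (0::real))" by (intro tendsto_intros)
    then show ?thesis by simp
  qed
  have tail: "((\<lambda>L. measure \<mu> {x. 3 * root 4 L \<le> \<bar>x\<bar>}) \<longlongrightarrow> \<pi>) (at_right 0)"
  proof (rule tendstoI)
    fix e :: real assume e: "0 < e"
    have U: "(\<Union>m. {x :: real. 1 / real (Suc m) \<le> \<bar>x\<bar>}) = {x. 0 < \<bar>x\<bar>}"
    proof (intro equalityI subsetI)
      fix x :: real assume "x \<in> {x. 0 < \<bar>x\<bar>}"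
      then obtain m where "1 / real (Suc m) < \<bar>x\<bar>" using nat_approx_posE[of "\<bar>x\<bar>"] by auto
      then show "x \<in> (\<Union>m. {x. 1 / real (Suc m) \<le> \<bar>x\<bar>})" by (auto simp del: of_nat_Suc intro: less_imp_le)
    next
      fix x :: real assume "x \<in> (\<Union>m. {x. 1 / real (Suc m) \<le> \<bar>x\<bar>})"
      then obtain m where "1 / real (Suc m) \<le> \<bar>x\<bar>" by blast
      moreover have "0 < 1 / real (Suc m)" by simp
      ultimately have "0 < \<bar>x\<bar>" by linarith
      then show "x \<in> {x. 0 < \<bar>x\<bar>}" by blast
    qed
    have "(\<lambda>m. measure \<mu> {x. 1 / real (Suc m) \<le> \<bar>x\<bar>}) \<longlonglongrightarrow> measure \<mu> (\<Union>m. {x. 1 / real (Suc m) \<le> \<bar>x\<bar>})"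
    proof (rule finite_Lim_measure_incseq)
      show "incseq (\<lambda>m. {x :: real. 1 / real (Suc m) \<le> \<bar>x\<bar>})"
        unfolding incseq_def
      proof (intro allI impI subsetI)
        fix k l :: nat and x :: real assume "k \<le> l" and x: "x \<in> {x. 1 / real (Suc k) \<le> \<bar>x\<bar>}"
        then have "1 / real (Suc l) \<le> 1 / real (Suc k)" by (intro divide_left_mono) auto
        also have "\<dots> \<le> \<bar>x\<bar>" using x by blast
        finally show "x \<in> {x. 1 / real (Suc l) \<le> \<bar>x\<bar>}" by blast
      qed
    qed (use sets in auto)
    then have "\<forall>\<^sub>F m in sequentially. \<pi> - e < measure \<mu> {x. 1 / real (Suc m) \<le> \<bar>x\<bar>}"
      unfolding U \<pi>_def[symmetric] by (rule order_tendstoD(1)) (use e in simp)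
    then obtain m where m: "\<pi> - e < measure \<mu> {x. 1 / real (Suc m) \<le> \<bar>x\<bar>}"
      by (auto simp: eventually_sequentially)
    have "\<forall>\<^sub>F L in at_right 0. root 4 L < 1 / (3 * real (Suc m))"
      by (rule order_tendstoD(2)[OF r0]) simp
    moreover have "\<forall>\<^sub>F L in at_right 0. 0 < (L::real)" by (simp add: eventually_at_right_less)
    ultimately show "\<forall>\<^sub>F L in at_right 0. dist (measure \<mu> {x. 3 * root 4 L \<le> \<bar>x\<bar>}) \<pi> < e"
    proof eventually_elim
      case (elim L)
      have r: "0 < root 4 L" using elim by simp
      have "3 * root 4 L \<le> 1 / real (Suc m)" using elim(1) by (simp add: field_simps del: of_nat_Suc)
      then have "measure \<mu> {x. 1 / real (Suc m) \<le> \<bar>x\<bar>} \<le> measure \<mu> {x. 3 * root 4 L \<le> \<bar>x\<bar>}"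
        using sets by (intro finite_measure_mono) auto
      moreover have "measure \<mu> {x. 3 * root 4 L \<le> \<bar>x\<bar>} \<le> \<pi>"
      proof -
        have "{x :: real. 0 < \<bar>x\<bar>} \<in> sets \<mu>" unfolding s by measurable
        then show ?thesis unfolding \<pi>_def using r by (intro finite_measure_mono) auto
      qed
      ultimately show ?case using m by (simp add: dist_real_def)
    qed
  qed
  have "((\<lambda>L. (3 * (2 * L + 8 * \<tau>\<^sup>2 * (root 4 L)\<^sup>2) + 2 * (\<pi> - measure \<mu> {x. 3 * root 4 L \<le> \<bar>x\<bar>})) / \<pi>)
      \<longlongrightarrow> (3 * (2 * 0 + 8 * \<tau>\<^sup>2 * 0\<^sup>2) + 2 * (\<pi> - \<pi>)) / \<pi>) (at_right 0)"
    using \<pi> by (intro tendsto_intros tail r0) auto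
  then have lim: "((\<lambda>L. (3 * (2 * L + 8 * \<tau>\<^sup>2 * (root 4 L)\<^sup>2) + 2 * (\<pi> - measure \<mu> {x. 3 * root 4 L \<le> \<bar>x\<bar>})) / \<pi>)
      \<longlongrightarrow> 0) (at_right 0)" by simp
  have "\<forall>\<^sub>F L in at_right 0. 0 < (L::real)" by (simp add: eventually_at_right_less)
  then have "\<forall>\<^sub>F L in at_right 0. (3 * (2 * L + 8 * \<tau>\<^sup>2 * (root 4 L)\<^sup>2) + 2 * (\<pi> - measure \<mu> {x. 3 * root 4 L \<le> \<bar>x\<bar>})) / \<pi>
      = err_const L \<mu> \<tau>"
    by eventually_elim (use nz in \<open>simp add: err_const_def \<pi>_def\<close>)
  from Lim_transform_eventually[OF lim this] show ?thesis .
qed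

text \<open>Without integrability the integral is 0, which satisfies both bounds.\<close>

lemma integral_unit_interval:
  fixes f :: "'a \<Rightarrow> real"
  assumes "prob_space M" "\<And>x. x \<in> space M \<Longrightarrow> 0 \<le> f x" "\<And>x. x \<in> space M \<Longrightarrow> f x \<le> 1"
  shows "0 \<le> (\<integral>x. f x \<partial>M)" "(\<integral>x. f x \<partial>M) \<le> 1"
proof -
  interpret prob_space M by fact
  show "0 \<le> (\<integral>x. f x \<partial>M)" using assms(2) by (intro integral_nonneg_AE) auto
  show "(\<integral>x. f x \<partial>M) \<le> 1"
  proof (cases "integrable M f")
    case True
    then show ?thesis using assms(3) by (intro integral_le_const) auto
  qed (simp add: not_integrable_integral_eq)
qed

section \<open>Error proportions of the selection procedure\<close>

context
  fixes M :: "'w measure" and \<sigma> lam \<delta> :: real and n :: "nat \<Rightarrow> nat" and S :: "nat \<Rightarrow> real mat"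
    and \<theta> :: "nat \<Rightarrow> real vec" and X :: "nat \<Rightarrow> 'w \<Rightarrow> real mat" and \<xi> \<theta>h :: "nat \<Rightarrow> 'w \<Rightarrow> real vec"
    and \<tau> :: real and \<kappa> :: "(real \<times> real) measure"
  assumes ls: "lasso_sequence M \<sigma> lam \<delta> n S \<theta> X \<xi> \<theta>h"
    and sdl: "standard_distributional_limit M S \<theta> (debiased_sequence S \<theta> X \<xi> \<theta>h) \<tau> \<kappa>"
begin

abbreviation (input) "V \<equiv> debiased_sequence S \<theta> X \<xi> \<theta>h"

lemma prob_M: "prob_space M" using ls by (simp add: lasso_sequence_def)
lemma prob_\<kappa>: "prob_space \<kappa>" using sdl by (simp add: standard_distributional_limit_def)
lemma sets_\<kappa>: "sets \<kappa> = sets borel" using sdl by (simp add: standard_distributional_limit_def)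

lemma theta_carrier: "1 \<le> p \<Longrightarrow> \<theta> p \<in> carrier_vec p"
  using ls by (simp add: lasso_sequence_def)

lemma V_carrier: "1 \<le> p \<Longrightarrow> \<omega> \<in> space M \<Longrightarrow> V p \<omega> \<in> carrier_vec p"
  unfolding debiased_sequence_def using ls
  by (intro debiased_carrier[where m="n p"] pos_def_precision) (auto simp: lasso_sequence_def gaussian_data_def)

lemma V_measurable: "1 \<le> p \<Longrightarrow> j < p \<Longrightarrow> (\<lambda>\<omega>. vec_index (V p \<omega>) j) \<in> borel_measurable M"
  unfolding debiased_sequence_def using ls
  by (intro debiased_measurable[where m="n p" and s="sqrt (real (n p) * \<sigma>\<^sup>2)" and p=p and lam=lam]) (auto simp: lasso_sequence_def)

lemma AE_weak: "AE \<omega> in M. weakly_converges (\<lambda>p. empirical_measure p (\<lambda>j.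
    (vec_index (\<theta> p) j, (vec_index (V p \<omega>) j - vec_index (\<theta> p) j) / \<tau>, precision_mat (S p) $$ (j, j)))) (sdl_law \<kappa>)"
  using sdl by (simp add: standard_distributional_limit_def)

text \<open>The precision matrices are deterministic, so a single outcome at which weak convergence
  holds determines the limit.\<close>

lemma LP_precision_limit: "LP_precision S \<longlonglongrightarrow> limit_LP \<kappa>"
proof -
  interpret prob_space M by (rule prob_M)
  obtain \<omega> where "weakly_converges (\<lambda>p. empirical_measure p (\<lambda>j.
    (vec_index (\<theta> p) j, (vec_index (V p \<omega>) j - vec_index (\<theta> p) j) / \<tau>, precision_mat (S p) $$ (j, j)))) (sdl_law \<kappa>)"
    using eventually_happens[OF AE_weak] by (auto simp: trivial_limit_def[symmetric] ae_filter_eq_bot_iff emeasure_space_1)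
  from LP_norm_limit[OF prob_\<kappa> sets_\<kappa> this] show ?thesis by (simp add: LP_precision_def[abs_def])
qed

lemma measure_law_Theta:
  assumes "A \<in> sets borel"
  shows "measure (law_Theta \<kappa>) A = measure \<kappa> {y. fst y \<in> A}"
proof -
  have "fst \<in> borel_measurable \<kappa>"
    using sets_\<kappa> by (simp add: borel_prod[symmetric] cong: measurable_cong_sets)
  then have "measure (law_Theta \<kappa>) A = measure \<kappa> (fst -` A \<inter> space \<kappa>)"
    unfolding law_Theta_def using assms by (rule measure_distr)
  also have "fst -` A \<inter> space \<kappa> = {y. fst y \<in> A}"
    using sets_eq_imp_space_eq[OF sets_\<kappa>] by auto
  finally show ?thesis .
qed

definition fdp :: "real \<Rightarrow> nat \<Rightarrow> 'w \<Rightarrow> real" where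
  "fdp t p \<omega> = real (card {j \<in> selected t (V p \<omega>). vec_index (\<theta> p) j = 0}) / real (max (card (selected t (V p \<omega>))) 1)"

definition tpp :: "real \<Rightarrow> nat \<Rightarrow> 'w \<Rightarrow> real" where
  "tpp t p \<omega> = real (card {j \<in> selected t (V p \<omega>). vec_index (\<theta> p) j \<noteq> 0}) /
     real (card {j. j < dim_vec (\<theta> p) \<and> vec_index (\<theta> p) j \<noteq> 0})"

lemma selected_V: "1 \<le> p \<Longrightarrow> \<omega> \<in> space M \<Longrightarrow> selected t (V p \<omega>) = {j. j < p \<and> t \<le> \<bar>vec_index (V p \<omega>) j\<bar>}"
  using V_carrier[of p \<omega>] by (simp add: selected_def)

lemma fdp_tpp_bounds:
  assumes "1 \<le> p" "\<omega> \<in> space M"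
  shows "0 \<le> fdp t p \<omega>" "fdp t p \<omega> \<le> 1" "0 \<le> tpp t p \<omega>" "tpp t p \<omega> \<le> 1"
proof -
  have fin: "finite (selected t (V p \<omega>))" by (simp add: selected_def)
  show "0 \<le> fdp t p \<omega>" "0 \<le> tpp t p \<omega>" by (simp_all add: fdp_def tpp_def)
  have "card {j \<in> selected t (V p \<omega>). vec_index (\<theta> p) j = 0} \<le> max (card (selected t (V p \<omega>))) 1"
    using card_mono[OF fin, of "{j \<in> selected t (V p \<omega>). vec_index (\<theta> p) j = 0}"] by auto
  then show "fdp t p \<omega> \<le> 1" unfolding fdp_def by (subst divide_le_eq_1_pos) auto
  have "card {j \<in> selected t (V p \<omega>). vec_index (\<theta> p) j \<noteq> 0} \<le> card {j. j < dim_vec (\<theta> p) \<and> vec_index (\<theta> p) j \<noteq> 0}"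
    using assms theta_carrier[of p] by (intro card_mono) (auto simp: selected_V)
  then show "tpp t p \<omega> \<le> 1" unfolding tpp_def by (intro divide_le_eq_1[THEN iffD2]) auto
qed

lemma fdp_tpp_measurable:
  assumes p: "1 \<le> p"
  shows "fdp t p \<in> borel_measurable M" "tpp t p \<in> borel_measurable M"
proof -
  define N where "N = (\<lambda>Q \<omega>. \<Sum>j<p. if t \<le> \<bar>vec_index (V p \<omega>) j\<bar> \<and> Q j then 1 else (0::real))"
  have Nm: "N Q \<in> borel_measurable M" for Q
    unfolding N_def
  proof (rule borel_measurable_sum)
    fix j assume "j \<in> {..<p}"
    then have [measurable]: "(\<lambda>\<omega>. vec_index (V p \<omega>) j) \<in> borel_measurable M" using V_measurable[OF p] by simp
    show "(\<lambda>\<omega>. if t \<le> \<bar>vec_index (V p \<omega>) j\<bar> \<and> Q j then 1 else (0::real)) \<in> borel_measurable M" by measurable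
  qed
  have N: "real (card {j \<in> selected t (V p \<omega>). Q j}) = N Q \<omega>" if "\<omega> \<in> space M" for Q \<omega>
  proof -
    have "{j \<in> selected t (V p \<omega>). Q j} = {j \<in> {..<p}. t \<le> \<bar>vec_index (V p \<omega>) j\<bar> \<and> Q j}"
      using that p by (auto simp: selected_V)
    then have "real (card {j \<in> selected t (V p \<omega>). Q j}) = (\<Sum>j\<in>{j \<in> {..<p}. t \<le> \<bar>vec_index (V p \<omega>) j\<bar> \<and> Q j}. 1)" by simp
    also have "\<dots> = N Q \<omega>" unfolding N_def by (rule sum.inter_filter) simp
    finally show ?thesis .
  qed
  have N1: "real (max (card (selected t (V p \<omega>))) 1) = max (N (\<lambda>_. True) \<omega>) 1" if "\<omega> \<in> space M" for \<omega>
    using N[OF that, of "\<lambda>_. True"] by (simp add: of_nat_max)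
  have "(\<lambda>\<omega>. N (\<lambda>j. vec_index (\<theta> p) j = 0) \<omega> / max (N (\<lambda>_. True) \<omega>) 1) \<in> borel_measurable M"
    by (intro borel_measurable_divide borel_measurable_max borel_measurable_const Nm)
  then show "fdp t p \<in> borel_measurable M"
    by (rule measurable_cong[THEN iffD1, rotated]) (simp only: fdp_def N N1)
  have "(\<lambda>\<omega>. N (\<lambda>j. vec_index (\<theta> p) j \<noteq> 0) \<omega> / real (card {j. j < dim_vec (\<theta> p) \<and> vec_index (\<theta> p) j \<noteq> 0})) \<in> borel_measurable M"
    by (intro borel_measurable_divide borel_measurable_const Nm)
  then show "tpp t p \<in> borel_measurable M"
    by (rule measurable_cong[THEN iffD1, rotated]) (simp add: tpp_def N)
qed

lemma error_eq: "FDR M (\<theta> p) (\<lambda>\<omega>. selected t (V p \<omega>)) + (1 - PWR M (\<theta> p) (\<lambda>\<omega>. selected t (V p \<omega>))) =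
    (\<integral>\<omega>. fdp t p \<omega> \<partial>M) + (1 - (\<integral>\<omega>. tpp t p \<omega> \<partial>M))"
  by (simp add: FDR_def PWR_def fdp_def tpp_def)

lemma limsup_error_le_2: "limsup_error M \<theta> V t \<le> ereal 2"
  unfolding limsup_error_def error_eq
proof (rule Limsup_bounded)
  show "\<forall>\<^sub>F p in sequentially. ereal ((\<integral>\<omega>. fdp t p \<omega> \<partial>M) + (1 - (\<integral>\<omega>. tpp t p \<omega> \<partial>M))) \<le> ereal 2"
    using eventually_ge_at_top[of 1]
  proof eventually_elim
    case (elim p)
    show ?case
      using integral_unit_interval(2)[OF prob_M, of "fdp t p"] integral_unit_interval(1)[OF prob_M, of "tpp t p"]
        fdp_tpp_bounds[OF elim] by fastforce
  qed
qed

text \<open>For a fixed outcome the counts of \<open>selection_error_bound\<close> are replaced by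
  means of ramps: one from \<open>t / 2\<close> to \<open>t\<close> above the large errors, one from
  \<open>2 * t\<close> to \<open>3 * t\<close> below the strong signals. The second is the origin of
  \<open>3 * root 4 L\<close> in \<open>err_const\<close>.\<close>

lemma fdp_tpp_limit:
  assumes L: "0 < limit_LP \<kappa>" and nz: "nonzero_law (law_Theta \<kappa>)" and e: "0 < e"
  shows "AE \<omega> in M. \<forall>\<^sub>F p in sequentially. fdp (root 4 (limit_LP \<kappa>)) p \<omega> + (1 - tpp (root 4 (limit_LP \<kappa>)) p \<omega>)
     < err_const (limit_LP \<kappa>) (law_Theta \<kappa>) \<tau> + e"
  using AE_weak AE_space
proof eventually_elim
  case (elim \<omega>)
  note wc = elim(1)
  define t where "t = root 4 (limit_LP \<kappa>)"
  have t: "0 < t" "t ^ 4 = limit_LP \<kappa>" using L by (auto simp: t_def)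
  define \<pi> where "\<pi> = measure (law_Theta \<kappa>) {x. \<bar>x\<bar> > 0}"
  have \<pi>: "0 < \<pi>" using nz by (simp add: nonzero_law_def \<pi>_def)
  have tau: "\<tau> \<noteq> 0" and k: "(\<lambda>p. real (norm0 (\<theta> p)) / real p) \<longlonglongrightarrow> \<pi>"
    using sdl by (auto simp: standard_distributional_limit_def \<pi>_def)
  let ?w = "\<lambda>p j. (vec_index (V p \<omega>) j - vec_index (\<theta> p) j) / \<tau>"
  define d where "d = (\<lambda>p. (\<Sum>j<p. ramp (t / 2) t (\<bar>\<tau>\<bar> * \<bar>?w p j\<bar>)) / real p)"
  define D where "D = (\<integral>x. ramp (t / 2) t (\<bar>\<tau>\<bar> * \<bar>fst (snd x)\<bar>) \<partial>sdl_law \<kappa>)"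
  have dD: "d \<longlonglongrightarrow> D" unfolding d_def D_def by (rule sdl_tail_limit[OF prob_\<kappa> sets_\<kappa> wc t(1)])
  have "measure \<kappa> {y. 2 * t ^ 4 \<le> \<bar>snd y\<bar>} < 2 * t ^ 4"
    using L t by (intro limit_LP_properties(2)[OF prob_\<kappa> sets_\<kappa>]) simp
  then have D_le: "D \<le> 2 * limit_LP \<kappa> + 8 * \<tau>\<^sup>2 * t\<^sup>2"
    using large_noise_integral[OF prob_\<kappa> sets_\<kappa> wc t(1), of \<tau>] t(2) unfolding D_def by simp
  define f where "f = (\<lambda>p. (\<Sum>j<p. ramp (2 * t) (3 * t) \<bar>vec_index (\<theta> p) j\<bar>) / real p)"
  define E where "E = (\<integral>y. ramp (2 * t) (3 * t) \<bar>fst y\<bar> \<partial>\<kappa>)"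
  have fE: "f \<longlonglongrightarrow> E"
    unfolding f_def E_def using t ramp_bounds
    by (intro mean_limit_a[OF prob_\<kappa> sets_\<kappa> wc, where g="\<lambda>x. ramp (2 * t) (3 * t) \<bar>x\<bar>" and B=1] continuous_intros) auto
  have E_ge: "measure (law_Theta \<kappa>) {x. 3 * t \<le> \<bar>x\<bar>} \<le> E"
  proof -
    have m: "(\<lambda>y. \<bar>fst y\<bar>) \<in> borel_measurable \<kappa>"
      by (intro kappa_borel[OF prob_\<kappa> sets_\<kappa> wc] borel_measurable_continuous_onI continuous_intros)
    have "{x :: real. 3 * t \<le> \<bar>x\<bar>} \<in> sets borel" by measurable
    then have "measure (law_Theta \<kappa>) {x. 3 * t \<le> \<bar>x\<bar>} = measure \<kappa> {y \<in> space \<kappa>. 3 * t \<le> \<bar>fst y\<bar>}"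
      using space_kappa[OF prob_\<kappa> sets_\<kappa> wc] by (simp add: measure_law_Theta)
    also have "\<dots> \<le> E" unfolding E_def using t by (intro ramp_integral_bounds(2)[OF prob_\<kappa> m]) simp
    finally show ?thesis .
  qed
  let ?k = "\<lambda>p. real (norm0 (\<theta> p)) / real p"
  have "(\<lambda>p. (3 * d p + 2 * (?k p - f p)) / ?k p) \<longlonglongrightarrow> (3 * D + 2 * (\<pi> - E)) / \<pi>"
    using \<pi> by (intro tendsto_intros dD fE k) auto
  moreover have "(3 * D + 2 * (\<pi> - E)) / \<pi> \<le> err_const (limit_LP \<kappa>) (law_Theta \<kappa>) \<tau>"
  proof -
    have "err_const (limit_LP \<kappa>) (law_Theta \<kappa>) \<tau> =
       (3 * (2 * limit_LP \<kappa> + 8 * \<tau>\<^sup>2 * t\<^sup>2) + 2 * (\<pi> - measure (law_Theta \<kappa>) {x. 3 * t \<le> \<bar>x\<bar>})) / \<pi>"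
      using L nz by (simp add: err_const_def t_def \<pi>_def)
    also have "(3 * D + 2 * (\<pi> - E)) / \<pi> \<le> \<dots>"
      using D_le E_ge \<pi> by (intro divide_right_mono) auto
    finally show ?thesis .
  qed
  ultimately have "\<forall>\<^sub>F p in sequentially. (3 * d p + 2 * (?k p - f p)) / ?k p < err_const (limit_LP \<kappa>) (law_Theta \<kappa>) \<tau> + e"
    using e by (intro order_tendstoD(2)) auto
  moreover have "\<forall>\<^sub>F p in sequentially. 0 < ?k p" using \<pi> by (rule order_tendstoD(1)[OF k])
  ultimately show ?case
    using eventually_ge_at_top[of 1]
  proof eventually_elim
    case (elim p)
    have p: "0 < real p" using elim by simp
    have n0: "0 < norm0 (\<theta> p)" using elim(2) p by (simp add: zero_less_divide_iff)
    have "fdp t p \<omega> + (1 - tpp t p \<omega>) \<le>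
       (3 * real (card {j. j < p \<and> t \<le> \<bar>vec_index (V p \<omega>) j - vec_index (\<theta> p) j\<bar>})
        + 2 * (real (norm0 (\<theta> p)) - real (card {j. j < p \<and> 2 * t < \<bar>vec_index (\<theta> p) j\<bar>}))) / real (norm0 (\<theta> p))"
      unfolding fdp_def tpp_def using elim(3) \<open>\<omega> \<in> space M\<close>
      by (intro selection_error_bound theta_carrier V_carrier t n0)
    also have "\<dots> = (3 * (real (card {j. j < p \<and> t \<le> \<bar>vec_index (V p \<omega>) j - vec_index (\<theta> p) j\<bar>}) / real p)
        + 2 * (?k p - real (card {j. j < p \<and> 2 * t < \<bar>vec_index (\<theta> p) j\<bar>}) / real p)) / ?k p"
      using p n0 by (simp add: field_simps)
    also have "\<dots> \<le> (3 * d p + 2 * (?k p - f p)) / ?k p"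
    proof (rule divide_right_mono)
      have "real (card {j. j < p \<and> t \<le> \<bar>vec_index (V p \<omega>) j - vec_index (\<theta> p) j\<bar>}) / real p \<le> d p"
        unfolding d_def using tau t by (intro le_mean) (auto simp: abs_divide ramp_eq_1 ramp_bounds)
      moreover have "f p \<le> real (card {j. j < p \<and> 2 * t < \<bar>vec_index (\<theta> p) j\<bar>}) / real p"
        unfolding f_def using t by (intro mean_le) (auto simp: ramp_eq_0 ramp_bounds)
      ultimately show "3 * (real (card {j. j < p \<and> t \<le> \<bar>vec_index (V p \<omega>) j - vec_index (\<theta> p) j\<bar>}) / real p)
        + 2 * (?k p - real (card {j. j < p \<and> 2 * t < \<bar>vec_index (\<theta> p) j\<bar>}) / real p) \<le> 3 * d p + 2 * (?k p - f p)"
        by argo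
    qed (use elim in simp)
    also have "\<dots> < err_const (limit_LP \<kappa>) (law_Theta \<kappa>) \<tau> + e" by (rule elim)
    finally show ?case by (simp add: t_def)
  qed
qed

text \<open>Almost surely only an eventual upper bound is known, so dominated convergence is applied
  to the positive part of the excess over \<open>c\<close>.\<close>

lemma limsup_error_le:
  assumes L: "0 < limit_LP \<kappa>" and nz: "nonzero_law (law_Theta \<kappa>)"
  shows "limsup_error M \<theta> V (root 4 (limit_LP \<kappa>)) \<le> ereal (err_const (limit_LP \<kappa>) (law_Theta \<kappa>) \<tau>)"
proof -
  interpret prob_space M by (rule prob_M)
  define t where "t = root 4 (limit_LP \<kappa>)"
  define c where "c = err_const (limit_LP \<kappa>) (law_Theta \<kappa>) \<tau>"
  define r where "r = (\<lambda>p \<omega>. fdp t p \<omega> + (1 - tpp t p \<omega>))"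
  \<comment> \<open>The data assumptions start at \<open>p = 1\<close>; the value 0 in dimension 0
    makes \<open>s\<close> measurable there.\<close>
  define s where "s = (\<lambda>p \<omega>. if p = 0 then 0 else max 0 (r p \<omega> - c))"
  have c0: "0 \<le> c"
  proof -
    have "measure (law_Theta \<kappa>) {x. 3 * root 4 (limit_LP \<kappa>) \<le> \<bar>x\<bar>} \<le> measure (law_Theta \<kappa>) {x. 0 < \<bar>x\<bar>}"
    proof (rule finite_measure.finite_measure_mono)
      show "finite_measure (law_Theta \<kappa>)" using nz by (simp add: nonzero_law_def prob_space.finite_measure)
      have "{x :: real. 0 < \<bar>x\<bar>} \<in> sets borel" by measurable
      then show "{x. 0 < \<bar>x\<bar>} \<in> sets (law_Theta \<kappa>)" by (simp add: law_Theta_def)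
      have "0 < root 4 (limit_LP \<kappa>)" using L by simp
      then show "{x. 3 * root 4 (limit_LP \<kappa>) \<le> \<bar>x\<bar>} \<subseteq> {x. 0 < \<bar>x\<bar>}" by auto
    qed
    then show ?thesis using L nz unfolding c_def err_const_def by (auto intro!: divide_nonneg_nonneg add_nonneg_nonneg)
  qed
  have rm: "r p \<in> borel_measurable M" if "1 \<le> p" for p
    unfolding r_def using fdp_tpp_measurable[OF that] by (intro borel_measurable_add borel_measurable_diff borel_measurable_const)
  have sm: "s p \<in> borel_measurable M" for p
    using rm[of p] by (cases "p = 0") (auto simp: s_def intro!: borel_measurable_max)
  have sb: "\<bar>s p \<omega>\<bar> \<le> 2" if "\<omega> \<in> space M" for p \<omega>
    using fdp_tpp_bounds[of p \<omega> t] that c0 by (cases "p = 0") (auto simp: s_def r_def)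
  have "(\<lambda>p. \<integral>\<omega>. s p \<omega> \<partial>M) \<longlonglongrightarrow> (\<integral>\<omega>. 0 \<partial>M)"
  proof (rule integral_dominated_convergence[where w="\<lambda>_. 2"])
    \<comment> \<open>Countably many tolerances keep the exceptional event null.\<close>
    have "AE \<omega> in M. \<forall>m::nat. \<forall>\<^sub>F p in sequentially. r p \<omega> < c + 1 / real (Suc m)"
      unfolding r_def t_def c_def AE_all_countable by (intro allI fdp_tpp_limit L nz) simp
    then show "AE \<omega> in M. (\<lambda>p. s p \<omega>) \<longlonglongrightarrow> 0"
    proof eventually_elim
      case (elim \<omega>)
      show ?case
      proof (rule tendstoI)
        fix e :: real assume "0 < e"
        then obtain m where m: "1 / real (Suc m) < e" using nat_approx_posE by blast
        from elim[rule_format, of m] show "\<forall>\<^sub>F p in sequentially. dist (s p \<omega>) 0 < e"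
          by eventually_elim (use m \<open>0 < e\<close> in \<open>auto simp: s_def simp del: of_nat_Suc\<close>)
      qed
    qed
  qed (use sm sb in auto)
  then have s0: "(\<lambda>p. c + (\<integral>\<omega>. s p \<omega> \<partial>M)) \<longlonglongrightarrow> c + 0" by (intro tendsto_intros) simp
  have "limsup_error M \<theta> V t \<le> limsup (\<lambda>p. ereal (c + (\<integral>\<omega>. s p \<omega> \<partial>M)))"
    unfolding limsup_error_def error_eq
  proof (rule Limsup_mono)
    show "\<forall>\<^sub>F p in sequentially. ereal ((\<integral>\<omega>. fdp t p \<omega> \<partial>M) + (1 - (\<integral>\<omega>. tpp t p \<omega> \<partial>M))) \<le> ereal (c + (\<integral>\<omega>. s p \<omega> \<partial>M))"
      using eventually_ge_at_top[of 1]
    proof eventually_elim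
      case (elim p)
      note b = fdp_tpp_bounds[OF elim] and m = fdp_tpp_measurable[OF elim]
      have i: "integrable M (fdp t p)" "integrable M (tpp t p)"
        using b m by (auto intro!: integrable_const_bound[where B=1])
      have is': "integrable M (s p)" using sm sb by (intro integrable_const_bound[where B=2]) auto
      have "(\<integral>\<omega>. fdp t p \<omega> \<partial>M) + (1 - (\<integral>\<omega>. tpp t p \<omega> \<partial>M)) = (\<integral>\<omega>. r p \<omega> \<partial>M)"
        using i by (simp add: r_def prob_space)
      also have "\<dots> \<le> (\<integral>\<omega>. c + s p \<omega> \<partial>M)"
        using i is' elim by (intro integral_mono) (auto simp: r_def s_def)
      also have "\<dots> = c + (\<integral>\<omega>. s p \<omega> \<partial>M)" using is' by (simp add: prob_space)
      finally show ?case by simp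
    qed
  qed
  also have "\<dots> = ereal (c + 0)"
    using s0 by (intro lim_imp_Limsup) auto
  finally show ?thesis by (simp add: t_def c_def)
qed

lemma limsup_error_le_err_const:
  "limsup_error M \<theta> V (root 4 (limit_LP \<kappa>)) \<le> ereal (err_const (limit_LP \<kappa>) (law_Theta \<kappa>) \<tau>)"
  using limsup_error_le limsup_error_le_2[of "root 4 (limit_LP \<kappa>)"] by (cases "0 < limit_LP \<kappa> \<and> nonzero_law (law_Theta \<kappa>)") (auto simp: err_const_def)

end

subsection \<open>Bound on the noise level\<close>

text \<open>The density is at most \<open>1 / sqrt (2 * pi) \<le> 1 / 2\<close>, on an interval of
  length \<open>2 * r\<close>.\<close>

lemma gauss_small_ball:
  assumes "0 \<le> r"
  shows "measure (density lborel (\<lambda>z. ennreal (std_normal_density z))) {-r..r} \<le> r"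
proof -
  have d: "std_normal_density z \<le> 1 / 2" for z :: real
  proof -
    have "4 \<le> 2 * pi" using pi_ge_two by simp
    then have "sqrt 4 \<le> sqrt (2 * pi)" by (rule real_sqrt_le_mono)
    then have "2 \<le> sqrt (2 * pi)" by (simp add: real_sqrt_four)
    then have "1 / sqrt (2 * pi) \<le> 1 / 2" by (intro divide_left_mono) auto
    moreover have "exp (- z\<^sup>2 / 2) \<le> 1" by simp
    ultimately have "1 / sqrt (2 * pi) * exp (- z\<^sup>2 / 2) \<le> 1 / 2 * 1" by (intro mult_mono) auto
    then show ?thesis by (simp add: std_normal_density_def)
  qed
  have "emeasure (density lborel (\<lambda>z. ennreal (std_normal_density z))) {-r..r} =
      (\<integral>\<^sup>+z. ennreal (std_normal_density z) * indicator {-r..r} z \<partial>lborel)"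
    by (rule emeasure_density) auto
  also have "\<dots> \<le> (\<integral>\<^sup>+z. ennreal (1 / 2) * indicator {-r..r} z \<partial>lborel)"
    using d by (intro nn_integral_mono mult_right_mono ennreal_leI) auto
  also have "\<dots> = ennreal (1 / 2) * emeasure lborel {-r..r}" by (rule nn_integral_cmult_indicator) simp
  also have "\<dots> = ennreal (1 / 2 * (2 * r))"
    using assms by (subst ennreal_mult) auto
  finally have "emeasure (density lborel (\<lambda>z. ennreal (std_normal_density z))) {-r..r} \<le> ennreal r" by simp
  then show ?thesis using assms by (simp add: measure_def enn2real_leI)
qed

text \<open>Makes the second term of \<open>debiased_tail\<close> at most 1/4 when
  \<open>n - p \<ge> k * n\<close> with \<open>k = (1 - 1 / \<delta>) / 2\<close>. The added 1 is
  the slack with which the mean l1 norm of \<open>\<theta>\<close> is eventually below its limit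
  plus 1.\<close>

definition tail_const :: "real \<Rightarrow> real \<Rightarrow> real \<Rightarrow> real measure \<Rightarrow> real" where
  "tail_const \<sigma> lam \<delta> \<mu> = sqrt (4 * (9 * 103 * (4 * \<sigma>\<^sup>2 + 4 * lam * ((\<integral>x. \<bar>x\<bar> \<partial>\<mu>) + 1)) / ((1 - 1 / \<delta>) / 2) ^ 4))"

lemma tail_const:
  assumes "0 < \<sigma>" "0 < lam" "1 < \<delta>"
  shows "0 < tail_const \<sigma> lam \<delta> \<mu>"
    and "(tail_const \<sigma> lam \<delta> \<mu>)\<^sup>2 = 4 * (9 * 103 * (4 * \<sigma>\<^sup>2 + 4 * lam * ((\<integral>x. \<bar>x\<bar> \<partial>\<mu>) + 1)) / ((1 - 1 / \<delta>) / 2) ^ 4)"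
proof -
  have "0 < (1 - 1 / \<delta>) / 2" using assms by simp
  then have k: "0 < ((1 - 1 / \<delta>) / 2) ^ 4" by (rule zero_less_power)
  have "0 \<le> (\<integral>x. \<bar>x\<bar> \<partial>\<mu>)" by (intro integral_nonneg_AE) auto
  then have "0 < 4 * \<sigma>\<^sup>2 + 4 * lam * ((\<integral>x. \<bar>x\<bar> \<partial>\<mu>) + 1)" using assms by (intro add_pos_pos mult_pos_pos add_nonneg_pos) auto
  then have "0 < 4 * (9 * 103 * (4 * \<sigma>\<^sup>2 + 4 * lam * ((\<integral>x. \<bar>x\<bar> \<partial>\<mu>) + 1)) / ((1 - 1 / \<delta>) / 2) ^ 4)"
    using k by (intro mult_pos_pos divide_pos_pos) auto
  then show "0 < tail_const \<sigma> lam \<delta> \<mu>"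
    "(tail_const \<sigma> lam \<delta> \<mu>)\<^sup>2 = 4 * (9 * 103 * (4 * \<sigma>\<^sup>2 + 4 * lam * ((\<integral>x. \<bar>x\<bar> \<partial>\<mu>) + 1)) / ((1 - 1 / \<delta>) / 2) ^ 4)"
    unfolding tail_const_def by (simp_all only: real_sqrt_gt_0_iff real_sqrt_pow2 less_imp_le)
qed

text \<open>\<open>(n - p) / n\<close> tends to \<open>1 - 1 / \<delta>\<close>; half of this leaves
  room for the rounding of \<open>n\<close>.\<close>

lemma sample_size_gap:
  assumes \<delta>: "1 < \<delta>" and n: "\<And>p. 1 \<le> p \<Longrightarrow> \<bar>real (n p) - \<delta> * real p\<bar> < 1"
  shows "\<forall>\<^sub>F p in sequentially. c \<le> real (n p) \<and> (1 - 1 / \<delta>) / 2 * real (n p) \<le> real (n p) - real p \<and> 1 \<le> n p"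
proof -
  have ev: "\<forall>\<^sub>F p in sequentially. x \<le> real p" for x
    by (rule eventually_sequentiallyI[of "nat \<lceil>x\<rceil>"]) linarith
  define k where "k = (1 - 1 / \<delta>) / 2"
  have k: "0 < k" using \<delta> by (simp add: k_def)
  have "\<forall>\<^sub>F p in sequentially. c + 1 \<le> real p \<and> 2 \<le> real p \<and> 1 / (\<delta> * k) + 1 \<le> real p"
    by (intro eventually_conj ev)
  then show ?thesis
  proof eventually_elim
    case (elim p)
    have "1 * real p \<le> \<delta> * real p" using \<delta> by (intro mult_right_mono) auto
    moreover have "\<bar>real (n p) - \<delta> * real p\<bar> < 1" using elim by (intro n) auto
    ultimately have a: "real p - 1 < real (n p)" "\<delta> * real p < real (n p) + 1" by argo+
    have "real p < (real (n p) + 1) / \<delta>" using a(2) \<delta> by (simp add: pos_less_divide_eq mult.commute)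
    also have "\<dots> = real (n p) / \<delta> + 1 / \<delta>" by (simp add: add_divide_distrib)
    finally have p: "real p < real (n p) / \<delta> + 1 / \<delta>" .
    have "1 / (\<delta> * k) \<le> real (n p)" using a elim by linarith
    then have "1 / \<delta> \<le> k * real (n p)" using k \<delta> by (simp add: field_simps)
    moreover have "real (n p) / \<delta> = real (n p) - 2 * (k * real (n p))" by (simp add: k_def algebra_simps diff_divide_distrib)
    ultimately have "k * real (n p) \<le> real (n p) - real p" using p by linarith
    then show ?case using a elim by (auto simp: k_def)
  qed
qed

text \<open>Both terms are at most 1/4, with \<open>336 = 4 * 84\<close> in the first. In the
  second, the noise variance \<open>n * \<sigma>\<^sup>2\<close> makes the numerator of order
  \<open>n ^ 4\<close>, like the denominator.\<close>

lemma tail_term_bounds: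
  fixes n p :: nat
  assumes k: "0 < k" "k * real n \<le> real n - real p" and n: "1 \<le> n" "336 / k\<^sup>2 \<le> real n"
    and c: "0 \<le> \<sigma>" "0 \<le> lam" "N \<le> b * real n"
    and K: "0 < K" "K\<^sup>2 = 4 * (9 * 103 * (4 * \<sigma>\<^sup>2 + 4 * lam * b) / k ^ 4)"
  shows "84 * real n / (real n - real p)\<^sup>2 + 9 * (real n)\<^sup>2 *
       (103 * (4 * real n * (sqrt (real n * \<sigma>\<^sup>2))\<^sup>2 + 4 * real n * lam * N)) / (K\<^sup>2 * (real n - real p) ^ 4) \<le> 1 / 2"
proof -
  have n0: "0 < real n" using n by simp
  have kn: "0 < k * real n" using k n0 by simp
  have "84 * real n / (real n - real p)\<^sup>2 \<le> 84 * real n / (k * real n)\<^sup>2"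
    using k kn n0 by (intro divide_left_mono power_mono mult_pos_pos zero_less_power) linarith+
  also have "\<dots> = 84 / (k\<^sup>2 * real n)" using n0 k by (simp add: field_simps power2_eq_square)
  also have "\<dots> \<le> 1 / 4" using n(2) k n0 by (simp add: field_simps)
  finally have 1: "84 * real n / (real n - real p)\<^sup>2 \<le> 1 / 4" .
  let ?A = "4 * \<sigma>\<^sup>2 + 4 * lam * b"
  have A: "0 < ?A"
  proof -
    have "0 < K\<^sup>2" using K(1) by simp
    then have "0 < 4 * (9 * 103 * ?A / k ^ 4)" by (simp only: K(2))
    then show ?thesis using k by (simp add: zero_less_mult_iff zero_less_divide_iff)
  qed
  have "4 * real n * (sqrt (real n * \<sigma>\<^sup>2))\<^sup>2 + 4 * real n * lam * N \<le> 4 * real n * (real n * \<sigma>\<^sup>2) + 4 * real n * lam * (b * real n)"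
    using c n0 by (intro add_mono mult_left_mono) auto
  also have "\<dots> = (real n)\<^sup>2 * ?A" by (simp add: algebra_simps power2_eq_square)
  finally have "9 * (real n)\<^sup>2 * (103 * (4 * real n * (sqrt (real n * \<sigma>\<^sup>2))\<^sup>2 + 4 * real n * lam * N)) \<le> 9 * (real n)\<^sup>2 * (103 * ((real n)\<^sup>2 * ?A))"
    by (intro mult_left_mono) auto
  also have "\<dots> = 9 * 103 * ?A * (real n) ^ 4" by (simp add: algebra_simps power2_eq_square power4_eq_xxxx)
  finally have num: "9 * (real n)\<^sup>2 * (103 * (4 * real n * (sqrt (real n * \<sigma>\<^sup>2))\<^sup>2 + 4 * real n * lam * N)) \<le> 9 * 103 * ?A * (real n) ^ 4" .
  have "9 * (real n)\<^sup>2 * (103 * (4 * real n * (sqrt (real n * \<sigma>\<^sup>2))\<^sup>2 + 4 * real n * lam * N)) / (K\<^sup>2 * (real n - real p) ^ 4)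
      \<le> 9 * 103 * ?A * (real n) ^ 4 / (K\<^sup>2 * (k * real n) ^ 4)"
    using num k kn n0 K(1) A by (intro frac_le mult_left_mono power_mono mult_pos_pos zero_less_power mult_nonneg_nonneg) auto
  also have "\<dots> = (9 * 103 * ?A / k ^ 4) / K\<^sup>2" using n0 by (simp add: power_mult_distrib)
  also have "\<dots> = 1 / 4"
  proof -
    have "x / (4 * x) = 1 / 4" if "0 < x" for x :: real using that by simp
    moreover have "0 < 9 * 103 * ?A / k ^ 4" using A k by simp
    ultimately show ?thesis unfolding K(2) by blast
  qed
  finally show ?thesis using 1 by linarith
qed

section \<open>Concentration of single coordinates and the bound on the noise level\<close>

context
  fixes M :: "'w measure" and \<sigma> lam \<delta> :: real and n :: "nat \<Rightarrow> nat" and S :: "nat \<Rightarrow> real mat"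
    and \<theta> :: "nat \<Rightarrow> real vec" and X :: "nat \<Rightarrow> 'w \<Rightarrow> real mat" and \<xi> \<theta>h :: "nat \<Rightarrow> 'w \<Rightarrow> real vec"
    and \<tau> :: real and \<kappa> :: "(real \<times> real) measure"
  assumes ls: "lasso_sequence M \<sigma> lam \<delta> n S \<theta> X \<xi> \<theta>h"
    and sdl: "standard_distributional_limit M S \<theta> (debiased_sequence S \<theta> X \<xi> \<theta>h) \<tau> \<kappa>"
    and \<delta>: "1 < \<delta>"
begin

lemma coordinate_concentration:
  "\<forall>\<^sub>F p in sequentially. 1 \<le> p \<and> (\<forall>j<p. 1 / 2 \<le> measure M {\<omega> \<in> space M.
     \<bar>vec_index (debiased_sequence S \<theta> X \<xi> \<theta>h p \<omega>) j - vec_index (\<theta> p) j\<bar>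
       \<le> tail_const \<sigma> lam \<delta> (law_Theta \<kappa>) * sqrt (precision_mat (S p) $$ (j, j))})"
proof -
  define k where "k = (1 - 1 / \<delta>) / 2"
  have k: "0 < k" using \<delta> by (simp add: k_def)
  define b where "b = (\<integral>x. \<bar>x\<bar> \<partial>law_Theta \<kappa>) + 1"
  have b: "0 \<le> b" unfolding b_def by (intro add_nonneg_nonneg integral_nonneg_AE) auto
  have pos: "0 < \<sigma>" "0 < lam" using ls by (auto simp: lasso_sequence_def)
  note tc = tail_const[OF pos \<delta>, of "law_Theta \<kappa>", folded k_def b_def]
  have "(\<lambda>p. norm1 (\<theta> p) / real p) \<longlonglongrightarrow> b - 1" using sdl by (simp add: standard_distributional_limit_def b_def)
  then have "\<forall>\<^sub>F p in sequentially. norm1 (\<theta> p) / real p < b" by (rule order_tendstoD(2)) simp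
  moreover have "\<forall>\<^sub>F p in sequentially. 336 / k\<^sup>2 \<le> real (n p) \<and> k * real (n p) \<le> real (n p) - real p \<and> 1 \<le> n p"
    unfolding k_def using ls by (intro sample_size_gap[OF \<delta>]) (auto simp: lasso_sequence_def)
  ultimately show ?thesis using eventually_ge_at_top[of 1]
  proof eventually_elim
    case (elim p)
    have "0 < k * real (n p)" using k elim by simp
    with elim have pn: "p < n p" by linarith
    have "norm1 (\<theta> p) \<le> b * real p" using elim by (simp add: pos_divide_less_eq)
    also have "\<dots> \<le> b * real (n p)" using b pn by (intro mult_left_mono) auto
    finally have N: "norm1 (\<theta> p) \<le> b * real (n p)" .
    have s: "0 < sqrt (real (n p) * \<sigma>\<^sup>2)" using pos elim by simp
    have "84 * real (n p) / (real (n p) - real p)\<^sup>2 + 9 * (real (n p))\<^sup>2 *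
       (103 * (4 * real (n p) * (sqrt (real (n p) * \<sigma>\<^sup>2))\<^sup>2 + 4 * real (n p) * lam * norm1 (\<theta> p))) /
         ((tail_const \<sigma> lam \<delta> (law_Theta \<kappa>))\<^sup>2 * (real (n p) - real p) ^ 4) \<le> 1 / 2"
      using k elim pos N tc by (intro tail_term_bounds[of k _ _ \<sigma> lam _ b]) auto
    moreover note debiased_tail[where M=M and p=p and S="S p" and m="n p" and s="sqrt (real (n p) * \<sigma>\<^sup>2)" and X="X p" and \<xi>="\<xi> p"
        and \<theta>="\<theta> p" and \<theta>h="\<theta>h p" and lam=lam and Kc="tail_const \<sigma> lam \<delta> (law_Theta \<kappa>)", OF _ _ _ _ _ _ _ pn s pos(2) tc(1)]
    ultimately show ?case
      using ls elim(3) unfolding lasso_sequence_def debiased_sequence_def by fastforce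
  qed
qed

text \<open>Positive \<open>L\<close> gives the coordinates with precision away from 0 a positive
  limiting mass \<open>E\<close>. The test function \<open>F\<close> counts those among them with a
  small normalized error; its limit is at least \<open>E / 2\<close> by concentration and at most
  \<open>E\<close> times a Gaussian small ball probability.\<close>

lemma tau_bound:
  assumes L: "0 < limit_LP \<kappa>"
  shows "\<bar>\<tau>\<bar> \<le> 4 * tail_const \<sigma> lam \<delta> (law_Theta \<kappa>)"
proof -
  interpret prob_space M by (rule prob_M[OF ls sdl])
  note pk = prob_\<kappa>[OF ls sdl] and sk = sets_\<kappa>[OF ls sdl]
  interpret k: prob_space \<kappa> by (rule pk)
  let ?g = "density lborel (\<lambda>z. ennreal (std_normal_density z))"
  interpret g: prob_space ?g by (rule prob_space_normal_density) simp
  interpret kg: pair_sigma_finite \<kappa> ?g ..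
  interpret K: prob_space "\<kappa> \<Otimes>\<^sub>M ?g" by (rule prob_kg[OF pk sk])
  let ?V = "debiased_sequence S \<theta> X \<xi> \<theta>h"
  define c where "c = tail_const \<sigma> lam \<delta> (law_Theta \<kappa>)"
  have c: "0 < c" unfolding c_def using ls \<delta> by (intro tail_const) (auto simp: lasso_sequence_def)
  have tau: "\<tau> \<noteq> 0" using sdl by (simp add: standard_distributional_limit_def)
  define y0 where "y0 = c / \<bar>\<tau>\<bar>"
  have y0: "0 < y0" using c tau by (simp add: y0_def)
  \<comment> \<open>The ramp \<open>cut\<close> rises from \<open>L / 4\<close> to
    \<open>L / 2\<close>; since \<open>L / 2 < L\<close>, the tail of \<open>\<Upsilon>\<close> at
    \<open>L / 2\<close> has mass above \<open>L / 2\<close>, so \<open>E > 0\<close>.\<close>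
  define e where "e = limit_LP \<kappa> / 4"
  have e: "0 < e" using L by (simp add: e_def)
  define cut where "cut = (\<lambda>u :: real. ramp e (2 * e) \<bar>u\<bar>)"
  have cut: "0 \<le> cut u" "cut u \<le> 1" "\<bar>u\<bar> \<le> e \<Longrightarrow> cut u = 0" for u
    using e by (auto simp: cut_def ramp_bounds intro: ramp_eq_0)
  have cutc: "continuous_on UNIV cut" unfolding cut_def using e by (intro continuous_intros) auto
  \<comment> \<open>The maximum keeps the denominator away from 0 and equals the precision wherever
    \<open>cut\<close> is nonzero, so \<open>F\<close> is continuous without distorting the
    normalized error.\<close>
  define F :: "real \<times> real \<times> real \<Rightarrow> real" where
    "F = (\<lambda>x. cut (snd (snd x)) * (1 - ramp y0 (2 * y0) (\<bar>fst (snd x)\<bar> / sqrt (max \<bar>snd (snd x)\<bar> e))))"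
  have Fb: "0 \<le> F x" "F x \<le> 1" for x
    unfolding F_def using cut ramp_bounds[of y0 "2 * y0"] by (auto intro!: mult_nonneg_nonneg mult_le_one)
  have Fc: "continuous_on UNIV F"
  proof -
    have "continuous_on UNIV (\<lambda>x :: real \<times> real \<times> real. cut (snd (snd x)))"
      by (rule continuous_on_compose2[OF cutc]) (auto intro!: continuous_intros)
    then show ?thesis unfolding F_def using e y0 by (intro continuous_intros) (auto simp: max_def)
  qed
  have Fm: "F \<in> borel_measurable borel" by (rule borel_measurable_continuous_onI[OF Fc])
  let ?x = "\<lambda>p \<omega> j. (vec_index (\<theta> p) j, (vec_index (?V p \<omega>) j - vec_index (\<theta> p) j) / \<tau>, precision_mat (S p) $$ (j, j))"
  define E where "E = (\<integral>y. cut (snd y) \<partial>\<kappa>)"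
  have chi_lim: "(\<lambda>p. (\<Sum>j<p. cut (precision_mat (S p) $$ (j, j))) / real p) \<longlonglongrightarrow> E"
    and tail_le: "measure \<kappa> {y. 2 * e \<le> \<bar>snd y\<bar>} \<le> E"
    and cutm: "(\<lambda>y. cut (snd y)) \<in> borel_measurable \<kappa>"
  proof -
    obtain \<omega> where wc: "weakly_converges (\<lambda>p. empirical_measure p (?x p \<omega>)) (sdl_law \<kappa>)"
      using eventually_happens[OF AE_weak[OF ls sdl]] by (auto simp: trivial_limit_def[symmetric] ae_filter_eq_bot_iff emeasure_space_1)
    show "(\<lambda>p. (\<Sum>j<p. cut (precision_mat (S p) $$ (j, j))) / real p) \<longlonglongrightarrow> E"
      unfolding E_def using cut by (intro mean_limit_u[OF pk sk wc cutc, of 1]) simp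
    show "measure \<kappa> {y. 2 * e \<le> \<bar>snd y\<bar>} \<le> E"
      unfolding E_def cut_def using e by (intro tail_u_bounds(2)[OF pk sk wc]) simp
    have "continuous_on UNIV (\<lambda>y :: real \<times> real. cut (snd y))"
      by (rule continuous_on_compose2[OF cutc]) (auto intro!: continuous_intros)
    then show "(\<lambda>y. cut (snd y)) \<in> borel_measurable \<kappa>"
      by (intro kappa_borel[OF pk sk wc] borel_measurable_continuous_onI)
  qed
  have E0: "0 < E"
  proof -
    have "2 * e < measure \<kappa> {y. 2 * e \<le> \<bar>snd y\<bar>}" using L by (intro limit_LP_properties(3)[OF pk sk]) (auto simp: e_def)
    then show ?thesis using tail_le e by linarith
  qed
  have xm: "(\<lambda>\<omega>. F (?x p \<omega> j)) \<in> borel_measurable M" if "1 \<le> p" "j < p" for p j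
  proof -
    have v: "(\<lambda>\<omega>. vec_index (?V p \<omega>) j) \<in> borel_measurable M" by (rule V_measurable[OF ls sdl that])
    have "continuous_on UNIV (\<lambda>v. (vec_index (\<theta> p) j, (v - vec_index (\<theta> p) j) / \<tau>, precision_mat (S p) $$ (j, j)))"
      using tau by (intro continuous_intros) auto
    then have "continuous_on UNIV (\<lambda>v. F (vec_index (\<theta> p) j, (v - vec_index (\<theta> p) j) / \<tau>, precision_mat (S p) $$ (j, j)))"
      by (rule continuous_on_compose2[OF Fc]) auto
    from measurable_compose[OF v borel_measurable_continuous_onI[OF this]] show ?thesis .
  qed
  have Fi: "integrable M (\<lambda>\<omega>. F (?x p \<omega> j))" if "1 \<le> p" "j < p" for p j
    using xm[OF that] Fb by (intro integrable_const_bound[where B=1]) auto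
  define G where "G = (\<lambda>p \<omega>. if p = 0 then 0 else (\<Sum>j<p. F (?x p \<omega> j)) / real p)"
  have "(\<lambda>p. \<integral>\<omega>. G p \<omega> \<partial>M) \<longlonglongrightarrow> (\<integral>\<omega>. (\<integral>x. F x \<partial>sdl_law \<kappa>) \<partial>M)"
  proof (rule integral_dominated_convergence[where w="\<lambda>_. 1"])
    show "G p \<in> borel_measurable M" for p
      unfolding G_def using xm[of p]
      by (cases "p = 0") (auto intro!: borel_measurable_divide borel_measurable_sum)
    show "AE \<omega> in M. (\<lambda>p. G p \<omega>) \<longlonglongrightarrow> (\<integral>x. F x \<partial>sdl_law \<kappa>)"
      using AE_weak[OF ls sdl]
    proof eventually_elim
      case (elim \<omega>)
      have "G p \<omega> = (\<Sum>j<p. F (?x p \<omega> j)) / real p" for p by (simp add: G_def)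
      then show ?case using Fb by (simp only:) (rule weakly_converges_mean[OF elim Fc, of 1], simp)
    qed
    have "0 \<le> G p \<omega> \<and> G p \<omega> \<le> 1" for p \<omega>
    proof -
      have "(\<Sum>j<p. F (?x p \<omega> j)) \<le> (\<Sum>j<p. 1)" by (intro sum_mono Fb)
      then show ?thesis by (auto simp: G_def Fb divide_le_eq_1 intro!: divide_nonneg_nonneg sum_nonneg)
    qed
    then show "AE \<omega> in M. norm (G p \<omega>) \<le> 1" for p by simp
  qed auto
  then have Glim: "(\<lambda>p. \<integral>\<omega>. G p \<omega> \<partial>M) \<longlonglongrightarrow> (\<integral>x. F x \<partial>sdl_law \<kappa>)" by (simp add: prob_space)
  \<comment> \<open>Concentration is a statement about the probability of each coordinate under
    \<open>M\<close>, so it enters through the mean of \<open>G\<close> and not through its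
    values.\<close>
  have "E * (1 / 2) \<le> (\<integral>x. F x \<partial>sdl_law \<kappa>)"
  proof (rule tendsto_le[OF sequentially_bot Glim tendsto_mult_right[OF chi_lim]])
    show "\<forall>\<^sub>F p in sequentially. (\<Sum>j<p. cut (precision_mat (S p) $$ (j, j))) / real p * (1 / 2) \<le> (\<integral>\<omega>. G p \<omega> \<partial>M)"
      using coordinate_concentration
    proof eventually_elim
      case (elim p)
      have p: "1 \<le> p" "p \<noteq> 0" using elim by auto
      have le: "cut (precision_mat (S p) $$ (j, j)) * (1 / 2) \<le> (\<integral>\<omega>. F (?x p \<omega> j) \<partial>M)" if j: "j < p" for j
      proof -
        let ?P = "precision_mat (S p) $$ (j, j)"
        let ?B = "{\<omega> \<in> space M. \<bar>vec_index (?V p \<omega>) j - vec_index (\<theta> p) j\<bar> \<le> c * sqrt ?P}"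
        have v: "(\<lambda>\<omega>. vec_index (?V p \<omega>) j) \<in> borel_measurable M" by (rule V_measurable[OF ls sdl p(1) j])
        have B: "?B \<in> sets M"
          by (intro borel_measurable_le borel_measurable_abs borel_measurable_diff v borel_measurable_const)
        have P: "0 < ?P" using ls p j by (intro precision_mat_diag_pos) (auto simp: lasso_sequence_def)
        have pw: "cut ?P * indicator ?B \<omega> \<le> F (?x p \<omega> j)" for \<omega>
        proof (cases "\<omega> \<in> ?B \<and> e < ?P")
          case True
          have "\<bar>(vec_index (?V p \<omega>) j - vec_index (\<theta> p) j) / \<tau>\<bar> / sqrt ?P \<le> c * sqrt ?P / \<bar>\<tau>\<bar> / sqrt ?P"
            using True P unfolding abs_divide by (intro divide_right_mono) auto
          also have "\<dots> = y0" using P by (simp add: y0_def)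
          finally have "ramp y0 (2 * y0) (\<bar>(vec_index (?V p \<omega>) j - vec_index (\<theta> p) j) / \<tau>\<bar> / sqrt ?P) = 0"
            using y0 by (intro ramp_eq_0) auto
          then show ?thesis using True P by (simp add: F_def max_def)
        next
          case False
          then have "cut ?P * indicator ?B \<omega> = 0" using cut(3)[of ?P] P by (auto simp: indicator_def)
          then show ?thesis by (simp only: Fb)
        qed
        have "cut ?P * (1 / 2) \<le> cut ?P * measure M ?B" using elim j cut by (intro mult_left_mono) (auto simp: c_def)
        also have "\<dots> = (\<integral>\<omega>. cut ?P * indicator ?B \<omega> \<partial>M)" using B by simp
        also have "\<dots> \<le> (\<integral>\<omega>. F (?x p \<omega> j) \<partial>M)"
          using B by (intro integral_mono Fi p j pw integrable_mult_right integrable_real_indicator) (auto simp: emeasure_eq_measure)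
        finally show ?thesis .
      qed
      have "(\<Sum>j<p. cut (precision_mat (S p) $$ (j, j))) / real p * (1 / 2) = (\<Sum>j<p. cut (precision_mat (S p) $$ (j, j)) * (1 / 2)) / real p"
        by (simp add: sum_divide_distrib mult.commute)
      also have "\<dots> \<le> (\<Sum>j<p. \<integral>\<omega>. F (?x p \<omega> j) \<partial>M) / real p"
        using le by (intro divide_right_mono sum_mono) auto
      also have "\<dots> = (\<integral>\<omega>. G p \<omega> \<partial>M)"
        unfolding G_def using p Fi[OF p(1)] by (simp add: Bochner_Integration.integral_sum)
      finally show ?case .
    qed
  qed
  also have "\<dots> = (\<integral>y. F (fst (fst y), sqrt (snd (fst y)) * snd y, snd (fst y)) \<partial>(\<kappa> \<Otimes>\<^sub>M ?g))"
    by (rule integral_sdl_law[OF pk sk Fm])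
  also have "\<dots> \<le> (\<integral>y. cut (snd (fst y)) * indicator {-(2 * y0)..2 * y0} (snd y) \<partial>(\<kappa> \<Otimes>\<^sub>M ?g))"
  proof (rule integral_mono)
    have m1: "(\<lambda>y. cut (snd (fst y)) * indicator {-(2 * y0)..2 * y0} (snd y)) \<in> borel_measurable (\<kappa> \<Otimes>\<^sub>M ?g)"
      by (intro borel_measurable_times measurable_compose[OF measurable_fst cutm] measurable_compose[OF measurable_snd]) auto
    show "integrable (\<kappa> \<Otimes>\<^sub>M ?g) (\<lambda>y. cut (snd (fst y)) * indicator {-(2 * y0)..2 * y0} (snd y))"
      using cut m1 by (intro K.integrable_const_bound[where B=1]) (auto simp: indicator_def)
    from measurable_compose[OF sdl_law_map_measurable[OF sk] Fm]
    have "(\<lambda>y. F (fst (fst y), sqrt (snd (fst y)) * snd y, snd (fst y))) \<in> borel_measurable (\<kappa> \<Otimes>\<^sub>M ?g)"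
      by (simp add: case_prod_beta)
    then show "integrable (\<kappa> \<Otimes>\<^sub>M ?g) (\<lambda>y. F (fst (fst y), sqrt (snd (fst y)) * snd y, snd (fst y)))"
      using Fb by (intro K.integrable_const_bound[where B=1]) auto
    fix y :: "(real \<times> real) \<times> real"
    let ?u = "snd (fst y)" and ?z = "snd y"
    show "F (fst (fst y), sqrt ?u * ?z, ?u) \<le> cut ?u * indicator {-(2 * y0)..2 * y0} ?z"
    proof (cases "\<bar>?u\<bar> \<le> e")
      case True
      then show ?thesis using cut(3) by (simp add: F_def)
    next
      case False
      have "\<bar>sqrt ?u\<bar> = sqrt \<bar>?u\<bar>"
        using real_sqrt_abs[of "sqrt ?u", symmetric] by (simp only: sqrt_sq_abs)
      then have "\<bar>sqrt ?u * ?z\<bar> / sqrt (max \<bar>?u\<bar> e) = \<bar>?z\<bar>" using False e by (simp add: abs_mult max_def)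
      then have F: "F (fst (fst y), sqrt ?u * ?z, ?u) = cut ?u * (1 - ramp y0 (2 * y0) \<bar>?z\<bar>)" by (simp add: F_def)
      have "1 - ramp y0 (2 * y0) \<bar>?z\<bar> \<le> indicator {-(2 * y0)..2 * y0} ?z"
        using y0 ramp_eq_1[of y0 "2 * y0" "\<bar>?z\<bar>"] ramp_bounds[of y0 "2 * y0" "\<bar>?z\<bar>"] by (auto simp: indicator_def)
      then show ?thesis unfolding F using cut by (intro mult_left_mono) auto
    qed
  qed
  also have "\<dots> = E * measure ?g {-(2 * y0)..2 * y0}"
  proof -
    have m1: "(\<lambda>y. cut (snd (fst y)) * indicator {-(2 * y0)..2 * y0} (snd y)) \<in> borel_measurable (\<kappa> \<Otimes>\<^sub>M ?g)"
      by (intro borel_measurable_times measurable_compose[OF measurable_fst cutm] measurable_compose[OF measurable_snd]) auto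
    have "integrable (\<kappa> \<Otimes>\<^sub>M ?g) (\<lambda>y. cut (snd (fst y)) * indicator {-(2 * y0)..2 * y0} (snd y))"
      using cut m1 by (intro K.integrable_const_bound[where B=1]) (auto simp: indicator_def)
    then have "(\<integral>y. cut (snd (fst y)) * indicator {-(2 * y0)..2 * y0} (snd y) \<partial>(\<kappa> \<Otimes>\<^sub>M ?g))
       = (\<integral>y. (\<integral>z. cut (snd (fst (y, z))) * indicator {-(2 * y0)..2 * y0} (snd (y, z)) \<partial>?g) \<partial>\<kappa>)"
      by (rule kg.integral_fst'[symmetric])
    also have "\<dots> = (\<integral>y. cut (snd y) * measure ?g {-(2 * y0)..2 * y0} \<partial>\<kappa>)" by simp
    finally show ?thesis by (simp add: E_def)
  qed
  also have "\<dots> \<le> E * (2 * y0)" using E0 y0 by (intro mult_left_mono gauss_small_ball) auto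
  \<comment> \<open>Division by \<open>E\<close> leaves
    \<open>c / \<bar>\<tau>\<bar> \<ge> 1 / 4\<close>, whence the factor 4.\<close>
  finally have "1 / 2 \<le> 2 * y0" using E0 by (simp only: mult_le_cancel_left_pos)
  then show ?thesis using tau unfolding y0_def c_def[symmetric] by (simp add: field_simps)
qed

end

text \<open>\<open>B\<close> and \<open>C\<close> are quantified before the data, which expresses
  that they depend on the listed quantities only. The bound on \<open>\<tau>\<close> is guarded by
  \<open>0 < L\<close>: for \<open>L = 0\<close> the variable \<open>\<Upsilon>\<close> is 0 almost
  surely, and every rescaling of \<open>\<tau>\<close> fits the same limit.\<close>

theorem theorem3:
  shows
    "(\<exists>C :: real \<Rightarrow> real measure \<Rightarrow> real \<Rightarrow> real.
        (\<forall>\<mu> \<tau>. nonzero_law \<mu> \<longrightarrow> ((\<lambda>L. C L \<mu> \<tau>) \<longlongrightarrow> 0) (at_right 0)) \<and>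
        (\<forall>(M :: 'w measure) \<sigma> lam \<delta> n S \<theta> X \<xi> \<theta>h \<tau> \<kappa>.
           lasso_sequence M \<sigma> lam \<delta> n S \<theta> X \<xi> \<theta>h \<and>
           standard_distributional_limit M S \<theta> (debiased_sequence S \<theta> X \<xi> \<theta>h) \<tau> \<kappa> \<longrightarrow>
           (\<exists>L. LP_precision S \<longlonglongrightarrow> L \<and>
                limsup_error M \<theta> (debiased_sequence S \<theta> X \<xi> \<theta>h) (root 4 L)
                  \<le> ereal (C L (law_Theta \<kappa>) \<tau>)))) \<and>
     (\<exists>(B :: real \<Rightarrow> real \<Rightarrow> real \<Rightarrow> real measure \<Rightarrow> real)
       (C :: real \<Rightarrow> real measure \<Rightarrow> real \<Rightarrow> real \<Rightarrow> real \<Rightarrow> real).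
        (\<forall>\<mu> \<sigma> lam \<delta>. nonzero_law \<mu> \<and> 0 < \<sigma> \<and> 0 < lam \<and> 1 < \<delta> \<longrightarrow>
           ((\<lambda>L. C L \<mu> \<sigma> lam \<delta>) \<longlongrightarrow> 0) (at_right 0)) \<and>
        (\<forall>(M :: 'w measure) \<sigma> lam \<delta> n S \<theta> X \<xi> \<theta>h \<tau> \<kappa>.
           lasso_sequence M \<sigma> lam \<delta> n S \<theta> X \<xi> \<theta>h \<and> 1 < \<delta> \<and>
           standard_distributional_limit M S \<theta> (debiased_sequence S \<theta> X \<xi> \<theta>h) \<tau> \<kappa> \<longrightarrow>
           (\<exists>L. LP_precision S \<longlonglongrightarrow> L \<and>
                (0 < L \<longrightarrow> \<bar>\<tau>\<bar> \<le> B \<sigma> lam \<delta> (law_Theta \<kappa>)) \<and>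
                limsup_error M \<theta> (debiased_sequence S \<theta> X \<xi> \<theta>h) (root 4 L)
                  \<le> ereal (C L (law_Theta \<kappa>) \<sigma> lam \<delta>))))"
proof -
  let ?B = "\<lambda>\<sigma> lam \<delta> \<mu>. 4 * tail_const \<sigma> lam \<delta> \<mu>"
  show ?thesis
  proof (intro conjI exI[of _ err_const] exI[of _ ?B] exI[of _ "\<lambda>L \<mu> \<sigma> lam \<delta>. err_const L \<mu> (?B \<sigma> lam \<delta> \<mu>)"] allI impI)
    fix M :: "'w measure" and \<sigma> lam \<delta> n S \<theta> X \<xi> \<theta>h \<tau> \<kappa>
    assume *: "lasso_sequence M \<sigma> lam \<delta> n S \<theta> X \<xi> \<theta>h \<and>
           standard_distributional_limit M S \<theta> (debiased_sequence S \<theta> X \<xi> \<theta>h) \<tau> \<kappa>"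
    then have ls: "lasso_sequence M \<sigma> lam \<delta> n S \<theta> X \<xi> \<theta>h"
      and sdl: "standard_distributional_limit M S \<theta> (debiased_sequence S \<theta> X \<xi> \<theta>h) \<tau> \<kappa>" by auto
    show "\<exists>L. LP_precision S \<longlonglongrightarrow> L \<and> limsup_error M \<theta> (debiased_sequence S \<theta> X \<xi> \<theta>h) (root 4 L)
       \<le> ereal (err_const L (law_Theta \<kappa>) \<tau>)"
      using LP_precision_limit[OF ls sdl] limsup_error_le_err_const[OF ls sdl] by blast
  next
    fix M :: "'w measure" and \<sigma> lam \<delta> n S \<theta> X \<xi> \<theta>h \<tau> \<kappa>
    assume *: "lasso_sequence M \<sigma> lam \<delta> n S \<theta> X \<xi> \<theta>h \<and> 1 < \<delta> \<and>
           standard_distributional_limit M S \<theta> (debiased_sequence S \<theta> X \<xi> \<theta>h) \<tau> \<kappa>"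
    then have ls: "lasso_sequence M \<sigma> lam \<delta> n S \<theta> X \<xi> \<theta>h" and \<delta>: "1 < \<delta>"
      and sdl: "standard_distributional_limit M S \<theta> (debiased_sequence S \<theta> X \<xi> \<theta>h) \<tau> \<kappa>" by auto
    have "err_const (limit_LP \<kappa>) (law_Theta \<kappa>) \<tau> \<le> err_const (limit_LP \<kappa>) (law_Theta \<kappa>) (?B \<sigma> lam \<delta> (law_Theta \<kappa>))"
    \<comment> \<open>For \<open>L = 0\<close> both sides have the default value 2.\<close>
    proof (cases "0 < limit_LP \<kappa>")
      case True
      then show ?thesis by (intro err_const_mono tau_bound[OF ls sdl \<delta>])
    qed (simp add: err_const_def)
    with limsup_error_le_err_const[OF ls sdl]
    have "limsup_error M \<theta> (debiased_sequence S \<theta> X \<xi> \<theta>h) (root 4 (limit_LP \<kappa>))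
        \<le> ereal (err_const (limit_LP \<kappa>) (law_Theta \<kappa>) (?B \<sigma> lam \<delta> (law_Theta \<kappa>)))"
      by (meson ereal_less_eq(3) order_trans)
    then show "\<exists>L. LP_precision S \<longlonglongrightarrow> L \<and> (0 < L \<longrightarrow> \<bar>\<tau>\<bar> \<le> ?B \<sigma> lam \<delta> (law_Theta \<kappa>)) \<and>
        limsup_error M \<theta> (debiased_sequence S \<theta> X \<xi> \<theta>h) (root 4 L) \<le> ereal (err_const L (law_Theta \<kappa>) (?B \<sigma> lam \<delta> (law_Theta \<kappa>)))"
      using LP_precision_limit[OF ls sdl] tau_bound[OF ls sdl \<delta>] by blast
  qed (auto intro: err_const_tendsto)
qed

end
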